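(* Let $A_1\in GL(N,\mathbb{Z})$ be ergodic and let $A_2,\dots,A_n\in GL(N,\mathbb{Z})$ be unipotent matrices satisfying $A_1A_i=A_iA_1$ and $(A_i-I_N)^2=0$ for $2\le i\le n$. Suppose moreover that $\bigcap_{i=2}^n p_1(A_i)=\{0\}$, where $p_1(U)=\{v\in\mathbb{R}^N: Uv=v\}$ for a unipotent $U\in GL(N,\mathbb{Z})$. Let $\mathcal{H}$ be the group generated by $A_1,\dots,A_n$ and let $\alpha$ be the natural action of $\mathcal{H}$ on $\mathbb{T}^N$ by automorphisms. Then there exists a constant $l=l(\alpha,N)$ such that $\alpha$ is $C^{\infty,l,\infty}$ locally rigid.
   Context: $GL(N,\mathbb{Z})$ is the group of integer $N\times N$ matrices with determinant $\pm1$, acting on $\mathbb{T}^N=\mathbb{R}^N/\mathbb{Z}^N$ by automorphisms. A matrix in $GL(N,\mathbb{Z})$ is called ergodic if the induced toral automorphism is ergodic with respect to Lebesgue (Haar) measure (equivalently, none of its eigenvalues is a root of unity). Local rigidity: an action $\alpha$ of a finitely generated group $\mathcal{H}$ on $\mathbb{T}^N$ is $C^{k,r,\ell}$ locally rigid if any $C^k$ perturbation $\tilde\alpha$ (an action of $\mathcal{H}$ on $\mathbb{T}^N$ by $C^k$ diffeomorphisms) which is sufficiently $C^r$ close to $\alpha$ on a compact (here: finite) generating set is $C^\ell$ conjugate to $\alpha$, i.e. there is a $C^\ell$ diffeomorphism $h$ of $\mathbb{T}^N$ with $\tilde\alpha(g)\circ h=h\circ\alpha(g)$ for all $g\in\mathcal{H}$.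 *)

theory Defs
  imports "HOL-Analysis.Analysis" "HOL-Algebra.Generated_Groups" "HOL-Algebra.Group_Action"
begin

section \<open>The torus\<close>

definition lattice_rel :: "real ^ 'n \<Rightarrow> real ^ 'n \<Rightarrow> bool" where
  "lattice_rel x y \<longleftrightarrow> (\<forall>i. x $ i - y $ i \<in> \<int>)"

lemma equivp_lattice_rel: "equivp lattice_rel"
proof (rule equivpI)
  show "reflp lattice_rel"
    by (auto simp: lattice_rel_def intro: reflpI)
  show "symp lattice_rel"
    by (rule sympI) (metis Ints_minus lattice_rel_def minus_diff_eq)
  show "transp lattice_rel"
  proof (rule transpI)
    fix x y z :: "real ^ 'n"
    assume *: "lattice_rel x y" "lattice_rel y z"
    show "lattice_rel x z"
      unfolding lattice_rel_def
    proof
      fix i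
      have "x $ i - z $ i = (x $ i - y $ i) + (y $ i - z $ i)" by simp
      then show "x $ i - z $ i \<in> \<int>"
        using * by (metis Ints_add lattice_rel_def)
    qed
  qed
qed

quotient_type 'n torus = "real ^ 'n" / lattice_rel
  morphisms torus_rep torus_proj
  by (rule equivp_lattice_rel)

instantiation torus :: (finite) topological_space
begin

definition open_torus :: "'a torus set \<Rightarrow> bool" where
  "open_torus S \<longleftrightarrow> open (torus_proj -` S)"

instance
proof
  show "open (UNIV :: 'a torus set)"
    by (simp add: open_torus_def)
next
  fix S T :: "'a torus set"
  assume "open S" "open T"
  then show "open (S \<inter> T)"
    by (simp add: open_torus_def open_Int vimage_Int)
next
  fix K :: "'a torus set set"
  assume "\<forall>S\<in>K. open S"
  then show "open (\<Union>K)"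
    by (auto simp: open_torus_def vimage_Union intro: open_UN)
qed

end

definition torus_measure :: "'n::finite torus measure" where
  "torus_measure =
     distr (restrict_space lborel {x :: real ^ 'n. \<forall>i. 0 \<le> x $ i \<and> x $ i < 1}) borel torus_proj"


section \<open>Integer matrices acting on the torus\<close>

definition GLZ :: "(int ^ 'n ^ 'n) monoid" where
  "GLZ = \<lparr>carrier = {A. det A = 1 \<or> det A = -1}, mult = (**), one = mat 1\<rparr>"

lift_definition torus_aut :: "int ^ 'n ^ 'n \<Rightarrow> 'n torus \<Rightarrow> 'n torus" is
  "\<lambda>A x. map_matrix real_of_int A *v x"
proof -
  fix A :: "int ^ 'n ^ 'n" and x y :: "real ^ 'n"
  assume "lattice_rel x y"
  then have "(\<Sum>j\<in>UNIV. real_of_int (A $ i $ j) * (x $ j - y $ j)) \<in> \<int>" for i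
    by (intro Ints_sum Ints_mult) (auto simp: lattice_rel_def)
  then show "lattice_rel (map_matrix real_of_int A *v x) (map_matrix real_of_int A *v y)"
    by (simp add: lattice_rel_def matrix_vector_mult_def map_matrix_def
        sum_subtractf right_diff_distrib)
qed

definition ergodic :: "'a measure \<Rightarrow> ('a \<Rightarrow> 'a) \<Rightarrow> bool" where
  "ergodic M T \<longleftrightarrow>
     T \<in> measurable M M \<and> distr M M T = M \<and>
     (\<forall>S\<in>sets M. T -` S \<inter> space M = S \<longrightarrow> emeasure M S = 0 \<or> emeasure M (space M - S) = 0)"

definition ergodic_matrix :: "int ^ 'n ^ 'n \<Rightarrow> bool" where
  "ergodic_matrix A \<longleftrightarrow> A \<in> carrier GLZ \<and> ergodic torus_measure (torus_aut A)"

definition unipotent :: "int ^ 'n ^ 'n \<Rightarrow> bool" where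
  "unipotent U \<longleftrightarrow> (\<exists>k. (((**) (U - mat 1)) ^^ k) (mat 1) = 0)"

definition p1 :: "int ^ 'n ^ 'n \<Rightarrow> (real ^ 'n) set" where
  "p1 U = {v. map_matrix real_of_int U *v v = v}"


section \<open>Differentiability classes on the torus\<close>

text \<open>Meaningful on open sets \<open>S\<close> only. Asking for all directional derivatives
  to be \<open>n\<close> times continuously differentiable is the same as asking it of the Frechet derivative,
  because the dimension is finite.\<close>

primrec nat_Ck_on :: "nat \<Rightarrow> (real ^ 'n \<Rightarrow> real ^ 'n) \<Rightarrow> (real ^ 'n) set \<Rightarrow> bool" where
  "nat_Ck_on 0 F S \<longleftrightarrow> continuous_on S F"
| "nat_Ck_on (Suc n) F S \<longleftrightarrow>
     (\<forall>x\<in>S. F differentiable (at x)) \<and>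
     (\<forall>v. nat_Ck_on n (\<lambda>x. frechet_derivative F (at x) v) S)"

definition Ck_on :: "enat \<Rightarrow> (real ^ 'n \<Rightarrow> real ^ 'n) \<Rightarrow> (real ^ 'n) set \<Rightarrow> bool" where
  "Ck_on k F S \<longleftrightarrow> (\<forall>j::nat. enat j \<le> k \<longrightarrow> nat_Ck_on j F S)"

primrec iter_deriv ::
    "(real ^ 'n) list \<Rightarrow> (real ^ 'n \<Rightarrow> real ^ 'n) \<Rightarrow> real ^ 'n \<Rightarrow> real ^ 'n" where
  "iter_deriv [] F = F"
| "iter_deriv (v # vs) F = (\<lambda>x. frechet_derivative (iter_deriv vs F) (at x) v)"

text \<open>The charts of the torus are the local inverses of \<^const>\<open>torus_proj\<close>; a local lift is
  a representation of \<open>f\<close> in such charts.\<close>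

definition local_lift ::
    "('n torus \<Rightarrow> 'n torus) \<Rightarrow> (real ^ 'n) set \<Rightarrow> (real ^ 'n \<Rightarrow> real ^ 'n) \<Rightarrow> bool" where
  "local_lift f U F \<longleftrightarrow> (\<forall>x\<in>U. f (torus_proj x) = torus_proj (F x))"

definition torus_Ck :: "enat \<Rightarrow> ('n::finite torus \<Rightarrow> 'n torus) \<Rightarrow> bool" where
  "torus_Ck k f \<longleftrightarrow> (\<forall>x. \<exists>U F. open U \<and> x \<in> U \<and> local_lift f U F \<and> Ck_on k F U)"

definition torus_diffeo :: "enat \<Rightarrow> ('n::finite torus \<Rightarrow> 'n torus) \<Rightarrow> bool" where
  "torus_diffeo k f \<longleftrightarrow> bij f \<and> torus_Ck k f \<and> torus_Ck k (inv_into UNIV f)"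

text \<open>The \<open>C\<^sup>r\<close> topology is measured in the flat charts: all partial derivatives of the
  difference, up to order \<open>r\<close> and including order 0, are smaller than \<open>\<epsilon>\<close>.\<close>

definition Cr_close ::
    "nat \<Rightarrow> real \<Rightarrow> ('n::finite torus \<Rightarrow> 'n torus) \<Rightarrow> ('n torus \<Rightarrow> 'n torus) \<Rightarrow> bool" where
  "Cr_close r \<epsilon> f g \<longleftrightarrow>
     (\<forall>x. \<exists>U F G. open U \<and> x \<in> U \<and>
        local_lift f U F \<and> Ck_on (enat r) F U \<and>
        local_lift g U G \<and> Ck_on (enat r) G U \<and>
        (\<forall>y\<in>U. \<forall>vs. length vs \<le> r \<and> set vs \<subseteq> Basis \<longrightarrow>
           norm (iter_deriv vs (\<lambda>z. F z - G z) y) < \<epsilon>))"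


section \<open>Local rigidity\<close>

definition Ck_action ::
    "enat \<Rightarrow> ('g, 'b) monoid_scheme \<Rightarrow> ('g \<Rightarrow> 'n::finite torus \<Rightarrow> 'n torus) \<Rightarrow> bool" where
  "Ck_action k H \<beta> \<longleftrightarrow>
     group_action H UNIV \<beta> \<and> (\<forall>g\<in>carrier H. torus_diffeo k (\<beta> g))"

text \<open>For a finitely generated group \<open>H\<close>. The perturbation may be controlled on whichever finite
  generating set one likes: the property does not depend on the choice, and here it is demanded
  for each choice, the size \<open>\<epsilon>\<close> of the admissible perturbations depending on it.\<close>

definition locally_rigid ::
    "enat \<Rightarrow> nat \<Rightarrow> enat \<Rightarrow> ('g, 'b) monoid_scheme \<Rightarrow> ('g \<Rightarrow> 'n::finite torus \<Rightarrow> 'n torus) \<Rightarrow> bool"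
  where
  "locally_rigid k r l H \<alpha> \<longleftrightarrow>
     (\<forall>S. finite S \<and> S \<subseteq> carrier H \<and> generate H S = carrier H \<longrightarrow>
        (\<exists>\<epsilon>>0. \<forall>\<beta>. Ck_action k H \<beta> \<and> (\<forall>g\<in>S. Cr_close r \<epsilon> (\<beta> g) (\<alpha> g)) \<longrightarrow>
           (\<exists>h. torus_diffeo l h \<and> (\<forall>g\<in>carrier H. \<beta> g \<circ> h = h \<circ> \<alpha> g))))"

end

theory Submission
  imports Defs "HOL-Probability.Probability"
begin

text \<open>The elements of the perturbed action that matter lift to maps \<open>x \<mapsto> B x + f x\<close> of Euclidean space
  with \<open>f\<close> periodic, smooth and small, and the lifts of commuting elements commute.

  Since no power of the ergodic matrix \<open>A\<close> has eigenvalue 1, its lift has, like \<open>A\<close> itself,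
  periodic points with every prescribed lattice displacement. Write \<open>N\<^sub>i = A\<^sub>i - 1\<close>. The kernels of the \<open>N\<^sub>i\<close>
  intersect trivially, so there are \<open>M\<^sub>i\<close> with \<open>\<Sum>\<^sub>i M\<^sub>i N\<^sub>i = 1\<close>, and \<open>B\<^sub>i = 1 + k N\<^sub>i\<close> satisfies
  \<open>d = \<Sum>\<^sub>i k\<^sup>-\<^sup>1 M\<^sub>i (B\<^sub>i d - d)\<close>. For large \<open>k\<close> this makes the unipotent part rigid: corresponding periodic
  points of the two actions are uniformly close and depend continuously on each other. As periodic points are
  dense, they determine a homeomorphism \<open>id + v\<close> that conjugates everything commuting with \<open>A\<close>.

  The same identity, with \<open>B\<^sub>i\<close> or its inverse, expresses the Fourier coefficient of \<open>v\<close> at \<open>n\<close> through \<open>1/k\<close> times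
  those at sheared frequencies and those of the \<open>f\<^sub>i \<circ> (id + v)\<close>. As \<open>N\<^sub>i\<^sup>2 = 0\<close>, one of the two signs
  yields a frequency no shorter than \<open>n\<close>, so for \<open>k\<close> large the equation is solved by a contraction
  in every decay class, without loss of derivatives. Hence \<open>v\<close> is smooth and \<open>C\<^sup>1\<close> small, and \<open>id + v\<close>
  is a diffeomorphism.\<close>

text \<open>The roles are therefore divided. \<open>A 1\<close> supplies periodic points to be
  matched, and commutation passes the conjugacy on to \<open>A 1\<close> itself; no estimate is made
  along its orbits that depends on contraction or expansion. All estimates come from the powers
  \<open>1 + k * N\<close> of the unipotent elements. The exponent \<open>k\<close> is fixed by the
  linear data before any perturbation is given. Since these powers are words in the generators, a
  large \<open>k\<close> only costs a smaller \<epsilon>.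

  Regularity meets a second obstacle: the perturbation is small in one finite norm only, while every
  decay class has to be reached. So the composition estimate must carry a constant at top order that
  does not depend on the order. The iterates then stay in balls whose radii need not be small, and
  convergence is needed in mean square only.

  The constant is \<open>l = 2 * CARD('n) + 2\<close>: the exponent \<open>2 * CARD('n)\<close>
  makes the weighted lattice sum converge, and two more orders pay for differentiating a Fourier
  series term by term.\<close>

section \<open>Characters and continuous periodic functions\<close>

definition lat :: "int ^ 'n \<Rightarrow> real ^ 'n" where
  "lat m = (\<chi> i. of_int (m $ i))"

definition expi :: "int ^ 'n \<Rightarrow> real ^ 'n \<Rightarrow> complex" where
  "expi m x = cis (2 * pi * (lat m \<bullet> x))"

text \<open>Functions on the torus are treated throughout as lattice-periodic functions on
  \<open>real ^ 'n\<close>, where derivatives and linear maps are directly available.\<close>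

definition cont_periodic :: "(real ^ 'n \<Rightarrow> 'b::topological_space) \<Rightarrow> bool" where
  "cont_periodic u \<longleftrightarrow> continuous_on UNIV u \<and> (\<forall>x m. u (x + lat m) = u x)"

lemma lat_nth [simp]: "lat m $ i = of_int (m $ i)"
  by (simp add: lat_def)

lemma lat_simps: "lat (m + k) = lat m + lat k" "lat (m - k) = lat m - lat k" "lat (- m) = - lat m" "lat 0 = 0"
  by (simp_all add: vec_eq_iff)

lemma lat_eq_iff [simp]: "lat m = lat k \<longleftrightarrow> m = k"
  by (simp add: vec_eq_iff)

lemma lat_inner_lat: "lat m \<bullet> lat k \<in> \<int>"
  by (auto simp: inner_vec_def intro!: Ints_sum Ints_mult)

lemma cis_2pi_Ints: "t \<in> \<int> \<Longrightarrow> cis (2 * pi * t) = 1"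
  by (elim Ints_cases) (simp add: cis_multiple_2pi)

lemma norm_expi [simp]: "cmod (expi m x) = 1"
  by (simp add: expi_def)

lemma expi_add: "expi (m + k) x = expi m x * expi k x"
  by (simp add: expi_def lat_simps inner_add_left cis_mult ring_distribs)

lemma expi_0 [simp]: "expi 0 x = 1"
  by (simp add: expi_def lat_simps)

lemma expi_minus: "expi (- m) x = cnj (expi m x)"
  by (simp add: expi_def lat_simps cis_cnj)

lemma expi_shift: "expi m (x + y) = expi m x * expi m y"
  by (simp add: expi_def inner_add_right cis_mult ring_distribs)

lemma expi_lat [simp]: "expi m (lat k) = 1"
  by (simp add: expi_def cis_2pi_Ints lat_inner_lat)

lemma expi_mult_cnj [simp]: "expi m x * cnj (expi m x) = 1" "cnj (expi m x) * expi m x = 1"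
  by (simp_all add: expi_def cis_cnj cis_mult)

lemma continuous_expi [continuous_intros]: "continuous_on S (expi m)"
  unfolding expi_def cis_conv_exp by (intro continuous_intros)

lemma cont_periodic_expi: "cont_periodic (expi m)"
  by (simp add: cont_periodic_def continuous_expi expi_shift)

lemma cperD: "cont_periodic u \<Longrightarrow> continuous_on S u" "cont_periodic u \<Longrightarrow> u (x + lat m) = u x"
  by (auto simp: cont_periodic_def intro: continuous_on_subset)

lemma cont_periodic_const [simp]: "cont_periodic (\<lambda>x. c)"
  by (simp add: cont_periodic_def)

lemma cont_periodic_add: "cont_periodic u \<Longrightarrow> cont_periodic w \<Longrightarrow> cont_periodic (\<lambda>x. u x + w x :: 'b::real_normed_vector)"
  by (auto simp: cont_periodic_def intro!: continuous_intros)

lemma cont_periodic_diff: "cont_periodic u \<Longrightarrow> cont_periodic w \<Longrightarrow> cont_periodic (\<lambda>x. u x - w x :: 'b::real_normed_vector)"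
  by (auto simp: cont_periodic_def intro!: continuous_intros)

lemma cont_periodic_mult: "cont_periodic u \<Longrightarrow> cont_periodic w \<Longrightarrow> cont_periodic (\<lambda>x. u x * w x :: 'b::real_normed_algebra)"
  by (auto simp: cont_periodic_def intro!: continuous_intros)

lemma cont_periodic_compose: "cont_periodic u \<Longrightarrow> continuous_on UNIV h \<Longrightarrow> cont_periodic (\<lambda>x. h (u x))"
  by (auto simp: cont_periodic_def intro!: continuous_intros continuous_on_compose2[of UNIV h UNIV u])

lemma cont_periodic_norm: "cont_periodic u \<Longrightarrow> cont_periodic (\<lambda>x. norm (u x :: 'b::real_normed_vector))"
  by (rule cont_periodic_compose) (auto intro!: continuous_intros)

lemma cont_periodic_sum: "(\<And>i. i \<in> I \<Longrightarrow> cont_periodic (u i)) \<Longrightarrow> cont_periodic (\<lambda>x. \<Sum>i\<in>I. u i x :: 'b::real_normed_vector)"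
  by (induction I rule: infinite_finite_induct) (auto intro: cont_periodic_add)

lemma lattice_reduce:
  fixes x :: "real ^ 'n"
  obtains m where "x + lat m \<in> cbox 0 1"
proof
  show "x + lat (\<chi> i. - \<lfloor>x $ i\<rfloor>) \<in> cbox 0 1"
    by (auto simp: mem_box_cart) linarith+
qed

lemma cont_periodic_bounded:
  fixes u :: "real ^ 'n \<Rightarrow> 'b::real_normed_vector"
  assumes "cont_periodic u"
  obtains B where "0 < B" "\<And>x. norm (u x) \<le> B"
proof -
  have "compact (u ` cbox 0 1)"
    using assms by (intro compact_continuous_image) (auto simp: cperD)
  then obtain B where B: "0 < B" "\<And>y. y \<in> u ` cbox 0 1 \<Longrightarrow> norm y \<le> B"
    by (meson bounded_pos compact_imp_bounded)
  have "norm (u x) \<le> B" for x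
  proof -
    obtain m where "x + lat m \<in> cbox 0 1" by (rule lattice_reduce)
    then have "norm (u (x + lat m)) \<le> B" by (intro B(2) imageI)
    then show ?thesis using assms by (simp add: cperD)
  qed
  with B(1) show thesis by (rule that)
qed

subsection \<open>The mean of a function on the torus\<close>

abbreviation unit_interval_measure :: "real measure" where
  "unit_interval_measure \<equiv> restrict_space lborel {0..1}"

text \<open>A product measure on functions, rather than Lebesgue measure on
  \<open>real ^ 'n\<close>, lets the integral of a character factor into one-dimensional
  integrals.\<close>

definition cube_measure :: "('n::finite \<Rightarrow> real) measure" where
  "cube_measure = Pi\<^sub>M UNIV (\<lambda>_. unit_interval_measure)"

definition tmean :: "(real ^ 'n \<Rightarrow> 'b::{banach,second_countable_topology}) \<Rightarrow> 'b" where
  "tmean u = (\<integral>f. u (\<chi> i. f i) \<partial>cube_measure)"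

lemma prob_space_unit_interval: "prob_space unit_interval_measure"
  by (rule prob_spaceI) (simp add: space_restrict_space emeasure_restrict_space)

lemma prob_space_cube: "prob_space (cube_measure :: ('n::finite \<Rightarrow> real) measure)"
  unfolding cube_measure_def by (intro prob_space_PiM prob_space_unit_interval)

interpretation cube: prob_space "cube_measure :: ('n::finite \<Rightarrow> real) measure"
  by (rule prob_space_cube)

lemma measurable_vec_cube:
  "(\<lambda>f. \<chi> i. f i) \<in> borel_measurable (cube_measure :: ('n::finite \<Rightarrow> real) measure)"
proof (rule borel_measurable_euclidean_space[THEN iffD2], rule ballI)
  fix b :: "real ^ 'n" assume "b \<in> Basis"
  then obtain i where b: "b = axis i 1" by (auto simp: Basis_vec_def)
  have "(\<lambda>f. f i) \<in> measurable (cube_measure :: ('n \<Rightarrow> real) measure) unit_interval_measure"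
    unfolding cube_measure_def by (rule measurable_component_singleton) auto
  then have "(\<lambda>f. f i) \<in> measurable (cube_measure :: ('n \<Rightarrow> real) measure) lborel"
    by (rule measurable_restrict_space2_iff[THEN iffD1, THEN conjunct1])
  then have "(\<lambda>f. f i) \<in> borel_measurable (cube_measure :: ('n \<Rightarrow> real) measure)"
    by simp
  then show "(\<lambda>f. (\<chi> i. f i) \<bullet> b) \<in> borel_measurable (cube_measure :: ('n \<Rightarrow> real) measure)"
    by (simp add: b inner_axis)
qed

lemma integrable_cube:
  fixes u :: "real ^ 'n \<Rightarrow> 'b::{banach,second_countable_topology}"
  assumes "cont_periodic u"
  shows "integrable cube_measure (\<lambda>f. u (\<chi> i. f i))"
proof -
  obtain B where B: "\<And>x. norm (u x) \<le> B" using cont_periodic_bounded[OF assms] by metis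
  have "u \<in> borel_measurable borel"
    using assms by (intro borel_measurable_continuous_onI) (simp add: cperD)
  then have "(\<lambda>f. u (\<chi> i. f i)) \<in> borel_measurable (cube_measure :: ('n \<Rightarrow> real) measure)"
    by (rule measurable_compose[OF measurable_vec_cube])
  then show ?thesis
    by (intro cube.integrable_const_bound[where B = B]) (auto simp: B)
qed

lemma tmean_const [simp]: "tmean (\<lambda>x::real^'n. c) = c"
  by (simp add: tmean_def cube.prob_space)

lemma tmean_add: "cont_periodic u \<Longrightarrow> cont_periodic w \<Longrightarrow> tmean (\<lambda>x. u x + w x) = tmean u + tmean w"
  unfolding tmean_def by (intro Bochner_Integration.integral_add integrable_cube)

lemma tmean_diff: "cont_periodic u \<Longrightarrow> cont_periodic w \<Longrightarrow> tmean (\<lambda>x. u x - w x) = tmean u - tmean w"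
  unfolding tmean_def by (intro Bochner_Integration.integral_diff integrable_cube)

lemma tmean_bounded_linear: "bounded_linear h \<Longrightarrow> cont_periodic u \<Longrightarrow> tmean (\<lambda>x. h (u x)) = h (tmean u)"
  unfolding tmean_def by (intro integral_bounded_linear integrable_cube)

lemma tmean_cmult:
  fixes c :: complex shows "cont_periodic u \<Longrightarrow> tmean (\<lambda>x. c * u x) = c * tmean u"
  by (rule tmean_bounded_linear[OF bounded_linear_mult_right])

lemma tmean_sum:
  "(\<And>i. i \<in> I \<Longrightarrow> cont_periodic (u i)) \<Longrightarrow> tmean (\<lambda>x. \<Sum>i\<in>I. u i x) = (\<Sum>i\<in>I. tmean (u i))"
  unfolding tmean_def by (intro Bochner_Integration.integral_sum integrable_cube)

lemma tmean_mono:
  fixes u w :: "real ^ 'n \<Rightarrow> real"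
  shows "cont_periodic u \<Longrightarrow> cont_periodic w \<Longrightarrow> (\<And>x. u x \<le> w x) \<Longrightarrow> tmean u \<le> tmean w"
  unfolding tmean_def by (intro integral_mono integrable_cube)

lemma norm_tmean_le:
  fixes u :: "real ^ 'n \<Rightarrow> 'b::{banach,second_countable_topology}"
  assumes "cont_periodic u" "\<And>x. norm (u x) \<le> B"
  shows "norm (tmean u) \<le> B"
proof -
  have "norm (tmean u) \<le> tmean (\<lambda>x. norm (u x))"
    unfolding tmean_def by (rule integral_norm_bound)
  also have "\<dots> \<le> tmean (\<lambda>x :: real ^ 'n. B)"
    by (intro tmean_mono cont_periodic_norm cont_periodic_const assms)
  finally show ?thesis by simp
qed

lemma integral_cis_interval:
  fixes k :: int
  shows "(\<integral>t. cis (2 * pi * (of_int k * t)) \<partial>unit_interval_measure) = (if k = 0 then 1 else 0)"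
proof (cases "k = 0")
  case True
  then show ?thesis using prob_space.prob_space[OF prob_space_unit_interval] by simp
next
  case False
  define c :: complex where "c = 2 * pi * k * \<i>"
  have c: "c \<noteq> 0" using False by (simp add: c_def)
  have ec: "cis (2 * pi * (of_int k * t)) = exp (c * of_real t)" for t
    by (simp add: cis_conv_exp c_def mult_ac)
  have "(\<integral>t. cis (2 * pi * (of_int k * t)) \<partial>unit_interval_measure)
    = (LBINT t:{0..1}. exp (c * of_real t))"
    by (simp add: integral_restrict_space set_lebesgue_integral_def ec)
  also have "\<dots> = exp (c * of_real 1) / c - exp (c * of_real 0) / c"
    unfolding set_lebesgue_integral_def
  proof (rule integral_FTC_Icc)
    show "((\<lambda>t. exp (c * of_real t) / c) has_vector_derivative exp (c * of_real x)) (at x within {0..1})"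
      if "0 \<le> x" "x \<le> 1" for x
    proof -
      have "((\<lambda>z. exp (c * z) / c) has_field_derivative exp (c * of_real x)) (at (of_real x))"
        using c by (auto intro!: derivative_eq_intros)
      then have "((\<lambda>t. exp (c * of_real t) / c) has_vector_derivative exp (c * of_real x)) (at x)"
        by (rule has_vector_derivative_real_field)
      then show ?thesis by (rule has_vector_derivative_at_within)
    qed
    show "continuous_on {0..1} (\<lambda>t. exp (c * of_real t))"
      by (intro continuous_intros)
  qed auto
  also have "\<dots> = 0"
  proof -
    have "exp (c * of_real 1) = cis (2 * pi * of_int k)" by (simp add: ec[of 1, symmetric, simplified])
    then show ?thesis by (simp add: cis_2pi_Ints)
  qed
  finally show ?thesis using False by simp
qed

lemma tmean_expi: "tmean (expi (m :: int ^ 'n)) = (if m = 0 then 1 else 0)"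
proof -
  interpret product_sigma_finite "\<lambda>_::'n. unit_interval_measure"
    by (simp add: product_sigma_finite_def prob_space_imp_sigma_finite prob_space_unit_interval)
  have "tmean (expi m) = (\<integral>f. (\<Prod>i\<in>UNIV. cis (2 * pi * (of_int (m $ i) * f i))) \<partial>Pi\<^sub>M UNIV (\<lambda>_::'n. unit_interval_measure))"
    unfolding tmean_def cube_measure_def
    by (intro Bochner_Integration.integral_cong refl)
       (simp add: expi_def inner_vec_def sum_distrib_left cis_conv_exp exp_sum sum_distrib_right)
  also have "\<dots> = (\<Prod>i\<in>UNIV. \<integral>t. cis (2 * pi * (of_int (m $ i) * t)) \<partial>unit_interval_measure)"
  proof (rule product_integral_prod)
    show "integrable unit_interval_measure (\<lambda>t. cis (2 * pi * (of_int (m $ i) * t)))" for i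
    proof -
      interpret prob_space unit_interval_measure by (rule prob_space_unit_interval)
      have "(\<lambda>t. cis (2 * pi * (of_int (m $ i) * t))) \<in> borel_measurable borel"
        unfolding cis_conv_exp by (intro borel_measurable_continuous_onI continuous_intros)
      then show ?thesis
        by (intro integrable_const_bound[where B = 1]) (auto intro: measurable_restrict_space1)
    qed
  qed simp
  also have "\<dots> = (if m = 0 then 1 else 0)"
    by (auto simp: integral_cis_interval vec_eq_iff)
  finally show ?thesis .
qed

subsection \<open>Trigonometric polynomials\<close>

inductive trig_poly :: "(real ^ 'n \<Rightarrow> complex) \<Rightarrow> bool" where
  tp_expi: "trig_poly (expi m)"
| tp_cmult: "trig_poly u \<Longrightarrow> trig_poly (\<lambda>x. c * u x)"
| tp_add: "trig_poly u \<Longrightarrow> trig_poly w \<Longrightarrow> trig_poly (\<lambda>x. u x + w x)"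

lemma trig_poly_cont_periodic: "trig_poly u \<Longrightarrow> cont_periodic u"
  by (induction rule: trig_poly.induct) (auto intro: cont_periodic_expi cont_periodic_add cont_periodic_mult)

lemma trig_poly_const: "trig_poly (\<lambda>x :: real ^ 'n. c)"
  using tp_cmult[OF tp_expi[of "0 :: int ^ 'n"], of c] by simp

lemma trig_poly_mult_expi: "trig_poly u \<Longrightarrow> trig_poly (\<lambda>x. u x * expi m x)"
proof (induction rule: trig_poly.induct)
  case (tp_expi k)
  then show ?case using trig_poly.tp_expi[of "k + m"] by (simp add: expi_add[abs_def])
next
  case (tp_cmult u c)
  then show ?case using trig_poly.tp_cmult[of _ c] by (simp add: mult.assoc)
next
  case (tp_add u w)
  then show ?case using trig_poly.tp_add by (simp add: ring_distribs)
qed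

lemma trig_poly_mult: "trig_poly w \<Longrightarrow> trig_poly u \<Longrightarrow> trig_poly (\<lambda>x. u x * w x)"
proof (induction rule: trig_poly.induct)
  case (tp_expi k)
  then show ?case by (rule trig_poly_mult_expi)
next
  case (tp_cmult w c)
  then show ?case using trig_poly.tp_cmult[of _ c] by (simp add: mult.left_commute)
next
  case (tp_add w w')
  then show ?case using trig_poly.tp_add by (simp add: ring_distribs)
qed

lemma trig_poly_sum:
  "(\<And>i. i \<in> I \<Longrightarrow> trig_poly (u i)) \<Longrightarrow> trig_poly (\<lambda>x :: real ^ 'n. \<Sum>i\<in>I. u i x)"
  by (induction I rule: infinite_finite_induct) (auto intro: tp_add trig_poly_const)

lemma trig_poly_cos_sin:
  "trig_poly (\<lambda>x :: real ^ 'n. complex_of_real (cos (2 * pi * x $ i)))"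
  "trig_poly (\<lambda>x :: real ^ 'n. complex_of_real (sin (2 * pi * x $ i)))"
proof -
  define a :: "int ^ 'n" where "a = axis i 1"
  have a: "lat a \<bullet> x = x $ i" for x
  proof -
    have "lat a = axis i 1" by (simp add: a_def vec_eq_iff axis_def)
    then show ?thesis by (simp add: inner_axis')
  qed
  have e: "expi a x = cis (2 * pi * x $ i)" "expi (- a) x = cis (- (2 * pi * x $ i))" for x
    by (simp_all add: expi_def a lat_simps)
  have c: "complex_of_real (cos (2 * pi * x $ i)) = (1/2) * (expi a x + expi (- a) x)" for x
    by (simp add: e complex_eq_iff)
  have s: "complex_of_real (sin (2 * pi * x $ i)) = (-\<i>/2) * (expi a x + (-1) * expi (- a) x)" for x
    by (simp add: e complex_eq_iff)
  show "trig_poly (\<lambda>x :: real ^ 'n. complex_of_real (cos (2 * pi * x $ i)))"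
    unfolding c by (intro tp_expi tp_cmult tp_add)
  show "trig_poly (\<lambda>x :: real ^ 'n. complex_of_real (sin (2 * pi * x $ i)))"
    unfolding s by (intro tp_expi tp_cmult tp_add)
qed

text \<open>The image is compact, so that Stone-Weierstrass applies on it.\<close>

definition torus_emb :: "real ^ 'n \<Rightarrow> (real ^ 'n) \<times> (real ^ 'n)" where
  "torus_emb x = (\<chi> i. cos (2 * pi * x $ i), \<chi> i. sin (2 * pi * x $ i))"

lemma continuous_torus_emb: "continuous_on S torus_emb"
  unfolding torus_emb_def by (intro continuous_intros)

lemma torus_emb_eq:
  assumes "torus_emb x = torus_emb y"
  obtains m where "x = y + lat m"
proof -
  have "\<exists>k::int. x $ i = y $ i + of_int k" for i
  proof -
    have "sin (2 * pi * x $ i) = sin (2 * pi * y $ i) \<and> cos (2 * pi * x $ i) = cos (2 * pi * y $ i)"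
      using assms by (auto simp: torus_emb_def vec_eq_iff)
    then obtain k where "2 * pi * x $ i = 2 * pi * y $ i + 2 * pi * real_of_int k"
      using sin_cos_eq_iff by metis
    then have "2 * pi * x $ i = 2 * pi * (y $ i + real_of_int k)"
      by (simp add: algebra_simps)
    then show ?thesis by auto
  qed
  then obtain k where "\<And>i. x $ i = y $ i + of_int (k i :: int)" by metis
  then have "x = y + lat (\<chi> i. k i)" by (simp add: vec_eq_iff)
  then show thesis by (rule that)
qed

text \<open>The coordinates of \<open>torus_emb\<close> are cosines and sines, so linear functionals
  pull back to trigonometric polynomials; products are harmless because characters multiply.\<close>

lemma trig_poly_real_polynomial:
  assumes "real_polynomial_function p"
  shows "trig_poly (\<lambda>x :: real ^ 'n. complex_of_real (p (torus_emb x)))"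
  using assms
proof (induction rule: real_polynomial_function.induct)
  case (linear h)
  interpret bounded_linear h by fact
  have "h (torus_emb x) = (\<Sum>i\<in>UNIV. h (axis i 1, 0) * cos (2 * pi * x $ i))
     + (\<Sum>i\<in>UNIV. h (0, axis i 1) * sin (2 * pi * x $ i))" for x :: "real ^ 'n"
  proof -
    have ex: "y = (\<Sum>i\<in>UNIV. y $ i *\<^sub>R axis i 1)" for y :: "real ^ 'n"
      using basis_expansion[of y] by (simp add: scalar_mult_eq_scaleR)
    have "torus_emb x = (\<Sum>i\<in>UNIV. cos (2 * pi * x $ i) *\<^sub>R (axis i 1, 0))
      + (\<Sum>i\<in>UNIV. sin (2 * pi * x $ i) *\<^sub>R (0, axis i 1))"
      using ex[of "fst (torus_emb x)"] ex[of "snd (torus_emb x)"]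
      by (auto simp: prod_eq_iff fst_sum snd_sum torus_emb_def)
    then show ?thesis by (simp add: add sum scaleR mult.commute del: scaleR_Pair)
  qed
  then have "complex_of_real (h (torus_emb x)) =
     (\<Sum>i\<in>UNIV. complex_of_real (h (axis i 1, 0)) * complex_of_real (cos (2 * pi * x $ i)))
     + (\<Sum>i\<in>UNIV. complex_of_real (h (0, axis i 1)) * complex_of_real (sin (2 * pi * x $ i)))" for x :: "real ^ 'n"
    by simp
  then show ?case
    by (simp only:) (intro tp_add trig_poly_sum tp_cmult trig_poly_cos_sin)
next
  case (const c)
  then show ?case by (rule trig_poly_const)
next
  case (add f g)
  then show ?case by (simp add: tp_add)
next
  case (mult f g)
  then show ?case by (simp add: trig_poly_mult)
qed

text \<open>The fibres of \<open>torus_emb\<close> are the lattice cosets, so a periodic function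
  factors through it, and the factor can be approximated by polynomials on the compact
  image.\<close>

lemma trig_poly_dense_real:
  fixes u :: "real ^ 'n \<Rightarrow> real"
  assumes u: "cont_periodic u" and "0 < \<delta>"
  obtains p where "trig_poly p" "\<And>x. cmod (of_real (u x) - p x) < \<delta>"
proof -
  define C where "C = (cbox 0 1 :: (real ^ 'n) set)"
  define K where "K = torus_emb ` C"
  define U where "U y = u (SOME x. torus_emb x = y)" for y
  have U: "U (torus_emb x) = u x" for x
  proof -
    have "torus_emb (SOME z. torus_emb z = torus_emb x) = torus_emb x"
      by (rule someI[of _ x]) simp
    then obtain m where "(SOME z. torus_emb z = torus_emb x) = x + lat m"
      using torus_emb_eq by blast
    then show ?thesis using u by (simp add: U_def cperD)
  qed
  have Kall: "torus_emb x \<in> K" for x :: "real ^ 'n"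
  proof -
    obtain m where m: "x + lat m \<in> cbox 0 1" by (rule lattice_reduce)
    have "torus_emb (x + lat m) = torus_emb x"
    proof -
      have "2 * pi * (x $ i + of_int (m $ i)) = 2 * pi * x $ i + 2 * pi * of_int (m $ i)" for i
        by (simp add: ring_distribs)
      then show ?thesis
        using sin_cos_eq_iff by (simp add: torus_emb_def vec_eq_iff) (metis sin_cos_eq_iff)
    qed
    with m show ?thesis unfolding K_def C_def by (metis image_eqI)
  qed
  have "compact C" by (simp add: C_def)
  have "compact K"
    unfolding K_def using \<open>compact C\<close> by (intro compact_continuous_image continuous_torus_emb)
  \<comment> \<open>\<open>U\<close> is defined through an arbitrary choice of preimages. It is
    continuous because \<open>torus_emb\<close> maps closed subsets of the cube to closed sets, by
    compactness.\<close>
  have "continuous_on K U"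
    unfolding continuous_on_closed_vimage[OF compact_imp_closed[OF \<open>compact K\<close>]]
  proof (intro allI impI)
    fix B :: "real set" assume "closed B"
    have "U -` B \<inter> K = torus_emb ` (C \<inter> u -` B)"
      by (auto simp: K_def U)
    moreover have "compact (C \<inter> u -` B)"
      using \<open>compact C\<close> u \<open>closed B\<close>
      by (intro compact_Int_closed) (auto intro!: closed_vimage simp: cperD)
    ultimately show "closed (U -` B \<inter> K)"
      by (metis compact_continuous_image compact_imp_closed continuous_torus_emb)
  qed
  then obtain p where p: "real_polynomial_function p" "\<And>y. y \<in> K \<Longrightarrow> \<bar>U y - p y\<bar> < \<delta>"
    using Stone_Weierstrass_real_polynomial_function[OF \<open>compact K\<close> _ \<open>0 < \<delta>\<close>] by metis
  show thesis
  proof (rule that[OF trig_poly_real_polynomial[OF p(1)]])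
    fix x :: "real ^ 'n"
    show "cmod (of_real (u x) - of_real (p (torus_emb x))) < \<delta>"
      using p(2)[OF Kall, of x] unfolding of_real_diff[symmetric] norm_of_real by (simp add: U)
  qed
qed

lemma trig_poly_dense:
  assumes u: "cont_periodic u" and "0 < \<delta>"
  obtains p where "trig_poly p" "\<And>x. cmod (u x - p x) < \<delta>"
proof -
  have "cont_periodic (\<lambda>x. Re (u x))" "cont_periodic (\<lambda>x. Im (u x))"
    using u by (auto intro!: cont_periodic_compose[where u = u] continuous_intros)
  then obtain p q where pq: "trig_poly p" "trig_poly q"
     "\<And>x. cmod (of_real (Re (u x)) - p x) < \<delta>/2" "\<And>x. cmod (of_real (Im (u x)) - q x) < \<delta>/2"
    using trig_poly_dense_real[of "\<lambda>x. Re (u x)" "\<delta>/2"] trig_poly_dense_real[of "\<lambda>x. Im (u x)" "\<delta>/2"] \<open>0 < \<delta>\<close>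
    by (metis half_gt_zero)
  show thesis
  proof (rule that[of "\<lambda>x. p x + \<i> * q x"])
    show "trig_poly (\<lambda>x. p x + \<i> * q x)" using pq by (intro tp_add tp_cmult)
    fix x
    have "u x - (p x + \<i> * q x) = (of_real (Re (u x)) - p x) + \<i> * (of_real (Im (u x)) - q x)"
      by (simp add: complex_eq_iff)
    also have "cmod \<dots> \<le> cmod (of_real (Re (u x)) - p x) + cmod (of_real (Im (u x)) - q x)"
      by (metis norm_triangle_ineq norm_mult norm_ii mult_1)
    also have "\<dots> < \<delta>" using pq(3,4)[of x] by linarith
    finally show "cmod (u x - (p x + \<i> * q x)) < \<delta>" .
  qed
qed

subsection \<open>Fourier coefficients\<close>

definition fcoef :: "(real ^ 'n \<Rightarrow> complex) \<Rightarrow> int ^ 'n \<Rightarrow> complex" where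
  "fcoef u n = tmean (\<lambda>x. u x * expi (- n) x)"

lemma fcoef_expi: "fcoef (expi m) n = (if m = n then 1 else 0)"
proof -
  have "fcoef (expi m) n = tmean (expi (m - n))"
    by (simp add: fcoef_def expi_add[symmetric] del: expi_add)
  then show ?thesis by (simp add: tmean_expi)
qed

lemma fcoef_add: "cont_periodic u \<Longrightarrow> cont_periodic w \<Longrightarrow> fcoef (\<lambda>x. u x + w x) n = fcoef u n + fcoef w n"
  by (simp add: fcoef_def ring_distribs tmean_add cont_periodic_mult cont_periodic_expi)

lemma fcoef_diff: "cont_periodic u \<Longrightarrow> cont_periodic w \<Longrightarrow> fcoef (\<lambda>x. u x - w x) n = fcoef u n - fcoef w n"
  by (simp add: fcoef_def ring_distribs tmean_diff cont_periodic_mult cont_periodic_expi)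

lemma fcoef_cmult: "cont_periodic u \<Longrightarrow> fcoef (\<lambda>x. c * u x) n = c * fcoef u n"
  by (simp add: fcoef_def mult.assoc tmean_cmult cont_periodic_mult cont_periodic_expi)

lemma fcoef_sum:
  "(\<And>i. i \<in> I \<Longrightarrow> cont_periodic (u i)) \<Longrightarrow> fcoef (\<lambda>x. \<Sum>i\<in>I. u i x) n = (\<Sum>i\<in>I. fcoef (u i) n)"
  by (simp add: fcoef_def sum_distrib_right tmean_sum cont_periodic_mult cont_periodic_expi)

lemma fcoef_shift_index: "fcoef (\<lambda>x. u x * expi m x) n = fcoef u (n - m)"
  by (simp add: fcoef_def mult.assoc expi_add[symmetric] add.commute)

lemma norm_fcoef_le:
  assumes "cont_periodic u" "\<And>x. cmod (u x) \<le> B"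
  shows "cmod (fcoef u n) \<le> B"
  unfolding fcoef_def by (rule norm_tmean_le) (auto simp: norm_mult assms cont_periodic_mult cont_periodic_expi)

lemma fcoef_minus:
  assumes "cont_periodic u" "\<And>x. cnj (u x) = u x"
  shows "fcoef u (- n) = cnj (fcoef u n)"
proof -
  have "cnj (fcoef u n) = tmean (\<lambda>x. cnj (u x * expi (- n) x))"
    unfolding fcoef_def
    by (rule tmean_bounded_linear[symmetric]) (auto intro: bounded_linear_cnj cont_periodic_mult cont_periodic_expi assms)
  then show ?thesis by (simp add: fcoef_def assms expi_minus)
qed

text \<open>Both sides of an identity between bounded functionals only have to be compared on characters.\<close>

lemma fcoef_eqI_dense:
  fixes T :: "(real ^ 'n \<Rightarrow> complex) \<Rightarrow> complex"
  assumes add: "\<And>u w. cont_periodic u \<Longrightarrow> cont_periodic w \<Longrightarrow> T (\<lambda>x. u x + w x) = T u + T w"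
    and cmult: "\<And>u c. cont_periodic u \<Longrightarrow> T (\<lambda>x. c * u x) = c * T u"
    and bd: "\<And>u B. cont_periodic u \<Longrightarrow> (\<And>x. cmod (u x) \<le> B) \<Longrightarrow> cmod (T u) \<le> C * B"
    and char: "\<And>m. T (expi m) = 0"
    and u: "cont_periodic u"
  shows "T u = 0"
proof (rule ccontr)
  assume "T u \<noteq> 0"
  have C: "0 \<le> C" using bd[of "\<lambda>x. 0" 1] by (auto intro: order_trans[OF norm_ge_zero])
  have tp: "T p = 0" if "trig_poly p" for p
    using that
  proof (induction rule: trig_poly.induct)
    case (tp_expi m)
    show ?case by (rule char)
  next
    case (tp_cmult u c)
    then show ?case by (simp add: cmult trig_poly_cont_periodic)
  next
    case (tp_add u w)
    then show ?case by (simp add: add trig_poly_cont_periodic)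
  qed
  define \<delta> where "\<delta> = cmod (T u) / (2 * (C + 1))"
  have "\<delta> > 0" using \<open>T u \<noteq> 0\<close> C by (simp add: \<delta>_def)
  then obtain p where p: "trig_poly p" "\<And>x. cmod (u x - p x) < \<delta>"
    using trig_poly_dense[OF u] by blast
  have "T u = T (\<lambda>x. (u x - p x) + p x)" by simp
  also have "\<dots> = T (\<lambda>x. u x - p x)"
    by (subst add) (auto simp: tp p u trig_poly_cont_periodic cont_periodic_diff)
  also have "cmod \<dots> \<le> C * \<delta>"
    by (intro bd) (auto simp: less_imp_le p u trig_poly_cont_periodic cont_periodic_diff)
  also have "\<dots> < cmod (T u)"
    using C \<open>T u \<noteq> 0\<close> by (simp add: \<delta>_def field_simps) (smt (verit) mult_nonneg_nonneg norm_ge_zero zero_less_norm_iff)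
  finally show False by simp
qed

section \<open>Fourier coefficients under linear maps, translations and derivatives\<close>

abbreviation rmat :: "int ^ 'n ^ 'm \<Rightarrow> real ^ 'n ^ 'm" where
  "rmat \<equiv> map_matrix real_of_int"

lemma lat_mult: "lat (B *v m) = rmat B *v lat m"
  by (simp add: vec_eq_iff matrix_vector_mult_def map_matrix_def)

lemma cont_periodic_linear:
  fixes B :: "int ^ 'n ^ 'n"
  assumes "cont_periodic u" shows "cont_periodic (\<lambda>x. u (rmat B *v x))"
proof -
  have "continuous_on UNIV (\<lambda>x. u (rmat B *v x))"
    using assms by (intro continuous_on_compose2[OF cperD(1)[OF assms, of UNIV]])
      (auto intro!: matrix_vector_mult_linear_continuous_on)
  then show ?thesis
    using assms by (simp add: cont_periodic_def matrix_vector_right_distrib lat_mult[symmetric])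
qed

lemma expi_linear: "expi m (rmat B *v x) = expi (transpose B *v m) x"
proof -
  have "rmat (transpose B) = transpose (rmat B)"
    by (simp add: vec_eq_iff transpose_def map_matrix_def)
  then have "lat (transpose B *v m) \<bullet> x = lat m \<bullet> (rmat B *v x)"
    by (simp only: lat_mult) (simp add: dot_lmul_matrix[symmetric])
  then show ?thesis by (simp add: expi_def)
qed

text \<open>Composition with the matrix sends the character \<open>m\<close> to the character
  \<open>transpose B *v m\<close>, and density does the rest, so no change of variables in an
  integral is performed. The hypothesis says that \<open>n'\<close> is the only frequency sent to
  \<open>n\<close>.\<close>

lemma fcoef_linear:
  fixes B :: "int ^ 'n ^ 'n"
  assumes u: "cont_periodic u" and B: "\<And>m. transpose B *v m = n \<longleftrightarrow> m = n'"
  shows "fcoef (\<lambda>x. u (rmat B *v x)) n = fcoef u n'"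
proof -
  have "fcoef (\<lambda>x. u (rmat B *v x)) n - fcoef u n' = 0"
  proof (rule fcoef_eqI_dense[where T = "\<lambda>u. fcoef (\<lambda>x. u (rmat B *v x)) n - fcoef u n'" and C = 2 and u = u])
    fix u :: "real ^ 'n \<Rightarrow> complex" and b assume u: "cont_periodic u" "\<And>x. cmod (u x) \<le> b"
    have "cmod (fcoef (\<lambda>x. u (rmat B *v x)) n) \<le> b" "cmod (fcoef u n') \<le> b"
      using u by (auto intro!: norm_fcoef_le cont_periodic_linear)
    then show "cmod (fcoef (\<lambda>x. u (rmat B *v x)) n - fcoef u n') \<le> 2 * b"
      using norm_triangle_ineq4[of "fcoef (\<lambda>x. u (rmat B *v x)) n" "fcoef u n'"] by linarith
  next
    fix m
    show "fcoef (\<lambda>x. expi m (rmat B *v x)) n - fcoef (expi m) n' = 0"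
      using B[of m] by (simp add: expi_linear fcoef_expi)
  qed (auto simp: fcoef_add fcoef_cmult cont_periodic_linear u right_diff_distrib)
  then show ?thesis by simp
qed

lemma cont_periodic_translate:
  assumes "cont_periodic u" shows "cont_periodic (\<lambda>x. u (x + y))"
proof -
  have "continuous_on UNIV (\<lambda>x. u (x + y))"
    by (rule continuous_on_compose2[OF cperD(1)[OF assms, of UNIV]]) (auto intro!: continuous_intros)
  moreover have "u (x + lat m + y) = u (x + y)" for x m
    using cperD(2)[OF assms, of "x + y" m] by (simp add: algebra_simps)
  ultimately show ?thesis by (simp add: cont_periodic_def)
qed

text \<open>The same device: on the character \<open>m\<close> a translation is multiplication by
  the scalar \<open>expi m y\<close>.\<close>

lemma fcoef_translate:
  fixes u :: "real ^ 'n \<Rightarrow> complex"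
  assumes u: "cont_periodic u"
  shows "fcoef (\<lambda>x. u (x + y)) n = expi n y * fcoef u n"
proof -
  have "fcoef (\<lambda>x. u (x + y)) n - expi n y * fcoef u n = 0"
  proof (rule fcoef_eqI_dense[where T = "\<lambda>u. fcoef (\<lambda>x. u (x + y)) n - expi n y * fcoef u n" and C = 2 and u = u])
    fix u :: "real ^ 'n \<Rightarrow> complex" and b assume u: "cont_periodic u" "\<And>x. cmod (u x) \<le> b"
    have "cmod (fcoef (\<lambda>x. u (x + y)) n) \<le> b" "cmod (fcoef u n) \<le> b"
      using u by (auto intro!: norm_fcoef_le cont_periodic_translate)
    then show "cmod (fcoef (\<lambda>x. u (x + y)) n - expi n y * fcoef u n) \<le> 2 * b"
      using norm_triangle_ineq4[of "fcoef (\<lambda>x. u (x + y)) n" "expi n y * fcoef u n"]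
      by (simp add: norm_mult)
  next
    fix m
    have "(\<lambda>x. expi m (x + y)) = (\<lambda>x. expi m y * expi m x)" by (simp add: expi_shift mult.commute)
    then show "fcoef (\<lambda>x. expi m (x + y)) n - expi n y * fcoef (expi m) n = 0"
      by (simp add: fcoef_cmult cont_periodic_expi fcoef_expi)
  qed (auto simp: fcoef_add fcoef_cmult cont_periodic_translate u algebra_simps)
  then show ?thesis by simp
qed

lemma expi_axis: "expi n (t *\<^sub>R axis i 1) = cis (2 * pi * of_int (n $ i) * t)"
  by (simp add: expi_def inner_axis mult_ac)

text \<open>A lattice translation brings \<open>x\<close> into the unit cube, and a displacement
  shorter than 1 does not leave the compact cube from -1 to 2.\<close>

lemma cont_periodic_uniformly_continuous:
  fixes u :: "real ^ 'n \<Rightarrow> 'b::real_normed_vector"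
  assumes u: "cont_periodic u" and "0 < \<delta>"
  obtains d where "0 < d" "\<And>x y. norm y < d \<Longrightarrow> norm (u (x + y) - u x) < \<delta>"
proof -
  have "uniformly_continuous_on (cbox (-1) 2) u"
    using u by (intro compact_uniformly_continuous) (auto simp: cperD)
  then obtain d where d: "0 < d" "\<And>x y. x \<in> cbox (-1) 2 \<Longrightarrow> y \<in> cbox (-1) 2 \<Longrightarrow> dist y x < d \<Longrightarrow> dist (u y) (u x) < \<delta>"
    using \<open>0 < \<delta>\<close> unfolding uniformly_continuous_on_def by metis
  show thesis
  proof (rule that[of "min d 1"])
    fix x y :: "real ^ 'n" assume y: "norm y < min d 1"
    obtain m where m: "x + lat m \<in> cbox 0 1" by (rule lattice_reduce)
    have yi: "\<bar>y $ i\<bar> < 1" for i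
      using component_le_norm_cart[of y i] y by linarith
    have 1: "x + lat m \<in> cbox (-1) 2"
      unfolding mem_box_cart
    proof
      fix i
      have "0 \<le> (x + lat m) $ i \<and> (x + lat m) $ i \<le> 1" using m by (simp add: mem_box_cart)
      then show "(-1) $ i \<le> (x + lat m) $ i \<and> (x + lat m) $ i \<le> 2 $ i" by auto
    qed
    have 2: "(x + y) + lat m \<in> cbox (-1) 2"
      unfolding mem_box_cart
    proof
      fix i
      have "0 \<le> (x + lat m) $ i \<and> (x + lat m) $ i \<le> 1" using m by (simp add: mem_box_cart)
      then show "(-1) $ i \<le> (x + y + lat m) $ i \<and> (x + y + lat m) $ i \<le> 2 $ i"
        using yi[of i] by auto
    qed
    have "dist (u ((x + y) + lat m)) (u (x + lat m)) < \<delta>"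
      using d(2)[OF 1 2] y by (simp add: dist_norm)
    then show "norm (u (x + y) - u x) < \<delta>"
      using u by (simp add: dist_norm cperD)
  qed (use d in auto)
qed

text \<open>Integration by parts: the mean of a difference quotient is known by translation invariance.\<close>

lemma fcoef_deriv:
  fixes u :: "real ^ 'n \<Rightarrow> complex" and i :: 'n
  assumes u: "cont_periodic u" and u': "cont_periodic (\<lambda>x. D x (axis i 1))"
    and d: "\<And>x. (u has_derivative D x) (at x)"
  shows "fcoef (\<lambda>x. D x (axis i 1)) n = 2 * pi * \<i> * of_int (n $ i) * fcoef u n"
proof -
  define e :: "real ^ 'n" where "e = axis i 1"
  define c where "c = fcoef (\<lambda>x. D x e) n"
  have ne [simp]: "norm e = 1" by (simp add: e_def)
  have u': "cont_periodic (\<lambda>x. D x e)" using u' by (simp add: e_def)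
  have lin: "linear (D x)" for x
    using d[of x] has_derivative_linear by blast
  \<comment> \<open>Mean value inequality along \<open>e\<close>, after the linear part of
    \<open>u\<close> at \<open>x\<close> has been subtracted.\<close>
  have bound: "cmod (u (x + t *\<^sub>R e) - u x - t *\<^sub>R D x e) \<le> \<delta> * \<bar>t\<bar>"
    if *: "\<And>s. \<bar>s\<bar> \<le> \<bar>t\<bar> \<Longrightarrow> cmod (D (x + s *\<^sub>R e) e - D x e) \<le> \<delta>" for x t \<delta>
  proof -
    define f where "f s = u (x + s *\<^sub>R e) - s *\<^sub>R D x e" for s
    have "(f has_derivative (\<lambda>h. h *\<^sub>R (D (x + s *\<^sub>R e) e - D x e))) (at s within {-\<bar>t\<bar>..\<bar>t\<bar>})" for s
    proof -
      have "((\<lambda>s. x + s *\<^sub>R e) has_derivative (\<lambda>h. h *\<^sub>R e)) (at s within {-\<bar>t\<bar>..\<bar>t\<bar>})"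
        by (auto intro!: derivative_eq_intros)
      then have "((\<lambda>s. u (x + s *\<^sub>R e)) has_derivative (\<lambda>h. D (x + s *\<^sub>R e) (h *\<^sub>R e))) (at s within {-\<bar>t\<bar>..\<bar>t\<bar>})"
        by (rule has_derivative_compose[OF _ d])
      then show ?thesis
        unfolding f_def
        by (auto intro!: derivative_eq_intros simp: linear_cmul[OF lin] scaleR_right_diff_distrib)
    qed
    moreover have "onorm (\<lambda>h. h *\<^sub>R (D (x + s *\<^sub>R e) e - D x e)) \<le> \<delta>" if "s \<in> {-\<bar>t\<bar>..\<bar>t\<bar>}" for s
      using *[of s] that by (intro onorm_le) (auto simp: mult.commute[of \<delta>] intro!: mult_left_mono)
    ultimately have "norm (f t - f 0) \<le> \<delta> * norm (t - 0)"
      by (intro differentiable_bound[of "{-\<bar>t\<bar>..\<bar>t\<bar>}" f]) auto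
    then show ?thesis by (simp add: f_def algebra_simps)
  qed
  \<comment> \<open>As a function of \<open>t\<close> this is the coefficient of the translate of
    \<open>u\<close> by \<open>t *\<^sub>R e\<close>. Its derivative at 0 is computed twice, here as
    the limit of difference quotients and below from the explicit exponential.\<close>
  have "((\<lambda>t. expi n (t *\<^sub>R e) * fcoef u n) has_vector_derivative c) (at 0)"
    unfolding has_vector_derivative_def has_derivative_at_alt
  proof (intro conjI allI impI)
    fix \<delta> :: real assume "0 < \<delta>"
    then obtain r where r: "0 < r" "\<And>x y. norm y < r \<Longrightarrow> cmod (D (x + y) e - D x e) < \<delta>"
      using cont_periodic_uniformly_continuous[OF u'] by metis
    show "\<exists>r>0. \<forall>t. norm (t - 0) < r \<longrightarrow>
       norm (expi n (t *\<^sub>R e) * fcoef u n - expi n (0 *\<^sub>R e) * fcoef u n - (t - 0) *\<^sub>R c) \<le> \<delta> * norm (t - 0)"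
    proof (intro exI[of _ r] conjI allI impI)
      fix t :: real assume t: "norm (t - 0) < r"
      have sc: "cont_periodic (\<lambda>x. of_real t * D x e)" using u' by (intro cont_periodic_mult) auto
      have "expi n (t *\<^sub>R e) * fcoef u n - fcoef u n - t *\<^sub>R c
        = fcoef (\<lambda>x. u (x + t *\<^sub>R e) - u x - of_real t * D x e) n"
        using u u' sc
        by (simp add: fcoef_diff fcoef_cmult fcoef_translate cont_periodic_diff cont_periodic_translate c_def scaleR_conv_of_real)
      also have "cmod \<dots> \<le> \<delta> * \<bar>t\<bar>"
      proof (rule norm_fcoef_le)
        show "cont_periodic (\<lambda>x. u (x + t *\<^sub>R e) - u x - of_real t * D x e)"
          using u sc by (intro cont_periodic_diff cont_periodic_translate)
        show "cmod (u (x + t *\<^sub>R e) - u x - of_real t * D x e) \<le> \<delta> * \<bar>t\<bar>" for x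
        proof -
          have "cmod (D (x + s *\<^sub>R e) e - D x e) \<le> \<delta>" if "\<bar>s\<bar> \<le> \<bar>t\<bar>" for s
            using r(2)[of "s *\<^sub>R e" x] t that by simp
          then have "cmod (u (x + t *\<^sub>R e) - u x - t *\<^sub>R D x e) \<le> \<delta> * \<bar>t\<bar>"
            by (rule bound)
          then show ?thesis by (simp only: scaleR_conv_of_real[of t "D x e"])
        qed
      qed
      finally show "norm (expi n (t *\<^sub>R e) * fcoef u n - expi n (0 *\<^sub>R e) * fcoef u n - (t - 0) *\<^sub>R c) \<le> \<delta> * norm (t - 0)"
        by (simp add: expi_def)
    qed (use r in auto)
  qed (auto intro: bounded_linear_scaleR_left)
  moreover have "((\<lambda>t. expi n (t *\<^sub>R e) * fcoef u n) has_vector_derivative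
     (2 * pi * \<i> * of_int (n $ i)) * fcoef u n) (at 0)"
  proof -
    have "((\<lambda>z. exp ((2 * pi * \<i> * of_int (n $ i)) * z) * fcoef u n) has_field_derivative
       (2 * pi * \<i> * of_int (n $ i)) * fcoef u n) (at (of_real 0))"
      by (auto intro!: derivative_eq_intros)
    then have "((\<lambda>t. exp ((2 * pi * \<i> * of_int (n $ i)) * of_real t) * fcoef u n) has_vector_derivative
     (2 * pi * \<i> * of_int (n $ i)) * fcoef u n) (at 0)"
      by (rule has_vector_derivative_real_field)
    then show ?thesis
      by (simp add: e_def expi_axis cis_conv_exp mult_ac)
  qed
  ultimately have "c = 2 * pi * \<i> * of_int (n $ i) * fcoef u n"
    by (rule vector_derivative_unique_at)
  then show ?thesis by (simp add: c_def e_def)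
qed

subsection \<open>Parseval\<close>

definition mean_sq :: "(real ^ 'n \<Rightarrow> complex) \<Rightarrow> real" where
  "mean_sq u = tmean (\<lambda>x. (cmod (u x))\<^sup>2)"

lemma cont_periodic_cmod_sq: "cont_periodic u \<Longrightarrow> cont_periodic (\<lambda>x. (cmod (u x))\<^sup>2)"
  by (rule cont_periodic_compose) (auto intro!: continuous_intros)

lemma cont_periodic_partial_sum: "cont_periodic (\<lambda>x. \<Sum>n\<in>E. c n * expi n x)"
  by (intro cont_periodic_sum cont_periodic_mult cont_periodic_expi cont_periodic_const)

lemma mean_sq_nonneg: "0 \<le> mean_sq u"
  unfolding mean_sq_def tmean_def by (rule Bochner_Integration.integral_nonneg) simp

text \<open>Completing the square. The choice \<open>c = fcoef u\<close> gives Bessel's inequality;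
  leaving \<open>c\<close> free serves \<open>parseval_le\<close>, where the coefficients belong to
  an approximating trigonometric polynomial.\<close>

lemma mean_sq_diff_partial:
  fixes u :: "real ^ 'n \<Rightarrow> complex"
  assumes u: "cont_periodic u" and E: "finite E"
  shows "mean_sq (\<lambda>x. u x - (\<Sum>n\<in>E. c n * expi n x))
     = mean_sq u - (\<Sum>n\<in>E. (cmod (fcoef u n))\<^sup>2) + (\<Sum>n\<in>E. (cmod (fcoef u n - c n))\<^sup>2)"
proof -
  define S where "S x = (\<Sum>n\<in>E. c n * expi n x)" for x :: "real ^ 'n"
  have S: "cont_periodic S" unfolding S_def by (rule cont_periodic_partial_sum)
  have cnjc: "cont_periodic (\<lambda>x. cnj (w x))" if "cont_periodic w" for w :: "real ^ 'n \<Rightarrow> complex"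
    using that by (rule cont_periodic_compose) (auto intro!: continuous_intros)
  have R: "of_real (mean_sq w) = tmean (\<lambda>x. w x * cnj (w x))" if "cont_periodic w" for w :: "real ^ 'n \<Rightarrow> complex"
    unfolding mean_sq_def complex_norm_square[symmetric]
    by (rule tmean_bounded_linear[symmetric]) (auto intro: bounded_linear_of_real cont_periodic_cmod_sq that)
  have A: "tmean (\<lambda>x. w x * cnj (S x)) = (\<Sum>n\<in>E. cnj (c n) * fcoef w n)" if w: "cont_periodic w" for w
  proof -
    have "tmean (\<lambda>x. w x * cnj (S x)) = tmean (\<lambda>x. \<Sum>n\<in>E. cnj (c n) * (w x * expi (- n) x))"
      by (simp add: S_def sum_distrib_left expi_minus mult_ac)
    also have "\<dots> = (\<Sum>n\<in>E. cnj (c n) * fcoef w n)"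
      using w by (simp add: tmean_sum tmean_cmult cont_periodic_mult cont_periodic_expi fcoef_def)
    finally show ?thesis .
  qed
  have fS: "fcoef S n = c n" if "n \<in> E" for n
    using E that by (simp add: S_def[abs_def] fcoef_sum fcoef_cmult cont_periodic_mult cont_periodic_expi fcoef_expi if_distrib if_distribR sum.delta cong: if_cong)
  have B: "tmean (\<lambda>x. S x * cnj (u x)) = (\<Sum>n\<in>E. c n * cnj (fcoef u n))"
  proof -
    have "tmean (\<lambda>x. S x * cnj (u x)) = tmean (\<lambda>x. cnj (u x * cnj (S x)))"
      by (simp add: mult.commute)
    also have "\<dots> = cnj (tmean (\<lambda>x. u x * cnj (S x)))"
      by (rule tmean_bounded_linear[OF bounded_linear_cnj cont_periodic_mult[OF u cnjc[OF S]]])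
    finally show ?thesis using A[OF u] by simp
  qed
  have "of_real (mean_sq (\<lambda>x. u x - S x)) = tmean (\<lambda>x. (u x - S x) * cnj (u x - S x))"
    by (rule R) (intro cont_periodic_diff u S)
  also have "\<dots> = tmean (\<lambda>x. ((u x * cnj (u x) - u x * cnj (S x)) - S x * cnj (u x)) + S x * cnj (S x))"
    by (simp add: algebra_simps)
  also have "\<dots> = of_real (mean_sq u) - (\<Sum>n\<in>E. cnj (c n) * fcoef u n) - (\<Sum>n\<in>E. c n * cnj (fcoef u n)) + (\<Sum>n\<in>E. cnj (c n) * c n)"
    using u S by (simp add: tmean_add tmean_diff cont_periodic_diff cont_periodic_mult cnjc R A B fS)
  also have "\<dots> = of_real (mean_sq u) + (\<Sum>n\<in>E. (fcoef u n - c n) * cnj (fcoef u n - c n) - fcoef u n * cnj (fcoef u n))"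
    by (simp add: sum_subtractf sum.distrib algebra_simps)
  also have "\<dots> = of_real (mean_sq u + (\<Sum>n\<in>E. (cmod (fcoef u n - c n))\<^sup>2 - (cmod (fcoef u n))\<^sup>2))"
    by (simp only: of_real_add of_real_sum of_real_diff complex_norm_square)
  finally have "mean_sq (\<lambda>x. u x - S x) = mean_sq u + (\<Sum>n\<in>E. (cmod (fcoef u n - c n))\<^sup>2 - (cmod (fcoef u n))\<^sup>2)"
    using of_real_eq_iff by blast
  then show ?thesis by (simp add: S_def sum_subtractf)
qed

lemma bessel:
  assumes "cont_periodic u" "finite E"
  shows "(\<Sum>n\<in>E. (cmod (fcoef u n))\<^sup>2) \<le> mean_sq u"
  using mean_sq_diff_partial[OF assms, of "fcoef u"]
    mean_sq_nonneg[of "\<lambda>x. u x - (\<Sum>n\<in>E. fcoef u n * expi n x)"]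
  by simp

lemma trig_poly_finite:
  assumes "trig_poly p"
  shows "\<exists>E c. finite E \<and> p = (\<lambda>x. \<Sum>n\<in>E. c n * expi n x)"
  using assms
proof (induction rule: trig_poly.induct)
  case (tp_expi m)
  show ?case by (intro exI[of _ "{m}"] exI[of _ "\<lambda>_. 1"]) simp
next
  case (tp_cmult u k)
  then obtain E c where "finite E" "u = (\<lambda>x. \<Sum>n\<in>E. c n * expi n x)" by blast
  then show ?case
    by (intro exI[of _ E] exI[of _ "\<lambda>n. k * c n"]) (simp add: sum_distrib_left mult.assoc)
next
  case (tp_add u w)
  then obtain E c F d where *: "finite E" "u = (\<lambda>x. \<Sum>n\<in>E. c n * expi n x)"
     "finite F" "w = (\<lambda>x. \<Sum>n\<in>F. d n * expi n x)" by blast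
  have 1: "(\<Sum>n\<in>E. c n * expi n x) = (\<Sum>n\<in>E \<union> F. (if n \<in> E then c n else 0) * expi n x)" for x
    using * by (intro sum.mono_neutral_cong_left) auto
  have 2: "(\<Sum>n\<in>F. d n * expi n x) = (\<Sum>n\<in>E \<union> F. (if n \<in> F then d n else 0) * expi n x)" for x
    using * by (intro sum.mono_neutral_cong_left) auto
  show ?case
    using * by (intro exI[of _ "E \<union> F"] exI[of _ "\<lambda>n. (if n \<in> E then c n else 0) + (if n \<in> F then d n else 0)"])
       (simp add: 1 2 sum.distrib ring_distribs)
qed

text \<open>A trigonometric polynomial uniformly within \<open>sqrt e\<close> of \<open>u\<close>
  has mean square error at most \<open>e\<close>, and by \<open>mean_sq_diff_partial\<close> that
  error is at least \<open>mean_sq u\<close> minus a finite sum of squared coefficients.\<close>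

lemma parseval_le:
  fixes u :: "real ^ 'n \<Rightarrow> complex"
  assumes u: "cont_periodic u" and C: "\<And>E. finite E \<Longrightarrow> (\<Sum>n\<in>E. (cmod (fcoef u n))\<^sup>2) \<le> C"
  shows "mean_sq u \<le> C"
proof (rule field_le_epsilon)
  fix e :: real assume "0 < e"
  then obtain p where p: "trig_poly p" "\<And>x. cmod (u x - p x) < sqrt e"
    using trig_poly_dense[OF u, of "sqrt e"] by (metis real_sqrt_gt_0_iff)
  obtain E c where E: "finite E" "p = (\<lambda>x. \<Sum>n\<in>E. c n * expi n x)"
    using trig_poly_finite[OF p(1)] by blast
  have "mean_sq (\<lambda>x. u x - p x) \<le> tmean (\<lambda>x :: real ^ 'n. e)"
    unfolding mean_sq_def
  proof (intro tmean_mono cont_periodic_cmod_sq cont_periodic_diff u trig_poly_cont_periodic p(1) cont_periodic_const)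
    fix x
    have "(cmod (u x - p x))\<^sup>2 \<le> (sqrt e)\<^sup>2" using p(2)[of x] by (intro power_mono) auto
    then show "(cmod (u x - p x))\<^sup>2 \<le> e" using \<open>0 < e\<close> by simp
  qed
  then have "mean_sq u - (\<Sum>n\<in>E. (cmod (fcoef u n))\<^sup>2) + (\<Sum>n\<in>E. (cmod (fcoef u n - c n))\<^sup>2) \<le> e"
    using mean_sq_diff_partial[OF u E(1), of c] by (simp add: E(2))
  moreover have "0 \<le> (\<Sum>n\<in>E. (cmod (fcoef u n - c n))\<^sup>2)" by (intro sum_nonneg) auto
  ultimately show "mean_sq u \<le> C + e" using C[OF E(1)] by linarith
qed

text \<open>Finitely many translates of a ball cover the torus, so a nonnegative function that is positive
  somewhere has positive mean.\<close>

lemma mean_sq_eq_0: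
  fixes u :: "real ^ 'n \<Rightarrow> complex"
  assumes u: "cont_periodic u" and 0: "mean_sq u \<le> 0"
  shows "u x = 0"
proof (rule ccontr)
  assume "u x \<noteq> 0"
  define w where "w y = (cmod (u y))\<^sup>2" for y
  have w: "cont_periodic w" "\<And>y. 0 \<le> w y" using cont_periodic_cmod_sq[OF u] by (auto simp: w_def[abs_def])
  define \<delta> where "\<delta> = w x / 2"
  have "\<delta> > 0" using \<open>u x \<noteq> 0\<close> by (simp add: \<delta>_def w_def)
  then obtain d where d: "0 < d" "\<And>x y. norm y < d \<Longrightarrow> norm (w (x + y) - w x) < \<delta>"
    using cont_periodic_uniformly_continuous[OF w(1)] by metis
  \<comment> \<open>The mean is the coefficient at frequency 0, where \<open>fcoef_translate\<close>
    has the factor 1.\<close>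
  have tr: "tmean (\<lambda>y. w (y + t)) = tmean w" for t
  proof -
    have cw: "cont_periodic (\<lambda>y. complex_of_real (w y))" using w(1) by (rule cont_periodic_compose) (auto intro!: continuous_intros)
    have "complex_of_real (tmean (\<lambda>y. w (y + t))) = tmean (\<lambda>y. complex_of_real (w (y + t)))"
      by (rule tmean_bounded_linear[symmetric]) (auto intro: bounded_linear_of_real cont_periodic_translate w)
    also have "\<dots> = tmean (\<lambda>y. complex_of_real (w y))"
      using fcoef_translate[OF cw, of t 0] by (simp add: fcoef_def)
    also have "\<dots> = complex_of_real (tmean w)"
      by (rule tmean_bounded_linear) (auto intro: bounded_linear_of_real w)
    finally show ?thesis by simp
  qed
  define K where "K = cbox 0 (1 :: real ^ 'n)"
  have "compact K" by (simp add: K_def)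
  have cov: "K \<subseteq> (\<Union>t\<in>K. ball t d)" using d(1) by auto
  obtain T where T: "finite T" "K \<subseteq> (\<Union>t\<in>T. ball t d)"
    using compactE_image[OF \<open>compact K\<close> _ cov] open_ball by metis
  have "tmean (\<lambda>y :: real ^ 'n. \<delta>) \<le> tmean (\<lambda>y. \<Sum>t\<in>T. w (y + (x - t)))"
  proof (intro tmean_mono cont_periodic_sum cont_periodic_translate[OF w(1)] cont_periodic_const)
    fix y :: "real ^ 'n"
    obtain m where "y + lat m \<in> cbox 0 1" by (rule lattice_reduce)
    then have "y + lat m \<in> K" by (simp add: K_def)
    then obtain t where t: "t \<in> T" "dist t (y + lat m) < d" using T(2) by auto
    have "norm (w (x + (y + lat m - t)) - w x) < \<delta>"
      using t(2) by (intro d(2)) (simp add: dist_norm norm_minus_commute)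
    moreover have "w (x + (y + lat m - t)) = w (y + (x - t))"
      using cperD(2)[OF w(1), of "y + (x - t)" m] by (simp add: algebra_simps)
    ultimately have "\<delta> \<le> w (y + (x - t))" by (simp add: \<delta>_def abs_if split: if_splits)
    also have "\<dots> \<le> (\<Sum>t\<in>T. w (y + (x - t)))"
      using t(1) T(1) w(2) by (intro member_le_sum) auto
    finally show "\<delta> \<le> (\<Sum>t\<in>T. w (y + (x - t)))" .
  qed
  also have "\<dots> = of_nat (card T) * tmean w"
    by (simp add: tmean_sum cont_periodic_translate w tr)
  also have "\<dots> \<le> 0" using 0 by (simp add: mean_sq_def w_def[abs_def] mult_nonneg_nonpos)
  finally show False using \<open>\<delta> > 0\<close> by simp
qed

subsection \<open>Weighted lattice sums\<close>

definition wt :: "int ^ 'n \<Rightarrow> real" where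
  "wt n = 1 + norm (lat n)"

lemma wt_ge_1 [simp]: "1 \<le> wt n"
  by (simp add: wt_def)

lemma wt_pos [simp]: "0 < wt n"
  using wt_ge_1[of n] by linarith

lemma wt_nonneg [simp]: "0 \<le> wt n"
  by (simp add: less_imp_le)

lemma wt_neq_0 [simp]: "wt n \<noteq> 0"
  using wt_pos[of n] by linarith

lemma wt_minus [simp]: "wt (- n) = wt n"
  by (simp add: wt_def lat_simps)

lemma wt_triangle: "wt n \<le> wt (n - l) + wt l"
proof -
  have "lat n = lat (n - l) + lat l" by (simp add: lat_simps)
  then show ?thesis unfolding wt_def using norm_triangle_ineq[of "lat (n - l)" "lat l"] by simp
qed

lemma abs_nth_le_wt: "\<bar>of_int (n $ i)\<bar> \<le> wt n"
  using component_le_norm_cart[of "lat n" i] by (simp add: wt_def)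

lemma norm_lat_le_wt: "norm (lat n) \<le> wt n"
  by (simp add: wt_def)

lemma wt_le_sum_abs: "wt n \<le> 1 + (\<Sum>i\<in>UNIV. \<bar>of_int (n $ i)\<bar>)"
  using norm_le_l1_cart[of "lat n"] by (simp add: wt_def)

lemma sum_inverse_square_int_bounded:
  obtains C where "\<And>T :: int set. finite T \<Longrightarrow> (\<Sum>t\<in>T. 1 / (1 + \<bar>real_of_int t\<bar>)^2) \<le> C"
proof -
  define g where "g k = inverse ((real (Suc k))\<^sup>2)" for k :: nat
  have "summable (\<lambda>k. inverse ((real k)\<^sup>2))" by (rule inverse_power_summable) simp
  then have g: "summable g" unfolding g_def by (subst summable_Suc_iff)
  have g0: "0 \<le> g k" for k by (simp add: g_def)
  have part: "(\<Sum>t\<in>T. 1 / (1 + \<bar>real_of_int t\<bar>)^2) \<le> suminf g"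
    if "finite T" "inj_on (\<lambda>t. nat \<bar>t\<bar>) T" for T :: "int set"
  proof -
    have "(\<Sum>t\<in>T. 1 / (1 + \<bar>real_of_int t\<bar>)^2) = (\<Sum>k\<in>(\<lambda>t. nat \<bar>t\<bar>) ` T. g k)"
      using that by (subst sum.reindex) (auto simp: g_def field_simps intro!: sum.cong)
    also have "\<dots> \<le> suminf g"
      using that g g0 by (intro sum_le_suminf) auto
    finally show ?thesis .
  qed
  show thesis
  proof (rule that[of "suminf g + suminf g"])
    fix T :: "int set" assume T: "finite T"
    have "(\<Sum>t\<in>T. 1 / (1 + \<bar>real_of_int t\<bar>)^2)
       = (\<Sum>t\<in>T \<inter> {0..}. 1 / (1 + \<bar>real_of_int t\<bar>)^2) + (\<Sum>t\<in>T - {0..}. 1 / (1 + \<bar>real_of_int t\<bar>)^2)"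
      using sum.Int_Diff[OF T] .
    also have "\<dots> \<le> suminf g + suminf g"
      using T by (intro add_mono part) (auto simp: inj_on_def)
    finally show "(\<Sum>t\<in>T. 1 / (1 + \<bar>real_of_int t\<bar>)^2) \<le> suminf g + suminf g" .
  qed
qed

text \<open>The exponent is chosen so that the weight splits: \<open>wt n ^ (2 * CARD('n))\<close>
  dominates the product of the \<open>(1 + \<bar>n $ i\<bar>)^2\<close>, and the sum over a box
  factors into one-dimensional series.\<close>

lemma wt_sum_bounded:
  obtains S where "1 \<le> S" "\<And>E :: (int ^ 'n) set. finite E \<Longrightarrow> (\<Sum>n\<in>E. 1 / wt n ^ (2 * CARD('n))) \<le> S"
proof -
  obtain C where C: "\<And>T :: int set. finite T \<Longrightarrow> (\<Sum>t\<in>T. 1 / (1 + \<bar>real_of_int t\<bar>)^2) \<le> C"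
    by (rule sum_inverse_square_int_bounded) blast
  show thesis
  proof (rule that[of "max 1 (C ^ CARD('n))"])
    fix E :: "(int ^ 'n) set" assume E: "finite E"
    define T where "T = (\<Union>n\<in>E. range (($) n))"
    have T: "finite T" using E by (auto simp: T_def)
    have le: "1 / wt n ^ (2 * CARD('n)) \<le> (\<Prod>i\<in>UNIV. 1 / (1 + \<bar>real_of_int (n $ i)\<bar>)^2)" for n :: "int ^ 'n"
    proof -
      have "(\<Prod>i\<in>(UNIV :: 'n set). (1 + \<bar>real_of_int (n $ i)\<bar>)^2) \<le> (\<Prod>i\<in>(UNIV :: 'n set). (wt n)^2)"
        using component_le_norm_cart[of "lat n"]
        by (intro prod_mono conjI power_mono) (auto simp: wt_def)
      also have "\<dots> = wt n ^ (2 * CARD('n))" by (simp add: power_mult)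
      finally have "1 / wt n ^ (2 * CARD('n)) \<le> 1 / (\<Prod>i\<in>(UNIV :: 'n set). (1 + \<bar>real_of_int (n $ i)\<bar>)^2)"
        by (intro divide_left_mono mult_pos_pos prod_pos) (auto intro!: zero_less_power add_pos_nonneg)
      then show ?thesis by (simp add: prod_dividef)
    qed
    have "(\<Sum>n\<in>E. 1 / wt n ^ (2 * CARD('n))) \<le> (\<Sum>n\<in>E. \<Prod>i\<in>UNIV. 1 / (1 + \<bar>real_of_int (n $ i)\<bar>)^2)"
      by (intro sum_mono le)
    also have "\<dots> = (\<Sum>f\<in>($) ` E. \<Prod>i\<in>UNIV. 1 / (1 + \<bar>real_of_int (f i)\<bar>)^2)"
      by (subst sum.reindex) (auto simp: inj_on_def vec_eq_iff)
    also have "\<dots> \<le> (\<Sum>f\<in>PiE (UNIV :: 'n set) (\<lambda>_. T). \<Prod>i\<in>UNIV. 1 / (1 + \<bar>real_of_int (f i)\<bar>)^2)"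
    proof (rule sum_mono2)
      show "finite (PiE (UNIV :: 'n set) (\<lambda>_. T))" using T by (intro finite_PiE) auto
      show "($) ` E \<subseteq> PiE UNIV (\<lambda>_. T)" by (auto simp: T_def)
      show "0 \<le> (\<Prod>i\<in>(UNIV :: 'n set). 1 / (1 + \<bar>real_of_int (f i)\<bar>)^2)" for f :: "'n \<Rightarrow> int"
        by (intro prod_nonneg) simp
    qed
    also have "\<dots> = (\<Prod>i\<in>(UNIV :: 'n set). \<Sum>t\<in>T. 1 / (1 + \<bar>real_of_int t\<bar>)^2)"
      using T by (subst prod_sum_PiE) auto
    also have "\<dots> \<le> C ^ CARD('n)"
      using C[OF T] by (simp add: power_mono sum_nonneg)
    finally show "(\<Sum>n\<in>E. 1 / wt n ^ (2 * CARD('n))) \<le> max 1 (C ^ CARD('n))" by simp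
  qed simp
qed

lemma wt_sum_shift:
  assumes S: "\<And>E :: (int ^ 'n) set. finite E \<Longrightarrow> (\<Sum>n\<in>E. 1 / wt n ^ t) \<le> S" and "finite E"
  shows "(\<Sum>l\<in>E. 1 / wt (n - l :: int ^ 'n) ^ t) \<le> S"
proof -
  have "(\<Sum>l\<in>E. 1 / wt (n - l) ^ t) = (\<Sum>l\<in>(\<lambda>l. n - l) ` E. 1 / wt l ^ t)"
    by (subst sum.reindex) (auto simp: inj_on_def)
  also have "\<dots> \<le> S" by (intro S finite_imageI \<open>finite E\<close>)
  finally show ?thesis .
qed

lemma power_add_le:
  fixes x y :: real assumes "0 \<le> x" "0 \<le> y"
  shows "(x + y) ^ r \<le> 2 ^ r * (x ^ r + y ^ r)"
proof -
  have "(x + y) ^ r \<le> (2 * max x y) ^ r" using assms by (intro power_mono) auto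
  also have "\<dots> = 2 ^ r * (max x y) ^ r" by (simp add: power_mult_distrib)
  also have "\<dots> \<le> 2 ^ r * (x ^ r + y ^ r)"
    using assms by (intro mult_left_mono) (auto simp: max_def)
  finally show ?thesis .
qed

text \<open>Decay of order \<open>r\<close> survives convolution with decay of order
  \<open>t\<close>, because the weight at \<open>n\<close> is at most the sum of the weights at
  \<open>n - l\<close> and \<open>l\<close>, and each of the two can be absorbed by one
  factor.\<close>

lemma wt_convolution:
  assumes S: "\<And>E :: (int ^ 'n) set. finite E \<Longrightarrow> (\<Sum>n\<in>E. 1 / wt n ^ t) \<le> S"
    and E: "finite (E :: (int ^ 'n) set)" and r: "r \<le> t"
  shows "(\<Sum>l\<in>E. 1 / wt (n - l) ^ r * (1 / wt l ^ t)) \<le> 2 ^ r * 3 * S / wt n ^ r"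
proof -
  have key: "wt n ^ r * (1 / wt (n - l) ^ r * (1 / wt l ^ t)) \<le> 2 ^ r * (2 / wt l ^ t + 1 / wt (n - l) ^ t)" for l
  proof -
    define x where "x = wt (n - l)"
    define y where "y = wt l"
    have xy: "0 < x" "0 < y" "1 \<le> x" "1 \<le> y" by (auto simp: x_def y_def)
    have "wt n ^ r \<le> (x + y) ^ r"
      using wt_triangle[of n l] by (intro power_mono) (auto simp: x_def y_def)
    also have "\<dots> \<le> 2 ^ r * (x ^ r + y ^ r)" using xy by (intro power_add_le) auto
    finally have "wt n ^ r * (1 / x ^ r * (1 / y ^ t)) \<le> 2 ^ r * (x ^ r + y ^ r) * (1 / x ^ r * (1 / y ^ t))"
      using xy by (intro mult_right_mono) auto
    also have "\<dots> = 2 ^ r * (1 / y ^ t + y ^ r / (x ^ r * y ^ t))"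
      using xy by (simp add: field_simps)
    \<comment> \<open>If \<open>y\<close> is the smaller weight, \<open>y ^ r\<close> cancels
      against \<open>x ^ r\<close>. Otherwise the powers of \<open>y\<close> left in the denominator
      are exchanged for powers of \<open>x\<close>; this is where \<open>r \<le> t\<close>
      enters.\<close>
    also have "y ^ r / (x ^ r * y ^ t) \<le> 1 / y ^ t + 1 / x ^ t"
    proof (cases "y \<le> x")
      case True
      then have "y ^ r \<le> x ^ r" using xy by (intro power_mono) auto
      then have "y ^ r / (x ^ r * y ^ t) \<le> 1 / y ^ t" using xy by (simp add: divide_simps)
      then show ?thesis using xy by (smt (verit) zero_less_divide_1_iff zero_less_power)
    next
      case False
      have t: "t = r + (t - r)" using r by simp
      have "y ^ r / (x ^ r * y ^ t) = 1 / (x ^ r * y ^ (t - r))"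
        using xy by (subst t, subst power_add) (simp add: field_simps)
      also have "\<dots> \<le> 1 / (x ^ r * x ^ (t - r))"
        using False xy by (intro divide_left_mono mult_left_mono power_mono mult_pos_pos) auto
      also have "\<dots> = 1 / x ^ t" by (simp add: power_add[symmetric] r)
      finally show ?thesis using xy by (smt (verit) zero_less_divide_1_iff zero_less_power)
    qed
    finally show ?thesis by (simp add: x_def y_def)
  qed
  have "wt n ^ r * (\<Sum>l\<in>E. 1 / wt (n - l) ^ r * (1 / wt l ^ t)) \<le> (\<Sum>l\<in>E. 2 ^ r * (2 / wt l ^ t + 1 / wt (n - l) ^ t))"
    unfolding sum_distrib_left by (intro sum_mono key)
  also have "\<dots> = 2 ^ r * (2 * (\<Sum>l\<in>E. 1 / wt l ^ t) + (\<Sum>l\<in>E. 1 / wt (n - l) ^ t))"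
    by (simp add: sum_distrib_left[symmetric] sum.distrib) (simp add: sum_distrib_left)
  also have "\<dots> \<le> 2 ^ r * (2 * S + S)"
    using S[OF E] wt_sum_shift[OF S E, of n] by (intro mult_left_mono add_mono) auto
  finally show ?thesis by (simp add: field_simps)
qed

text \<open>In contrast to \<open>power_add_le\<close>, the factor in front of \<open>x ^ s\<close>
  is 2 for every \<open>s\<close>; the growth with \<open>s\<close> is moved into \<open>C\<close>.
  This uniformity lets one smallness condition serve all orders of regularity. For \<open>y\<close>
  at most a small multiple \<open>d\<close> of \<open>x\<close> the factor is
  \<open>(1 + d) ^ s\<close>, and for larger \<open>y\<close> all is charged to
  \<open>y ^ s\<close>.\<close>

lemma power_add_le_absorb:
  assumes "0 < s" obtains C where "0 \<le> C" "\<And>x y :: real. 0 \<le> x \<Longrightarrow> 0 \<le> y \<Longrightarrow> (x + y) ^ s \<le> 2 * x ^ s + C * y ^ s"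
proof -
  have "eventually (\<lambda>d :: real. (1 + d) ^ s < 2) (at_right 0)"
  proof (rule order_tendstoD)
    show "((\<lambda>d :: real. (1 + d) ^ s) \<longlongrightarrow> (1 + 0) ^ s) (at_right 0)"
      by (intro tendsto_intros)
  qed simp
  then obtain b where b: "0 < b" "\<And>d. 0 < d \<Longrightarrow> d < b \<Longrightarrow> (1 + d) ^ s < (2 :: real)"
    unfolding eventually_at_right_field by auto
  define d where "d = b / 2"
  have d: "0 < d" "(1 + d) ^ s \<le> 2" using b(1) b(2)[of d] by (auto simp: d_def)
  show thesis
  proof (rule that[of "(1 + 1 / d) ^ s"])
    fix x y :: real assume xy: "0 \<le> x" "0 \<le> y"
    show "(x + y) ^ s \<le> 2 * x ^ s + (1 + 1 / d) ^ s * y ^ s"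
    proof (cases "y \<le> d * x")
      case True
      then have "(x + y) ^ s \<le> ((1 + d) * x) ^ s" using xy by (intro power_mono) (auto simp: algebra_simps)
      also have "\<dots> \<le> 2 * x ^ s" unfolding power_mult_distrib using d xy by (intro mult_right_mono) auto
      finally show ?thesis using d xy by (smt (verit) mult_nonneg_nonneg zero_le_power divide_nonneg_pos)
    next
      case False
      then have "(x + y) ^ s \<le> ((1 + 1 / d) * y) ^ s" using xy d by (intro power_mono) (auto simp: field_simps)
      also have "\<dots> = (1 + 1 / d) ^ s * y ^ s" by (rule power_mult_distrib)
      finally show ?thesis using xy by (smt (verit) zero_le_power)
    qed
  qed (use d in auto)
qed

subsection \<open>Absolutely convergent Fourier series\<close>

definition fser :: "(int ^ 'n \<Rightarrow> complex) \<Rightarrow> real ^ 'n \<Rightarrow> complex" where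
  "fser c x = (\<Sum>\<^sub>\<infinity>n. c n * expi n x)"

lemma abs_summable_wt:
  fixes c :: "int ^ 'n \<Rightarrow> complex"
  assumes S: "\<And>E :: (int ^ 'n) set. finite E \<Longrightarrow> (\<Sum>n\<in>E. 1 / wt n ^ t) \<le> S"
    and c: "\<And>n. cmod (c n) \<le> K / wt n ^ t"
  shows "Infinite_Sum.abs_summable_on c UNIV" "finite E \<Longrightarrow> (\<Sum>n\<in>E. cmod (c n)) \<le> K * S" "0 \<le> K"
proof -
  have "0 \<le> K / wt (0 :: int ^ 'n) ^ t" using c[of 0] norm_ge_zero order_trans by blast
  then show K: "0 \<le> K" by (meson divide_neg_pos not_le wt_pos zero_less_power)
  have *: "(\<Sum>n\<in>E. cmod (c n)) \<le> K * S" if "finite E" for E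
  proof -
    have "(\<Sum>n\<in>E. cmod (c n)) \<le> (\<Sum>n\<in>E. K * (1 / wt n ^ t))" using c by (intro sum_mono) simp
    also have "\<dots> \<le> K * S" unfolding sum_distrib_left[symmetric] using S[OF that] K by (rule mult_left_mono)
    finally show ?thesis .
  qed
  then show "finite E \<Longrightarrow> (\<Sum>n\<in>E. cmod (c n)) \<le> K * S" .
  show "Infinite_Sum.abs_summable_on c UNIV"
    unfolding abs_summable_iff_bdd_above using * by (intro bdd_aboveI2[where M = "K * S"]) auto
qed

context
  fixes c :: "int ^ 'n \<Rightarrow> complex"
  assumes c: "Infinite_Sum.abs_summable_on c UNIV"
begin

lemma fser_abs_summable: "Infinite_Sum.abs_summable_on (\<lambda>n. c n * expi n x) A"
proof -
  have "Infinite_Sum.abs_summable_on (\<lambda>n. c n * expi n x) UNIV" using c by (simp add: norm_mult)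
  then show ?thesis using summable_on_subset_banach by blast
qed

text \<open>The tail of the series of absolute values bounds the error uniformly in
  \<open>x\<close>. Prescribing a frequency \<open>n0\<close> of the finite set is for
  \<open>fcoef_fser\<close>.\<close>

lemma fser_approx:
  assumes "0 < \<delta>"
  obtains E where "finite E" "n0 \<in> E" "\<And>x. cmod (fser c x - (\<Sum>n\<in>E. c n * expi n x)) \<le> \<delta>"
proof -
  obtain E0 where E0: "finite E0" "dist (\<Sum>n\<in>E0. cmod (c n)) (\<Sum>\<^sub>\<infinity>n. cmod (c n)) \<le> \<delta>"
    using infsum_finite_approximation[OF c \<open>0 < \<delta>\<close>] by blast
  define E where "E = insert n0 E0"
  have "(\<Sum>n\<in>E0. cmod (c n)) \<le> (\<Sum>n\<in>E. cmod (c n))"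
    using E0(1) by (intro sum_mono2) (auto simp: E_def)
  then have E: "finite E" "n0 \<in> E" "(\<Sum>\<^sub>\<infinity>n. cmod (c n)) - (\<Sum>n\<in>E. cmod (c n)) \<le> \<delta>"
    using E0 by (auto simp: E_def dist_real_def)
  have cE: "(\<lambda>n. cmod (c n)) summable_on E" "(\<lambda>n. cmod (c n)) summable_on - E"
    using c summable_on_subset_banach by blast+
  have "(\<Sum>\<^sub>\<infinity>n. cmod (c n)) = (\<Sum>\<^sub>\<infinity>n\<in>E. cmod (c n)) + (\<Sum>\<^sub>\<infinity>n\<in>-E. cmod (c n))"
    using infsum_Un_disjoint[OF cE] by (simp add: Compl_partition)
  then have tail: "(\<Sum>\<^sub>\<infinity>n\<in>-E. cmod (c n)) \<le> \<delta>"
    using E by simp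
  show thesis
  proof (rule that[OF E(1,2)])
    fix x
    have "fser c x = (\<Sum>\<^sub>\<infinity>n\<in>E. c n * expi n x) + (\<Sum>\<^sub>\<infinity>n\<in>-E. c n * expi n x)"
      using infsum_Un_disjoint[OF abs_summable_summable[OF fser_abs_summable, of x E] abs_summable_summable[OF fser_abs_summable, of x "-E"]]
      by (simp add: Compl_partition fser_def)
    then have "fser c x - (\<Sum>n\<in>E. c n * expi n x) = (\<Sum>\<^sub>\<infinity>n\<in>-E. c n * expi n x)"
      using E(1) by simp
    also have "cmod \<dots> \<le> (\<Sum>\<^sub>\<infinity>n\<in>-E. cmod (c n * expi n x))"
      by (rule norm_infsum_bound[OF fser_abs_summable])
    also have "\<dots> \<le> \<delta>" using tail by (simp add: norm_mult)
    finally show "cmod (fser c x - (\<Sum>n\<in>E. c n * expi n x)) \<le> \<delta>" .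
  qed
qed

lemma continuous_fser: "continuous_on UNIV (fser c)"
proof -
  have "\<exists>E. finite E \<and> (\<forall>x. cmod (fser c x - (\<Sum>n\<in>E. c n * expi n x)) \<le> 1 / real (Suc k))" for k
    using fser_approx[of "1 / real (Suc k)"] by (metis of_nat_0_less_iff zero_less_Suc zero_less_divide_1_iff)
  then obtain E where E: "\<And>k. finite (E k)" "\<And>k x. cmod (fser c x - (\<Sum>n\<in>E k. c n * expi n x)) \<le> 1 / real (Suc k)"
    by metis
  have "uniform_limit UNIV (\<lambda>k x. \<Sum>n\<in>E k. c n * expi n x) (fser c) sequentially"
  proof (rule uniform_limitI)
    fix e :: real assume "0 < e"
    then have "\<forall>\<^sub>F k in sequentially. 1 / real (Suc k) < e"
      using LIMSEQ_inverse_real_of_nat by (intro order_tendstoD(2)[of _ 0]) (auto simp: inverse_eq_divide)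
    then show "\<forall>\<^sub>F k in sequentially. \<forall>x\<in>UNIV. dist (\<Sum>n\<in>E k. c n * expi n x) (fser c x) < e"
    proof eventually_elim
      case (elim k)
      show ?case
      proof
        fix x
        show "dist (\<Sum>n\<in>E k. c n * expi n x) (fser c x) < e"
          using E(2)[where k = k and x = x] elim by (simp add: dist_norm norm_minus_commute)
      qed
    qed
  qed
  then show ?thesis
    by (rule uniform_limit_theorem[rotated]) (auto intro!: always_eventually cperD(1) cont_periodic_partial_sum)
qed

lemma cont_periodic_fser: "cont_periodic (fser c)"
  using continuous_fser by (simp add: cont_periodic_def) (simp add: fser_def cperD[OF cont_periodic_expi])

lemma fcoef_fser: "fcoef (fser c) n = c n"
proof (rule ccontr)
  assume "fcoef (fser c) n \<noteq> c n"
  define \<delta> where "\<delta> = cmod (fcoef (fser c) n - c n) / 2"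
  have "\<delta> > 0" using \<open>fcoef (fser c) n \<noteq> c n\<close> by (simp add: \<delta>_def)
  obtain E where E: "finite E" "n \<in> E" "\<And>x. cmod (fser c x - (\<Sum>n\<in>E. c n * expi n x)) \<le> \<delta>"
    using fser_approx[OF \<open>\<delta> > 0\<close>, where ?n0.0 = n] by blast
  have "fcoef (\<lambda>x. \<Sum>n\<in>E. c n * expi n x) n = (\<Sum>m\<in>E. c m * (if m = n then 1 else 0))"
    by (simp add: fcoef_sum fcoef_cmult cont_periodic_mult cont_periodic_expi fcoef_expi)
  also have "\<dots> = (\<Sum>m\<in>E. if m = n then c m else 0)" by (intro sum.cong) auto
  also have "\<dots> = c n" using E(1,2) by simp
  finally have "fcoef (\<lambda>x. fser c x - (\<Sum>n\<in>E. c n * expi n x)) n = fcoef (fser c) n - c n"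
    by (simp add: fcoef_diff cont_periodic_fser cont_periodic_partial_sum)
  moreover have "cmod (fcoef (\<lambda>x. fser c x - (\<Sum>n\<in>E. c n * expi n x)) n) \<le> \<delta>"
    by (rule norm_fcoef_le) (auto intro: cont_periodic_diff cont_periodic_fser cont_periodic_partial_sum E)
  ultimately show False using \<open>\<delta> > 0\<close> by (simp add: \<delta>_def)
qed

lemma cmod_fser_le:
  assumes "\<And>E. finite E \<Longrightarrow> (\<Sum>n\<in>E. cmod (c n)) \<le> C"
  shows "cmod (fser c x) \<le> C"
proof -
  have "cmod (fser c x) \<le> (\<Sum>\<^sub>\<infinity>n. cmod (c n * expi n x))"
    unfolding fser_def by (rule norm_infsum_bound[OF fser_abs_summable])
  also have "\<dots> \<le> C"
    using c assms by (intro infsum_le_finite_sums) (simp_all add: norm_mult)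
  finally show ?thesis .
qed

end

text \<open>The coefficients of a product form a convolution. Bounds on its finite partial sums
  suffice, since a partial sum of \<open>fser c\<close> is uniformly close to it and so changes the
  coefficient arbitrarily little.\<close>

lemma fcoef_mult_le:
  assumes a: "cont_periodic a" and c: "Infinite_Sum.abs_summable_on c UNIV"
    and C: "\<And>E. finite E \<Longrightarrow> (\<Sum>l\<in>E. cmod (fcoef a (n - l)) * cmod (c l)) \<le> C"
  shows "cmod (fcoef (\<lambda>x. a x * fser c x) n) \<le> C"
proof (rule field_le_epsilon)
  fix e :: real assume "0 < e"
  obtain B where B: "0 < B" "\<And>x. cmod (a x) \<le> B" using cont_periodic_bounded[OF a] by blast
  obtain E where E: "finite E" "\<And>x. cmod (fser c x - (\<Sum>n\<in>E. c n * expi n x)) \<le> e / B"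
    using fser_approx[OF c, of "e / B"] \<open>0 < e\<close> B(1) by (metis zero_less_divide_iff)
  have sc: "cont_periodic (\<lambda>x. a x * (\<Sum>n\<in>E. c n * expi n x))" by (intro cont_periodic_mult a cont_periodic_partial_sum)
  have "fcoef (\<lambda>x. a x * (\<Sum>n\<in>E. c n * expi n x)) n = fcoef (\<lambda>x. \<Sum>l\<in>E. c l * (a x * expi l x)) n"
    by (simp add: sum_distrib_left mult_ac)
  also have "\<dots> = (\<Sum>l\<in>E. c l * fcoef a (n - l))"
    using a by (simp add: fcoef_sum fcoef_cmult cont_periodic_mult cont_periodic_expi fcoef_shift_index)
  finally have "cmod (fcoef (\<lambda>x. a x * (\<Sum>n\<in>E. c n * expi n x)) n) \<le> C"
    using norm_sum[of "\<lambda>l. c l * fcoef a (n - l)" E] C[OF E(1)] by (simp add: norm_mult mult.commute)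
  moreover have "cmod (fcoef (\<lambda>x. a x * (fser c x - (\<Sum>n\<in>E. c n * expi n x))) n) \<le> e"
  proof (rule norm_fcoef_le)
    show "cont_periodic (\<lambda>x. a x * (fser c x - (\<Sum>n\<in>E. c n * expi n x)))"
      by (intro cont_periodic_mult a cont_periodic_diff cont_periodic_partial_sum cont_periodic_fser c)
    fix x
    have "cmod (a x) * cmod (fser c x - (\<Sum>n\<in>E. c n * expi n x)) \<le> B * (e / B)"
      using B E(2)[of x] by (intro mult_mono) auto
    then show "cmod (a x * (fser c x - (\<Sum>n\<in>E. c n * expi n x))) \<le> e"
      using B(1) by (simp add: norm_mult)
  qed
  moreover have "fcoef (\<lambda>x. a x * fser c x) n
     = fcoef (\<lambda>x. a x * (\<Sum>n\<in>E. c n * expi n x) + a x * (fser c x - (\<Sum>n\<in>E. c n * expi n x))) n"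
    by (simp add: algebra_simps)
  then have "fcoef (\<lambda>x. a x * fser c x) n = fcoef (\<lambda>x. a x * (\<Sum>n\<in>E. c n * expi n x)) n
     + fcoef (\<lambda>x. a x * (fser c x - (\<Sum>n\<in>E. c n * expi n x))) n"
    by (simp only: fcoef_add[OF sc] cont_periodic_mult a cont_periodic_diff cont_periodic_partial_sum cont_periodic_fser c)
  ultimately show "cmod (fcoef (\<lambda>x. a x * fser c x) n) \<le> C + e"
    using norm_triangle_ineq[of "fcoef (\<lambda>x. a x * (\<Sum>n\<in>E. c n * expi n x)) n"
        "fcoef (\<lambda>x. a x * (fser c x - (\<Sum>n\<in>E. c n * expi n x))) n"]
    by (simp only:)
qed

lemma expi_taylor: "cmod (expi n (x + y) - expi n x - 2 * pi * \<i> * (lat n \<bullet> y) * expi n x) \<le> (2 * pi)\<^sup>2 * (wt n)\<^sup>2 * (norm y)\<^sup>2"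
proof -
  define t where "t = 2 * pi * (lat n \<bullet> y)"
  have "\<bar>lat n \<bullet> y\<bar> \<le> wt n * norm y"
    using Cauchy_Schwarz_ineq2[of "lat n" y] mult_right_mono[OF norm_lat_le_wt, of "norm y" n] by simp
  then have "\<bar>t\<bar> \<le> 2 * pi * (wt n * norm y)" by (simp add: t_def abs_mult)
  then have t: "t\<^sup>2 \<le> (2 * pi)\<^sup>2 * (wt n)\<^sup>2 * (norm y)\<^sup>2"
    using power_mono[of "\<bar>t\<bar>" "2 * pi * (wt n * norm y)" 2] by (simp add: power_mult_distrib mult.assoc)
  have "cmod (exp (\<i> * t) - (\<Sum>k\<le>1. (\<i> * t) ^ k / fact k)) \<le> exp \<bar>Re (\<i> * t)\<bar> * cmod (\<i> * t) ^ Suc 1 / fact 1"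
    by (rule Taylor_exp)
  then have "cmod (cis t - 1 - \<i> * t) \<le> t\<^sup>2"
    by (simp add: cis_conv_exp norm_mult power2_eq_square abs_mult algebra_simps)
  moreover have "expi n (x + y) - expi n x - 2 * pi * \<i> * (lat n \<bullet> y) * expi n x = expi n x * (cis t - 1 - \<i> * t)"
  proof -
    have "expi n y = cis t" by (simp add: expi_def t_def)
    then show ?thesis by (simp add: expi_shift t_def algebra_simps)
  qed
  ultimately show ?thesis using t by (simp add: norm_mult)
qed

text \<open>The second order remainder of the character \<open>n\<close> costs
  \<open>(wt n)^2\<close>, so the summability hypothesis makes the total remainder quadratic in the
  increment.\<close>

lemma has_derivative_fser:
  fixes c :: "int ^ 'n \<Rightarrow> complex"
  assumes "(\<lambda>n. (wt n)\<^sup>2 * cmod (c n)) summable_on UNIV"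
  shows "(fser c has_derivative (\<lambda>y. fser (\<lambda>n. 2 * pi * \<i> * (lat n \<bullet> y) * c n) x)) (at x)"
proof -
  define K where "K = (\<Sum>\<^sub>\<infinity>n. (wt n)\<^sup>2 * cmod (c n))"
  have K: "0 \<le> K" unfolding K_def by (intro infsum_nonneg) simp
  have sm: "Infinite_Sum.abs_summable_on d UNIV" if "\<And>n. cmod (d n) \<le> B * ((wt n)\<^sup>2 * cmod (c n))" for d B
  proof (rule Infinite_Sum.abs_summable_on_comparison_test)
    show "Infinite_Sum.abs_summable_on (\<lambda>n. B * ((wt n)\<^sup>2 * cmod (c n))) UNIV"
      using summable_on_cmult_right[OF assms, of "\<bar>B\<bar>"] by (simp add: abs_mult)
    show "cmod (d n) \<le> norm (B * ((wt n)\<^sup>2 * cmod (c n)))" for n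
      using that[of n] abs_ge_self[of "B * ((wt n)\<^sup>2 * cmod (c n))"] by simp
  qed
  have w1: "1 \<le> (wt n)\<^sup>2" "wt n \<le> (wt n)\<^sup>2" for n :: "int ^ 'n"
    using self_le_power[of "wt n" 2] by (auto intro: one_le_power)
  have c: "Infinite_Sum.abs_summable_on c UNIV"
    using w1 by (intro sm[of _ 1]) (simp add: mult_le_cancel_right1)
  have ny: "\<bar>lat n \<bullet> y\<bar> \<le> norm y * (wt n)\<^sup>2" for n :: "int ^ 'n" and y
  proof -
    have "\<bar>lat n \<bullet> y\<bar> \<le> norm (lat n) * norm y" by (rule Cauchy_Schwarz_ineq2)
    also have "\<dots> \<le> (wt n)\<^sup>2 * norm y"
      using norm_lat_le_wt[of n] w1(2)[of n] by (intro mult_right_mono) auto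
    finally show ?thesis by (simp add: mult.commute)
  qed
  have cy: "Infinite_Sum.abs_summable_on (\<lambda>n. 2 * pi * \<i> * (lat n \<bullet> y) * c n) UNIV" for y
  proof (rule sm[of _ "2 * pi * norm y"])
    show "cmod (2 * pi * \<i> * (lat n \<bullet> y) * c n) \<le> 2 * pi * norm y * ((wt n)\<^sup>2 * cmod (c n))" for n
      using mult_right_mono[OF mult_left_mono[OF ny[of n y], of "2 * pi"], of "cmod (c n)"]
      by (simp add: norm_mult mult_ac)
  qed
  define D where "D y = fser (\<lambda>n. 2 * pi * \<i> * (lat n \<bullet> y) * c n) x" for y
  have sD: "(\<lambda>n. 2 * pi * \<i> * (lat n \<bullet> y) * c n * expi n x) summable_on UNIV" for y
    by (rule abs_summable_summable[OF fser_abs_summable[OF cy]])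
  have est: "cmod (fser c (x + y) - fser c x - D y) \<le> (2 * pi)\<^sup>2 * K * (norm y)\<^sup>2" for y
  proof -
    have "((\<lambda>n. c n * expi n (x + y) - c n * expi n x - 2 * pi * \<i> * (lat n \<bullet> y) * c n * expi n x) has_sum
      fser c (x + y) - fser c x - D y) UNIV"
      unfolding fser_def D_def diff_conv_add_uminus
      by (intro has_sum_add has_sum_uminus[THEN iffD2])
         (simp_all only: minus_minus has_sum_infsum sD abs_summable_summable[OF fser_abs_summable[OF c]])
    moreover have "((\<lambda>n. (2 * pi)\<^sup>2 * (norm y)\<^sup>2 * ((wt n)\<^sup>2 * cmod (c n))) has_sum (2 * pi)\<^sup>2 * (norm y)\<^sup>2 * K) UNIV"
      unfolding K_def by (intro has_sum_cmult_right has_sum_infsum assms)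
    moreover have "cmod (c n * expi n (x + y) - c n * expi n x - 2 * pi * \<i> * (lat n \<bullet> y) * c n * expi n x)
       \<le> (2 * pi)\<^sup>2 * (norm y)\<^sup>2 * ((wt n)\<^sup>2 * cmod (c n))" for n
    proof -
      have "c n * expi n (x + y) - c n * expi n x - 2 * pi * \<i> * (lat n \<bullet> y) * c n * expi n x
        = c n * (expi n (x + y) - expi n x - 2 * pi * \<i> * (lat n \<bullet> y) * expi n x)"
        by (simp add: algebra_simps)
      also have "cmod \<dots> \<le> cmod (c n) * ((2 * pi)\<^sup>2 * (wt n)\<^sup>2 * (norm y)\<^sup>2)"
        unfolding norm_mult by (intro mult_left_mono expi_taylor) auto
      finally show ?thesis by (simp add: mult_ac)
    qed
    ultimately have "cmod (fser c (x + y) - fser c x - D y) \<le> (2 * pi)\<^sup>2 * (norm y)\<^sup>2 * K"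
      by (rule norm_infsum_le)
    then show ?thesis by (simp add: mult_ac)
  qed
  have Dsum: "((\<lambda>n. 2 * pi * \<i> * (lat n \<bullet> y) * c n * expi n x) has_sum D y) UNIV" for y
    unfolding D_def fser_def by (rule has_sum_infsum[OF sD])
  have "linear D"
  proof (rule linearI)
    fix y z and r :: real
    have "((\<lambda>n. 2 * pi * \<i> * (lat n \<bullet> (y + z)) * c n * expi n x) has_sum D y + D z) UNIV"
      using has_sum_add[OF Dsum[of y] Dsum[of z]]
      by (simp only: inner_add_right of_real_add distrib_left distrib_right)
    then show "D (y + z) = D y + D z"
      by (rule has_sum_unique[OF Dsum])
    have "(2 * pi * \<i> * (lat n \<bullet> (r *\<^sub>R y)) * c n * expi n x) = of_real r * (2 * pi * \<i> * (lat n \<bullet> y) * c n * expi n x)" for n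
      by simp
    then have "((\<lambda>n. 2 * pi * \<i> * (lat n \<bullet> (r *\<^sub>R y)) * c n * expi n x) has_sum of_real r * D y) UNIV"
      by (simp only: has_sum_cmult_right[OF Dsum[of y], of "of_real r"])
    then show "D (r *\<^sub>R y) = r *\<^sub>R D y"
      unfolding scaleR_conv_of_real[of r "D y"] by (rule has_sum_unique[OF Dsum])
  qed
  then have bl: "bounded_linear D" by (simp add: linear_conv_bounded_linear)
  have "(fser c has_derivative D) (at x)"
    unfolding has_derivative_at_alt
  proof (intro conjI allI impI bl)
    fix e :: real assume "0 < e"
    define M where "M = (2 * pi)\<^sup>2 * K + 1"
    have M: "0 < M" "(2 * pi)\<^sup>2 * K \<le> M" using K by (auto simp: M_def intro: add_nonneg_pos)
    show "\<exists>d>0. \<forall>y. norm (y - x) < d \<longrightarrow> norm (fser c y - fser c x - D (y - x)) \<le> e * norm (y - x)"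
    proof (intro exI[of _ "e / M"] conjI allI impI)
      fix y assume y: "norm (y - x) < e / M"
      have "norm (fser c y - fser c x - D (y - x)) \<le> (2 * pi)\<^sup>2 * K * (norm (y - x))\<^sup>2"
        using est[of "y - x"] by simp
      also have "\<dots> \<le> M * (norm (y - x))\<^sup>2"
        by (rule mult_right_mono[OF M(2)]) simp
      also have "\<dots> = (M * norm (y - x)) * norm (y - x)"
        by (simp add: power2_eq_square)
      also have "\<dots> \<le> e * norm (y - x)"
        using y M(1) by (intro mult_right_mono) (simp_all add: pos_less_divide_eq mult.commute less_imp_le)
      finally show "norm (fser c y - fser c x - D (y - x)) \<le> e * norm (y - x)" .
    qed (use \<open>0 < e\<close> M in auto)
  qed
  then show ?thesis by (simp only: D_def[abs_def])
qed

subsection \<open>Functions with bounded partial derivatives\<close>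

abbreviation pd :: "'n \<Rightarrow> (real ^ 'n \<Rightarrow> 'b::real_normed_vector) \<Rightarrow> real ^ 'n \<Rightarrow> 'b" where
  "pd i f x \<equiv> frechet_derivative f (at x) (axis i 1)"

text \<open>A bound \<open>K\<close> for all iterated partial derivatives up to order
  \<open>n\<close>, on the whole space. A single constant for all orders keeps the rules for
  products and compositions short. The value space is general because vector fields, their
  components and complex functions all occur.\<close>

primrec CB :: "nat \<Rightarrow> real \<Rightarrow> (real ^ 'n \<Rightarrow> 'b::real_normed_vector) \<Rightarrow> bool" where
  "CB 0 K f \<longleftrightarrow> continuous_on UNIV f \<and> (\<forall>x. norm (f x) \<le> K)"
| "CB (Suc n) K f \<longleftrightarrow> (\<forall>x. norm (f x) \<le> K) \<and> (\<forall>x. f differentiable (at x)) \<and> (\<forall>i. CB n K (pd i f))"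

lemma frechet_derivative_eq: "(f has_derivative D) (at x) \<Longrightarrow> frechet_derivative f (at x) = D"
  by (rule frechet_derivative_at[symmetric])

lemma linear_axis_expansion:
  fixes D :: "real ^ 'n \<Rightarrow> 'b::real_vector"
  assumes "linear D" shows "D y = (\<Sum>i\<in>UNIV. y $ i *\<^sub>R D (axis i 1))"
proof -
  have "D y = D (\<Sum>i\<in>UNIV. y $ i *\<^sub>R axis i 1)"
    using basis_expansion[of y] by (simp add: scalar_mult_eq_scaleR)
  then show ?thesis using assms by (simp add: linear_sum linear_cmul)
qed

lemma frechet_derivative_expansion:
  assumes "f differentiable (at x)"
  shows "frechet_derivative f (at x) y = (\<Sum>i\<in>UNIV. y $ i *\<^sub>R pd i f x)"
  by (rule linear_axis_expansion) (rule linear_frechet_derivative[OF assms])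

lemma CB_bound: "CB n K f \<Longrightarrow> norm (f x) \<le> K"
  by (cases n) auto

lemma CB_nonneg: "CB n K f \<Longrightarrow> 0 \<le> K"
  using CB_bound norm_ge_zero order_trans by blast

lemma CB_I:
  assumes "\<And>x. (f has_derivative D x) (at x)" "\<And>x. norm (f x) \<le> K" "\<And>i. CB n K (\<lambda>x. D x (axis i 1))"
  shows "CB (Suc n) K f"
proof -
  have "pd i f = (\<lambda>x. D x (axis i 1))" for i
    by (rule ext) (simp add: frechet_derivative_eq[OF assms(1)])
  then show ?thesis using assms by (auto simp: differentiable_def)
qed

lemma CB_Suc_D: "CB (Suc n) K f \<Longrightarrow> CB n K f"
proof (induction n arbitrary: f)
  case 0
  then show ?case
    by (auto simp: differentiable_imp_continuous_within continuous_at_imp_continuous_on)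
next
  case (Suc n)
  then show ?case by simp
qed

lemma CB_le: "CB n K f \<Longrightarrow> m \<le> n \<Longrightarrow> CB m K f"
  by (erule inc_induct) (auto dest: CB_Suc_D simp del: CB.simps)

lemma CB_continuous: "CB n K f \<Longrightarrow> continuous_on S f"
  using CB_le[of n K f 0] by (auto intro: continuous_on_subset)

lemma CB_mono: "CB n K f \<Longrightarrow> K \<le> L \<Longrightarrow> CB n L f"
  by (induction n arbitrary: f) (auto intro: order_trans)

lemma CB_has_derivative: "CB (Suc n) K f \<Longrightarrow> (f has_derivative frechet_derivative f (at x)) (at x)"
  by (simp add: frechet_derivative_works[symmetric])

lemma CB_pd: "CB (Suc n) K f \<Longrightarrow> CB n K (pd i f)"
  by simp

lemma CB_const:
  fixes c :: "'b::real_normed_vector"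
  shows "norm c \<le> K \<Longrightarrow> CB n K (\<lambda>x :: real ^ 'n. c)"
proof (induction n arbitrary: c)
  case (Suc n)
  show ?case
  proof (rule CB_I[where D = "\<lambda>x y. 0"])
    show "CB n K (\<lambda>x :: real ^ 'n. 0 :: 'b)" using Suc.prems by (intro Suc.IH) (auto intro: order_trans[OF norm_ge_zero])
  qed (use Suc.prems in auto)
qed auto

lemma CB_add: "CB n K f \<Longrightarrow> CB n L g \<Longrightarrow> CB n (K + L) (\<lambda>x. f x + g x)"
proof (induction n arbitrary: f g)
  case 0
  then show ?case by (auto intro!: continuous_intros order_trans[OF norm_triangle_ineq] add_mono)
next
  case (Suc n)
  show ?case
  proof (rule CB_I[where D = "\<lambda>x y. frechet_derivative f (at x) y + frechet_derivative g (at x) y"])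
    show "((\<lambda>x. f x + g x) has_derivative (\<lambda>y. frechet_derivative f (at x) y + frechet_derivative g (at x) y)) (at x)" for x
      by (intro has_derivative_add CB_has_derivative[OF Suc.prems(1)] CB_has_derivative[OF Suc.prems(2)])
    show "norm (f x + g x) \<le> K + L" for x
      using CB_bound[OF Suc.prems(1), of x] CB_bound[OF Suc.prems(2), of x] norm_triangle_ineq[of "f x" "g x"] by linarith
    show "CB n (K + L) (\<lambda>x. pd i f x + pd i g x)" for i
      using Suc by simp
  qed
qed

lemma CB_linear:
  assumes h: "bounded_linear h" and C: "\<And>y. norm (h y) \<le> C * norm y" "0 \<le> C"
  shows "CB n K f \<Longrightarrow> CB n (C * K) (\<lambda>x. h (f x))"
proof (induction n arbitrary: f)
  case 0
  have "norm (h (f x)) \<le> C * K" for x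
    using C(1)[of "f x"] mult_left_mono[OF CB_bound[OF 0] C(2), of x] by linarith
  then show ?case using 0 h by (auto intro: bounded_linear.continuous_on)
next
  case (Suc n)
  show ?case
  proof (rule CB_I[where D = "\<lambda>x y. h (frechet_derivative f (at x) y)"])
    show "((\<lambda>x. h (f x)) has_derivative (\<lambda>y. h (frechet_derivative f (at x) y))) (at x)" for x
      by (intro bounded_linear.has_derivative[OF h] CB_has_derivative[OF Suc.prems])
    show "norm (h (f x)) \<le> C * K" for x
      using C(1)[of "f x"] mult_left_mono[OF CB_bound[OF Suc.prems] C(2), of x] by linarith
    show "CB n (C * K) (\<lambda>x. h (pd i f x))" for i
      using Suc by simp
  qed
qed

lemma CB_uminus: "CB n K f \<Longrightarrow> CB n K (\<lambda>x. - f x)"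
  using CB_linear[of uminus 1 n K f] by (simp add: bounded_linear_minus bounded_linear_ident)

text \<open>Each differentiation doubles the number of terms in the product rule, whence
  \<open>2 ^ n\<close>.\<close>

lemma CB_scaleR: "CB n K a \<Longrightarrow> CB n L f \<Longrightarrow> CB n (2 ^ n * K * L) (\<lambda>x. a x *\<^sub>R f x)"
proof (induction n arbitrary: a f)
  case 0
  have "\<bar>a x\<bar> * norm (f x) \<le> K * L" for x
    using CB_bound[OF 0(1), of x] CB_bound[OF 0(2), of x] CB_nonneg[OF 0(1)] by (intro mult_mono) auto
  then show ?case using 0 by (auto intro!: continuous_intros)
next
  case (Suc n)
  note K = CB_nonneg[OF Suc.prems(1)] and L = CB_nonneg[OF Suc.prems(2)]
  show ?case
  proof (rule CB_I[where D = "\<lambda>x y. a x *\<^sub>R frechet_derivative f (at x) y + frechet_derivative a (at x) y *\<^sub>R f x"])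
    show "((\<lambda>x. a x *\<^sub>R f x) has_derivative (\<lambda>y. a x *\<^sub>R frechet_derivative f (at x) y + frechet_derivative a (at x) y *\<^sub>R f x)) (at x)" for x
      by (intro has_derivative_scaleR CB_has_derivative[OF Suc.prems(1)] CB_has_derivative[OF Suc.prems(2)])
    have "norm (a x *\<^sub>R f x) \<le> K * L" for x
      using CB_bound[OF Suc.prems(1), of x] CB_bound[OF Suc.prems(2), of x] K by (auto intro!: mult_mono)
    moreover have "1 * (K * L) \<le> 2 ^ Suc n * (K * L)" using K L by (intro mult_right_mono) (auto intro: one_le_power simp del: power_Suc)
    ultimately show "norm (a x *\<^sub>R f x) \<le> 2 ^ Suc n * K * L" for x
      by (simp add: mult.assoc) (meson order_trans)
    have "CB n (2 ^ n * K * L + 2 ^ n * K * L) (\<lambda>x. a x *\<^sub>R pd i f x + pd i a x *\<^sub>R f x)" for i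
      using Suc.prems by (intro CB_add Suc.IH CB_Suc_D[OF Suc.prems(1)] CB_Suc_D[OF Suc.prems(2)]) auto
    then show "CB n (2 ^ Suc n * K * L) (\<lambda>x. a x *\<^sub>R pd i f x + pd i a x *\<^sub>R f x)" for i
      by (simp add: algebra_simps)
  qed
qed

lemma CB_sum:
  "finite I \<Longrightarrow> (\<And>i. i \<in> I \<Longrightarrow> CB n (K i) (f i)) \<Longrightarrow> CB n (\<Sum>i\<in>I. K i) (\<lambda>x. \<Sum>i\<in>I. f i x)"
  by (induction I rule: finite_induct) (auto intro: CB_const CB_add)

text \<open>\<open>G\<close> will be a linear map plus a periodic one, hence unbounded, so only its
  first partials are bounded. The result is linear in \<open>K\<close> with a constant depending on
  \<open>L\<close> and \<open>n\<close>, so that a small \<open>f\<close> stays small after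
  composition.\<close>

lemma CB_compose:
  assumes "0 \<le> L"
  obtains C where "0 \<le> C"
    "\<And>(f :: real ^ 'n \<Rightarrow> 'b::real_normed_vector) K (G :: real ^ 'n \<Rightarrow> real ^ 'n). CB n K f \<Longrightarrow> continuous_on UNIV G \<Longrightarrow>
       (\<And>x. 0 < n \<Longrightarrow> G differentiable (at x)) \<Longrightarrow> (\<And>m i j. m < n \<Longrightarrow> CB m L (\<lambda>x. pd i G x $ j)) \<Longrightarrow>
       CB n (C * K) (\<lambda>x. f (G x))"
proof -
  have "\<exists>C\<ge>0. \<forall>(f :: real ^ 'n \<Rightarrow> 'b) K (G :: real ^ 'n \<Rightarrow> real ^ 'n). CB n K f \<longrightarrow> continuous_on UNIV G \<longrightarrow>
       (\<forall>x. 0 < n \<longrightarrow> G differentiable (at x)) \<longrightarrow> (\<forall>m i j. m < n \<longrightarrow> CB m L (\<lambda>x. pd i G x $ j)) \<longrightarrow>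
       CB n (C * K) (\<lambda>x. f (G x))"
  proof (induction n)
    case 0
    show ?case
      by (intro exI[of _ 1]) (auto intro: continuous_on_compose2)
  next
    case (Suc n)
    then obtain C where C: "C \<ge> 0" "\<And>(f :: real ^ 'n \<Rightarrow> 'b) K (G :: real ^ 'n \<Rightarrow> real ^ 'n). CB n K f \<Longrightarrow> continuous_on UNIV G \<Longrightarrow>
       (\<And>x. 0 < n \<Longrightarrow> G differentiable (at x)) \<Longrightarrow> (\<And>m i j. m < n \<Longrightarrow> CB m L (\<lambda>x. pd i G x $ j)) \<Longrightarrow>
       CB n (C * K) (\<lambda>x. f (G x))" by blast
    \<comment> \<open>The 1 covers the values of the composition, the other entry the chain rule sum
      over \<open>CARD('n)\<close> products.\<close>
    define C' where "C' = max 1 (CARD('n) * (2 ^ n * L * C))"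
    have C': "0 \<le> C'" by (simp add: C'_def)
    show ?case
    proof (intro exI[of _ C'] conjI C' allI impI)
      fix f :: "real ^ 'n \<Rightarrow> 'b" and K and G :: "real ^ 'n \<Rightarrow> real ^ 'n"
      assume f: "CB (Suc n) K f" and G: "continuous_on UNIV G" "\<forall>x. 0 < Suc n \<longrightarrow> G differentiable (at x)"
        "\<forall>m i j. m < Suc n \<longrightarrow> CB m L (\<lambda>x. pd i G x $ j)"
      note K = CB_nonneg[OF f]
      have dG: "(G has_derivative frechet_derivative G (at x)) (at x)" for x
        using G by (simp add: frechet_derivative_works[symmetric])
      show "CB (Suc n) (C' * K) (\<lambda>x. f (G x))"
      proof (rule CB_I[where D = "\<lambda>x y. frechet_derivative f (at (G x)) (frechet_derivative G (at x) y)"])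
        show "((\<lambda>x. f (G x)) has_derivative (\<lambda>y. frechet_derivative f (at (G x)) (frechet_derivative G (at x) y))) (at x)" for x
          by (rule has_derivative_compose[OF dG CB_has_derivative[OF f]])
        have "1 * K \<le> C' * K" using K by (intro mult_right_mono) (auto simp: C'_def)
        then show "norm (f (G x)) \<le> C' * K" for x using CB_bound[OF f, of "G x"] by simp
        fix i
        have "CB n (\<Sum>j\<in>(UNIV :: 'n set). 2 ^ n * L * (C * K)) (\<lambda>x. \<Sum>j\<in>UNIV. (pd i G x $ j) *\<^sub>R pd j f (G x))"
          using f G by (intro CB_sum CB_scaleR C(2)) auto
        moreover have "frechet_derivative f (at (G x)) (pd i G x) = (\<Sum>j\<in>UNIV. (pd i G x $ j) *\<^sub>R pd j f (G x))" for x
          using f by (intro frechet_derivative_expansion) simp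
        moreover have "(\<Sum>j\<in>(UNIV :: 'n set). 2 ^ n * L * (C * K)) \<le> C' * K"
        proof -
          have "(\<Sum>j\<in>(UNIV :: 'n set). 2 ^ n * L * (C * K)) = (CARD('n) * (2 ^ n * L * C)) * K"
            by (simp add: mult_ac)
          also have "\<dots> \<le> C' * K" using K by (intro mult_right_mono) (auto simp: C'_def)
          finally show ?thesis .
        qed
        ultimately show "CB n (C' * K) (\<lambda>x. frechet_derivative f (at (G x)) (pd i G x))"
          by (simp add: CB_mono)
      qed
    qed
  qed
  then show thesis using that by blast
qed

lemma CB_lipschitz:
  fixes f :: "real ^ 'n \<Rightarrow> 'b::real_normed_vector" and K :: real
  assumes f: "CB (Suc n) K f"
  shows "norm (f x - f y) \<le> CARD('n) * K * norm (x - y)"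
proof (rule differentiable_bound[of UNIV f "\<lambda>x. frechet_derivative f (at x)"])
  fix z :: "real ^ 'n"
  show "onorm (frechet_derivative f (at z)) \<le> CARD('n) * K"
  proof (rule onorm_le)
    fix y
    have "norm (frechet_derivative f (at z) y) \<le> (\<Sum>i\<in>UNIV. norm (y $ i *\<^sub>R pd i f z))"
      using f by (subst frechet_derivative_expansion, simp) (rule norm_sum)
    also have "\<dots> \<le> (\<Sum>i\<in>(UNIV :: 'n set). norm y * K)"
      using CB_bound[OF CB_pd[OF f]] CB_nonneg[OF f]
      by (intro sum_mono) (auto intro!: mult_mono component_le_norm_cart)
    finally show "norm (frechet_derivative f (at z) y) \<le> CARD('n) * K * norm y"
      by (simp add: mult_ac)
  qed
qed (use CB_has_derivative[OF f] in \<open>auto intro: has_derivative_at_withinI\<close>)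

lemma periodic_pd:
  assumes per: "\<And>x m. f (x + lat m) = f x"
  shows "pd i f (x + lat m) = pd i f x"
proof -
  have "((\<lambda>y. y + lat m) has_derivative (\<lambda>y. y)) (at x)" by (auto intro!: derivative_eq_intros)
  have "(f has_derivative D) (at (x + lat m)) \<longleftrightarrow> (f has_derivative D) (at x)" for D
  proof
    assume "(f has_derivative D) (at (x + lat m))"
    from has_derivative_compose[OF \<open>((\<lambda>y. y + lat m) has_derivative (\<lambda>y. y)) (at x)\<close> this]
    show "(f has_derivative D) (at x)" by (simp add: per)
  next
    assume "(f has_derivative D) (at x)"
    then have "(f has_derivative D) (at ((x + lat m) - lat m))" by simp
    moreover have "((\<lambda>y. y - lat m) has_derivative (\<lambda>y. y)) (at (x + lat m))" by (auto intro!: derivative_eq_intros)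
    ultimately have "((\<lambda>y. f (y - lat m)) has_derivative D) (at (x + lat m))"
      using has_derivative_compose[of "\<lambda>y. y - lat m" "\<lambda>y. y" "x + lat m" UNIV f D] by simp
    moreover have "f (y - lat m) = f y" for y using per[of "y - lat m" m] by simp
    ultimately show "(f has_derivative D) (at (x + lat m))" by simp
  qed
  then show ?thesis by (simp add: frechet_derivative_def)
qed

subsection \<open>Smooth maps in charts\<close>

lemma has_derivative_germ:
  assumes "open U" "x \<in> U" "\<And>y. y \<in> U \<Longrightarrow> f y = g y"
  shows "(f has_derivative D) (at x) \<longleftrightarrow> (g has_derivative D) (at x)"
  using assms has_derivative_transform_within_open[of f D x UNIV U g]
    has_derivative_transform_within_open[of g D x UNIV U f] by auto

lemma frechet_derivative_germ:
  assumes "open U" "x \<in> U" "\<And>y. y \<in> U \<Longrightarrow> f y = g y"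
  shows "frechet_derivative f (at x) = frechet_derivative g (at x)"
  unfolding frechet_derivative_def by (simp add: has_derivative_germ[OF assms])

lemma iter_deriv_germ:
  assumes "open U" "\<And>y. y \<in> U \<Longrightarrow> f y = g y" "x \<in> U"
  shows "iter_deriv vs f x = iter_deriv vs g x"
  using assms(3)
proof (induction vs arbitrary: x)
  case (Cons v vs)
  have "frechet_derivative (iter_deriv vs f) (at x) = frechet_derivative (iter_deriv vs g) (at x)"
    using Cons by (intro frechet_derivative_germ[OF assms(1)]) auto
  then show ?case by simp
qed (use assms in auto)

lemma nat_Ck_on_germ:
  assumes "open U" "\<And>y. y \<in> U \<Longrightarrow> f y = g y"
  shows "nat_Ck_on j f U \<Longrightarrow> nat_Ck_on j g U"
  using assms(2)
proof (induction j arbitrary: f g)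
  case 0
  then show ?case by (simp cong: continuous_on_cong)
next
  case (Suc j)
  have "g differentiable (at x)" if xU: "x \<in> U" for x
  proof -
    obtain D where "(f has_derivative D) (at x)"
      using Suc.prems(1) xU by (auto simp: differentiable_def)
    then have "(g has_derivative D) (at x)"
      using has_derivative_germ[OF assms(1) xU, of f g] Suc.prems(2) by blast
    then show ?thesis by (auto simp: differentiable_def)
  qed
  moreover have "nat_Ck_on j (\<lambda>x. frechet_derivative g (at x) v) U" for v
  proof (rule Suc.IH)
    show "nat_Ck_on j (\<lambda>x. frechet_derivative f (at x) v) U" using Suc.prems(1) by simp
    show "frechet_derivative f (at x) v = frechet_derivative g (at x) v" if "x \<in> U" for x
      using frechet_derivative_germ[OF assms(1) that Suc.prems(2)] by simp
  qed
  ultimately show ?case by simp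
qed

lemma nat_Ck_on_subset: "nat_Ck_on j f U \<Longrightarrow> W \<subseteq> U \<Longrightarrow> nat_Ck_on j f W"
  by (induction j arbitrary: f) (auto intro: continuous_on_subset)

lemma nat_Ck_on_diff_affine:
  assumes "open U"
  shows "nat_Ck_on j f U \<Longrightarrow> nat_Ck_on j (\<lambda>x. f x - (B *v x + c)) U"
proof (induction j arbitrary: f B c)
  case 0
  then show ?case by (auto intro!: continuous_intros matrix_vector_mult_linear_continuous_on)
next
  case (Suc j)
  have d: "((\<lambda>x. f x - (B *v x + c)) has_derivative (\<lambda>v. frechet_derivative f (at x) v - B *v v)) (at x)" if "x \<in> U" for x
  proof -
    have "(f has_derivative frechet_derivative f (at x)) (at x)"
      using Suc.prems that by (simp add: frechet_derivative_works[symmetric])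
    moreover have "((*v) B has_derivative (*v) B) (at x)"
      by (intro bounded_linear_imp_has_derivative matrix_vector_mul_bounded_linear)
    ultimately show ?thesis
      by (auto intro!: derivative_eq_intros)
  qed
  have "nat_Ck_on j (\<lambda>x. frechet_derivative (\<lambda>x. f x - (B *v x + c)) (at x) v) U" for v
  proof (rule nat_Ck_on_germ[OF \<open>open U\<close>])
    \<comment> \<open>The derivative of an affine map is constant, written here as an affine map
      with zero matrix so that the induction hypothesis applies.\<close>
    show "nat_Ck_on j (\<lambda>x. frechet_derivative f (at x) v - (0 *v x + B *v v)) U"
      using Suc.prems by (intro Suc.IH) simp
    show "frechet_derivative f (at x) v - (0 *v x + B *v v) = frechet_derivative (\<lambda>x. f x - (B *v x + c)) (at x) v" if "x \<in> U" for x
      by (simp add: frechet_derivative_eq[OF d[OF that]])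
  qed
  then show ?case using d by (auto simp: differentiable_def)
qed

lemma nat_Ck_on_cover:
  assumes "\<And>x. \<exists>U. open U \<and> x \<in> U \<and> nat_Ck_on j f U"
  shows "nat_Ck_on j f UNIV"
  using assms
proof (induction j arbitrary: f)
  case 0
  then show ?case
    by (auto simp: continuous_on_eq_continuous_at) (metis continuous_on_eq_continuous_at)
next
  case (Suc j)
  show ?case
    using Suc.prems by (auto intro!: Suc.IH) metis+
qed

lemma CB_of_nat_Ck:
  fixes f :: "real ^ 'n \<Rightarrow> real ^ 'n"
  assumes "nat_Ck_on r f UNIV" "\<And>x vs. length vs \<le> r \<Longrightarrow> set vs \<subseteq> Basis \<Longrightarrow> norm (iter_deriv vs f x) \<le> K"
  shows "CB r K f"
  using assms
proof (induction r arbitrary: f)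
  case 0
  then show ?case using 0(2)[of "[]"] by simp
next
  case (Suc r)
  \<comment> \<open>\<open>iter_deriv\<close> takes the derivative in the direction of the head
    last, while \<open>CB\<close> peels off the first derivative; hence the list is split at its
    end.\<close>
  have it: "iter_deriv (vs @ [v]) f = iter_deriv vs (\<lambda>x. frechet_derivative f (at x) v)" for vs v
    by (induction vs) auto
  have "CB r K (pd i f)" for i
  proof (rule Suc.IH)
    show "norm (iter_deriv vs (pd i f) x) \<le> K" if "length vs \<le> r" "set vs \<subseteq> Basis" for vs x
      using Suc.prems(2)[of "vs @ [axis i 1]" x] that by (simp add: it axis_in_Basis_iff)
  qed (use Suc.prems in auto)
  then show ?case using Suc.prems(1) Suc.prems(2)[of "[]"] by simp
qed

lemma CB_periodic_exists:
  fixes f :: "real ^ 'n \<Rightarrow> real ^ 'n"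
  assumes "nat_Ck_on r f UNIV" "\<And>x m. f (x + lat m) = f x"
  shows "\<exists>K. CB r K f"
  using assms
proof (induction r arbitrary: f)
  case 0
  then have "cont_periodic f" by (simp add: cont_periodic_def)
  then obtain K where "\<And>x. norm (f x) \<le> K" using cont_periodic_bounded by metis
  then show ?case using 0 by auto
next
  case (Suc r)
  have "\<exists>K. CB r K (pd i f)" for i
    using Suc.prems periodic_pd[OF Suc.prems(2)] by (intro Suc.IH) auto
  then obtain K where K: "\<And>i. CB r (K i) (pd i f)" by metis
  have "continuous_on UNIV f"
    using Suc.prems by (auto intro!: continuous_at_imp_continuous_on simp: differentiable_imp_continuous_within)
  then have "cont_periodic f" using Suc.prems by (simp add: cont_periodic_def)
  then obtain B where B: "\<And>x. norm (f x) \<le> B" using cont_periodic_bounded by metis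
  define M where "M = Max (insert B (range K))"
  have "B \<le> M" "K i \<le> M" for i unfolding M_def by (intro Max_ge; simp)+
  then have "CB (Suc r) M f"
    using Suc.prems(1) B K by (auto intro: CB_mono order_trans)
  then show ?case by blast
qed

lemma nat_Ck_on_CB:
  fixes f :: "real ^ 'n \<Rightarrow> real ^ 'n"
  shows "CB j K f \<Longrightarrow> nat_Ck_on j f UNIV"
proof (induction j arbitrary: f K)
  case (Suc j)
  have "nat_Ck_on j (\<lambda>x. frechet_derivative f (at x) v) UNIV" for v
  proof (rule Suc.IH)
    have "CB j (\<Sum>i\<in>UNIV. \<bar>v $ i\<bar> * K) (\<lambda>x. \<Sum>i\<in>UNIV. v $ i *\<^sub>R pd i f x)"
      using Suc.prems by (intro CB_sum CB_linear bounded_linear_scaleR_right) auto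
    then show "CB j (\<Sum>i\<in>UNIV. \<bar>v $ i\<bar> * K) (\<lambda>x. frechet_derivative f (at x) v)"
      using Suc.prems by (simp add: frechet_derivative_expansion[of f])
  qed
  then show ?case using Suc.prems by simp
qed auto

definition smooth_periodic :: "(real ^ 'n \<Rightarrow> real ^ 'n) \<Rightarrow> bool" where
  "smooth_periodic f \<longleftrightarrow> (\<forall>x m. f (x + lat m) = f x) \<and> (\<forall>n. \<exists>K. CB n K f)"

lemma smooth_periodic_cont_periodic: "smooth_periodic f \<Longrightarrow> cont_periodic f"
  unfolding smooth_periodic_def cont_periodic_def by (metis CB_continuous)

lemma smooth_periodic_nat_Ck: "smooth_periodic f \<Longrightarrow> nat_Ck_on j f UNIV"
  unfolding smooth_periodic_def by (metis nat_Ck_on_CB)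

lemma smooth_periodic_I: "(\<And>x m. f (x + lat m) = f x) \<Longrightarrow> (\<And>j. nat_Ck_on j f UNIV) \<Longrightarrow> smooth_periodic f"
  unfolding smooth_periodic_def by (metis CB_periodic_exists)

lemma smooth_periodic_Ck_affine:
  assumes "smooth_periodic f" shows "Ck_on k (\<lambda>x. B *v x + f x) UNIV"
proof -
  have "nat_Ck_on j (\<lambda>x. f x - ((- B) *v x + 0)) UNIV" for j
    by (intro nat_Ck_on_diff_affine smooth_periodic_nat_Ck assms) simp
  moreover have "(\<lambda>x. f x - ((- B) *v x + 0)) = (\<lambda>x. B *v x + f x)"
  proof
    fix x
    have "(- B) *v x = - (B *v x)"
      by (simp add: vec_eq_iff matrix_vector_mult_def sum_negf)
    then show "f x - ((- B) *v x + 0) = B *v x + f x" by simp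
  qed
  ultimately show ?thesis unfolding Ck_on_def by simp
qed

subsection \<open>Lifts of torus maps\<close>

lemma torus_proj_eq_iff: "torus_proj x = torus_proj y \<longleftrightarrow> (\<exists>m. x = y + lat m)"
proof -
  have "torus_proj x = torus_proj y \<longleftrightarrow> lattice_rel x y"
    by (rule torus.abs_eq_iff)
  also have "\<dots> \<longleftrightarrow> (\<exists>m. x = y + lat m)"
  proof
    assume "lattice_rel x y"
    then have "x = y + lat (\<chi> i. \<lfloor>x $ i - y $ i\<rfloor>)"
      by (auto simp: lattice_rel_def vec_eq_iff Ints_def)
    then show "\<exists>m. x = y + lat m" ..
  qed (auto simp: lattice_rel_def)
  finally show ?thesis .
qed

lemma torus_proj_lat [simp]: "torus_proj (x + lat m) = torus_proj x"
  by (auto simp: torus_proj_eq_iff)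

lemma torus_proj_rep [simp]: "torus_proj (torus_rep p) = p"
  by (rule Quotient_abs_rep[OF Quotient_torus])

lemma torus_aut_proj: "torus_aut B (torus_proj x) = torus_proj (rmat B *v x)"
  by (rule torus_aut.abs_eq)

lemma lat_small: "norm (lat m) < 1 \<Longrightarrow> m = 0"
proof -
  assume *: "norm (lat m) < 1"
  have "m $ i = 0" for i
  proof -
    have "\<bar>real_of_int (m $ i)\<bar> < 1" using component_le_norm_cart[of "lat m" i] * by simp
    then show ?thesis by linarith
  qed
  then show ?thesis by (simp add: vec_eq_iff)
qed

definition lifts :: "('n::finite torus \<Rightarrow> 'n torus) \<Rightarrow> int ^ 'n ^ 'n \<Rightarrow> (real ^ 'n \<Rightarrow> real ^ 'n) \<Rightarrow> bool" where
  "lifts \<phi> B f \<longleftrightarrow> smooth_periodic f \<and> (\<forall>x. \<phi> (torus_proj x) = torus_proj (rmat B *v x + f x))"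

text \<open>A continuous lift differs from a smooth chart lift by a continuous function with values
  in the lattice, which is locally constant. So continuity and periodicity of \<open>f\<close>
  already give smoothness.\<close>

lemma lifts_smooth:
  assumes \<phi>: "torus_Ck \<infinity> \<phi>" and f: "cont_periodic f" "\<And>x. \<phi> (torus_proj x) = torus_proj (rmat B *v x + f x)"
  shows "lifts \<phi> B f"
proof -
  have "nat_Ck_on j f UNIV" for j
  proof (rule nat_Ck_on_cover)
    fix x
    obtain V H where V: "open V" "x \<in> V" "local_lift \<phi> V H" "Ck_on \<infinity> H V"
      using \<phi> unfolding torus_Ck_def by blast
    have H: "nat_Ck_on i H V" for i using V(4) by (simp add: Ck_on_def)
    define d where "d y = H y - (rmat B *v y + f y)" for y
    have dl: "\<exists>m. d y = lat m" if "y \<in> V" for y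
      using V(3) that f(2)[of y] by (auto simp: local_lift_def d_def torus_proj_eq_iff algebra_simps)
    obtain m where m: "d x = lat m" using dl V(2) by blast
    have "continuous_on V d"
      unfolding d_def using H[of 0] cperD(1)[OF f(1), of V]
      by (auto intro!: continuous_intros matrix_vector_mult_linear_continuous_on)
    then have "isCont d x" using V(1,2) by (simp add: continuous_on_eq_continuous_at)
    \<comment> \<open>Distinct lattice points have distance at least 1, so \<open>d\<close> is
      constant on this ball.\<close>
    then obtain r where r: "0 < r" "\<And>y. dist y x < r \<Longrightarrow> dist (d y) (d x) < 1"
      unfolding continuous_at_eps_delta by (metis zero_less_one)
    define W where "W = V \<inter> ball x r"
    have W: "open W" "x \<in> W" "W \<subseteq> V" using V r by (auto simp: W_def)
    have fW: "H y - (rmat B *v y + lat m) = f y" if yW: "y \<in> W" for y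
    proof -
      obtain k where k: "d y = lat k" using dl[of y] yW W(3) by blast
      have "norm (lat (k - m)) < 1"
        using r(2)[of y] yW k m by (simp add: W_def dist_commute dist_norm lat_simps)
      then have "k = m" using lat_small by fastforce
      then show ?thesis using k by (simp add: d_def algebra_simps)
    qed
    have "nat_Ck_on j (\<lambda>y. H y - (rmat B *v y + lat m)) W"
      by (intro nat_Ck_on_diff_affine W nat_Ck_on_subset[OF H])
    then have "nat_Ck_on j f W"
      by (rule nat_Ck_on_germ[where f = "\<lambda>y. H y - (rmat B *v y + lat m)", rotated -1]) (use W(1) fW in auto)
    then show "\<exists>U. open U \<and> x \<in> U \<and> nat_Ck_on j f U" using W by blast
  qed
  then have "smooth_periodic f" using f(1) by (intro smooth_periodic_I) (auto simp: cont_periodic_def)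
  then show ?thesis using f(2) by (simp add: lifts_def)
qed

text \<open>For \<epsilon> at most 1/2 a displacement shorter than \<epsilon> is determined by its
  class modulo the lattice. The local differences \<open>F - G\<close> therefore glue to one global
  periodic function, and the bounds on their derivatives carry over to it.\<close>

lemma Cr_close_lift:
  fixes \<phi> :: "'n::finite torus \<Rightarrow> 'n torus"
  assumes \<phi>: "torus_Ck \<infinity> \<phi>" and close: "Cr_close r \<epsilon> \<phi> (torus_aut B)" and \<epsilon>: "\<epsilon> \<le> 1 / 2"
  obtains f where "lifts \<phi> B f" "CB r \<epsilon> f"
proof -
  have uniq: "d = d'" if dd: "norm d < \<epsilon>" "norm d' < \<epsilon>" "torus_proj (y + d) = (torus_proj (y + d') :: 'n torus)" for d d' y
  proof -
    obtain m where m: "y + d = y + d' + lat m" using dd(3) by (auto simp: torus_proj_eq_iff)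
    then have "lat m = d - d'" by (simp add: algebra_simps)
    then have "norm (lat m) < 1" using norm_triangle_ineq4[of d d'] dd(1,2) \<epsilon> by simp
    then have "m = 0" by (rule lat_small)
    then show ?thesis using m by (simp add: lat_simps)
  qed
  have ex: "\<exists>U F G. open U \<and> x \<in> U \<and> continuous_on U F \<and> continuous_on U G \<and>
     (\<forall>y\<in>U. norm (F y - G y) < \<epsilon> \<and> \<phi> (torus_proj y) = torus_proj (rmat B *v y + (F y - G y)) \<and>
       (\<forall>vs. length vs \<le> r \<and> set vs \<subseteq> Basis \<longrightarrow> norm (iter_deriv vs (\<lambda>z. F z - G z) y) < \<epsilon>))" for x
  proof -
    obtain U F G where U: "open U" "x \<in> U" "local_lift \<phi> U F" "Ck_on (enat r) F U"
        "local_lift (torus_aut B) U G" "Ck_on (enat r) G U"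
        "\<And>y vs. y \<in> U \<Longrightarrow> length vs \<le> r \<Longrightarrow> set vs \<subseteq> Basis \<Longrightarrow> norm (iter_deriv vs (\<lambda>z. F z - G z) y) < \<epsilon>"
      using close unfolding Cr_close_def by metis
    have c: "continuous_on U F" "continuous_on U G"
      using U(4,6) unfolding Ck_on_def by (metis enat_ord_simps(1) nat_Ck_on.simps(1) zero_le)+
    \<comment> \<open>The chart lift \<open>G\<close> of the automorphism may differ from its linear
      lift by a lattice vector, which the projection does not see.\<close>
    have "\<phi> (torus_proj y) = torus_proj (rmat B *v y + (F y - G y))" if y: "y \<in> U" for y
    proof -
      have "torus_proj (rmat B *v y) = torus_proj (G y)"
        using U(5) y by (simp add: local_lift_def torus_aut_proj)
      then obtain m where "rmat B *v y = G y + lat m" by (auto simp: torus_proj_eq_iff)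
      then have e: "rmat B *v y + (F y - G y) = F y + lat m" by simp
      show ?thesis unfolding e torus_proj_lat using U(3) y by (simp add: local_lift_def)
    qed
    moreover have "norm (F y - G y) < \<epsilon>" if "y \<in> U" for y
      using U(7)[OF that, of "[]"] by simp
    ultimately show ?thesis using U(1,2) c
      by (intro exI[of _ U] exI[of _ F] exI[of _ G] conjI ballI allI impI) (simp_all add: U(7))
  qed
  have "\<exists>d. norm d < \<epsilon> \<and> \<phi> (torus_proj x) = torus_proj (rmat B *v x + d)" for x
    using ex[of x] by blast
  then obtain f where f: "\<And>x. norm (f x) < \<epsilon>" "\<And>x. \<phi> (torus_proj x) = torus_proj (rmat B *v x + f x)"
    by metis
  have feq: "f y = d" if "norm d < \<epsilon>" "\<phi> (torus_proj y) = torus_proj (rmat B *v y + d)" for y d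
    using that f by (intro uniq[of _ _ "rmat B *v y"]) auto
  have per: "f (x + lat m) = f x" for x m
  proof (rule feq[OF f(1)])
    have e: "rmat B *v (x + lat m) + f x = (rmat B *v x + f x) + lat (B *v m)"
      by (simp add: lat_mult matrix_vector_right_distrib)
    show "\<phi> (torus_proj (x + lat m)) = torus_proj (rmat B *v (x + lat m) + f x)"
      by (simp only: e torus_proj_lat f(2))
  qed
  have loc: "\<exists>U F G. open U \<and> x \<in> U \<and> continuous_on U F \<and> continuous_on U G \<and>
     (\<forall>y\<in>U. f y = F y - G y \<and>
       (\<forall>vs. length vs \<le> r \<and> set vs \<subseteq> Basis \<longrightarrow> norm (iter_deriv vs (\<lambda>z. F z - G z) y) < \<epsilon>))" for x
  proof -
    obtain U F G where U: "open U" "x \<in> U" "continuous_on U F" "continuous_on U G"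
      "\<forall>y\<in>U. norm (F y - G y) < \<epsilon> \<and> \<phi> (torus_proj y) = torus_proj (rmat B *v y + (F y - G y)) \<and>
       (\<forall>vs. length vs \<le> r \<and> set vs \<subseteq> Basis \<longrightarrow> norm (iter_deriv vs (\<lambda>z. F z - G z) y) < \<epsilon>)"
      using ex[of x] by blast
    then have "\<forall>y\<in>U. f y = F y - G y" by (intro ballI feq) blast+
    with U show ?thesis by (intro exI[of _ U] exI[of _ F] exI[of _ G] conjI ballI allI impI) simp_all
  qed
  have "isCont f x" for x
  proof -
    obtain U F G where U: "open U" "x \<in> U" "continuous_on U F" "continuous_on U G" "\<And>y. y \<in> U \<Longrightarrow> f y = F y - G y"
      using loc[of x] by blast
    then have "continuous_on U f" by (simp add: continuous_on_diff cong: continuous_on_cong)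
    then show ?thesis using continuous_on_eq_continuous_at[OF U(1), of f] U(2) by blast
  qed
  then have cf: "cont_periodic f" using per by (simp add: cont_periodic_def continuous_at_imp_continuous_on)
  show thesis
  proof (rule that)
    show l: "lifts \<phi> B f" by (rule lifts_smooth[OF \<phi> cf f(2)])
    show "CB r \<epsilon> f"
    proof (rule CB_of_nat_Ck)
      show "nat_Ck_on r f UNIV" using l by (simp add: lifts_def smooth_periodic_nat_Ck)
      fix x and vs :: "(real ^ 'n) list" assume vs: "length vs \<le> r" "set vs \<subseteq> Basis"
      obtain U F G where U: "open U" "x \<in> U" "\<And>y. y \<in> U \<Longrightarrow> f y = F y - G y"
         "norm (iter_deriv vs (\<lambda>z. F z - G z) x) < \<epsilon>"
        using loc[of x] vs by blast
      then show "norm (iter_deriv vs f x) \<le> \<epsilon>"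
        using iter_deriv_germ[OF U(1,3,2), where vs = vs] by simp
    qed
  qed
qed

section \<open>Composition and inversion of lifts\<close>

lemma rmat_mult: "rmat (B ** E) = rmat B ** rmat E"
  by (simp add: vec_eq_iff matrix_matrix_mult_def map_matrix_def)

lemma rmat_mat1 [simp]: "rmat (mat 1) = mat 1"
  by (simp add: vec_eq_iff mat_def map_matrix_def)

lemma matrix_vector_bound:
  fixes B :: "real ^ 'n ^ 'm"
  obtains b where "0 \<le> b" "\<And>y. norm (B *v y) \<le> b * norm y"
  using bounded_linear.nonneg_bounded[OF matrix_vector_mul_bounded_linear[of B]]
  by (metis mult.commute)

lemma has_derivative_matrix: "((*v) B has_derivative (*v) B) (at (x :: real ^ 'n))"
  by (intro bounded_linear_imp_has_derivative matrix_vector_mul_bounded_linear)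

lemma CB_affine_pd:
  fixes E :: "real ^ 'n ^ 'n"
  assumes e: "\<And>y. norm (E *v y) \<le> e * norm y" "0 \<le> e"
  shows "CB (Suc m) K g \<Longrightarrow> CB m (e + K) (\<lambda>x. pd i (\<lambda>x. E *v x + g x) x $ j)"
    "CB (Suc m) K g \<Longrightarrow> ((\<lambda>x. E *v x + g x) has_derivative (\<lambda>y. E *v y + frechet_derivative g (at x) y)) (at x)"
proof -
  assume g: "CB (Suc m) K g"
  show d: "((\<lambda>x. E *v x + g x) has_derivative (\<lambda>y. E *v y + frechet_derivative g (at x) y)) (at x)" for x
    by (intro has_derivative_add has_derivative_matrix CB_has_derivative[OF g])
  have "norm ((E *v axis i 1) $ j) \<le> e"
    using component_le_norm_cart[of "E *v axis i 1" j] e(1)[of "axis i 1"] by simp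
  moreover have "CB m (1 * K) (\<lambda>x. pd i g x $ j)"
    by (intro CB_linear[OF bounded_linear_vec_nth] CB_pd[OF g]) (auto simp: component_le_norm_cart)
  ultimately have "CB m (e + K) (\<lambda>x. (E *v axis i 1) $ j + pd i g x $ j)"
    by (intro CB_add CB_const) simp_all
  then show "CB m (e + K) (\<lambda>x. pd i (\<lambda>x. E *v x + g x) x $ j)"
    by (simp add: frechet_derivative_eq[OF d])
qed

lemma CB_comp_affine:
  fixes E :: "real ^ 'n ^ 'n"
  assumes L: "0 \<le> L"
  obtains C where "0 \<le> C"
    "\<And>(f :: real ^ 'n \<Rightarrow> 'b::real_normed_vector) K (g :: real ^ 'n \<Rightarrow> real ^ 'n). CB n K f \<Longrightarrow> CB n L g \<Longrightarrow> CB n (C * K) (\<lambda>x. f (E *v x + g x))"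
proof -
  obtain e where e: "0 \<le> e" "\<And>y. norm (E *v y) \<le> e * norm y" by (rule matrix_vector_bound) blast
  have "0 \<le> e + L" using e L by simp
  then obtain C where C: "0 \<le> C"
    "\<And>(f :: real ^ 'n \<Rightarrow> 'b) K (G :: real ^ 'n \<Rightarrow> real ^ 'n). CB n K f \<Longrightarrow> continuous_on UNIV G \<Longrightarrow>
       (\<And>x. 0 < n \<Longrightarrow> G differentiable (at x)) \<Longrightarrow> (\<And>m i j. m < n \<Longrightarrow> CB m (e + L) (\<lambda>x. pd i G x $ j)) \<Longrightarrow>
       CB n (C * K) (\<lambda>x. f (G x))"
    by (rule CB_compose[of "e + L" n]) blast
  show thesis
  proof (rule that[OF C(1)])
    fix f :: "real ^ 'n \<Rightarrow> 'b" and K and g :: "real ^ 'n \<Rightarrow> real ^ 'n"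
    assume f: "CB n K f" and g: "CB n L g"
    show "CB n (C * K) (\<lambda>x. f (E *v x + g x))"
    proof (rule C(2)[OF f])
      show "continuous_on UNIV (\<lambda>x. E *v x + g x)"
        using CB_continuous[OF g] by (auto intro!: continuous_intros matrix_vector_mult_linear_continuous_on)
      show "(\<lambda>x. E *v x + g x) differentiable (at x)" if "0 < n" for x
        using CB_affine_pd(2)[OF e(2,1), of "n - 1" L g x] g that by (auto simp: differentiable_def)
      show "CB m (e + L) (\<lambda>x. pd i (\<lambda>x. E *v x + g x) x $ j)" if "m < n" for m i j
        using CB_affine_pd(1)[OF e(2,1), of m L g] CB_le[OF g, of "Suc m"] that by simp
    qed
  qed
qed

lemma CB_matrix:
  fixes B :: "real ^ 'n ^ 'n"
  assumes "\<And>y. norm (B *v y) \<le> b * norm y" "0 \<le> b"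
  shows "CB n K g \<Longrightarrow> CB n (b * K) (\<lambda>x. B *v g x)"
  by (intro CB_linear assms matrix_vector_mul_bounded_linear)

lemma smooth_periodic_comp:
  fixes f g :: "real ^ 'n \<Rightarrow> real ^ 'n" and B E :: "int ^ 'n ^ 'n"
  assumes f: "smooth_periodic f" and g: "smooth_periodic g"
  shows "smooth_periodic (\<lambda>x. rmat B *v g x + f (rmat E *v x + g x))"
  unfolding smooth_periodic_def
proof (intro conjI allI)
  fix x m
  have e: "rmat E *v (x + lat m) + g (x + lat m) = (rmat E *v x + g x) + lat (E *v m)"
    using g by (simp add: smooth_periodic_def lat_mult matrix_vector_right_distrib)
  show "rmat B *v g (x + lat m) + f (rmat E *v (x + lat m) + g (x + lat m)) = rmat B *v g x + f (rmat E *v x + g x)"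
    unfolding e using f g by (simp add: smooth_periodic_def)
next
  fix n
  obtain K L where K: "CB n K f" and L: "CB n L g" using f g unfolding smooth_periodic_def by blast
  obtain C where "0 \<le> C" "\<And>(f :: real ^ 'n \<Rightarrow> real ^ 'n) K g. CB n K f \<Longrightarrow> CB n L g \<Longrightarrow> CB n (C * K) (\<lambda>x. f (rmat E *v x + g x))"
    using CB_comp_affine[OF CB_nonneg[OF L], of n "rmat E"] by metis
  then have "CB n (C * K) (\<lambda>x. f (rmat E *v x + g x))" using K L by blast
  moreover obtain b where "0 \<le> b" "\<And>y. norm (rmat B *v y) \<le> b * norm y" by (rule matrix_vector_bound) blast
  then have "CB n (b * L) (\<lambda>x. rmat B *v g x)" using L by (intro CB_matrix) auto
  ultimately show "\<exists>K. CB n K (\<lambda>x. rmat B *v g x + f (rmat E *v x + g x))"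
    using CB_add by blast
qed

lemma lifts_comp:
  assumes "lifts \<phi> B f" "lifts \<psi> E g"
  shows "lifts (\<phi> \<circ> \<psi>) (B ** E) (\<lambda>x. rmat B *v g x + f (rmat E *v x + g x))"
  using assms by (simp add: lifts_def smooth_periodic_comp rmat_mult matrix_vector_mul_assoc[symmetric] matrix_vector_right_distrib add.assoc)

lemma CB_comp_small:
  fixes B E :: "int ^ 'n ^ 'n"
  assumes "0 < \<delta>"
  obtains \<delta>' where "0 < \<delta>'" "\<And>f g :: real ^ 'n \<Rightarrow> real ^ 'n. CB n \<delta>' f \<Longrightarrow> CB n \<delta>' g \<Longrightarrow> CB n \<delta> (\<lambda>x. rmat B *v g x + f (rmat E *v x + g x))"
proof -
  obtain C where C: "0 \<le> C" "\<And>(f :: real ^ 'n \<Rightarrow> real ^ 'n) K g. CB n K f \<Longrightarrow> CB n 1 g \<Longrightarrow> CB n (C * K) (\<lambda>x. f (rmat E *v x + g x))"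
    using CB_comp_affine[of 1 n "rmat E"] by (metis zero_le_one)
  obtain b where b: "0 \<le> b" "\<And>y. norm (rmat B *v y) \<le> b * norm y" by (rule matrix_vector_bound) blast
  define \<delta>' where "\<delta>' = min 1 (\<delta> / (b + C + 1))"
  have pos: "0 < b + C + 1" using b C by linarith
  have \<delta>': "0 < \<delta>'" "\<delta>' \<le> 1" "b * \<delta>' + C * \<delta>' \<le> \<delta>"
  proof -
    show "0 < \<delta>'" "\<delta>' \<le> 1" using pos assms by (auto simp: \<delta>'_def)
    then have "b * \<delta>' + C * \<delta>' \<le> (b + C + 1) * \<delta>'" by (simp add: algebra_simps)
    also have "\<dots> \<le> (b + C + 1) * (\<delta> / (b + C + 1))" using pos by (intro mult_left_mono) (auto simp: \<delta>'_def)
    finally show "b * \<delta>' + C * \<delta>' \<le> \<delta>" using pos by simp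
  qed
  show thesis
  proof (rule that[OF \<delta>'(1)])
    fix f g :: "real ^ 'n \<Rightarrow> real ^ 'n" assume fg: "CB n \<delta>' f" "CB n \<delta>' g"
    have "CB n (b * \<delta>' + C * \<delta>') (\<lambda>x. rmat B *v g x + f (rmat E *v x + g x))"
      by (intro CB_add CB_matrix[OF b(2,1)] C(2) fg CB_mono[OF fg(2) \<delta>'(2)])
    then show "CB n \<delta> (\<lambda>x. rmat B *v g x + f (rmat E *v x + g x))" by (rule CB_mono) (rule \<delta>'(3))
  qed
qed

text \<open>Smoothness of the inverse is part of the data, so only its lift has to be found: solving
  \<open>y = B z + f z\<close> for \<open>z\<close> yields the implicit equation in the conclusion,
  from which \<open>CB_inverse_small\<close> derives smallness.\<close>

lemma lifts_inverse:
  fixes \<phi> \<psi> :: "'n::finite torus \<Rightarrow> 'n torus" and B B' :: "int ^ 'n ^ 'n"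
  assumes \<phi>: "lifts \<phi> B f" and \<psi>: "torus_Ck \<infinity> \<psi>" and inv: "\<And>p. \<phi> (\<psi> p) = p" and B': "B' ** B = mat 1"
  obtains f' where "lifts \<psi> B' f'" "\<And>y. f' y = - (rmat B' *v f (rmat B' *v y + f' y))"
proof -
  have f: "cont_periodic f" "\<And>x m. f (x + lat m) = f x" "\<And>x. \<phi> (torus_proj x) = torus_proj (rmat B *v x + f x)"
    using \<phi> by (auto simp: lifts_def smooth_periodic_cont_periodic smooth_periodic_def)
  have BB: "rmat B' *v (rmat B *v x) = x" for x
    by (simp add: matrix_vector_mul_assoc rmat_mult[symmetric] B')
  \<comment> \<open>The representative is arbitrary, but periodicity of \<open>f\<close> makes the
    value independent of it.\<close>
  define f' where "f' y = - (rmat B' *v f (torus_rep (\<psi> (torus_proj y))))" for y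
  have f'z: "f' y = - (rmat B' *v f z)" if "\<psi> (torus_proj y) = torus_proj z" for y z
  proof -
    have "torus_proj (torus_rep (\<psi> (torus_proj y))) = torus_proj z" using that by simp
    then obtain m where "torus_rep (\<psi> (torus_proj y)) = z + lat m" by (auto simp only: torus_proj_eq_iff)
    then show ?thesis by (simp add: f'_def f(2))
  qed
  have lift: "\<psi> (torus_proj y) = torus_proj (rmat B' *v y + f' y)" for y
  proof -
    define z where "z = torus_rep (\<psi> (torus_proj y))"
    have z: "\<psi> (torus_proj y) = torus_proj z" by (simp add: z_def)
    have "torus_proj y = torus_proj (rmat B *v z + f z)" by (metis inv z f(3))
    then obtain m where "y = rmat B *v z + f z + lat m" by (auto simp: torus_proj_eq_iff)
    then have "rmat B' *v y = z + rmat B' *v f z + lat (B' *v m)"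
      by (simp only: matrix_vector_right_distrib BB lat_mult)
    then have e: "rmat B' *v y + f' y = z + lat (B' *v m)" using f'z[OF z] by simp
    show ?thesis unfolding e torus_proj_lat by (rule z)
  qed
  have "isCont f' x" for x
  proof -
    obtain V H where V: "open V" "x \<in> V" "local_lift \<psi> V H" "Ck_on \<infinity> H V"
      using \<psi> unfolding torus_Ck_def by blast
    have H: "continuous_on V H" using V(4) unfolding Ck_on_def by (metis nat_Ck_on.simps(1) enat_ord_simps(3))
    have "f' y = - (rmat B' *v f (H y))" if "y \<in> V" for y
      using V(3) that by (intro f'z) (simp add: local_lift_def)
    moreover have "continuous_on V (\<lambda>y. - (rmat B' *v f (H y)))"
      by (intro continuous_intros continuous_on_compose2[OF matrix_vector_mult_linear_continuous_on[of UNIV]]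
        continuous_on_compose2[OF cperD(1)[OF f(1), of UNIV] H]) auto
    ultimately have "continuous_on V f'" by (simp cong: continuous_on_cong)
    then show ?thesis using continuous_on_eq_continuous_at[OF V(1), of f'] V(2) by blast
  qed
  moreover have "f' (x + lat m) = f' x" for x m by (simp add: f'_def)
  ultimately have "cont_periodic f'" by (simp add: cont_periodic_def continuous_at_imp_continuous_on)
  show thesis
  proof (rule that)
    show "lifts \<psi> B' f'" by (rule lifts_smooth[OF \<psi> \<open>cont_periodic f'\<close> lift])
    show "f' y = - (rmat B' *v f (rmat B' *v y + f' y))" for y by (rule f'z[OF lift])
  qed
qed

text \<open>The partials of \<open>f'\<close> satisfy an affine equation with small coefficients,
  obtained by differentiating the implicit equation. A bound \<open>Y\<close> for them thus improves
  to \<open>\<kappa> * (b + Y)\<close>. Some finite bound exists because \<open>f'\<close> is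
  bounded in every \<open>CB\<close> class; iterating the improvement removes all dependence on
  it.\<close>

lemma CB_inverse_small:
  fixes B' :: "real ^ 'n ^ 'n"
  shows "0 < \<delta> \<Longrightarrow> \<exists>\<delta>'>0. \<forall>f f' :: real ^ 'n \<Rightarrow> real ^ 'n. CB r \<delta>' f \<longrightarrow> (\<forall>n. \<exists>K. CB n K f') \<longrightarrow>
     (\<forall>y. f' y = - (B' *v f (B' *v y + f' y))) \<longrightarrow> CB r \<delta> f'"
proof (induction r arbitrary: \<delta>)
  case 0
  obtain b where b: "0 \<le> b" "\<And>y. norm (B' *v y) \<le> b * norm y" by (rule matrix_vector_bound) blast
  show ?case
  proof (intro exI[of _ "\<delta> / (b + 1)"] conjI allI impI)
    fix f f' :: "real ^ 'n \<Rightarrow> real ^ 'n"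
    assume f: "CB 0 (\<delta> / (b + 1)) f" and f': "\<forall>n. \<exists>K. CB n K f'" and eq: "\<forall>y. f' y = - (B' *v f (B' *v y + f' y))"
    have "norm (f' y) \<le> \<delta>" for y
    proof -
      have "norm (f' y) \<le> b * norm (f (B' *v y + f' y))"
        using b(2)[of "f (B' *v y + f' y)"] eq by (metis norm_minus_cancel)
      also have "\<dots> \<le> b * (\<delta> / (b + 1))" using CB_bound[OF f] b(1) by (intro mult_left_mono)
      also have "\<dots> \<le> \<delta>" using 0 b(1) by (simp add: field_simps)
      finally show ?thesis .
    qed
    moreover have "continuous_on UNIV f'" using f' CB_continuous by blast
    ultimately show "CB 0 \<delta> f'" by simp
  qed (use 0 b in auto)
next
  case (Suc r)
  obtain b where b: "0 \<le> b" "\<And>y. norm (B' *v y) \<le> b * norm y" by (rule matrix_vector_bound) blast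
  \<comment> \<open>The bound 1 on \<open>f'\<close> at the lower order is what the composition
    estimate below takes for \<open>g\<close>.\<close>
  obtain \<delta>1 where \<delta>1: "0 < \<delta>1" "\<And>f f' :: real ^ 'n \<Rightarrow> real ^ 'n. CB r \<delta>1 f \<Longrightarrow> (\<And>n. \<exists>K. CB n K f') \<Longrightarrow>
     (\<And>y. f' y = - (B' *v f (B' *v y + f' y))) \<Longrightarrow> CB r (min \<delta> 1) f'"
    using Suc.IH[of "min \<delta> 1"] Suc.prems by (auto simp del: CB.simps)
  obtain C where C: "0 \<le> C" "\<And>(f :: real ^ 'n \<Rightarrow> real ^ 'n) K g. CB r K f \<Longrightarrow> CB r 1 g \<Longrightarrow> CB r (C * K) (\<lambda>x. f (B' *v x + g x))"
    using CB_comp_affine[of 1 r B'] by (metis zero_le_one)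
  define M where "M = b * (CARD('n) * (2 ^ r * C))"
  have M: "0 \<le> M" using b C by (simp add: M_def)
  \<comment> \<open>The bound 1/2 makes the improvement halve the excess; the other entry places the
    limit \<open>2 * \<kappa> * b\<close> below half of \<delta>.\<close>
  define \<kappa> where "\<kappa> = min (1 / 2) (\<delta> / (4 * (b + 1)))"
  have \<kappa>: "0 < \<kappa>" "\<kappa> \<le> 1 / 2" "2 * \<kappa> * b \<le> \<delta> / 2"
  proof -
    show "0 < \<kappa>" using Suc.prems b by (auto simp: \<kappa>_def)
    show "\<kappa> \<le> 1 / 2" unfolding \<kappa>_def by (rule min.cobounded1)
    have "2 * \<kappa> * b \<le> 2 * (\<delta> / (4 * (b + 1))) * (b + 1)" using b Suc.prems \<open>0 < \<kappa>\<close>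
      by (intro mult_mono) (auto simp: \<kappa>_def)
    also have "\<dots> = \<delta> / 2" using b by (simp add: field_simps)
    finally show "2 * \<kappa> * b \<le> \<delta> / 2" .
  qed
  define \<delta>0 where "\<delta>0 = min \<delta>1 (\<kappa> / (M + 1))"
  have \<delta>0: "0 < \<delta>0" "\<delta>0 \<le> \<delta>1" "M * \<delta>0 \<le> \<kappa>"
  proof -
    show "0 < \<delta>0" "\<delta>0 \<le> \<delta>1" using \<delta>1 \<kappa> M by (auto simp: \<delta>0_def)
    have "M * \<delta>0 \<le> (M + 1) * (\<kappa> / (M + 1))" using M \<open>0 < \<delta>0\<close> by (intro mult_mono) (auto simp: \<delta>0_def)
    then show "M * \<delta>0 \<le> \<kappa>" using M by simp
  qed
  show ?case
  proof (intro exI[of _ \<delta>0] conjI allI impI)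
    fix f f' :: "real ^ 'n \<Rightarrow> real ^ 'n"
    assume f: "CB (Suc r) \<delta>0 f" and f': "\<forall>n. \<exists>K. CB n K f'" and eq: "\<forall>y. f' y = - (B' *v f (B' *v y + f' y))"
    have f'r: "CB r (min \<delta> 1) f'"
      using f' eq by (intro \<delta>1(2)[of f]) (auto intro: CB_mono[OF CB_Suc_D[OF f] \<delta>0(2)] simp del: CB.simps)
    obtain X where X: "CB (Suc r) X f'" using f' by blast
    define F where "F x = B' *v x + f' x" for x
    have dF: "(F has_derivative (\<lambda>y. B' *v y + frechet_derivative f' (at x) y)) (at x)" for x
      unfolding F_def by (rule CB_affine_pd(2)[OF b(2,1) X])
    have q: "CB r (C * \<delta>0) (\<lambda>x. pd j f (F x))" for j
      unfolding F_def by (intro C(2) CB_pd[OF f] CB_mono[OF f'r]) simp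
    have pd_eq: "pd i f' x = - (B' *v (\<Sum>j\<in>UNIV. ((B' *v axis i 1) $ j + pd i f' x $ j) *\<^sub>R pd j f (F x)))" for i x
    proof -
      have "(f has_derivative frechet_derivative f (at (F x))) (at (F x))" by (rule CB_has_derivative[OF f])
      from has_derivative_compose[OF dF this]
      have "((\<lambda>x. f (F x)) has_derivative (\<lambda>y. frechet_derivative f (at (F x)) (B' *v y + frechet_derivative f' (at x) y))) (at x)" .
      from has_derivative_minus[OF bounded_linear.has_derivative[OF matrix_vector_mul_bounded_linear[of B'] this]]
      have "(f' has_derivative (\<lambda>y. - (B' *v frechet_derivative f (at (F x)) (B' *v y + frechet_derivative f' (at x) y)))) (at x)"
        using eq by (simp add: F_def)
      then have "pd i f' x = - (B' *v frechet_derivative f (at (F x)) (B' *v axis i 1 + pd i f' x))"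
        by (rule frechet_derivative_eq[THEN fun_cong])
      moreover have "frechet_derivative f (at (F x)) (B' *v axis i 1 + pd i f' x)
         = (\<Sum>j\<in>UNIV. ((B' *v axis i 1) $ j + pd i f' x $ j) *\<^sub>R pd j f (F x))"
        using f by (subst frechet_derivative_expansion) auto
      ultimately show ?thesis by simp
    qed
    have step: "CB r (\<kappa> * (b + Y)) (pd i f')" if Y: "CB r Y (pd i f')" for i Y
    proof -
      have bY: "0 \<le> b + Y" using b CB_nonneg[OF Y] by simp
      have c: "CB r (b + Y) (\<lambda>x. (B' *v axis i 1) $ j + pd i f' x $ j)" for j
      proof -
        have "norm ((B' *v axis i 1) $ j) \<le> b"
          using component_le_norm_cart[of "B' *v axis i 1" j] b(2)[of "axis i 1"] by simp
        moreover have "CB r (1 * Y) (\<lambda>x. pd i f' x $ j)"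
          by (intro CB_linear[OF bounded_linear_vec_nth] Y) (auto simp: component_le_norm_cart)
        ultimately show ?thesis by (intro CB_add CB_const) simp_all
      qed
      have c1: "CB r (b * (\<Sum>j\<in>(UNIV :: 'n set). 2 ^ r * (b + Y) * (C * \<delta>0)))
         (\<lambda>x. - (B' *v (\<Sum>j\<in>UNIV. ((B' *v axis i 1) $ j + pd i f' x $ j) *\<^sub>R pd j f (F x))))"
        by (intro CB_uminus CB_matrix[OF b(2,1)] CB_sum CB_scaleR c q) simp
      have "b * (\<Sum>j\<in>(UNIV :: 'n set). 2 ^ r * (b + Y) * (C * \<delta>0)) = (M * \<delta>0) * (b + Y)"
        by (simp add: M_def mult_ac)
      also have "\<dots> \<le> \<kappa> * (b + Y)" using \<delta>0 bY by (intro mult_right_mono)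
      finally have "CB r (\<kappa> * (b + Y)) (\<lambda>x. - (B' *v (\<Sum>j\<in>UNIV. ((B' *v axis i 1) $ j + pd i f' x $ j) *\<^sub>R pd j f (F x))))"
        by (rule CB_mono[OF c1])
      moreover have "pd i f' = (\<lambda>x. - (B' *v (\<Sum>j\<in>UNIV. ((B' *v axis i 1) $ j + pd i f' x $ j) *\<^sub>R pd j f (F x))))"
        by (rule ext) (rule pd_eq)
      ultimately show ?thesis by argo
    qed
    \<comment> \<open>The fixed point of \<open>Y = \<kappa> * (b + Y)\<close> is at most
      \<open>2 * \<kappa> * b\<close>, and the initial bound \<open>X\<close> is halved in every
      round.\<close>
    have iter: "CB r (2 * \<kappa> * b + X / 2 ^ t) (pd i f')" for t i
    proof (induction t)
      case 0
      have "X \<le> 2 * \<kappa> * b + X / 2 ^ 0" using \<kappa> b by simp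
      then show ?case using CB_mono[OF CB_pd[OF X]] by blast
    next
      case (Suc t)
      have X0: "0 \<le> X" using CB_nonneg[OF X] .
      have "\<kappa> * (b + (2 * \<kappa> * b + X / 2 ^ t)) \<le> 2 * \<kappa> * b + X / 2 ^ Suc t"
      proof -
        have "\<kappa> * (2 * \<kappa> * b) \<le> 1 / 2 * (2 * \<kappa> * b)" "\<kappa> * (X / 2 ^ t) \<le> 1 / 2 * (X / 2 ^ t)"
          using \<kappa> b X0 by (intro mult_right_mono; simp)+
        then show ?thesis by (simp add: algebra_simps)
      qed
      then show ?case using CB_mono[OF step[OF Suc]] by blast
    qed
    have "(\<lambda>t. X / 2 ^ t) \<longlonglongrightarrow> 0"
      by (rule LIMSEQ_divide_realpow_zero) simp
    then have "\<forall>\<^sub>F t in sequentially. X / 2 ^ t < \<delta> / 2"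
      using Suc.prems by (intro order_tendstoD) auto
    then obtain t where "X / 2 ^ t < \<delta> / 2" by (auto simp: eventually_sequentially)
    then have "2 * \<kappa> * b + X / 2 ^ t \<le> \<delta>" using \<kappa>(3) by linarith
    then have "CB r \<delta> (pd i f')" for i using CB_mono[OF iter] by blast
    moreover have "norm (f' x) \<le> \<delta>" for x using CB_bound[OF f'r, of x] by simp
    ultimately show "CB (Suc r) \<delta> f'" using X by simp
  qed (use \<delta>0 in auto)
qed

section \<open>Small lifts for all elements of the perturbed action\<close>

lemma Ck_action_mult:
  assumes "Ck_action k (GLZ\<lparr>carrier := X\<rparr>) \<beta>" "g \<in> X" "h \<in> X"
  shows "\<beta> (g ** h) = \<beta> g \<circ> \<beta> h"
proof -
  interpret group_action "GLZ\<lparr>carrier := X\<rparr>" UNIV \<beta> using assms(1) by (simp add: Ck_action_def)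
  show ?thesis using composition_rule[of _ g h] assms(2,3) by (auto simp: fun_eq_iff GLZ_def)
qed

lemma Ck_action_one:
  assumes "Ck_action k (GLZ\<lparr>carrier := X\<rparr>) \<beta>"
  shows "\<beta> (mat 1) = id"
proof -
  interpret group_action "GLZ\<lparr>carrier := X\<rparr>" UNIV \<beta> using assms by (simp add: Ck_action_def)
  show ?thesis using id_eq_one by (auto simp: fun_eq_iff restrict_def GLZ_def)
qed

lemma Cr_close_mono: "Cr_close r \<epsilon> \<phi> \<psi> \<Longrightarrow> \<epsilon> \<le> \<epsilon>' \<Longrightarrow> Cr_close r \<epsilon>' \<phi> \<psi>"
  unfolding Cr_close_def by (meson order_less_le_trans)

text \<open>Closeness is known only on the given generating set \<open>S\<close>, whereas the proof
  works with other elements. Each is a word in \<open>S\<close>, so its lift is small once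
  \<epsilon> is small in terms of the word. The bound \<delta> varies in the induction because
  inverses and products ask for smaller bounds on their factors.\<close>

lemma generate_small_lifts:
  fixes X S :: "(int ^ 'n ^ 'n) set" and \<gamma> :: "int ^ 'n ^ 'n"
  defines "H \<equiv> GLZ\<lparr>carrier := X\<rparr>"
  assumes H: "group H" and S: "S \<subseteq> X" and \<gamma>: "\<gamma> \<in> generate H S" and \<delta>: "0 < \<delta>"
  shows "\<exists>\<epsilon>>0. \<forall>\<beta> :: int ^ 'n ^ 'n \<Rightarrow> 'n torus \<Rightarrow> 'n torus.
     Ck_action \<infinity> H \<beta> \<longrightarrow> (\<forall>g\<in>S. Cr_close r \<epsilon> (\<beta> g) (torus_aut g)) \<longrightarrow> (\<exists>f. lifts (\<beta> \<gamma>) \<gamma> f \<and> CB r \<delta> f)"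
  using \<gamma> \<delta>
proof (induction arbitrary: \<delta> rule: generate.induct)
  have Hs: "carrier H = X" "mult H = (**)" "one H = mat 1" by (simp_all add: H_def GLZ_def)
  interpret H: group H by fact
  have sm: "torus_Ck \<infinity> (\<beta> g)" if "Ck_action \<infinity> H \<beta>" "g \<in> X" for \<beta> :: "int ^ 'n ^ 'n \<Rightarrow> 'n torus \<Rightarrow> 'n torus" and g
    using that by (simp add: Ck_action_def torus_diffeo_def Hs)
  {
    case one
    have "lifts id (mat 1) (\<lambda>x :: real ^ 'n. 0)"
      by (auto simp: lifts_def smooth_periodic_def intro!: exI[of _ 0] CB_const)
    moreover have "CB r \<delta> (\<lambda>x :: real ^ 'n. 0 :: real ^ 'n)" using one by (intro CB_const) simp
    ultimately have "\<exists>f. lifts (\<beta> (mat 1)) (mat 1) f \<and> CB r \<delta> f"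
      if "Ck_action \<infinity> H \<beta>" for \<beta> :: "int ^ 'n ^ 'n \<Rightarrow> 'n torus \<Rightarrow> 'n torus"
      using Ck_action_one[OF that[unfolded H_def]] by auto
    then show ?case by (intro exI[of _ 1]) (simp add: Hs)
  next
    case (incl h)
    show ?case
    proof (intro exI[of _ "min \<delta> (1/2)"] conjI allI impI)
      fix \<beta> :: "int ^ 'n ^ 'n \<Rightarrow> 'n torus \<Rightarrow> 'n torus"
      assume \<beta>: "Ck_action \<infinity> H \<beta>" "\<forall>g\<in>S. Cr_close r (min \<delta> (1/2)) (\<beta> g) (torus_aut g)"
      have "torus_Ck \<infinity> (\<beta> h)" using sm \<beta>(1) incl S by auto
      then obtain f where "lifts (\<beta> h) h f" "CB r (min \<delta> (1/2)) f"
        using Cr_close_lift[OF _ bspec[OF \<beta>(2) incl(1)] min.cobounded2] by blast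
      then show "\<exists>f. lifts (\<beta> h) h f \<and> CB r \<delta> f" using CB_mono min.cobounded1 by blast
    qed (use incl in auto)
  next
    case (inv h)
    define h' where "h' = inv\<^bsub>H\<^esub> h"
    have hX: "h \<in> X" "h' \<in> X" using inv S H.inv_closed Hs by (auto simp: h'_def)
    have hh: "h' ** h = mat 1" "h ** h' = mat 1"
      using H.l_inv[of h] H.r_inv[of h] hX Hs by (auto simp: h'_def)
    obtain \<delta>' where \<delta>': "0 < \<delta>'" "\<And>f f' :: real ^ 'n \<Rightarrow> real ^ 'n. CB r \<delta>' f \<Longrightarrow> (\<And>n. \<exists>K. CB n K f') \<Longrightarrow>
       (\<And>y. f' y = - (rmat h' *v f (rmat h' *v y + f' y))) \<Longrightarrow> CB r \<delta> f'"
      using CB_inverse_small[OF inv(2), of r "rmat h'"] by blast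
    show ?case
    proof (intro exI[of _ "min \<delta>' (1/2)"] conjI allI impI)
      fix \<beta> :: "int ^ 'n ^ 'n \<Rightarrow> 'n torus \<Rightarrow> 'n torus"
      assume \<beta>: "Ck_action \<infinity> H \<beta>" "\<forall>g\<in>S. Cr_close r (min \<delta>' (1/2)) (\<beta> g) (torus_aut g)"
      obtain f where f: "lifts (\<beta> h) h f" "CB r (min \<delta>' (1/2)) f"
        using Cr_close_lift[OF sm[OF \<beta>(1) hX(1)] bspec[OF \<beta>(2) inv(1)] min.cobounded2] by blast
      have "\<beta> h (\<beta> h' p) = p" for p
        using Ck_action_mult[OF \<beta>(1)[unfolded H_def] hX] Ck_action_one[OF \<beta>(1)[unfolded H_def]] hh by (metis comp_apply id_apply)
      then obtain f' where f': "lifts (\<beta> h') h' f'" "\<And>y. f' y = - (rmat h' *v f (rmat h' *v y + f' y))"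
        using lifts_inverse[OF f(1) sm[OF \<beta>(1) hX(2)] _ hh(1)] by blast
      have "CB r \<delta> f'"
        using f' by (intro \<delta>'(2)[of f] CB_mono[OF f(2) min.cobounded1]) (auto simp: lifts_def smooth_periodic_def)
      then show "\<exists>f. lifts (\<beta> (inv\<^bsub>H\<^esub> h)) (inv\<^bsub>H\<^esub> h) f \<and> CB r \<delta> f"
        using f'(1) by (auto simp: h'_def)
    qed (use \<delta>' in auto)
  next
    case (eng h1 h2)
    have hX: "h1 \<in> X" "h2 \<in> X" using H.generate_in_carrier[of S] S Hs eng by auto
    obtain \<delta>' where \<delta>': "0 < \<delta>'" "\<And>f g :: real ^ 'n \<Rightarrow> real ^ 'n. CB r \<delta>' f \<Longrightarrow> CB r \<delta>' g \<Longrightarrow> CB r \<delta> (\<lambda>x. rmat h1 *v g x + f (rmat h2 *v x + g x))"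
      using CB_comp_small[OF eng(5), of r h1 h2] by blast
    obtain \<epsilon>1 where \<epsilon>1: "0 < \<epsilon>1" "\<And>\<beta> :: int ^ 'n ^ 'n \<Rightarrow> 'n torus \<Rightarrow> 'n torus.
     Ck_action \<infinity> H \<beta> \<Longrightarrow> (\<forall>g\<in>S. Cr_close r \<epsilon>1 (\<beta> g) (torus_aut g)) \<Longrightarrow> (\<exists>f. lifts (\<beta> h1) h1 f \<and> CB r \<delta>' f)"
      using eng(3)[OF \<delta>'(1)] by blast
    obtain \<epsilon>2 where \<epsilon>2: "0 < \<epsilon>2" "\<And>\<beta> :: int ^ 'n ^ 'n \<Rightarrow> 'n torus \<Rightarrow> 'n torus.
     Ck_action \<infinity> H \<beta> \<Longrightarrow> (\<forall>g\<in>S. Cr_close r \<epsilon>2 (\<beta> g) (torus_aut g)) \<Longrightarrow> (\<exists>f. lifts (\<beta> h2) h2 f \<and> CB r \<delta>' f)"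
      using eng(4)[OF \<delta>'(1)] by blast
    show ?case
    proof (intro exI[of _ "min \<epsilon>1 \<epsilon>2"] conjI allI impI)
      fix \<beta> :: "int ^ 'n ^ 'n \<Rightarrow> 'n torus \<Rightarrow> 'n torus"
      assume \<beta>: "Ck_action \<infinity> H \<beta>" "\<forall>g\<in>S. Cr_close r (min \<epsilon>1 \<epsilon>2) (\<beta> g) (torus_aut g)"
      obtain f where f: "lifts (\<beta> h1) h1 f" "CB r \<delta>' f"
        using \<epsilon>1(2)[OF \<beta>(1)] \<beta>(2) Cr_close_mono min.cobounded1 by meson
      obtain g where g: "lifts (\<beta> h2) h2 g" "CB r \<delta>' g"
        using \<epsilon>2(2)[OF \<beta>(1)] \<beta>(2) Cr_close_mono min.cobounded2 by meson
      have "lifts (\<beta> (h1 \<otimes>\<^bsub>H\<^esub> h2)) (h1 \<otimes>\<^bsub>H\<^esub> h2) (\<lambda>x. rmat h1 *v g x + f (rmat h2 *v x + g x))"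
        using lifts_comp[OF f(1) g(1)] Ck_action_mult[OF \<beta>(1)[unfolded H_def] hX] Hs by simp
      then show "\<exists>f. lifts (\<beta> (h1 \<otimes>\<^bsub>H\<^esub> h2)) (h1 \<otimes>\<^bsub>H\<^esub> h2) f \<and> CB r \<delta> f"
        using \<delta>'(2)[OF f(2) g(2)] by blast
    qed (use \<epsilon>1 \<epsilon>2 in auto)
  }
qed

subsection \<open>Linear algebra\<close>

primrec mpow :: "int ^ 'n ^ 'n \<Rightarrow> nat \<Rightarrow> int ^ 'n ^ 'n" where
  "mpow A 0 = mat 1"
| "mpow A (Suc k) = A ** mpow A k"

lemma mpow_commute_other: "A ** B = B ** A \<Longrightarrow> mpow A k ** B = B ** mpow A k"
  by (induction k) (simp, metis matrix_mul_assoc mpow.simps(2))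

lemmas mpow_commute = mpow_commute_other[OF refl]

lemma inner_lat_rmat: "lat m \<bullet> (rmat B *v x) = lat (transpose B *v m) \<bullet> x"
proof -
  have "rmat (transpose B) = transpose (rmat B)"
    by (simp add: vec_eq_iff transpose_def map_matrix_def)
  then show ?thesis by (simp only: lat_mult) (simp add: dot_lmul_matrix[symmetric])
qed

lemma det_of_int: "det (map_matrix of_int A :: 'a::comm_ring_1 ^ 'n ^ 'n) = of_int (det A)"
  by (simp add: det_def map_matrix_def)

text \<open>A kernel vector exists over the rationals; the product of its denominators clears
  them.\<close>

lemma det_eq_0_int_kernel:
  fixes B :: "int ^ 'n ^ 'n"
  assumes "det B = 0"
  obtains n where "n \<noteq> 0" "B *v n = 0"
proof -
  define Q :: "rat ^ 'n ^ 'n" where "Q = map_matrix of_int B"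
  have "det Q = 0" using assms by (simp add: Q_def det_of_int)
  then have "\<not> invertible Q" by (simp add: invertible_det_nz)
  then obtain x where x: "x \<noteq> 0" "Q *v x = 0"
    unfolding invertible_left_inverse matrix_left_invertible_ker by blast
  define d where "d = (\<Prod>i\<in>UNIV. snd (quotient_of (x $ i)))"
  have dpos: "d > 0" unfolding d_def by (intro prod_pos) (simp add: quotient_of_denom_pos')
  have "\<exists>k. of_int d * x $ i = of_int k" for i
  proof -
    define q where "q = snd (quotient_of (x $ i))"
    define p where "p = fst (quotient_of (x $ i))"
    define r where "r = (\<Prod>j\<in>UNIV - {i}. snd (quotient_of (x $ j)))"
    have d: "d = q * r"
      unfolding d_def q_def r_def by (rule prod.remove) auto
    have xi: "x $ i = of_int p / of_int q"
      unfolding p_def q_def by (rule quotient_of_div) simp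
    have "q \<noteq> 0" unfolding q_def using quotient_of_denom_pos'[of "x $ i"] by simp
    then have "of_int d * x $ i = of_int (r * p)" by (simp add: d xi)
    then show ?thesis by blast
  qed
  then obtain k where k: "\<And>i. of_int d * x $ i = of_int (k i)" by metis
  define n where "n = (\<chi> i. k i)"
  have "n \<noteq> 0"
  proof
    assume "n = 0"
    then have "k i = 0" for i by (simp add: n_def vec_eq_iff)
    then have "x = 0" using k dpos by (simp add: vec_eq_iff)
    then show False using x by simp
  qed
  moreover have "B *v n = 0"
  proof -
    have "of_int ((B *v n) $ i) = (0 :: rat)" for i
    proof -
      have "of_int ((B *v n) $ i) = of_int d * (Q *v x) $ i"
        by (simp add: matrix_vector_mult_def n_def Q_def map_matrix_def k[symmetric] sum_distrib_left mult_ac)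
      then show ?thesis using x by simp
    qed
    then show ?thesis by (simp add: vec_eq_iff)
  qed
  ultimately show thesis by (rule that)
qed

section \<open>Ergodicity excludes roots of unity as eigenvalues\<close>

lemma torus_proj_measurable: "torus_proj \<in> borel_measurable (restrict_space lborel A)"
proof -
  have "torus_proj \<in> borel_measurable (lborel :: (real ^ 'n) measure)"
    by (rule borel_measurableI) (auto simp: open_torus_def)
  then show ?thesis by (rule measurable_restrict_space1)
qed

text \<open>Being open and lattice-invariant, \<open>V\<close> meets the open unit cube, on which
  the measure is Lebesgue measure.\<close>

lemma torus_measure_open_pos:
  fixes W :: "'n::finite torus set"
  assumes W: "W \<in> sets borel" "open V" "V \<noteq> {}" "\<And>x m. x \<in> V \<Longrightarrow> x + lat m \<in> V" "\<And>x. x \<in> V \<Longrightarrow> torus_proj x \<in> W"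
  shows "emeasure torus_measure W \<noteq> 0"
proof -
  define C where "C = {x :: real ^ 'n. \<forall>i. 0 \<le> x $ i \<and> x $ i < 1}"
  have C: "C \<in> sets lborel"
  proof -
    have "C = (\<Inter>i. {x. 0 \<le> x $ i} \<inter> {x. x $ i < 1})" by (auto simp: C_def)
    also have "\<dots> \<in> sets borel"
      by (intro sets.finite_INT sets.Int) (auto intro!: borel_closed borel_open closed_Collect_le open_Collect_less continuous_intros)
    finally show ?thesis by simp
  qed
  obtain w where "w \<in> V" using W(3) by blast
  obtain m where m: "w + lat m \<in> cbox 0 1" by (rule lattice_reduce)
  \<comment> \<open>The translated point may lie on the boundary of the cube; openness of
    \<open>V\<close> then leads into the interior.\<close>
  have "box 0 1 \<noteq> ({} :: (real ^ 'n) set)"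
    by (auto simp: interval_ne_empty_cart)
  then have "w + lat m \<in> closure (box 0 1)" using m by (simp add: closure_box)
  moreover have "w + lat m \<in> V" using W(4) \<open>w \<in> V\<close> by blast
  ultimately have ne: "V \<inter> box 0 1 \<noteq> {}"
    using open_Int_closure_eq_empty[OF W(2), of "box 0 1"] by blast
  have "V \<inter> box 0 1 \<subseteq> torus_proj -` W \<inter> C"
    using W(5) by (auto simp: C_def mem_box_cart less_imp_le)
  moreover have meas: "torus_proj -` W \<inter> C \<in> sets lborel"
  proof -
    have "torus_proj \<in> borel_measurable (lborel :: (real ^ 'n) measure)"
      by (rule borel_measurableI) (auto simp: open_torus_def)
    then have "torus_proj -` W \<inter> space lborel \<in> sets (lborel :: (real ^ 'n) measure)" using W(1) by (rule measurable_sets)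
    then show ?thesis using C by auto
  qed
  ultimately have "emeasure lborel (V \<inter> box 0 1) \<le> emeasure lborel (torus_proj -` W \<inter> C)"
    by (intro emeasure_mono)
  moreover have "emeasure lborel (V \<inter> box 0 1) \<noteq> 0"
  proof
    assume "emeasure lborel (V \<inter> box 0 1) = 0"
    then have "V \<inter> box 0 1 \<in> null_sets lborel" using W(2) by (auto simp: null_sets_def)
    then have "negligible (V \<inter> box 0 1)" by (simp add: negligible_iff_null_sets null_sets_completionI)
    then show False using open_not_negligible[OF open_Int[OF W(2) open_box] ne] by simp
  qed
  ultimately have "emeasure lborel (torus_proj -` W \<inter> C) \<noteq> 0" by (metis le_zero_eq)
  moreover have "emeasure torus_measure W = emeasure (restrict_space lborel C) (torus_proj -` W \<inter> C)"
    unfolding torus_measure_def C_def[symmetric]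
    using emeasure_distr[OF torus_proj_measurable W(1), of C] by (simp add: space_restrict_space)
  moreover have "\<dots> = emeasure lborel (torus_proj -` W \<inter> C)"
    using C by (intro emeasure_restrict_space) auto
  ultimately show ?thesis by simp
qed

text \<open>Otherwise the transpose of \<open>A ^ m\<close> fixes a nonzero integer vector
  \<open>n\<close>. Summing a function of \<open>lat n \<bullet> x\<close> over \<open>m\<close>
  steps of the orbit gives an invariant continuous function that is not constant, and one of its
  sublevel sets contradicts ergodicity.\<close>

lemma ergodic_det_nonzero:
  fixes A :: "int ^ 'n ^ 'n"
  assumes A: "ergodic_matrix A" and m: "0 < m"
  shows "det (mpow A m - mat 1) \<noteq> 0"
proof
  assume "det (mpow A m - mat 1) = 0"
  then have "det (transpose (mpow A m - mat 1)) = 0" by (simp add: det_transpose)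
  then obtain n where n: "n \<noteq> 0" "transpose (mpow A m - mat 1) *v n = 0"
    using det_eq_0_int_kernel by blast
  have "transpose (mpow A m - mat 1) = transpose (mpow A m) - mat 1"
    by (simp add: transpose_def vec_eq_iff mat_def)
  then have "transpose (mpow A m) *v n = n"
    using n(2) by (simp add: matrix_vector_mult_diff_rdistrib)
  then have fix_n: "lat n \<bullet> (rmat (mpow A m) *v x) = lat n \<bullet> x" for x
    by (simp add: inner_lat_rmat)
  \<comment> \<open>The squared sine descends to the torus, vanishes at 0 and is 1 where the inner
    product is 1/2. Its nonnegativity prevents the terms of the orbit sum from cancelling.\<close>
  define g where "g j x = (sin (pi * (lat n \<bullet> (rmat (mpow A j) *v x))))\<^sup>2" for j x
  define G where "G x = (\<Sum>j<m. g j x)" for x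
  have sin_per: "(sin (pi * (t + of_int z)))\<^sup>2 = (sin (pi * t))\<^sup>2" for t z
  proof -
    have "sin (pi * (t + of_int z)) = sin (pi * t) * cos (pi * of_int z)"
      by (simp add: ring_distribs sin_add)
    moreover have "(cos (pi * of_int z))\<^sup>2 = 1"
      using sin_cos_squared_add[of "pi * of_int z"] by simp
    ultimately show ?thesis by (simp add: power_mult_distrib)
  qed
  have per: "G (x + lat k) = G x" for x k
  proof -
    have "g j (x + lat k) = g j x" for j
    proof -
      have "rmat (mpow A j) *v (x + lat k) = rmat (mpow A j) *v x + lat (mpow A j *v k)"
        by (simp add: lat_mult matrix_vector_right_distrib)
      moreover obtain z where "lat n \<bullet> lat (mpow A j *v k) = of_int z"
        using lat_inner_lat[of n "mpow A j *v k"] by (elim Ints_cases)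
      ultimately show ?thesis by (simp add: g_def inner_add_right sin_per)
    qed
    then show ?thesis by (simp add: G_def)
  qed
  have inv: "G (rmat A *v x) = G x" for x
  proof -
    have gs: "g j (rmat A *v x) = g (Suc j) x" for j
      by (simp add: g_def matrix_vector_mul_assoc rmat_mult[symmetric] mpow_commute)
    have "g m x = g 0 x" by (simp add: g_def fix_n)
    then show ?thesis
      unfolding G_def gs using sum.lessThan_Suc_shift[of "\<lambda>j. g j x" m] by simp
  qed
  have cont: "continuous_on UNIV G"
    unfolding G_def g_def
    by (intro continuous_intros matrix_vector_mult_linear_continuous_on)
  define S where "S = {p. G (torus_rep p) < 1 / 2}"
  have rep: "G (torus_rep (torus_proj x)) = G x" for x
  proof -
    have "torus_proj (torus_rep (torus_proj x)) = torus_proj x" by simp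
    then obtain k where "torus_rep (torus_proj x) = x + lat k" by (auto simp only: torus_proj_eq_iff)
    then show ?thesis by (simp add: per)
  qed
  have vS: "torus_proj x \<in> S \<longleftrightarrow> G x < 1 / 2" for x by (simp add: S_def rep)
  have openV: "open {x. G x < 1 / 2}" "open {x. 1 / 2 < G x}"
    using cont by (auto intro!: open_Collect_less continuous_intros)
  have "open S"
    using openV(1) by (simp add: open_torus_def vimage_def vS)
  then have Sb: "S \<in> sets borel" by simp
  have sp: "sets torus_measure = sets borel" "space torus_measure = UNIV"
    by (simp_all add: torus_measure_def)
  have "torus_aut A -` S = S"
  proof -
    have "torus_aut A p \<in> S \<longleftrightarrow> p \<in> S" for p
      using vS[of "rmat A *v torus_rep p"] by (simp add: torus_aut_proj[symmetric] inv S_def)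
    then show ?thesis by auto
  qed
  then have dich: "emeasure torus_measure S = 0 \<or> emeasure torus_measure (UNIV - S) = 0"
    using A Sb sp unfolding ergodic_matrix_def ergodic_def by (metis Int_UNIV_right)
  have "emeasure torus_measure S \<noteq> 0"
  proof (rule torus_measure_open_pos[OF Sb openV(1)])
    have "G 0 = 0" by (simp add: G_def g_def)
    then have "0 \<in> {x. G x < 1 / 2}" by simp
    then show "{x. G x < 1 / 2} \<noteq> {}" by blast
  qed (auto simp: per vS)
  moreover have "emeasure torus_measure (UNIV - S) \<noteq> 0"
  proof (rule torus_measure_open_pos[OF _ openV(2)])
    define x0 where "x0 = (1 / (2 * (norm (lat n))\<^sup>2)) *\<^sub>R lat n"
    have "lat n \<noteq> 0" using n(1) lat_eq_iff[of n 0] by (simp add: lat_simps)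
    then have "lat n \<bullet> x0 = 1 / 2" by (simp add: x0_def power2_norm_eq_inner)
    then have h: "pi * (lat n \<bullet> x0) = pi / 2" by simp
    have "g 0 x0 = (sin (pi * (lat n \<bullet> x0)))\<^sup>2" by (simp add: g_def)
    then have "g 0 x0 = 1" unfolding h by simp
    moreover have "g 0 x0 \<le> G x0"
      unfolding G_def using m by (intro member_le_sum) (auto simp: g_def)
    ultimately have "1 / 2 < G x0" by simp
    then show "{x. 1 / 2 < G x} \<noteq> {}" by auto
  qed (use Sb in \<open>auto simp: per vS\<close>)
  ultimately show False using dich by blast
qed

text \<open>The Gram matrix of the family is injective, since its quadratic form is the sum of the
  squared norms of the \<open>N i *v d\<close>; the \<open>M i\<close> are its inverse times the
  transposes.\<close>

lemma gram_left_inverse: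
  fixes N :: "nat \<Rightarrow> real ^ 'n ^ 'n"
  assumes I: "finite I" and ker: "\<And>d. (\<And>i. i \<in> I \<Longrightarrow> N i *v d = 0) \<Longrightarrow> d = 0"
  obtains M where "\<And>d. (\<Sum>i\<in>I. M i *v (N i *v d)) = d"
proof -
  define G where "G = (\<Sum>i\<in>I. transpose (N i) ** N i)"
  have Gd: "G *v d = (\<Sum>i\<in>I. transpose (N i) *v (N i *v d))" for d
    unfolding G_def using I by (induction I rule: finite_induct) (simp_all add: matrix_vector_mult_add_rdistrib matrix_vector_mul_assoc)
  have "d = 0" if "G *v d = 0" for d
  proof (rule ker)
    fix i assume i: "i \<in> I"
    have "0 = d \<bullet> (G *v d)" using that by simp
    also have "\<dots> = (\<Sum>i\<in>I. (N i *v d) \<bullet> (N i *v d))"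
      by (simp add: Gd inner_sum_right dot_lmul_matrix[symmetric] vector_transpose_matrix inner_commute)
    finally have "(\<Sum>i\<in>I. (N i *v d) \<bullet> (N i *v d)) = 0" by simp
    then have "(N i *v d) \<bullet> (N i *v d) = 0"
      using I i by (subst (asm) sum_nonneg_eq_0_iff) auto
    then show "N i *v d = 0" by simp
  qed
  then obtain P where P: "P ** G = mat 1" using matrix_left_invertible_ker by blast
  show thesis
  proof (rule that)
    fix d
    have "d = P *v (G *v d)" by (simp add: matrix_vector_mul_assoc P)
    also have "\<dots> = (\<Sum>i\<in>I. (P ** transpose (N i)) *v (N i *v d))"
      by (simp add: Gd linear_sum[OF matrix_vector_mul_linear] matrix_vector_mul_assoc matrix_mul_assoc)
    finally show "(\<Sum>i\<in>I. (P ** transpose (N i)) *v (N i *v d)) = d" by simp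
  qed
qed

subsection \<open>The topological conjugacy\<close>

text \<open>The iterates of the numerator take finitely many values modulo \<open>p\<close>, so two
  of them agree. Invertibility over the integers cancels the smaller power, and the orbit returns to
  its starting point modulo the lattice.\<close>

lemma rational_point_periodic:
  fixes A A' :: "int ^ 'n ^ 'n"
  assumes A': "A' ** A = mat 1" and p: "0 < p"
  shows "\<exists>m>0. \<exists>z. rmat (mpow A m) *v ((1 / real p) *\<^sub>R lat w) - (1 / real p) *\<^sub>R lat w = lat z"
proof -
  define r where "r n = (\<chi> i. (n $ i) mod int p)" for n :: "int ^ 'n"
  have "finite {n :: int ^ 'n. \<forall>i. n $ i \<in> {0..<int p}}"
  proof (rule finite_subset)
    show "{n :: int ^ 'n. \<forall>i. n $ i \<in> {0..<int p}} \<subseteq> (\<lambda>f. \<chi> i. f i) ` PiE UNIV (\<lambda>_. {0..<int p})"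
    proof
      fix n :: "int ^ 'n" assume "n \<in> {n. \<forall>i. n $ i \<in> {0..<int p}}"
      then have "(\<lambda>i. n $ i) \<in> PiE UNIV (\<lambda>_. {0..<int p})" "n = (\<chi> i. n $ i)" by auto
      then show "n \<in> (\<lambda>f. \<chi> i. f i) ` PiE UNIV (\<lambda>_. {0..<int p})" by blast
    qed
    show "finite ((\<lambda>f. \<chi> i. f i) ` PiE (UNIV :: 'n set) (\<lambda>_. {0..<int p}) :: (int ^ 'n) set)"
      by (intro finite_imageI finite_PiE) auto
  qed
  moreover have "range (\<lambda>j. r (mpow A j *v w)) \<subseteq> {n :: int ^ 'n. \<forall>i. n $ i \<in> {0..<int p}}"
    using p by (auto simp: r_def)
  ultimately have "finite (range (\<lambda>j. r (mpow A j *v w)))" by (rule finite_subset[rotated])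
  then have "\<not> inj (\<lambda>j. r (mpow A j *v w))" using finite_imageD infinite_UNIV_nat by blast
  then obtain a b where ab: "a < b" "r (mpow A a *v w) = r (mpow A b *v w)"
    unfolding inj_def by (metis linorder_neqE_nat)
  have addp: "mpow A (i + j) = mpow A i ** mpow A j" for i j
    by (induction i) (simp_all add: matrix_mul_assoc)
  have inva: "mpow A' a ** mpow A a = mat 1" for a
  proof (induction a)
    case (Suc a)
    have "mpow A' (Suc a) ** mpow A (Suc a) = mpow A' a ** (A' ** A) ** mpow A a"
      by (simp add: mpow_commute[of A'] matrix_mul_assoc)
    then show ?case using Suc A' by simp
  qed simp
  have "\<exists>k. (mpow A b *v w - mpow A a *v w) $ i = int p * k" for i
  proof -
    have "(mpow A b *v w) $ i mod int p = (mpow A a *v w) $ i mod int p"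
      using ab(2) by (simp add: r_def vec_eq_iff)
    then show ?thesis by (metis mod_eq_dvd_iff vector_minus_component dvd_def)
  qed
  then obtain k where k: "\<And>i. (mpow A b *v w - mpow A a *v w) $ i = int p * k i" by metis
  define z where "z = mpow A' a *v (\<chi> i. k i)"
  have "mpow A b *v w - mpow A a *v w = int p *s (\<chi> i. k i)" using k by (simp add: vec_eq_iff)
  then have "mpow A' a *v (mpow A b *v w - mpow A a *v w) = int p *s z"
    by (simp add: z_def) (simp add: vec_eq_iff matrix_vector_mult_def sum_distrib_left mult_ac)
  moreover have "mpow A b = mpow A a ** mpow A (b - a)" using ab(1) addp[of a "b - a"] by simp
  ultimately have e: "mpow A (b - a) *v w - w = int p *s z"
    by (simp add: matrix_vector_mult_diff_distrib matrix_vector_mul_assoc matrix_mul_assoc inva)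
  have "rmat (mpow A (b - a)) *v ((1 / real p) *\<^sub>R lat w) - (1 / real p) *\<^sub>R lat w = (1 / real p) *\<^sub>R lat (mpow A (b - a) *v w - w)"
    by (simp add: lat_simps lat_mult scaleR_right_diff_distrib matrix_vector_mult_scaleR)
  also have "\<dots> = lat z" using p by (simp add: e vec_eq_iff)
  finally show ?thesis using ab(1) by (metis zero_less_diff)
qed

lemma rationals_dense:
  fixes x :: "real ^ 'n"
  assumes "0 < e"
  obtains p w where "0 < p" "norm (x - (1 / real p) *\<^sub>R lat w) < e"
proof -
  obtain p where p: "real CARD('n) / e < real p" using reals_Archimedean2 by blast
  have p0: "0 < p"
    using p assms by (metis divide_nonneg_pos not_gr_zero of_nat_0 of_nat_0_le_iff not_less)
  define w :: "int ^ 'n" where "w = (\<chi> i. \<lfloor>real p * x $ i\<rfloor>)"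
  have c: "\<bar>(x - (1 / real p) *\<^sub>R lat w) $ i\<bar> \<le> 1 / real p" for i
  proof -
    have "(x - (1 / real p) *\<^sub>R lat w) $ i = (1 / real p) * (real p * x $ i - of_int \<lfloor>real p * x $ i\<rfloor>)"
      using p0 by (simp add: w_def field_simps)
    moreover have "\<bar>real p * x $ i - of_int \<lfloor>real p * x $ i\<rfloor>\<bar> \<le> 1" by linarith
    ultimately show ?thesis using p0 by (simp add: abs_mult divide_le_cancel)
  qed
  have "norm (x - (1 / real p) *\<^sub>R lat w) \<le> (\<Sum>i\<in>UNIV. \<bar>(x - (1 / real p) *\<^sub>R lat w) $ i\<bar>)"
    by (rule norm_le_l1_cart)
  also have "\<dots> \<le> (\<Sum>i\<in>(UNIV :: 'n set). 1 / real p)" by (intro sum_mono c)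
  also have "\<dots> < e" using p p0 assms by (simp add: field_simps)
  finally show thesis using that p0 by blast
qed

text \<open>\<open>B i\<close> will be a shear with factor \<open>k\<close> and \<open>P i\<close>
  will be \<open>1 / k\<close> times a fixed matrix, so \<open>card I * c\<close> is small for large
  \<open>k\<close>. The bounds on the \<open>f i\<close> are the only smallness asked of the
  perturbation; \<open>fA\<close> is an arbitrary continuous periodic map.\<close>

context
  fixes A A' :: "int ^ 'n ^ 'n" and fA :: "real ^ 'n \<Rightarrow> real ^ 'n"
    and I :: "'i set" and B :: "'i \<Rightarrow> int ^ 'n ^ 'n" and f :: "'i \<Rightarrow> real ^ 'n \<Rightarrow> real ^ 'n"
    and P :: "'i \<Rightarrow> real ^ 'n ^ 'n" and \<eta> c :: real
  assumes A': "A' ** A = mat 1" and nondeg: "\<And>m. 0 < m \<Longrightarrow> det (mpow A m - mat 1) \<noteq> 0"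
    and fA: "cont_periodic fA" and I: "finite I"
    and AB: "\<And>i. i \<in> I \<Longrightarrow> A ** B i = B i ** A"
    and f: "\<And>i. i \<in> I \<Longrightarrow> cont_periodic (f i)" "\<And>i x. i \<in> I \<Longrightarrow> norm (f i x) \<le> \<eta>"
      "\<And>i x y. i \<in> I \<Longrightarrow> norm (f i x - f i y) \<le> norm (x - y)"
    and P: "\<And>d. (\<Sum>i\<in>I. P i *v (rmat (B i) *v d - d)) = d"
      "\<And>i y. i \<in> I \<Longrightarrow> norm (P i *v y) \<le> c * norm y" "card I * c \<le> 1 / 4" "0 \<le> c"
    and \<eta>: "0 \<le> \<eta>"
    and comm: "\<And>i x. i \<in> I \<Longrightarrow> rmat A *v (rmat (B i) *v x + f i x) + fA (rmat (B i) *v x + f i x)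
      = rmat (B i) *v (rmat A *v x + fA x) + f i (rmat A *v x + fA x)"
begin

definition lift_A :: "real ^ 'n \<Rightarrow> real ^ 'n" where
  "lift_A x = rmat A *v x + fA x"

text \<open>\<open>x\<close> and \<open>q\<close> are periodic modulo the lattice under the perturbed and the linear map, and one
  period displaces them by the same lattice vector.\<close>

definition period_match :: "nat \<Rightarrow> real ^ 'n \<Rightarrow> real ^ 'n \<Rightarrow> bool" where
  "period_match m x q \<longleftrightarrow> 0 < m \<and> (\<exists>z. (lift_A ^^ m) x = x + lat z \<and> rmat (mpow A m) *v q - q = lat z)"

text \<open>A map commuting with \<open>lift_A\<close> preserves the relation: on both sides the
  displacement \<open>z\<close> turns into \<open>C *v z\<close> and the period stays the same. It
  is this common period that \<open>period_match_bound\<close> relies on.\<close>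

lemma period_match_equivariant:
  assumes R: "period_match m x q" and fC: "cont_periodic fC" and AC: "A ** C = C ** A"
    and commC: "\<And>x. lift_A (rmat C *v x + fC x) = rmat C *v lift_A x + fC (lift_A x)"
  shows "period_match m (rmat C *v x + fC x) (rmat C *v q)"
proof -
  obtain z where z: "(lift_A ^^ m) x = x + lat z" "rmat (mpow A m) *v q - q = lat z" "0 < m"
    using R by (auto simp: period_match_def)
  have "(lift_A ^^ j) (rmat C *v x + fC x) = rmat C *v (lift_A ^^ j) x + fC ((lift_A ^^ j) x)" for j
    by (induction j) (simp_all add: commC)
  then have "(lift_A ^^ m) (rmat C *v x + fC x) = (rmat C *v x + fC x) + lat (C *v z)"
    using fC by (simp add: z lat_mult matrix_vector_right_distrib cperD)
  moreover have "rmat (mpow A m) *v (rmat C *v q) - rmat C *v q = lat (C *v z)"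
  proof -
    have "rmat (mpow A m) *v (rmat C *v q) - rmat C *v q = rmat C *v (rmat (mpow A m) *v q - q)"
      by (simp add: matrix_vector_mult_diff_distrib matrix_vector_mul_assoc rmat_mult[symmetric] mpow_commute_other[OF AC])
    then show ?thesis by (simp add: z lat_mult)
  qed
  ultimately show ?thesis using z(3) by (auto simp: period_match_def)
qed

lemma period_match_B:
  assumes "i \<in> I" "period_match m x q" shows "period_match m (rmat (B i) *v x + f i x) (rmat (B i) *v q)"
  using assms comm by (intro period_match_equivariant f AB) (simp_all add: lift_A_def)

lemma iterate_diff:
  shows "cont_periodic (\<lambda>x. (lift_A ^^ m) x - rmat (mpow A m) *v x)"
proof (induction m)
  case (Suc m)
  define h where "h x = (lift_A ^^ m) x - rmat (mpow A m) *v x" for x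
  have e: "(lift_A ^^ Suc m) x - rmat (mpow A (Suc m)) *v x = rmat A *v h x + fA (rmat (mpow A m) *v x + h x)" for x
    by (simp add: h_def lift_A_def rmat_mult matrix_vector_mul_assoc[symmetric] matrix_vector_mult_diff_distrib)
  have h: "continuous_on UNIV h" "h (x + lat k) = h x" for x k
    using Suc by (auto simp: h_def[abs_def] cont_periodic_def)
  show ?case
    unfolding e cont_periodic_def
  proof (intro conjI allI)
    show "continuous_on UNIV (\<lambda>x. rmat A *v h x + fA (rmat (mpow A m) *v x + h x))"
      by (intro continuous_intros h continuous_on_compose2[OF matrix_vector_mult_linear_continuous_on[of UNIV "rmat A"] h(1)]
         continuous_on_compose2[OF cperD(1)[OF fA, of UNIV]] matrix_vector_mult_linear_continuous_on) auto
    fix x k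
    have "rmat (mpow A m) *v (x + lat k) + h (x + lat k) = (rmat (mpow A m) *v x + h x) + lat (mpow A m *v k)"
      by (simp add: h lat_mult matrix_vector_right_distrib)
    then show "rmat A *v h (x + lat k) + fA (rmat (mpow A m) *v (x + lat k) + h (x + lat k)) =
       rmat A *v h x + fA (rmat (mpow A m) *v x + h x)"
      by (simp only: h cperD(2)[OF fA])
  qed
qed (simp add: cont_periodic_def)

lemma nondeg_inverse:
  assumes "0 < m"
  obtains W where "\<And>y. W *v (rmat (mpow A m) *v y - y) = y" "\<And>y. rmat (mpow A m) *v (W *v y) - W *v y = y"
proof -
  define M where "M = rmat (mpow A m - mat 1)"
  have "det M \<noteq> 0" using nondeg[OF assms] by (simp add: M_def det_of_int)
  then have "invertible M" by (simp add: invertible_det_nz)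
  then obtain W where W: "M ** W = mat 1" "W ** M = mat 1" by (auto simp: invertible_def)
  have M: "M *v y = rmat (mpow A m) *v y - y" for y
  proof -
    have "M = rmat (mpow A m) - mat 1" by (simp add: M_def vec_eq_iff map_matrix_def mat_def)
    then show ?thesis by (simp add: matrix_vector_mult_diff_rdistrib)
  qed
  show thesis
  proof (rule that[of W])
    fix y
    show "W *v (rmat (mpow A m) *v y - y) = y"
      unfolding M[symmetric] by (simp add: matrix_vector_mul_assoc W)
    have "M *v (W *v y) = y" by (simp add: matrix_vector_mul_assoc W)
    then show "rmat (mpow A m) *v (W *v y) - W *v y = y" by (simp only: M)
  qed
qed

text \<open>For fixed \<open>m\<close> the inverse of \<open>A ^ m - 1\<close> gives some bound on
  the distances, which depends on \<open>m\<close> and serves only to make their supremum finite.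
  The shears map matched pairs to matched pairs, and the identity for \<open>P\<close> then gives
  \<open>Sup E \<le> Sup E / 2 + \<eta> / 4\<close>, a bound free of \<open>m\<close>.\<close>

lemma period_match_bound:
  assumes "period_match m x q" shows "norm (q - x) \<le> \<eta> / 2"
proof -
  have m: "0 < m" using assms by (simp add: period_match_def)
  obtain W where W: "\<And>y. W *v (rmat (mpow A m) *v y - y) = y" using nondeg_inverse[OF m] by blast
  obtain K where K: "\<And>x. norm ((lift_A ^^ m) x - rmat (mpow A m) *v x) \<le> K"
    using cont_periodic_bounded[OF iterate_diff] by metis
  obtain b where b: "0 \<le> b" "\<And>y. norm (W *v y) \<le> b * norm y" by (rule matrix_vector_bound) blast
  define E where "E = {norm (q - x) | q x. period_match m x q}"
  have EK: "e \<le> b * K" if eE: "e \<in> E" for e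
  proof -
    obtain q x where e: "e = norm (q - x)" and R: "period_match m x q" using eE by (auto simp: E_def)
    obtain z where z: "(lift_A ^^ m) x = x + lat z" "rmat (mpow A m) *v q - q = lat z" using R by (auto simp: period_match_def)
    have "rmat (mpow A m) *v (q - x) - (q - x) = (lift_A ^^ m) x - rmat (mpow A m) *v x"
      using z by (simp add: matrix_vector_mult_diff_distrib)
    then have "q - x = W *v ((lift_A ^^ m) x - rmat (mpow A m) *v x)" using W[of "q - x"] by simp
    then have "e \<le> b * norm ((lift_A ^^ m) x - rmat (mpow A m) *v x)" using b(2) e by simp
    also have "\<dots> \<le> b * K" using K b(1) by (intro mult_left_mono)
    finally show ?thesis .
  qed
  have bdd: "bdd_above E" using EK by (rule bdd_aboveI)
  have inE: "norm (q - x) \<in> E" if "period_match m x q" for x q using that by (auto simp: E_def)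
  have "e \<le> Sup E / 2 + \<eta> / 4" if eE: "e \<in> E" for e
  proof -
    obtain q x where e: "e = norm (q - x)" and R: "period_match m x q" using eE by (auto simp: E_def)
    define d where "d = q - x"
    have S: "norm d \<le> Sup E" using cSup_upper[OF inE[OF R] bdd] by (simp add: d_def)
    have "norm (P i *v (rmat (B i) *v d - d)) \<le> c * (2 * Sup E + \<eta>)" if i: "i \<in> I" for i
    proof -
      define d' where "d' = rmat (B i) *v q - (rmat (B i) *v x + f i x)"
      have "norm d' \<le> Sup E"
        using cSup_upper[OF inE[OF period_match_B[OF i R]] bdd] by (simp add: d'_def)
      moreover have eq: "rmat (B i) *v d - d = d' - d + f i x"
        by (simp add: d_def d'_def matrix_vector_mult_diff_distrib)
      ultimately have "norm (rmat (B i) *v d - d) \<le> 2 * Sup E + \<eta>"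
        unfolding eq using S f(2)[OF i, of x] norm_triangle_ineq[of "d' - d" "f i x"] norm_triangle_ineq4[of d' d] by linarith
      then show ?thesis using P(2)[OF i, of "rmat (B i) *v d - d"] P(4) by (meson mult_left_mono order_trans)
    qed
    then have "norm (\<Sum>i\<in>I. P i *v (rmat (B i) *v d - d)) \<le> (\<Sum>i\<in>I. c * (2 * Sup E + \<eta>))"
      by (intro sum_norm_le)
    then have "norm d \<le> (card I * c) * (2 * Sup E + \<eta>)" by (simp add: P(1))
    also have "\<dots> \<le> 1 / 4 * (2 * Sup E + \<eta>)"
      using P(3) S \<eta> norm_ge_zero[of d] by (intro mult_right_mono) linarith+
    finally show ?thesis by (simp add: e d_def)
  qed
  then have "Sup E \<le> Sup E / 2 + \<eta> / 4" using inE[OF assms] by (intro cSup_least) auto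
  then show ?thesis using cSup_upper[OF inE[OF assms] bdd] by linarith
qed

text \<open>If every \<open>B i\<close> stretched \<open>d\<close> by less than 3, the identity for
  \<open>P\<close> together with \<open>card I * c \<le> 1 / 4\<close> would make \<open>d\<close>
  shorter than itself. Passing to the perturbed maps loses at most 1 of the factor 3, by the
  Lipschitz bound on \<open>f i\<close>.\<close>

lemma expansion:
  shows "\<exists>i\<in>I. 2 * norm (x - y) \<le> norm ((rmat (B i) *v x + f i x) - (rmat (B i) *v y + f i y))"
proof -
  define d where "d = x - y"
  have "\<exists>i\<in>I. 3 * norm d \<le> norm (rmat (B i) *v d)"
  proof (rule ccontr)
    assume *: "\<not> (\<exists>i\<in>I. 3 * norm d \<le> norm (rmat (B i) *v d))"
    \<comment> \<open>Without any index the identity for \<open>P\<close> would say that every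
      vector is 0.\<close>
    have Ine: "I \<noteq> {}"
    proof
      assume "I = {}"
      then have "axis undefined 1 = (0 :: real ^ 'n)" using P(1)[of "axis undefined 1"] by simp
      then show False by simp
    qed
    then have d: "0 < norm d" using * by fastforce
    have "norm (P i *v (rmat (B i) *v d - d)) \<le> c * (norm (rmat (B i) *v d) + norm d)" if "i \<in> I" for i
      using P(2)[OF that, of "rmat (B i) *v d - d"] P(4) norm_triangle_ineq4[of "rmat (B i) *v d" d]
      by (meson mult_left_mono order_trans)
    then have "norm (\<Sum>i\<in>I. P i *v (rmat (B i) *v d - d)) \<le> (\<Sum>i\<in>I. c * (norm (rmat (B i) *v d) + norm d))"
      by (intro sum_norm_le)
    then have 1: "norm d \<le> (\<Sum>i\<in>I. c * (norm (rmat (B i) *v d) + norm d))" by (simp add: P(1))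
    have "0 < c"
    proof (rule ccontr)
      assume "\<not> 0 < c"
      then have "c = 0" using P(4) by simp
      then show False using 1 d by simp
    qed
    then have "(\<Sum>i\<in>I. c * (norm (rmat (B i) *v d) + norm d)) < (\<Sum>i\<in>I. c * (4 * norm d))"
      using I Ine * by (intro sum_strict_mono mult_strict_left_mono) auto
    also have "\<dots> = (card I * c) * (4 * norm d)" by simp
    also have "\<dots> \<le> 1 / 4 * (4 * norm d)" using P(3) by (intro mult_right_mono) auto
    finally show False using 1 by simp
  qed
  then obtain i where i: "i \<in> I" "3 * norm d \<le> norm (rmat (B i) *v d)" by blast
  have "rmat (B i) *v d = ((rmat (B i) *v x + f i x) - (rmat (B i) *v y + f i y)) - (f i x - f i y)"
    by (simp add: d_def matrix_vector_mult_diff_distrib)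
  then have "norm (rmat (B i) *v d) \<le> norm ((rmat (B i) *v x + f i x) - (rmat (B i) *v y + f i y)) + norm (f i x - f i y)"
    by (metis norm_triangle_ineq4)
  then show ?thesis using i f(3)[OF i(1), of x y] by (intro bexI[of _ i]) (auto simp: d_def)
qed

text \<open>Applying an expanding shear \<open>t\<close> times doubles the distance of the perturbed
  points each time, while the linear points separate by at most \<open>L ^ t\<close>. At the end the
  two distances differ by at most \<eta>. Equal \<open>q\<close> gives uniqueness, varying
  \<open>q\<close> a modulus of continuity.\<close>

lemma period_match_contract:
  assumes L: "\<And>i y. i \<in> I \<Longrightarrow> norm (rmat (B i) *v y) \<le> L * norm y" "0 \<le> L"
  shows "period_match m x q \<Longrightarrow> period_match m' y q' \<Longrightarrow> norm (x - y) \<le> (\<eta> + L ^ t * norm (q - q')) / 2 ^ t"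
proof (induction t arbitrary: x y q q')
  case 0
  have "x - y = (q - q') - (q - x) + (q' - y)" by simp
  then have "norm (x - y) \<le> norm (q - q') + norm (q - x) + norm (q' - y)"
    using norm_triangle_ineq[of "(q - q') - (q - x)" "q' - y"] norm_triangle_ineq4[of "q - q'" "q - x"] by simp
  then show ?case using period_match_bound[OF 0(1)] period_match_bound[OF 0(2)] by simp
next
  case (Suc t)
  obtain i where i: "i \<in> I" "2 * norm (x - y) \<le> norm ((rmat (B i) *v x + f i x) - (rmat (B i) *v y + f i y))"
    using expansion by blast
  note i(2)
  also have "norm ((rmat (B i) *v x + f i x) - (rmat (B i) *v y + f i y)) \<le> (\<eta> + L ^ t * norm (rmat (B i) *v q - rmat (B i) *v q')) / 2 ^ t"
    by (intro Suc.IH period_match_B i Suc.prems)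
  also have "\<dots> \<le> (\<eta> + L ^ t * (L * norm (q - q'))) / 2 ^ t"
    using L(1)[OF i(1), of "q - q'"] L(2)
    by (intro divide_right_mono add_left_mono mult_left_mono) (auto simp: matrix_vector_mult_diff_distrib)
  finally show ?case by (simp add: field_simps)
qed

text \<open>The condition on \<open>x\<close> reads \<open>(A ^ m - 1) x = lat z - h x\<close> with
  \<open>h\<close> bounded. Inverting the matrix makes it a fixed point problem on a ball, solved by
  Brouwer's theorem.\<close>

lemma period_match_exists:
  assumes m: "0 < m" and q: "rmat (mpow A m) *v q - q = lat z"
  shows "\<exists>x. period_match m x q"
proof -
  obtain W where W: "\<And>y. W *v (rmat (mpow A m) *v y - y) = y" "\<And>y. rmat (mpow A m) *v (W *v y) - W *v y = y"
    using nondeg_inverse[OF m] by blast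
  define h where "h x = (lift_A ^^ m) x - rmat (mpow A m) *v x" for x
  have h: "cont_periodic h" unfolding h_def[abs_def] by (rule iterate_diff)
  obtain K where K: "0 < K" "\<And>x. norm (h x) \<le> K" using cont_periodic_bounded[OF h] by metis
  obtain b where b: "0 \<le> b" "\<And>y. norm (W *v y) \<le> b * norm y" by (rule matrix_vector_bound) blast
  define T where "T x = W *v (lat z - h x)" for x
  have "T ` cball 0 (b * (norm (lat z) + K)) \<subseteq> cball 0 (b * (norm (lat z) + K))"
  proof (rule image_subsetI)
    fix x
    have "norm (T x) \<le> b * norm (lat z - h x)" unfolding T_def by (rule b)
    also have "\<dots> \<le> b * (norm (lat z) + K)"
      using K(2)[of x] norm_triangle_ineq4[of "lat z" "h x"] b(1) by (intro mult_left_mono) auto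
    finally show "T x \<in> cball 0 (b * (norm (lat z) + K))" by simp
  qed
  moreover have "continuous_on (cball 0 (b * (norm (lat z) + K))) T"
    unfolding T_def
    by (intro continuous_on_compose2[OF matrix_vector_mult_linear_continuous_on[of UNIV]] continuous_intros cperD(1)[OF h]) auto
  moreover have "cball 0 (b * (norm (lat z) + K)) \<noteq> ({} :: (real ^ 'n) set)"
  proof -
    have "0 \<le> b * (norm (lat z) + K)" using b(1) K(1) by simp
    then show ?thesis by simp
  qed
  ultimately obtain x where x: "T x = x"
    using brouwer[of "cball 0 (b * (norm (lat z) + K))" T] by (auto simp: image_subset_iff_funcset)
  have "rmat (mpow A m) *v x - x = lat z - h x" using W(2)[of "lat z - h x"] x by (simp add: T_def)
  then have "(lift_A ^^ m) x = x + lat z" by (simp add: h_def algebra_simps)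
  then show ?thesis using m q by (auto simp: period_match_def)
qed

text \<open>The point attached to \<open>q\<close> does not depend on the period used, as
  \<open>period_match_contract\<close> compares points of different periods. Only continuity of
  \<open>g\<close> is obtained here; invertibility follows later from a bound on the derivative of
  \<open>g - id\<close>. The choice \<open>C = A\<close>, \<open>fC = fA\<close> is admissible in
  the last conclusion.\<close>

lemma topological_conjugacy:
  obtains g where "continuous_on UNIV g" "\<And>x k. g (x + lat k) = g x + lat k"
    "\<And>C fC x. cont_periodic fC \<Longrightarrow> A ** C = C ** A \<Longrightarrow>
       (\<And>x. rmat A *v (rmat C *v x + fC x) + fA (rmat C *v x + fC x) = rmat C *v (rmat A *v x + fA x) + fC (rmat A *v x + fA x)) \<Longrightarrow>
       rmat C *v g x + fC (g x) = g (rmat C *v x)"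
proof -
  have "\<exists>b\<ge>0. \<forall>y. norm (rmat (B i) *v y) \<le> b * norm y" for i
    using matrix_vector_bound[of "rmat (B i)"] by metis
  then obtain bb where bb: "\<And>i. 0 \<le> bb i" "\<And>i y. norm (rmat (B i) *v y) \<le> bb i * norm y" by metis
  define L where "L = (\<Sum>i\<in>I. bb i)"
  have L: "norm (rmat (B i) *v y) \<le> L * norm y" "0 \<le> L" if "i \<in> I" for i y
  proof -
    have "bb i \<le> L" unfolding L_def using I that bb(1) by (intro member_le_sum) auto
    then show "norm (rmat (B i) *v y) \<le> L * norm y" using bb(2)[of i y] by (meson mult_right_mono norm_ge_zero order_trans)
  qed (auto simp: L_def bb sum_nonneg)
  have L0: "0 \<le> L" by (auto simp: L_def bb sum_nonneg)
  define Q where "Q = {q. \<exists>m x. period_match m x q}"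
  define g0 where "g0 q = (SOME x. \<exists>m. period_match m x q)" for q
  have g0: "\<exists>m. period_match m (g0 q) q" if "q \<in> Q" for q
    unfolding g0_def by (rule someI_ex) (use that in \<open>auto simp: Q_def\<close>)
  have small: "\<exists>t. \<eta> / 2 ^ t < e" if "0 < e" for e :: real
  proof -
    have "\<forall>\<^sub>F t in sequentially. \<eta> / 2 ^ t < e"
      using that by (intro order_tendstoD(2)[OF LIMSEQ_divide_realpow_zero]) auto
    then show ?thesis by (auto simp: eventually_sequentially)
  qed
  have uniq: "x = y" if "period_match m x q" "period_match m' y q" for m m' x y q
  proof (rule ccontr)
    assume "x \<noteq> y"
    then obtain t where "\<eta> / 2 ^ t < norm (x - y)" using small[of "norm (x - y)"] by auto
    then show False using period_match_contract[OF L(1) L0 that, of t] by simp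
  qed
  have g0_eq: "g0 q = x" if "period_match m x q" for m x q
    using g0[of q] that uniq unfolding Q_def by blast
  have "uniformly_continuous_on Q g0"
    unfolding uniformly_continuous_on_def
  proof (intro allI impI)
    fix e :: real assume "0 < e"
    \<comment> \<open>\<open>t\<close> is fixed first, to make the part of the estimate that does
      not involve \<open>q\<close> small; the distance of \<open>q\<close> and \<open>q'\<close> is
      then measured against \<open>L ^ t\<close>.\<close>
    then obtain t where t: "\<eta> / 2 ^ t < e / 2" using small[of "e / 2"] by auto
    show "\<exists>d>0. \<forall>q\<in>Q. \<forall>q'\<in>Q. dist q' q < d \<longrightarrow> dist (g0 q') (g0 q) < e"
    proof (intro exI[of _ "e / (2 * (L ^ t + 1))"] conjI ballI impI)
      fix q q' assume q: "q \<in> Q" "q' \<in> Q" "dist q' q < e / (2 * (L ^ t + 1))"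
      obtain m m' where m: "period_match m (g0 q') q'" "period_match m' (g0 q) q" using g0 q by blast
      have Lt: "0 < L ^ t + 1" using L0 by (simp add: add_nonneg_pos)
      have "norm (g0 q' - g0 q) \<le> (\<eta> + L ^ t * norm (q' - q)) / 2 ^ t"
        by (rule period_match_contract[OF L(1) L0 m])
      also have "\<dots> = \<eta> / 2 ^ t + L ^ t * norm (q' - q) / 2 ^ t" by (rule add_divide_distrib)
      also have "L ^ t * norm (q' - q) / 2 ^ t \<le> L ^ t * norm (q' - q) / 1"
        using L0 by (intro divide_left_mono) auto
      also have "L ^ t * norm (q' - q) / 1 \<le> (L ^ t + 1) * norm (q' - q)" by (simp add: mult_right_mono)
      also have "\<dots> \<le> (L ^ t + 1) * (e / (2 * (L ^ t + 1)))"
        using q(3) Lt by (intro mult_left_mono) (auto simp: dist_norm)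
      also have "\<dots> = e / 2"
      proof -
        have "s * (e / (2 * s)) = e / 2" if "0 < s" for s :: real using that by simp
        then show ?thesis using Lt by blast
      qed
      finally show "dist (g0 q') (g0 q) < e" using t unfolding dist_norm by linarith
    qed (use \<open>0 < e\<close> L0 in \<open>auto intro!: divide_pos_pos add_nonneg_pos\<close>)
  qed
  then obtain g where ug: "uniformly_continuous_on (closure Q) g" and gQ: "\<And>q. q \<in> Q \<Longrightarrow> g0 q = g q"
    by (rule uniformly_continuous_on_extension_on_closure) blast
  have dense: "closure Q = UNIV"
  proof -
    have "x \<in> closure Q" for x
      unfolding closure_approachable
    proof (intro allI impI)
      fix e :: real assume "0 < e"
      then obtain p w where pw: "0 < p" "norm (x - (1 / real p) *\<^sub>R lat w) < e" by (rule rationals_dense) blast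
      have "(1 / real p) *\<^sub>R lat w \<in> Q"
        using rational_point_periodic[OF A' pw(1), of w] period_match_exists unfolding Q_def by blast
      then show "\<exists>q\<in>Q. dist q x < e" using pw(2) by (auto simp: dist_norm norm_minus_commute)
    qed
    then show ?thesis by blast
  qed
  have cg: "continuous_on UNIV g" using ug uniformly_continuous_imp_continuous dense by auto
  have extend: "u x = w x" if "continuous_on UNIV u" "continuous_on UNIV w" "\<And>q. q \<in> Q \<Longrightarrow> u q = w q" for u w :: "real ^ 'n \<Rightarrow> real ^ 'n" and x
  proof -
    have "closed {x. u x = w x}" using that(1,2) by (rule closed_Collect_eq)
    then have "closure Q \<subseteq> {x. u x = w x}" using that(3) by (intro closure_minimal) auto
    then show ?thesis using dense by auto
  qed
  show thesis
  proof (rule that[OF cg])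
    fix x k
    show "g (x + lat k) = g x + lat k"
    proof (rule extend[of "\<lambda>x. g (x + lat k)" "\<lambda>x. g x + lat k"])
      show "continuous_on UNIV (\<lambda>x. g (x + lat k))"
        by (rule continuous_on_compose2[OF cg]) (auto intro!: continuous_intros)
      fix q assume "q \<in> Q"
      then obtain m where m: "period_match m (g q) q" using g0 gQ by metis
      then obtain z where z: "0 < m" "(lift_A ^^ m) (g q) = g q + lat z" "rmat (mpow A m) *v q - q = lat z" by (auto simp: period_match_def)
      have "(lift_A ^^ m) (g q + lat k) = (lift_A ^^ m) (g q) + lat (mpow A m *v k)"
        using cperD(2)[OF iterate_diff, of m "g q" k] by (simp add: matrix_vector_right_distrib lat_mult algebra_simps)
      then have "period_match m (g q + lat k) (q + lat k)"
        using z by (auto simp: period_match_def matrix_vector_right_distrib lat_simps lat_mult[symmetric] algebra_simps intro!: exI[of _ "z + (mpow A m *v k - k)"])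
      then show "g (q + lat k) = g q + lat k" using g0_eq gQ Q_def by (metis (mono_tags, lifting) mem_Collect_eq)
    qed (intro continuous_intros cg)
  next
    fix C fC x
    assume fC: "cont_periodic fC" and AC: "A ** C = C ** A" and
      "\<And>x. rmat A *v (rmat C *v x + fC x) + fA (rmat C *v x + fC x) = rmat C *v (rmat A *v x + fA x) + fC (rmat A *v x + fA x)"
    then have cC: "\<And>x. lift_A (rmat C *v x + fC x) = rmat C *v lift_A x + fC (lift_A x)" by (simp add: lift_A_def)
    show "rmat C *v g x + fC (g x) = g (rmat C *v x)"
    proof (rule extend[of "\<lambda>x. rmat C *v g x + fC (g x)" "\<lambda>x. g (rmat C *v x)"])
      show "continuous_on UNIV (\<lambda>x. rmat C *v g x + fC (g x))"
        by (intro continuous_intros continuous_on_compose2[OF matrix_vector_mult_linear_continuous_on[of UNIV] cg]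
          continuous_on_compose2[OF cperD(1)[OF fC, of UNIV] cg]) auto
      show "continuous_on UNIV (\<lambda>x. g (rmat C *v x))"
        by (rule continuous_on_compose2[OF cg matrix_vector_mult_linear_continuous_on]) auto
      fix q assume "q \<in> Q"
      then obtain m where "period_match m (g q) q" using g0 gQ by metis
      then have "period_match m (rmat C *v g q + fC (g q)) (rmat C *v q)" by (rule period_match_equivariant[OF _ fC AC cC])
      then show "rmat C *v g q + fC (g q) = g (rmat C *v q)" using g0_eq gQ Q_def by (metis (mono_tags, lifting) mem_Collect_eq)
    qed
  qed
qed

end

subsection \<open>Composition with a perturbation of the identity\<close>

definition csym :: "(int ^ 'n \<Rightarrow> complex) \<Rightarrow> bool" where
  "csym c \<longleftrightarrow> (\<forall>n. c (- n) = cnj (c n))"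

lemma fser_real:
  assumes "csym c" shows "cnj (fser c x) = fser c x"
proof -
  have "cnj (fser c x) = (\<Sum>\<^sub>\<infinity>n. cnj (c n * expi n x))"
    unfolding fser_def by (rule infsum_cnj[symmetric])
  also have "\<dots> = (\<Sum>\<^sub>\<infinity>n. c (- n) * expi (- n) x)"
    using assms by (simp add: csym_def expi_minus)
  also have "\<dots> = fser c x"
    unfolding fser_def
    by (rule infsum_reindex_bij_betw[of uminus UNIV UNIV "\<lambda>n. c n * expi n x"]) (auto intro: bij_uminus)
  finally show ?thesis .
qed

lemma fser_of_real_Re: "csym c \<Longrightarrow> of_real (Re (fser c x)) = fser c x"
  using fser_real[of c x] by (simp add: complex_eq_iff)

definition vser :: "(int ^ 'n \<Rightarrow> complex ^ 'n) \<Rightarrow> real ^ 'n \<Rightarrow> real ^ 'n" where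
  "vser c x = (\<chi> a. Re (fser (\<lambda>n. c n $ a) x))"

text \<open>The Fourier coefficients of the partial derivative in direction \<open>i\<close> of
  component \<open>a\<close>.\<close>

definition dcoef :: "(int ^ 'n \<Rightarrow> complex ^ 'n) \<Rightarrow> 'n \<Rightarrow> 'n \<Rightarrow> int ^ 'n \<Rightarrow> complex" where
  "dcoef c i a n = 2 * pi * \<i> * of_int (n $ i) * c n $ a"

text \<open>The symmetry belongs to the class so that each component series is real and taking real
  parts in \<open>vser\<close> loses nothing.\<close>

definition decay :: "nat \<Rightarrow> real \<Rightarrow> (int ^ 'n \<Rightarrow> complex ^ 'n) \<Rightarrow> bool" where
  "decay s K c \<longleftrightarrow> (\<forall>a. csym (\<lambda>n. c n $ a)) \<and> (\<forall>n. norm (c n) \<le> K / wt n ^ s)"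

lemma csym_dcoef: "csym (\<lambda>n. c n $ a) \<Longrightarrow> csym (dcoef c i a)"
  by (simp add: csym_def dcoef_def)

lemma decay_nonneg: "decay s K c \<Longrightarrow> 0 \<le> K"
proof -
  assume "decay s K c"
  then have "0 \<le> K / wt (0 :: int ^ 'a) ^ s" unfolding decay_def using norm_ge_zero order_trans by blast
  then show "0 \<le> K" by (meson divide_neg_pos not_le wt_pos zero_less_power)
qed

lemma wt_power_le: "a \<le> b \<Longrightarrow> 1 / wt n ^ b \<le> 1 / wt n ^ a"
  by (intro divide_left_mono power_increasing mult_pos_pos) auto

lemma cmod_dcoef_le:
  assumes "decay (Suc s) K c" shows "cmod (dcoef c i a n) \<le> 2 * pi * K / wt n ^ s"
proof -
  have "cmod (dcoef c i a n) = 2 * pi * \<bar>of_int (n $ i)\<bar> * cmod (c n $ a)"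
    by (simp add: dcoef_def norm_mult)
  also have "\<dots> \<le> 2 * pi * wt n * (K / wt n ^ Suc s)"
    using assms abs_nth_le_wt[of n i] Finite_Cartesian_Product.norm_nth_le[of "c n" a]
    by (intro mult_mono) (auto simp: decay_def intro: order_trans)
  also have "\<dots> = 2 * pi * K / wt n ^ s" by (simp add: field_simps)
  finally show ?thesis .
qed

context
  fixes S :: real and c :: "int ^ 'n \<Rightarrow> complex ^ 'n" and s :: nat and K :: real
  assumes S: "1 \<le> S" "\<And>E :: (int ^ 'n) set. finite E \<Longrightarrow> (\<Sum>n\<in>E. 1 / wt n ^ (2 * CARD('n))) \<le> S"
    and c: "decay s K c" and s: "2 * CARD('n) + 2 \<le> s"
begin

lemma wt_sum_le: "2 * CARD('n) \<le> t \<Longrightarrow> finite E \<Longrightarrow> (\<Sum>n\<in>(E :: (int ^ 'n) set). 1 / wt n ^ t) \<le> S"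
  by (rule order_trans[OF sum_mono[OF wt_power_le] S(2)])

lemma coef_le: "cmod (c n $ a) \<le> K / wt n ^ s"
  using c Finite_Cartesian_Product.norm_nth_le[of "c n" a] by (auto simp: decay_def intro: order_trans)

lemma coef_summable: "Infinite_Sum.abs_summable_on (\<lambda>n. c n $ a) UNIV"
proof (rule abs_summable_wt(1)[where t = s and K = K and S = S])
  show "cmod (c n $ a) \<le> K / wt n ^ s" for n
    by (rule coef_le)
qed (use wt_sum_le s in auto)

lemma coef_summable2: "(\<lambda>n. (wt n)\<^sup>2 * cmod (c n $ a)) summable_on UNIV"
proof -
  have "Infinite_Sum.abs_summable_on (\<lambda>n. complex_of_real ((wt n)\<^sup>2) * c n $ a) UNIV"
  proof (rule abs_summable_wt(1)[where t = "s - 2" and K = K and S = S])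
    fix n
    have "cmod (complex_of_real ((wt n)\<^sup>2) * c n $ a) = (wt n)\<^sup>2 * cmod (c n $ a)"
      by (simp add: norm_mult norm_power)
    also have "\<dots> \<le> (wt n)\<^sup>2 * (K / wt n ^ s)"
      by (intro mult_left_mono coef_le) simp
    also have "\<dots> = K / wt n ^ (s - 2)"
    proof -
      have "s = (s - 2) + 2" using s by simp
      then have "wt n ^ s = wt n ^ (s - 2) * (wt n)\<^sup>2" by (metis power_add)
      then show ?thesis by simp
    qed
    finally show "cmod (complex_of_real ((wt n)\<^sup>2) * c n $ a) \<le> K / wt n ^ (s - 2)" .
  qed (use wt_sum_le s in auto)
  then show ?thesis by (simp add: norm_mult norm_power)
qed

lemma dcoef_le: "cmod (dcoef c i a n) \<le> 2 * pi * K / wt n ^ (s - 1)"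
  using cmod_dcoef_le[of "s - 1" K c i a n] c s by simp

lemma dcoef_summable: "Infinite_Sum.abs_summable_on (dcoef c i a) UNIV"
  by (rule abs_summable_wt(1)[where t = "s - 1" and K = "2 * pi * K" and S = S]) (use dcoef_le wt_sum_le s in auto)

lemma csym_c: "csym (\<lambda>n. c n $ a)"
  using c by (simp add: decay_def)

lemma cont_periodic_vser: "cont_periodic (vser c)"
proof -
  have "continuous_on UNIV (\<lambda>x. \<chi> a. Re (fser (\<lambda>n. c n $ a) x))"
    by (intro continuous_intros continuous_fser coef_summable)
  moreover have "vser c = (\<lambda>x. \<chi> a. Re (fser (\<lambda>n. c n $ a) x))" by (rule ext) (rule vser_def)
  ultimately have "continuous_on UNIV (vser c)" by argo
  moreover have "vser c (x + lat m) = vser c x" for x m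
  proof -
    have "fser (\<lambda>n. c n $ a) (x + lat m) = fser (\<lambda>n. c n $ a) x" for a
      by (rule cperD(2)[OF cont_periodic_fser[OF coef_summable]])
    then show ?thesis unfolding vser_def by presburger
  qed
  ultimately show ?thesis unfolding cont_periodic_def by blast
qed

lemma has_derivative_vser:
  "(vser c has_derivative (\<lambda>y. \<chi> a. Re (fser (\<lambda>n. 2 * pi * \<i> * (lat n \<bullet> y) * c n $ a) x))) (at x)"
proof (rule has_derivative_componentwise_within[THEN iffD2], rule ballI)
  fix b :: "real ^ 'n" assume "b \<in> Basis"
  then obtain a where b: "b = axis a 1" by (auto simp: Basis_vec_def)
  have "((\<lambda>x. Re (fser (\<lambda>n. c n $ a) x)) has_derivative (\<lambda>y. Re (fser (\<lambda>n. 2 * pi * \<i> * (lat n \<bullet> y) * c n $ a) x))) (at x)"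
    by (intro bounded_linear.has_derivative[OF bounded_linear_Re] has_derivative_fser coef_summable2)
  then show "((\<lambda>x. vser c x \<bullet> b) has_derivative
     (\<lambda>y. (\<chi> a. Re (fser (\<lambda>n. 2 * pi * \<i> * (lat n \<bullet> y) * c n $ a) x)) \<bullet> b)) (at x)"
    by (simp add: b inner_axis vser_def)
qed

lemma pd_vser: "pd i (vser c) x $ a = Re (fser (dcoef c i a) x)"
  by (simp add: frechet_derivative_eq[OF has_derivative_vser] inner_axis dcoef_def[abs_def])

lemma cont_periodic_comp_vser:
  assumes u: "cont_periodic u" shows "cont_periodic (\<lambda>x. u (x + vser c x))"
proof -
  have "continuous_on UNIV (\<lambda>x. u (x + vser c x))"
    by (rule continuous_on_compose2[OF cperD(1)[OF u, of UNIV]])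
       (auto intro!: continuous_intros cperD(1)[OF cont_periodic_vser])
  moreover have "u (x + lat m + vser c (x + lat m)) = u (x + vser c x)" for x m
    using cperD(2)[OF u, of "x + vser c x" m] cperD(2)[OF cont_periodic_vser] by (simp add: algebra_simps)
  ultimately show ?thesis by (simp add: cont_periodic_def)
qed

text \<open>Integration by parts trades the factor \<open>n $ i\<close> for a derivative. The chain
  rule produces one term without derivatives of \<open>vser c\<close>, bounded by \<open>X\<close>,
  and \<open>CARD('n)\<close> products, whose convolution sums are bounded by \<open>Y\<close>.
  Keeping \<open>X\<close> and \<open>Y\<close> abstract allows a crude and a tame use; the factor
  \<open>2 * pi\<close> is discarded.\<close>

lemma fcoef_comp_deriv_le:
  fixes u :: "real ^ 'n \<Rightarrow> complex" and X Y :: real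
  assumes u: "CB (Suc r) \<kappa> u" "cont_periodic u"
    and X: "cmod (fcoef (\<lambda>x. pd i u (x + vser c x)) n) \<le> X"
    and Y: "\<And>a E. finite E \<Longrightarrow> (\<Sum>l\<in>E. cmod (fcoef (\<lambda>x. pd a u (x + vser c x)) (n - l)) * cmod (dcoef c i a l)) \<le> Y"
  shows "\<bar>of_int (n $ i)\<bar> * cmod (fcoef (\<lambda>x. u (x + vser c x)) n) \<le> X + CARD('n) * Y"
proof -
  have cpd: "cont_periodic (pd a u)" for a
    using periodic_pd[of u] u by (auto simp: cont_periodic_def intro: CB_continuous[OF CB_pd[OF u(1)]])
  note cg = cont_periodic_comp_vser[OF cpd]
  define D where "D x y = frechet_derivative u (at (x + vser c x)) (y + (\<chi> a. Re (fser (\<lambda>n. 2 * pi * \<i> * (lat n \<bullet> y) * c n $ a) x)))" for x y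
  have d: "((\<lambda>x. u (x + vser c x)) has_derivative D x) (at x)" for x
    unfolding D_def
    by (rule has_derivative_compose[OF has_derivative_add[OF has_derivative_ident has_derivative_vser] CB_has_derivative[OF u(1)]])
  have De: "D x (axis i 1) = pd i u (x + vser c x) + (\<Sum>a\<in>UNIV. pd a u (x + vser c x) * fser (dcoef c i a) x)" for x
  proof -
    have lin: "linear (frechet_derivative u (at (x + vser c x)))"
      using CB_has_derivative[OF u(1)] has_derivative_linear by blast
    have "D x (axis i 1) = pd i u (x + vser c x) + frechet_derivative u (at (x + vser c x)) (\<chi> a. Re (fser (dcoef c i a) x))"
      by (simp add: D_def linear_add[OF lin] inner_axis dcoef_def[abs_def])
    also have "frechet_derivative u (at (x + vser c x)) (\<chi> a. Re (fser (dcoef c i a) x)) = (\<Sum>a\<in>UNIV. pd a u (x + vser c x) * fser (dcoef c i a) x)"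
      by (subst linear_axis_expansion[OF lin])
         (simp add: scaleR_conv_of_real fser_of_real_Re csym_dcoef csym_c mult.commute)
    finally show ?thesis .
  qed
  have cm: "cont_periodic (\<lambda>x. pd a u (x + vser c x) * fser (dcoef c i a) x)" for a
    by (intro cont_periodic_mult cg cont_periodic_fser dcoef_summable)
  have cD: "cont_periodic (\<lambda>x. D x (axis i 1))"
    unfolding De by (intro cont_periodic_add cont_periodic_sum cg cm)
  have "fcoef (\<lambda>x. D x (axis i 1)) n = fcoef (\<lambda>x. pd i u (x + vser c x)) n
     + (\<Sum>a\<in>UNIV. fcoef (\<lambda>x. pd a u (x + vser c x) * fser (dcoef c i a) x) n)"
    unfolding De using cg cm by (simp add: fcoef_add fcoef_sum cont_periodic_sum)
  then have "cmod (fcoef (\<lambda>x. D x (axis i 1)) n) \<le> cmod (fcoef (\<lambda>x. pd i u (x + vser c x)) n)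
     + (\<Sum>a\<in>UNIV. cmod (fcoef (\<lambda>x. pd a u (x + vser c x) * fser (dcoef c i a) x) n))"
    by (simp only:) (intro order_trans[OF norm_triangle_ineq] add_left_mono norm_sum)
  also have "\<dots> \<le> X + (\<Sum>a\<in>(UNIV :: 'n set). Y)"
    by (intro add_mono X sum_mono fcoef_mult_le[OF cg dcoef_summable] Y)
  finally have 1: "cmod (fcoef (\<lambda>x. D x (axis i 1)) n) \<le> X + CARD('n) * Y" by simp
  have "fcoef (\<lambda>x. D x (axis i 1)) n = 2 * pi * \<i> * of_int (n $ i) * fcoef (\<lambda>x. u (x + vser c x)) n"
    by (rule fcoef_deriv[OF cont_periodic_comp_vser[OF u(2)] cD d])
  then have "2 * pi * (\<bar>of_int (n $ i)\<bar> * cmod (fcoef (\<lambda>x. u (x + vser c x)) n)) \<le> X + CARD('n) * Y"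
    using 1 by (simp add: norm_mult mult_ac)
  moreover have "1 * (\<bar>of_int (n $ i)\<bar> * cmod (fcoef (\<lambda>x. u (x + vser c x)) n)) \<le> 2 * pi * (\<bar>of_int (n $ i)\<bar> * cmod (fcoef (\<lambda>x. u (x + vser c x)) n))"
    using pi_gt3 by (intro mult_right_mono) auto
  ultimately show ?thesis by simp
qed

end

lemma wt_mult_le:
  fixes z B :: real
  assumes "\<And>i. \<bar>of_int (n $ i)\<bar> * z \<le> B" "z \<le> B" "0 \<le> z"
  shows "wt (n :: int ^ 'n) * z \<le> (1 + CARD('n)) * B"
proof -
  have "wt n * z \<le> (1 + (\<Sum>i\<in>UNIV. \<bar>of_int (n $ i)\<bar>)) * z"
    using wt_le_sum_abs assms(3) by (intro mult_right_mono)
  also have "\<dots> = z + (\<Sum>i\<in>UNIV. \<bar>of_int (n $ i)\<bar> * z)" by (simp add: ring_distribs sum_distrib_right)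
  also have "\<dots> \<le> B + (\<Sum>i\<in>(UNIV :: 'n set). B)" by (intro add_mono sum_mono assms)
  finally show ?thesis by (simp add: algebra_simps)
qed

text \<open>Each order of decay is bought with one derivative of \<open>u\<close>. The derivatives
  of \<open>vser c\<close> decay with order \<open>s - 1\<close>, so \<open>wt_convolution\<close>
  carries the induction up to order \<open>s\<close>. The bound is linear in \<kappa>, and its
  constant is the same for all \<open>c\<close> in the ball of radius \<open>K\<close>.\<close>

lemma fcoef_comp_le:
  fixes S K :: real and s r :: nat
  assumes S: "1 \<le> S" "\<And>E :: (int ^ 'n) set. finite E \<Longrightarrow> (\<Sum>n\<in>E. 1 / wt n ^ (2 * CARD('n))) \<le> S"
    and s: "2 * CARD('n) + 2 \<le> s" and K: "0 \<le> K"
  shows "r \<le> s \<Longrightarrow> \<exists>C\<ge>0. \<forall>(c :: int ^ 'n \<Rightarrow> complex ^ 'n) (u :: real ^ 'n \<Rightarrow> complex) \<kappa> n. decay s K c \<longrightarrow> CB r \<kappa> u \<longrightarrow> cont_periodic u \<longrightarrow>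
     cmod (fcoef (\<lambda>x. u (x + vser c x)) n) \<le> C * \<kappa> / wt n ^ r"
proof (induction r)
  case 0
  show ?case
  proof (intro exI[of _ 1] conjI allI impI)
    fix c :: "int ^ 'n \<Rightarrow> complex ^ 'n" and u :: "real ^ 'n \<Rightarrow> complex" and \<kappa> n
    assume c: "decay s K c" and u: "CB 0 \<kappa> u" "cont_periodic u"
    show "cmod (fcoef (\<lambda>x. u (x + vser c x)) n) \<le> 1 * \<kappa> / wt n ^ 0"
      using norm_fcoef_le[OF cont_periodic_comp_vser[OF S c s u(2)], of \<kappa> n] CB_bound[OF u(1)] by simp
  qed simp
next
  case (Suc r)
  then obtain C where C: "0 \<le> C" "\<And>(c :: int ^ 'n \<Rightarrow> complex ^ 'n) (u :: real ^ 'n \<Rightarrow> complex) \<kappa> n. decay s K c \<Longrightarrow> CB r \<kappa> u \<Longrightarrow> cont_periodic u \<Longrightarrow>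
     cmod (fcoef (\<lambda>x. u (x + vser c x)) n) \<le> C * \<kappa> / wt n ^ r" by auto
  define Z where "Z = 1 + CARD('n) * (2 * pi * K * (2 ^ r * 3 * S))"
  have Z: "1 \<le> Z" using K S by (simp add: Z_def)
  show ?case
  proof (intro exI[of _ "(1 + CARD('n)) * (C * Z)"] conjI allI impI)
    show "0 \<le> (1 + CARD('n)) * (C * Z)" using C Z by simp
    fix c :: "int ^ 'n \<Rightarrow> complex ^ 'n" and u :: "real ^ 'n \<Rightarrow> complex" and \<kappa> n
    assume c: "decay s K c" and u: "CB (Suc r) \<kappa> u" "cont_periodic u"
    have \<kappa>: "0 \<le> \<kappa>" using CB_nonneg[OF u(1)] .
    have cpd: "cont_periodic (pd a u)" for a
      using periodic_pd[of u] u by (auto simp: cont_periodic_def intro: CB_continuous[OF CB_pd[OF u(1)]])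
    have pdle: "cmod (fcoef (\<lambda>x. pd a u (x + vser c x)) k) \<le> C * \<kappa> / wt k ^ r" for a k
      by (intro C(2) c CB_pd[OF u(1)] cpd)
    have Y: "(\<Sum>l\<in>E. cmod (fcoef (\<lambda>x. pd a u (x + vser c x)) (n - l)) * cmod (dcoef c i a l))
       \<le> C * \<kappa> * (2 * pi * K * (2 ^ r * 3 * S)) / wt n ^ r" if E: "finite E" for a i E
    proof -
      have "(\<Sum>l\<in>E. cmod (fcoef (\<lambda>x. pd a u (x + vser c x)) (n - l)) * cmod (dcoef c i a l))
        \<le> (\<Sum>l\<in>E. (C * \<kappa> / wt (n - l) ^ r) * (2 * pi * K / wt l ^ (s - 1)))"
        by (intro sum_mono mult_mono pdle dcoef_le[OF S c s]) (use C \<kappa> in auto)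
      also have "\<dots> = C * \<kappa> * (2 * pi * K) * (\<Sum>l\<in>E. 1 / wt (n - l) ^ r * (1 / wt l ^ (s - 1)))"
        by (simp add: sum_distrib_left)
      also have "\<dots> \<le> C * \<kappa> * (2 * pi * K) * (2 ^ r * 3 * S / wt n ^ r)"
      proof (intro mult_left_mono wt_convolution E)
        show "(\<Sum>n\<in>E'. 1 / wt n ^ (s - 1)) \<le> S" if "finite E'" for E' :: "(int ^ 'n) set"
          using that s by (intro wt_sum_le[OF S c s]) auto
        show "r \<le> s - 1" using Suc.prems by simp
      qed (use C \<kappa> K in auto)
      finally show ?thesis by (simp add: mult_ac)
    qed
    define B where "B = C * \<kappa> * Z / wt n ^ r"
    have "\<bar>of_int (n $ i)\<bar> * cmod (fcoef (\<lambda>x. u (x + vser c x)) n) \<le> B" for i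
    proof -
      have "\<bar>of_int (n $ i)\<bar> * cmod (fcoef (\<lambda>x. u (x + vser c x)) n)
        \<le> C * \<kappa> / wt n ^ r + CARD('n) * (C * \<kappa> * (2 * pi * K * (2 ^ r * 3 * S)) / wt n ^ r)"
        by (rule fcoef_comp_deriv_le[OF S c s u pdle Y])
      also have "\<dots> = B" by (simp add: B_def Z_def field_simps)
      finally show ?thesis .
    qed
    moreover have "cmod (fcoef (\<lambda>x. u (x + vser c x)) n) \<le> B"
    proof -
      have "cmod (fcoef (\<lambda>x. u (x + vser c x)) n) \<le> C * \<kappa> / wt n ^ r"
        by (rule C(2)[OF c CB_Suc_D[OF u(1)] u(2)])
      also have "\<dots> \<le> C * \<kappa> * Z / wt n ^ r"
        using mult_left_mono[OF Z mult_nonneg_nonneg[OF C(1) \<kappa>]] by (intro divide_right_mono) auto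
      finally show ?thesis by (simp add: B_def)
    qed
    ultimately have "wt n * cmod (fcoef (\<lambda>x. u (x + vser c x)) n) \<le> (1 + CARD('n)) * B"
      by (intro wt_mult_le) auto
    then show "cmod (fcoef (\<lambda>x. u (x + vser c x)) n) \<le> (1 + CARD('n)) * (C * Z) * \<kappa> / wt n ^ Suc r"
      by (simp add: B_def field_simps)
  qed
qed

text \<open>The top order term only sees the small \<open>C\<close>-norm \<open>\<kappa>\<close> of \<open>u\<close>; this is what makes the
  regularity bootstrap work without further smallness.\<close>

lemma fcoef_comp_tame:
  assumes S: "1 \<le> S" "\<And>E :: (int ^ 'n) set. finite E \<Longrightarrow> (\<Sum>n\<in>E. 1 / wt n ^ (2 * CARD('n))) \<le> S"
  shows "\<exists>c0\<ge>0. \<forall>s\<ge>2 * CARD('n) + 2. \<forall>K\<ge>0. \<forall>K'\<ge>0. \<exists>C\<ge>0. \<forall>(c :: int ^ 'n \<Rightarrow> complex ^ 'n) (u :: real ^ 'n \<Rightarrow> complex) \<kappa> X n.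
     decay (2 * CARD('n) + 2) 1 c \<longrightarrow> decay s K c \<longrightarrow> decay (Suc s) X c \<longrightarrow> CB (2 * CARD('n) + 2) \<kappa> u \<longrightarrow> CB (Suc s) K' u \<longrightarrow> cont_periodic u \<longrightarrow>
     cmod (fcoef (\<lambda>x. u (x + vser c x)) n) \<le> (C + c0 * \<kappa> * X) / wt n ^ Suc s"
proof -
  define s0 where "s0 = 2 * CARD('n) + 2"
  have s0: "2 * CARD('n) + 2 \<le> s0" by (simp add: s0_def)
  obtain C1 where C1: "0 \<le> C1" "\<And>(c :: int ^ 'n \<Rightarrow> complex ^ 'n) (u :: real ^ 'n \<Rightarrow> complex) \<kappa> n. decay s0 1 c \<Longrightarrow> CB (2 * CARD('n)) \<kappa> u \<Longrightarrow> cont_periodic u \<Longrightarrow>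
     cmod (fcoef (\<lambda>x. u (x + vser c x)) n) \<le> C1 * \<kappa> / wt n ^ (2 * CARD('n))"
    using fcoef_comp_le[OF S s0, of 1 "2 * CARD('n)"] by (auto simp: s0_def)
  \<comment> \<open>Only \<open>C1\<close> and \<open>S\<close> enter, both fixed at the base order;
    whatever depends on \<open>s\<close>, \<open>K\<close> or \<open>K'\<close> goes into
    \<open>C\<close>.\<close>
  define c0 where "c0 = (1 + CARD('n)) * (CARD('n) * (4 * pi * C1 * S))"
  have c0: "0 \<le> c0" using C1 S by (simp add: c0_def)
  show ?thesis
  proof (rule exI[of _ c0], intro conjI c0 allI impI)
    fix s and K K' :: real assume s: "2 * CARD('n) + 2 \<le> s" and K: "0 \<le> K" and K': "0 \<le> K'"
    obtain CA where CA: "0 \<le> CA" "\<And>(c :: int ^ 'n \<Rightarrow> complex ^ 'n) (u :: real ^ 'n \<Rightarrow> complex) \<kappa> n. decay s K c \<Longrightarrow> CB s \<kappa> u \<Longrightarrow> cont_periodic u \<Longrightarrow>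
       cmod (fcoef (\<lambda>x. u (x + vser c x)) n) \<le> CA * \<kappa> / wt n ^ s"
      using fcoef_comp_le[OF S s K, of s] by auto
    have "0 < s" using s by simp
    then obtain Cs where Cs: "0 \<le> Cs" "\<And>x y :: real. 0 \<le> x \<Longrightarrow> 0 \<le> y \<Longrightarrow> (x + y) ^ s \<le> 2 * x ^ s + Cs * y ^ s"
      by (rule power_add_le_absorb) blast
    define Y1 where "Y1 = Cs * (CA * K') * (2 * pi * S)"
    have Y1: "0 \<le> Y1" using Cs CA K' S by (simp add: Y1_def)
    define C where "C = (1 + CARD('n)) * (CA * K' + CARD('n) * Y1)"
    have C: "0 \<le> C" using CA K' Y1 by (simp add: C_def)
    show "\<exists>C\<ge>0. \<forall>(c :: int ^ 'n \<Rightarrow> complex ^ 'n) (u :: real ^ 'n \<Rightarrow> complex) \<kappa> X n.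
       decay (2 * CARD('n) + 2) 1 c \<longrightarrow> decay s K c \<longrightarrow> decay (Suc s) X c \<longrightarrow> CB (2 * CARD('n) + 2) \<kappa> u \<longrightarrow> CB (Suc s) K' u \<longrightarrow> cont_periodic u \<longrightarrow>
       cmod (fcoef (\<lambda>x. u (x + vser c x)) n) \<le> (C + c0 * \<kappa> * X) / wt n ^ Suc s"
    proof (intro exI[of _ C] conjI C allI impI)
      fix c :: "int ^ 'n \<Rightarrow> complex ^ 'n" and u :: "real ^ 'n \<Rightarrow> complex" and \<kappa> X and n :: "int ^ 'n"
      assume c: "decay (2 * CARD('n) + 2) 1 c" "decay s K c" "decay (Suc s) X c"
        and u: "CB (2 * CARD('n) + 2) \<kappa> u" "CB (Suc s) K' u" "cont_periodic u"
      have c1: "decay s0 1 c" using c(1) by (simp add: s0_def)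
      have \<kappa>: "0 \<le> \<kappa>" and X: "0 \<le> X" using CB_nonneg[OF u(1)] decay_nonneg[OF c(3)] by auto
      have cpd: "cont_periodic (pd a u)" for a
        using periodic_pd[of u] u by (auto simp: cont_periodic_def intro: CB_continuous[OF CB_pd[OF u(2)]])
      define U where "U a k = cmod (fcoef (\<lambda>x. pd a u (x + vser c x)) k)" for a k
      have U0: "0 \<le> U a k" for a k by (simp add: U_def)
      have UA: "U a k \<le> CA * K' / wt k ^ s" for a k
        unfolding U_def by (intro CA(2) c CB_pd[OF u(2)] cpd)
      have U1: "U a k \<le> C1 * \<kappa> * (1 / wt k ^ (2 * CARD('n)))" for a k
      proof -
        have "CB (Suc (2 * CARD('n))) \<kappa> u" by (rule CB_le[OF u(1)]) simp
        then show ?thesis unfolding U_def using C1(2)[OF c1 CB_pd cpd] by simp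
      qed
      have dc1: "cmod (dcoef c i a l) \<le> 2 * pi * (1 / wt l ^ (s0 - 1))" for i a l
        using dcoef_le[OF S c1 s0] by simp
      have dcX: "wt l ^ s * cmod (dcoef c i a l) \<le> 2 * pi * X" for i a l
        using cmod_dcoef_le[OF c(3), of i a l] by (simp add: pos_le_divide_eq mult.commute)
      define Y where "Y = (4 * pi * C1 * S * \<kappa> * X + Y1) / wt n ^ s"
      have Y: "(\<Sum>l\<in>E. U a (n - l) * cmod (dcoef c i a l)) \<le> Y" if E: "finite E" for a i and E :: "(int ^ 'n) set"
      proof -
        have "wt n ^ s * (\<Sum>l\<in>E. U a (n - l) * cmod (dcoef c i a l))
          \<le> (\<Sum>l\<in>E. 2 * (2 * pi * X) * (C1 * \<kappa> * (1 / wt (n - l) ^ (2 * CARD('n)))) + Cs * (CA * K') * (2 * pi * (1 / wt l ^ (s0 - 1))))"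
          unfolding sum_distrib_left
        proof (intro sum_mono)
          fix l
          \<comment> \<open>The weight is shared between the two frequencies. On the derivative of
            \<open>vser c\<close> it is paid with \<open>X\<close> against low order coefficients of
            size \<kappa>; on the coefficients of \<open>u\<close> it meets only constants from the
            previous order. The absorbing inequality keeps the factor of the first part at 2 for
            every \<open>s\<close>.\<close>
          have "wt n ^ s \<le> (wt l + wt (n - l)) ^ s"
            using wt_triangle[of n l] by (intro power_mono) auto
          also have "\<dots> \<le> 2 * wt l ^ s + Cs * wt (n - l) ^ s" by (intro Cs(2)) auto
          finally have "wt n ^ s * (U a (n - l) * cmod (dcoef c i a l))
             \<le> (2 * wt l ^ s + Cs * wt (n - l) ^ s) * (U a (n - l) * cmod (dcoef c i a l))"
            using U0 by (intro mult_right_mono) auto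
          also have "\<dots> = 2 * (wt l ^ s * cmod (dcoef c i a l)) * U a (n - l) + Cs * (wt (n - l) ^ s * U a (n - l)) * cmod (dcoef c i a l)"
            by (simp add: algebra_simps)
          also have "\<dots> \<le> 2 * (2 * pi * X) * (C1 * \<kappa> * (1 / wt (n - l) ^ (2 * CARD('n)))) + Cs * (CA * K') * (2 * pi * (1 / wt l ^ (s0 - 1)))"
          proof (rule add_mono)
            have h: "wt (n - l) ^ s * U a (n - l) \<le> CA * K'"
              using UA[of a "n - l"] by (simp add: pos_le_divide_eq mult.commute)
            show "2 * (wt l ^ s * cmod (dcoef c i a l)) * U a (n - l) \<le> 2 * (2 * pi * X) * (C1 * \<kappa> * (1 / wt (n - l) ^ (2 * CARD('n))))"
              by (rule mult_mono[OF mult_left_mono[OF dcX] U1]) (use X U0 in auto)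
            show "Cs * (wt (n - l) ^ s * U a (n - l)) * cmod (dcoef c i a l) \<le> Cs * (CA * K') * (2 * pi * (1 / wt l ^ (s0 - 1)))"
              by (rule mult_mono[OF mult_left_mono[OF h Cs(1)] dc1]) (use Cs CA K' in auto)
          qed
          finally show "wt n ^ s * (U a (n - l) * cmod (dcoef c i a l)) \<le> \<dots>" .
        qed
        also have "\<dots> = 4 * pi * X * C1 * \<kappa> * (\<Sum>l\<in>E. 1 / wt (n - l) ^ (2 * CARD('n))) + Cs * (CA * K') * (2 * pi) * (\<Sum>l\<in>E. 1 / wt l ^ (s0 - 1))"
          by (simp add: sum.distrib sum_distrib_left mult_ac)
        also have "\<dots> \<le> 4 * pi * X * C1 * \<kappa> * S + Cs * (CA * K') * (2 * pi) * S"
        proof (rule add_mono)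
          show "4 * pi * X * C1 * \<kappa> * (\<Sum>l\<in>E. 1 / wt (n - l) ^ (2 * CARD('n))) \<le> 4 * pi * X * C1 * \<kappa> * S"
            by (rule mult_left_mono[OF wt_sum_shift[OF S(2) E]]) (use X C1 \<kappa> in auto)
          have "2 * CARD('n) \<le> s0 - 1" using s0 by linarith
          then have "(\<Sum>l\<in>E. 1 / wt l ^ (s0 - 1)) \<le> S" using wt_sum_le[OF S c1 s0, of "s0 - 1" E] E by blast
          then show "Cs * (CA * K') * (2 * pi) * (\<Sum>l\<in>E. 1 / wt l ^ (s0 - 1)) \<le> Cs * (CA * K') * (2 * pi) * S"
            by (rule mult_left_mono) (use Cs CA K' in auto)
        qed
        also have "\<dots> = 4 * pi * C1 * S * \<kappa> * X + Y1" by (simp add: Y1_def)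
        finally show ?thesis unfolding Y_def by (simp add: pos_le_divide_eq mult.commute)
      qed
      define B where "B = CA * K' / wt n ^ s + CARD('n) * Y"
      have Y0: "0 \<le> Y" using C1 S \<kappa> X Y1 by (simp add: Y_def)
      have "\<bar>of_int (n $ i)\<bar> * cmod (fcoef (\<lambda>x. u (x + vser c x)) n) \<le> B" for i
        unfolding B_def by (rule fcoef_comp_deriv_le[OF S c1 s0 u(2,3) UA[unfolded U_def] Y[unfolded U_def]])
      moreover have "cmod (fcoef (\<lambda>x. u (x + vser c x)) n) \<le> B"
        using CA(2)[OF c(2) CB_Suc_D[OF u(2)] u(3), of n] Y0 by (simp add: B_def add_increasing2)
      ultimately have "wt n * cmod (fcoef (\<lambda>x. u (x + vser c x)) n) \<le> (1 + CARD('n)) * B"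
        by (intro wt_mult_le) auto
      also have "\<dots> = (C + c0 * \<kappa> * X) / wt n ^ s"
        by (simp add: B_def Y_def C_def c0_def add_divide_distrib algebra_simps)
      finally show "cmod (fcoef (\<lambda>x. u (x + vser c x)) n) \<le> (C + c0 * \<kappa> * X) / wt n ^ Suc s"
        by (simp add: field_simps)
    qed
  qed
qed

subsection \<open>Vector-valued Fourier coefficients\<close>

abbreviation cmat :: "real ^ 'n ^ 'm \<Rightarrow> complex ^ 'n ^ 'm" where
  "cmat \<equiv> map_matrix complex_of_real"

definition vfcoef :: "(real ^ 'n \<Rightarrow> real ^ 'n) \<Rightarrow> int ^ 'n \<Rightarrow> complex ^ 'n" where
  "vfcoef v n = (\<chi> a. fcoef (\<lambda>x. complex_of_real (v x $ a)) n)"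

definition vmean_sq :: "(real ^ 'n \<Rightarrow> real ^ 'n) \<Rightarrow> real" where
  "vmean_sq v = (\<Sum>a\<in>UNIV. mean_sq (\<lambda>x. complex_of_real (v x $ a)))"

lemma cont_periodic_comp_nth: "cont_periodic v \<Longrightarrow> cont_periodic (\<lambda>x. complex_of_real (v x $ a))"
  by (rule cont_periodic_compose) (auto intro!: continuous_intros)

lemma cmat_mult: "cmat (P ** Q) = cmat P ** cmat Q"
  by (simp add: vec_eq_iff matrix_matrix_mult_def map_matrix_def)

lemma cmat_sum: "cmat (\<Sum>i\<in>I. P i) = (\<Sum>i\<in>I. cmat (P i))"
  by (induction I rule: infinite_finite_induct) (auto simp: vec_eq_iff map_matrix_def)

lemma cmat_mat1 [simp]: "cmat (mat 1) = mat 1"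
  by (simp add: vec_eq_iff mat_def map_matrix_def)

lemma cmat_bound:
  fixes P :: "real ^ 'n ^ 'm"
  obtains b where "0 \<le> b" "\<And>z. norm (cmat P *v z) \<le> b * norm z"
  using bounded_linear.nonneg_bounded[OF matrix_vector_mul_bounded_linear[of "cmat P"]]
  by (metis mult.commute)

lemma norm_sq_vec: "(norm (z :: complex ^ 'n))\<^sup>2 = (\<Sum>a\<in>UNIV. (cmod (z $ a))\<^sup>2)"
  unfolding norm_vec_def L2_set_def by (simp add: sum_nonneg)

lemma norm_sq_rvec: "(norm (z :: real ^ 'n))\<^sup>2 = (\<Sum>a\<in>UNIV. (z $ a)\<^sup>2)"
  unfolding norm_vec_def L2_set_def by (simp add: sum_nonneg)

lemma vfcoef_diff: "cont_periodic v \<Longrightarrow> cont_periodic w \<Longrightarrow> vfcoef (\<lambda>x. v x - w x) n = vfcoef v n - vfcoef w n"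
  by (simp add: vfcoef_def vec_eq_iff fcoef_diff cont_periodic_comp_nth)

lemma vfcoef_add: "cont_periodic v \<Longrightarrow> cont_periodic w \<Longrightarrow> vfcoef (\<lambda>x. v x + w x) n = vfcoef v n + vfcoef w n"
  by (simp add: vfcoef_def vec_eq_iff fcoef_add cont_periodic_comp_nth)

lemma vfcoef_matrix: "cont_periodic v \<Longrightarrow> vfcoef (\<lambda>x. P *v v x) n = cmat P *v vfcoef v n"
proof -
  assume v: "cont_periodic v"
  have "fcoef (\<lambda>x. complex_of_real ((P *v v x) $ a)) n = (\<Sum>b\<in>UNIV. of_real (P $ a $ b) * fcoef (\<lambda>x. complex_of_real (v x $ b)) n)" for a
  proof -
    have "fcoef (\<lambda>x. complex_of_real ((P *v v x) $ a)) n = fcoef (\<lambda>x. \<Sum>b\<in>UNIV. of_real (P $ a $ b) * complex_of_real (v x $ b)) n"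
      by (simp add: matrix_vector_mult_def)
    also have "\<dots> = (\<Sum>b\<in>UNIV. of_real (P $ a $ b) * fcoef (\<lambda>x. complex_of_real (v x $ b)) n)"
      by (simp add: fcoef_sum fcoef_cmult cont_periodic_mult cont_periodic_comp_nth[OF v])
    finally show ?thesis .
  qed
  then show ?thesis by (simp add: vfcoef_def vec_eq_iff matrix_vector_mult_def map_matrix_def)
qed

lemma vfcoef_linear:
  assumes "cont_periodic v" "\<And>m. transpose B *v m = n \<longleftrightarrow> m = n'"
  shows "vfcoef (\<lambda>x. v (rmat B *v x)) n = vfcoef v n'"
  using fcoef_linear[OF cont_periodic_comp_nth[OF assms(1)] assms(2)] by (simp add: vfcoef_def vec_eq_iff)

lemma csym_vfcoef: "cont_periodic v \<Longrightarrow> csym (\<lambda>n. vfcoef v n $ a)"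
  by (simp add: csym_def vfcoef_def fcoef_minus cont_periodic_comp_nth)

lemma vbessel:
  assumes "cont_periodic v" "finite E" shows "(\<Sum>n\<in>E. (norm (vfcoef v n))\<^sup>2) \<le> vmean_sq v"
proof -
  have "(\<Sum>n\<in>E. (norm (vfcoef v n))\<^sup>2) = (\<Sum>a\<in>UNIV. \<Sum>n\<in>E. (cmod (fcoef (\<lambda>x. complex_of_real (v x $ a)) n))\<^sup>2)"
    unfolding norm_sq_vec vfcoef_def by (subst sum.swap) simp
  also have "\<dots> \<le> vmean_sq v"
    unfolding vmean_sq_def by (intro sum_mono bessel assms cont_periodic_comp_nth)
  finally show ?thesis .
qed

lemma vparseval:
  fixes v :: "real ^ 'n \<Rightarrow> real ^ 'n" and C :: real
  assumes "cont_periodic v" "\<And>E. finite E \<Longrightarrow> (\<Sum>n\<in>E. (norm (vfcoef v n))\<^sup>2) \<le> C"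
  shows "vmean_sq v \<le> CARD('n) * C"
proof -
  have "mean_sq (\<lambda>x. complex_of_real (v x $ a)) \<le> C" for a
  proof (rule parseval_le[OF cont_periodic_comp_nth[OF assms(1)]])
    fix E :: "(int ^ 'n) set" assume E: "finite E"
    have "(\<Sum>n\<in>E. (cmod (fcoef (\<lambda>x. complex_of_real (v x $ a)) n))\<^sup>2) \<le> (\<Sum>n\<in>E. (norm (vfcoef v n))\<^sup>2)"
      using Finite_Cartesian_Product.norm_nth_le[of "vfcoef v _" a] by (intro sum_mono power_mono) (auto simp: vfcoef_def)
    then show "(\<Sum>n\<in>E. (cmod (fcoef (\<lambda>x. complex_of_real (v x $ a)) n))\<^sup>2) \<le> C" using assms(2)[OF E] by linarith
  qed
  then have "vmean_sq v \<le> (\<Sum>a\<in>(UNIV :: 'n set). C)" unfolding vmean_sq_def by (intro sum_mono)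
  then show ?thesis by simp
qed

lemma vmean_sq_mono:
  assumes "cont_periodic v" "cont_periodic w" "\<And>x. norm (v x) \<le> norm (w x)"
  shows "vmean_sq v \<le> vmean_sq w"
proof -
  have e: "vmean_sq u = tmean (\<lambda>x. (norm (u x))\<^sup>2)" if "cont_periodic u" for u :: "real ^ 'n \<Rightarrow> real ^ 'n"
  proof -
    have "cont_periodic (\<lambda>x. (cmod (complex_of_real (u x $ a)))\<^sup>2)" for a by (intro cont_periodic_cmod_sq cont_periodic_comp_nth that)
    then show ?thesis by (simp add: vmean_sq_def mean_sq_def norm_sq_rvec tmean_sum)
  qed
  have "cont_periodic (\<lambda>x. (norm (u x))\<^sup>2)" if "cont_periodic u" for u :: "real ^ 'n \<Rightarrow> real ^ 'n"
    using that by (rule cont_periodic_compose) (auto intro!: continuous_intros)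
  then have "tmean (\<lambda>x. (norm (v x))\<^sup>2) \<le> tmean (\<lambda>x. (norm (w x))\<^sup>2)"
    using assms by (intro tmean_mono power_mono) auto
  then show ?thesis using assms by (simp add: e)
qed

lemma vmean_sq_nonneg: "0 \<le> vmean_sq v"
  unfolding vmean_sq_def by (intro sum_nonneg mean_sq_nonneg)

lemma vfcoef_vser:
  assumes S: "1 \<le> S" "\<And>E :: (int ^ 'n) set. finite E \<Longrightarrow> (\<Sum>n\<in>E. 1 / wt n ^ (2 * CARD('n))) \<le> S"
    and c: "decay s K (c :: int ^ 'n \<Rightarrow> complex ^ 'n)" and s: "2 * CARD('n) + 2 \<le> s"
  shows "vfcoef (vser c) n = c n"
  by (simp add: vfcoef_def vser_def vec_eq_iff fser_of_real_Re csym_c[OF S c s] fcoef_fser coef_summable[OF S c s])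

subsection \<open>Shears\<close>

text \<open>For \<open>N ** N = 0\<close> this is the \<open>t\<close>-th power of
  \<open>1 + N\<close>, also for negative \<open>t\<close>.\<close>

definition shear :: "int \<Rightarrow> int ^ 'n ^ 'n \<Rightarrow> int ^ 'n ^ 'n" where
  "shear t N = mat 1 + (\<chi> a b. t * N $ a $ b)"

lemma shear_mult: "shear t N *v m = m + t *s (N *v m)"
proof -
  have "(\<chi> a b. t * N $ a $ b) *v m = t *s (N *v m)"
    by (simp add: vec_eq_iff matrix_vector_mult_def sum_distrib_left mult.assoc)
  then show ?thesis by (simp add: shear_def matrix_vector_mult_add_rdistrib)
qed

lemma rmat_shear: "rmat (shear t N) *v x = x + of_int t *\<^sub>R (rmat N *v x)"
proof -
  have "rmat (shear t N) = mat 1 + (\<chi> a b. of_int t * real_of_int (N $ a $ b))"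
    by (simp add: shear_def vec_eq_iff map_matrix_def mat_def)
  moreover have "(\<chi> a b. of_int t * real_of_int (N $ a $ b)) *v x = of_int t *\<^sub>R (rmat N *v x)"
    by (simp add: vec_eq_iff matrix_vector_mult_def sum_distrib_left mult.assoc map_matrix_def)
  ultimately show ?thesis by (simp add: matrix_vector_mult_add_rdistrib)
qed

lemma cmat_shear: "cmat (rmat (shear t N)) *v z = z + of_int t *\<^sub>R (cmat (rmat N) *v z)"
proof -
  have "cmat (rmat (shear t N)) = mat 1 + (\<chi> a b. of_int t * complex_of_int (N $ a $ b))"
    by (simp add: shear_def vec_eq_iff map_matrix_def mat_def)
  moreover have "(\<chi> a b. of_int t * complex_of_int (N $ a $ b)) *v z = of_int t *\<^sub>R (cmat (rmat N) *v z)"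
    by (simp add: vec_eq_iff matrix_vector_mult_def sum_distrib_left mult.assoc map_matrix_def)
      (simp add: scaleR_conv_of_real sum_distrib_left)
  ultimately show ?thesis by (simp add: matrix_vector_mult_add_rdistrib)
qed

lemma shear_inverse:
  assumes "N ** N = 0" shows "shear t N *v (shear (- t) N *v m) = m"
proof -
  have "N *v (N *v m) = 0" using assms by (simp add: matrix_vector_mul_assoc)
  moreover have "N *v (m + (- t) *s (N *v m)) = N *v m + (- t) *s (N *v (N *v m))"
    by (simp add: vec_eq_iff matrix_vector_mult_def sum_distrib_left sum.distrib sum_subtractf algebra_simps)
  ultimately show ?thesis by (simp add: shear_mult vec_eq_iff)
qed

text \<open>The frequency which composition with \<open>shear t N\<close> carries to
  \<open>n\<close>, provided that \<open>N ** N = 0\<close>.\<close>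

definition shear_target :: "int \<Rightarrow> int ^ 'n ^ 'n \<Rightarrow> int ^ 'n \<Rightarrow> int ^ 'n" where
  "shear_target t N n = shear (- t) (transpose N) *v n"

lemma shear_target_iff:
  assumes "N ** N = (0 :: int ^ 'n ^ 'n)"
  shows "transpose (shear t N) *v m = n \<longleftrightarrow> m = shear_target t N n"
proof -
  have "transpose (shear t N) = shear t (transpose N)"
    by (simp add: shear_def vec_eq_iff transpose_def mat_def)
  moreover have "transpose N ** transpose N = 0"
  proof -
    have "transpose N ** transpose N = transpose (N ** N)" by (simp add: matrix_transpose_mul)
    then show ?thesis using assms by (simp add: transpose_def vec_eq_iff)
  qed
  ultimately show ?thesis
    using shear_inverse[of "transpose N" t n] shear_inverse[of "transpose N" "- t" m] by (auto simp: shear_target_def)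
qed

lemma shear_target_inj: "N ** N = (0 :: int ^ 'n ^ 'n) \<Longrightarrow> inj_on (shear_target t N) E"
  by (rule inj_onI) (metis shear_target_iff)

lemma shear_target_minus: "shear_target t N (- n) = - shear_target t N n"
  by (simp add: shear_target_def shear_mult vec_eq_iff matrix_vector_mult_def sum_negf)

text \<open>By the parallelogram law one of the two shears does not shorten a given frequency.\<close>

lemma wt_shear_target: "wt n \<le> wt (shear_target t N n) \<or> wt n \<le> wt (shear_target (- t) N n)"
proof -
  define x where "x = lat n"
  define y where "y = of_int t *\<^sub>R lat (transpose N *v n)"
  have l: "lat (shear_target t N n) = x - y" "lat (shear_target (- t) N n) = x + y"
    by (simp_all add: shear_target_def shear_mult x_def y_def vec_eq_iff)
  have "(norm (x - y))\<^sup>2 + (norm (x + y))\<^sup>2 = 2 * (norm x)\<^sup>2 + 2 * (norm y)\<^sup>2"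
    by (simp add: power2_norm_eq_inner algebra_simps inner_commute)
  then have "(norm x)\<^sup>2 \<le> (norm (x - y))\<^sup>2 \<or> (norm x)\<^sup>2 \<le> (norm (x + y))\<^sup>2"
    using zero_le_power2[of "norm y"] by linarith
  then show ?thesis by (auto simp: wt_def l x_def[symmetric] dest: power2_le_imp_le)
qed

definition vcnj :: "complex ^ 'n \<Rightarrow> complex ^ 'n" where
  "vcnj z = (\<chi> a. cnj (z $ a))"

lemma csym_vec: "(\<forall>a. csym (\<lambda>n. c n $ a)) \<longleftrightarrow> (\<forall>n. c (- n) = vcnj (c n))"
  by (auto simp: csym_def vcnj_def vec_eq_iff)

lemma vcnj_simps: "vcnj (y + z) = vcnj y + vcnj z" "vcnj (y - z) = vcnj y - vcnj z" "vcnj (r *\<^sub>R z) = r *\<^sub>R vcnj z"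
  "vcnj (cmat P *v z) = cmat P *v vcnj z" "vcnj 0 = 0"
  by (simp_all add: vcnj_def vec_eq_iff matrix_vector_mult_def map_matrix_def)

lemma vcnj_sum: "vcnj (\<Sum>i\<in>I. z i) = (\<Sum>i\<in>I. vcnj (z i))"
  by (induction I rule: infinite_finite_induct) (auto simp: vcnj_simps)

subsection \<open>Regularity of the conjugacy\<close>

context
  fixes I :: "'i set" and Nm :: "'i \<Rightarrow> int ^ 'n ^ 'n" and M :: "'i \<Rightarrow> real ^ 'n ^ 'n" and k :: nat and \<mu> q :: real
  assumes I: "finite I" and k: "0 < k"
    and N2: "\<And>i. i \<in> I \<Longrightarrow> Nm i ** Nm i = 0"
    and M: "(\<Sum>i\<in>I. M i ** rmat (Nm i)) = mat 1"
    and \<mu>: "0 \<le> \<mu>" "\<And>i z. i \<in> I \<Longrightarrow> norm (cmat (M i) *v z) \<le> \<mu> * norm z"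
    and q: "q = card I * \<mu> / k"
begin

text \<open>The sign of the shear is chosen such that passing to the frequency \<open>step_target\<close> loses no decay.\<close>

definition step_sign :: "'i \<Rightarrow> int ^ 'n \<Rightarrow> int" where
  "step_sign i n = (if wt n \<le> wt (shear_target (int k) (Nm i) n) then 1 else - 1)"

definition step_target :: "'i \<Rightarrow> int ^ 'n \<Rightarrow> int ^ 'n" where
  "step_target i n = shear_target (step_sign i n * int k) (Nm i) n"

text \<open>At frequency \<open>n\<close> the conjugacy equation of the shear with sign
  \<open>s\<close> reads \<open>c m - c n - F n = s * k * (N c n)\<close>, where \<open>m\<close> is
  the target frequency. Dividing by \<open>s * k\<close>, applying \<open>M i\<close> and summing
  recovers \<open>c n\<close>, because the sum of the \<open>M i ** rmat (Nm i)\<close> is the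
  identity. \<open>step\<close> is the resulting right-hand side, with one sign selected for each
  index and frequency.\<close>

definition step :: "(int ^ 'n \<Rightarrow> complex ^ 'n) \<Rightarrow> ('i \<Rightarrow> int \<Rightarrow> int ^ 'n \<Rightarrow> complex ^ 'n) \<Rightarrow> int ^ 'n \<Rightarrow> complex ^ 'n" where
  "step c F n = (\<Sum>i\<in>I. cmat (M i) *v ((1 / (of_int (step_sign i n) * real k)) *\<^sub>R (c (step_target i n) - c n - F i (step_sign i n) n)))"

lemma step_sign_cases: "step_sign i n = 1 \<or> step_sign i n = - 1"
  by (simp add: step_sign_def)

lemma wt_step_target: "wt n \<le> wt (step_target i n)"
  using wt_shear_target[of n "int k" "Nm i"] by (auto simp: step_target_def step_sign_def)

lemma step_norm:
  "norm (step c F n) \<le> \<mu> / k * (\<Sum>i\<in>I. norm (c (step_target i n)) + norm (c n) + norm (F i (step_sign i n) n))"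
  unfolding step_def sum_distrib_left
proof (rule order_trans[OF norm_sum sum_mono])
  fix i assume i: "i \<in> I"
  define d where "d = c (step_target i n) - c n - F i (step_sign i n) n"
  have "norm (cmat (M i) *v ((1 / (of_int (step_sign i n) * real k)) *\<^sub>R d)) \<le> \<mu> * norm ((1 / (of_int (step_sign i n) * real k)) *\<^sub>R d)"
    by (rule \<mu>(2)[OF i])
  also have "\<dots> = \<mu> / k * norm d" using step_sign_cases[of i n] by (auto simp: divide_simps)
  also have "\<dots> \<le> \<mu> / k * (norm (c (step_target i n)) + norm (c n) + norm (F i (step_sign i n) n))"
  proof (rule mult_left_mono)
    show "norm d \<le> norm (c (step_target i n)) + norm (c n) + norm (F i (step_sign i n) n)"
      unfolding d_def using norm_triangle_ineq4[of "c (step_target i n) - c n" "F i (step_sign i n) n"] norm_triangle_ineq4[of "c (step_target i n)" "c n"] by linarith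
  qed (use \<mu> in simp)
  finally show "norm (cmat (M i) *v ((1 / (of_int (step_sign i n) * real k)) *\<^sub>R (c (step_target i n) - c n - F i (step_sign i n) n)))
     \<le> \<mu> / k * (norm (c (step_target i n)) + norm (c n) + norm (F i (step_sign i n) n))" by (simp add: d_def)
qed

text \<open>Target frequencies are no shorter than \<open>n\<close>, so coefficients there obey the
  bound that holds at \<open>n\<close>; no order is lost and the factor \<open>q\<close> is
  gained.\<close>

lemma decay_step:
  assumes c: "decay t X c" and F: "\<And>i s. i \<in> I \<Longrightarrow> s = 1 \<or> s = - 1 \<Longrightarrow> decay t Y (F i s)"
  shows "decay t (q * (2 * X + Y)) (step c F)"
  unfolding decay_def csym_vec
proof (intro conjI allI)
  fix n
  have cn: "c (- m) = vcnj (c m)" for m using c by (simp add: decay_def csym_vec)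
  have Fn: "F i (step_sign i m') (- m) = vcnj (F i (step_sign i m') m)" if "i \<in> I" for i m m'
    using F[OF that step_sign_cases[of i m']] by (simp add: decay_def csym_vec)
  \<comment> \<open>The choice of sign is even in the frequency, which preserves the symmetry of
    real functions.\<close>
  have sgm: "step_sign i (- m) = step_sign i m" for i m by (simp add: step_sign_def shear_target_minus)
  have tgm: "step_target i (- m) = - step_target i m" for i m by (simp add: step_target_def sgm shear_target_minus)
  show "step c F (- n) = vcnj (step c F n)"
    unfolding step_def vcnj_sum by (intro sum.cong refl) (simp add: sgm tgm cn Fn vcnj_simps)
next
  fix n
  have "norm (step c F n) \<le> \<mu> / k * (\<Sum>i\<in>I. norm (c (step_target i n)) + norm (c n) + norm (F i (step_sign i n) n))"
    by (rule step_norm)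
  also have "\<dots> \<le> \<mu> / k * (\<Sum>i\<in>I. X / wt n ^ t + X / wt n ^ t + Y / wt n ^ t)"
  proof (intro mult_left_mono sum_mono add_mono)
    fix i assume i: "i \<in> I"
    have "norm (c (step_target i n)) \<le> X / wt (step_target i n) ^ t" using c by (simp add: decay_def)
    also have "\<dots> \<le> X / wt n ^ t"
      using decay_nonneg[OF c] wt_step_target[of n i] by (intro divide_left_mono power_mono mult_pos_pos) auto
    finally show "norm (c (step_target i n)) \<le> X / wt n ^ t" .
    show "norm (c n) \<le> X / wt n ^ t" using c by (simp add: decay_def)
    show "norm (F i (step_sign i n) n) \<le> Y / wt n ^ t" using F[OF i step_sign_cases[of i n]] by (simp add: decay_def)
  qed (use \<mu> in simp)
  also have "\<dots> = q * (2 * X + Y) / wt n ^ t"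
    by (simp add: q field_simps)
  finally show "norm (step c F n) \<le> q * (2 * X + Y) / wt n ^ t" .
qed

text \<open>The equations are required for both signs because the selected sign changes with the
  frequency.\<close>

lemma step_fixpoint:
  assumes v: "cont_periodic v" and F: "\<And>i s. i \<in> I \<Longrightarrow> s = 1 \<or> s = - 1 \<Longrightarrow> cont_periodic (F i s)"
    and eq: "\<And>i s x. i \<in> I \<Longrightarrow> s = 1 \<or> s = - 1 \<Longrightarrow> v (rmat (shear (s * int k) (Nm i)) *v x) = rmat (shear (s * int k) (Nm i)) *v v x + F i s x"
  shows "step (vfcoef v) (\<lambda>i s. vfcoef (F i s)) n = vfcoef v n"
proof -
  have "(1 / (of_int (step_sign i n) * real k)) *\<^sub>R (vfcoef v (step_target i n) - vfcoef v n - vfcoef (F i (step_sign i n)) n) = cmat (rmat (Nm i)) *v vfcoef v n" if i: "i \<in> I" for i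
  proof -
    define s where "s = step_sign i n"
    have s: "s = 1 \<or> s = - 1" unfolding s_def by (rule step_sign_cases)
    define Bs where "Bs = shear (s * int k) (Nm i)"
    have "vfcoef v (step_target i n) = vfcoef (\<lambda>x. v (rmat Bs *v x)) n"
      unfolding step_target_def s_def[symmetric] Bs_def
      by (rule vfcoef_linear[OF v shear_target_iff[OF N2[OF i]], symmetric])
    also have "\<dots> = vfcoef (\<lambda>x. rmat Bs *v v x + F i s x) n"
      using eq[OF i s] by (simp add: Bs_def)
    also have "\<dots> = cmat (rmat Bs) *v vfcoef v n + vfcoef (F i s) n"
    proof -
      have "cont_periodic (\<lambda>x. rmat Bs *v v x)"
        using v by (rule cont_periodic_compose) (rule matrix_vector_mult_linear_continuous_on)
      then show ?thesis using F[OF i s] v by (simp add: vfcoef_add vfcoef_matrix)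
    qed
    finally have "vfcoef v (step_target i n) - vfcoef v n - vfcoef (F i s) n = of_int (s * int k) *\<^sub>R (cmat (rmat (Nm i)) *v vfcoef v n)"
      by (simp add: Bs_def cmat_shear)
    then show ?thesis using s k by (auto simp: s_def[symmetric])
  qed
  then have "step (vfcoef v) (\<lambda>i s. vfcoef (F i s)) n = (\<Sum>i\<in>I. cmat (M i) *v (cmat (rmat (Nm i)) *v vfcoef v n))"
    by (simp add: step_def)
  also have "\<dots> = cmat (\<Sum>i\<in>I. M i ** rmat (Nm i)) *v vfcoef v n"
  proof -
    have "(\<Sum>i\<in>J. cmat (M i) *v (cmat (rmat (Nm i)) *v z)) = (\<Sum>i\<in>J. cmat (M i ** rmat (Nm i))) *v z" if "finite J" for J z
      using that by (induction J rule: finite_induct) (simp_all add: cmat_mult matrix_vector_mul_assoc matrix_vector_mult_add_rdistrib)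
    then show ?thesis using I by (simp add: cmat_sum)
  qed
  finally show ?thesis by (simp add: M)
qed

lemma step_cong:
  assumes "\<And>n. c n = c' n" "\<And>i s. i \<in> I \<Longrightarrow> s = 1 \<or> s = - 1 \<Longrightarrow> F i s n = F' i s n"
  shows "step c F n = step c' F' n"
  unfolding step_def using assms step_sign_cases by (intro sum.cong refl) simp

lemma step_diff:
  "step c F n - step c' F' n = step (\<lambda>n. c n - c' n) (\<lambda>i s n. F i s n - F' i s n) n"
proof -
  have "cmat (M i) *v (r *\<^sub>R (a - b - d)) - cmat (M i) *v (r *\<^sub>R (a' - b' - d'))
     = cmat (M i) *v (r *\<^sub>R ((a - a') - (b - b') - (d - d')))" for i and r :: real and a b d a' b' d' :: "complex ^ 'n"
  proof -
    have "cmat (M i) *v y - cmat (M i) *v z = cmat (M i) *v (y - z)" for y z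
      by (simp add: matrix_vector_mult_diff_distrib)
    then show ?thesis by (simp add: scaleR_right_diff_distrib[symmetric] algebra_simps)
  qed
  then show ?thesis unfolding step_def sum_subtractf[symmetric] by (intro sum.cong refl)
qed

lemma step_l2:
  assumes w: "cont_periodic w" and h: "\<And>i s. i \<in> I \<Longrightarrow> s = 1 \<or> s = - 1 \<Longrightarrow> cont_periodic (h i s)"
    and hw: "\<And>i s x. i \<in> I \<Longrightarrow> s = 1 \<or> s = - 1 \<Longrightarrow> norm (h i s x) \<le> norm (w x)" and E: "finite E"
  shows "(\<Sum>n\<in>E. (norm (step (vfcoef w) (\<lambda>i s. vfcoef (h i s)) n))\<^sup>2) \<le> 15 * q\<^sup>2 * vmean_sq w"
proof -
  define D where "D = vmean_sq w"
  define a where "a n = norm (vfcoef w n)" for n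
  define b where "b i s n = norm (vfcoef (h i s) n)" for i s n
  \<comment> \<open>As the sign varies with \<open>n\<close>, \<open>step_target\<close> need not be
    injective. Both signs are therefore included, each fixed shear being injective. The factor 15
    below is 3, from the square of a three-term sum, times the 2 + 1 + 2 squares.\<close>
  define T where "T i n = 3 * (((a (shear_target (int k) (Nm i) n))\<^sup>2 + (a (shear_target (- int k) (Nm i) n))\<^sup>2) + (a n)\<^sup>2 + ((b i 1 n)\<^sup>2 + (b i (- 1) n)\<^sup>2))" for i n
  have sq3: "(x + y + z)\<^sup>2 \<le> 3 * (x\<^sup>2 + y\<^sup>2 + z\<^sup>2)" for x y z :: real
  proof -
    have "0 \<le> (x - y)\<^sup>2 + (y - z)\<^sup>2 + (x - z)\<^sup>2" by simp
    then show ?thesis by (simp add: power2_eq_square algebra_simps)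
  qed
  have one: "(norm (step (vfcoef w) (\<lambda>i s. vfcoef (h i s)) n))\<^sup>2 \<le> (\<mu> / k)\<^sup>2 * (card I * (\<Sum>i\<in>I. T i n))" for n
  proof -
    have "(norm (step (vfcoef w) (\<lambda>i s. vfcoef (h i s)) n))\<^sup>2 \<le> (\<mu> / k * (\<Sum>i\<in>I. a (step_target i n) + a n + b i (step_sign i n) n))\<^sup>2"
      using step_norm[of "vfcoef w" "\<lambda>i s. vfcoef (h i s)" n] by (intro power_mono) (auto simp: a_def b_def)
    also have "\<dots> = (\<mu> / k)\<^sup>2 * (\<Sum>i\<in>I. a (step_target i n) + a n + b i (step_sign i n) n)\<^sup>2" by (rule power_mult_distrib)
    also have "\<dots> \<le> (\<mu> / k)\<^sup>2 * ((\<Sum>i\<in>I. (a (step_target i n) + a n + b i (step_sign i n) n)\<^sup>2) * card I)"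
      by (intro mult_left_mono sum_squared_le_sum_of_squares) simp
    also have "\<dots> \<le> (\<mu> / k)\<^sup>2 * ((\<Sum>i\<in>I. T i n) * card I)"
    proof (intro mult_left_mono mult_right_mono sum_mono)
      fix i assume "i \<in> I"
      have "(a (step_target i n))\<^sup>2 \<le> (a (shear_target (int k) (Nm i) n))\<^sup>2 + (a (shear_target (- int k) (Nm i) n))\<^sup>2"
        using step_sign_cases[of i n] by (auto simp: step_target_def)
      moreover have "(b i (step_sign i n) n)\<^sup>2 \<le> (b i 1 n)\<^sup>2 + (b i (- 1) n)\<^sup>2" using step_sign_cases[of i n] by auto
      ultimately show "(a (step_target i n) + a n + b i (step_sign i n) n)\<^sup>2 \<le> T i n"
        using sq3[of "a (step_target i n)" "a n" "b i (step_sign i n) n"] by (simp add: T_def)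
    qed auto
    finally show ?thesis by (simp add: mult.commute)
  qed
  have aE: "(\<Sum>n\<in>E. (a n)\<^sup>2) \<le> D" if "finite E" for E
    unfolding a_def D_def by (rule vbessel[OF w that])
  have aT: "(\<Sum>n\<in>E. (a (shear_target t (Nm i) n))\<^sup>2) \<le> D" if "i \<in> I" for t i
  proof -
    have "(\<Sum>n\<in>E. (a (shear_target t (Nm i) n))\<^sup>2) = (\<Sum>n\<in>shear_target t (Nm i) ` E. (a n)\<^sup>2)"
      by (simp add: sum.reindex[OF shear_target_inj[OF N2[OF that]]])
    then show ?thesis using aE[of "shear_target t (Nm i) ` E"] E by simp
  qed
  have bE: "(\<Sum>n\<in>E. (b i s n)\<^sup>2) \<le> D" if "i \<in> I" "s = 1 \<or> s = - 1" for i s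
    unfolding b_def D_def using vbessel[OF h[OF that] E] vmean_sq_mono[OF h[OF that] w hw[OF that]] by linarith
  have TE: "(\<Sum>n\<in>E. T i n) \<le> 15 * D" if i: "i \<in> I" for i
  proof -
    have "(\<Sum>n\<in>E. T i n) = 3 * (((\<Sum>n\<in>E. (a (shear_target (int k) (Nm i) n))\<^sup>2) + (\<Sum>n\<in>E. (a (shear_target (- int k) (Nm i) n))\<^sup>2)) + (\<Sum>n\<in>E. (a n)\<^sup>2)
       + ((\<Sum>n\<in>E. (b i 1 n)\<^sup>2) + (\<Sum>n\<in>E. (b i (- 1) n)\<^sup>2)))"
      by (simp add: T_def sum.distrib sum_distrib_left[symmetric])
    then show ?thesis using aT[OF i, of "int k"] aT[OF i, of "- int k"] aE[OF E] bE[OF i, of 1] bE[OF i, of "- 1"] by simp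
  qed
  have "(\<Sum>n\<in>E. (norm (step (vfcoef w) (\<lambda>i s. vfcoef (h i s)) n))\<^sup>2) \<le> (\<Sum>n\<in>E. (\<mu> / k)\<^sup>2 * (card I * (\<Sum>i\<in>I. T i n)))"
    by (intro sum_mono one)
  also have "\<dots> = (\<mu> / k)\<^sup>2 * (card I * (\<Sum>i\<in>I. \<Sum>n\<in>E. T i n))"
    by (subst sum.swap) (simp add: sum_distrib_left)
  also have "\<dots> \<le> (\<mu> / k)\<^sup>2 * (card I * (\<Sum>i\<in>I. 15 * D))"
    by (intro mult_left_mono sum_mono TE) auto
  also have "\<dots> = 15 * q\<^sup>2 * D" by (simp add: q power2_eq_square)
  finally show ?thesis by (simp add: D_def)
qed

end

lemma CB_component:
  fixes f :: "real ^ 'n \<Rightarrow> real ^ 'n"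
  assumes "CB r \<kappa> f" shows "CB r \<kappa> (\<lambda>x. complex_of_real (f x $ a))"
proof -
  have "bounded_linear (\<lambda>y :: real ^ 'n. complex_of_real (y $ a))"
    by (rule bounded_linear_compose[OF bounded_linear_of_real bounded_linear_vec_nth])
  then have "CB r (1 * \<kappa>) (\<lambda>x. complex_of_real (f x $ a))"
    by (rule CB_linear) (use assms in \<open>auto simp: component_le_norm_cart\<close>)
  then show ?thesis by simp
qed

lemma norm_vfcoef_le:
  fixes v :: "real ^ 'n \<Rightarrow> real ^ 'n" and B :: real
  assumes "\<And>a. cmod (fcoef (\<lambda>x. complex_of_real (v x $ a)) n) \<le> B"
  shows "norm (vfcoef v n) \<le> CARD('n) * B"
proof -
  have "norm (vfcoef v n) \<le> (\<Sum>a\<in>UNIV. cmod (vfcoef v n $ a))"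
    unfolding norm_vec_def by (rule L2_set_le_sum) simp
  also have "\<dots> \<le> (\<Sum>a\<in>(UNIV :: 'n set). B)" by (intro sum_mono) (simp add: vfcoef_def assms)
  finally show ?thesis by simp
qed

lemma csym_decayI: "cont_periodic v \<Longrightarrow> (\<And>n. norm (vfcoef v n) \<le> K / wt n ^ s) \<Longrightarrow> decay s K (vfcoef v)"
  by (simp add: decay_def csym_vfcoef)

text \<open>A continuous solution \<open>v\<close> of the conjugacy equations is the \<open>L\<^sup>2\<close> limit of an iteration
  started at \<open>0\<close> whose members stay in a fixed ball of each of the decay classes.\<close>

theorem conjugacy_decay:
  assumes \<rho>: "0 < \<rho>" "\<rho> \<le> 1"
  obtains \<kappa> where "0 < \<kappa>"
    "\<And>(I :: 'i set) (Nm :: 'i \<Rightarrow> int ^ 'n ^ 'n) (M :: 'i \<Rightarrow> real ^ 'n ^ 'n) (k :: nat) (\<mu> :: real) (f :: 'i \<Rightarrow> int \<Rightarrow> real ^ 'n \<Rightarrow> real ^ 'n) v.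
      finite I \<Longrightarrow> 0 < k \<Longrightarrow> (\<And>i. i \<in> I \<Longrightarrow> Nm i ** Nm i = 0) \<Longrightarrow> (\<Sum>i\<in>I. M i ** rmat (Nm i)) = mat 1 \<Longrightarrow>
      0 \<le> \<mu> \<Longrightarrow> (\<And>i z. i \<in> I \<Longrightarrow> norm (cmat (M i) *v z) \<le> \<mu> * norm z) \<Longrightarrow> card I * \<mu> / real k * 9 * CARD('n) \<le> 1 \<Longrightarrow>
      (\<And>i s. i \<in> I \<Longrightarrow> s = 1 \<or> s = - 1 \<Longrightarrow> smooth_periodic (f i s) \<and> CB (2 * CARD('n) + 2) \<kappa> (f i s)) \<Longrightarrow> cont_periodic v \<Longrightarrow>
      (\<And>i s x. i \<in> I \<Longrightarrow> s = 1 \<or> s = - 1 \<Longrightarrow> v (rmat (shear (s * int k) (Nm i)) *v x) = rmat (shear (s * int k) (Nm i)) *v v x + f i s (x + v x)) \<Longrightarrow>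
      decay (2 * CARD('n) + 2) \<rho> (vfcoef v) \<and> (\<forall>s. \<exists>K. decay s K (vfcoef v))"
proof -
  obtain S where S: "1 \<le> S" "\<And>E :: (int ^ 'n) set. finite E \<Longrightarrow> (\<Sum>n\<in>E. 1 / wt n ^ (2 * CARD('n))) \<le> S"
    by (rule wt_sum_bounded) blast
  define s0 where "s0 = 2 * CARD('n) + 2"
  have s0: "2 * CARD('n) + 2 \<le> s0" by (simp add: s0_def)
  obtain C0 where C0: "0 \<le> C0" "\<And>(c :: int ^ 'n \<Rightarrow> complex ^ 'n) (u :: real ^ 'n \<Rightarrow> complex) \<kappa> n. decay s0 1 c \<Longrightarrow> CB s0 \<kappa> u \<Longrightarrow> cont_periodic u \<Longrightarrow>
     cmod (fcoef (\<lambda>x. u (x + vser c x)) n) \<le> C0 * \<kappa> / wt n ^ s0"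
    using fcoef_comp_le[OF S s0, of 1 s0] by auto
  obtain c0 where c0: "0 \<le> c0" "\<And>s K K'. s0 \<le> s \<Longrightarrow> 0 \<le> K \<Longrightarrow> 0 \<le> K' \<Longrightarrow> \<exists>C\<ge>0. \<forall>(c :: int ^ 'n \<Rightarrow> complex ^ 'n) (u :: real ^ 'n \<Rightarrow> complex) \<kappa> X n.
     decay s0 1 c \<longrightarrow> decay s K c \<longrightarrow> decay (Suc s) X c \<longrightarrow> CB s0 \<kappa> u \<longrightarrow> CB (Suc s) K' u \<longrightarrow> cont_periodic u \<longrightarrow>
     cmod (fcoef (\<lambda>x. u (x + vser c x)) n) \<le> (C + c0 * \<kappa> * X) / wt n ^ Suc s"
  proof -
    have "\<exists>c0\<ge>0. \<forall>s\<ge>s0. \<forall>K\<ge>0. \<forall>K'\<ge>0. \<exists>C\<ge>0. \<forall>(c :: int ^ 'n \<Rightarrow> complex ^ 'n) (u :: real ^ 'n \<Rightarrow> complex) \<kappa> X n.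
     decay s0 1 c \<longrightarrow> decay s K c \<longrightarrow> decay (Suc s) X c \<longrightarrow> CB s0 \<kappa> u \<longrightarrow> CB (Suc s) K' u \<longrightarrow> cont_periodic u \<longrightarrow>
     cmod (fcoef (\<lambda>x. u (x + vser c x)) n) \<le> (C + c0 * \<kappa> * X) / wt n ^ Suc s"
      unfolding s0_def by (rule fcoef_comp_tame[OF S])
    then obtain c0 where c: "0 \<le> c0" "\<forall>s\<ge>s0. \<forall>K\<ge>0. \<forall>K'\<ge>0. \<exists>C\<ge>0. \<forall>(c :: int ^ 'n \<Rightarrow> complex ^ 'n) (u :: real ^ 'n \<Rightarrow> complex) \<kappa> X n.
     decay s0 1 c \<longrightarrow> decay s K c \<longrightarrow> decay (Suc s) X c \<longrightarrow> CB s0 \<kappa> u \<longrightarrow> CB (Suc s) K' u \<longrightarrow> cont_periodic u \<longrightarrow>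
     cmod (fcoef (\<lambda>x. u (x + vser c x)) n) \<le> (C + c0 * \<kappa> * X) / wt n ^ Suc s" by (elim exE conjE)
    show thesis by (rule that[OF c(1)]) (rule c(2)[rule_format])
  qed
  define N where "N = real CARD('n)"
  have N: "1 \<le> N" by (simp add: N_def Suc_leI)
  \<comment> \<open>This serves three purposes: the base ball of radius \<rho> is preserved, the top
    order term of the tame estimate gets a factor at most 1, and the \<open>f i s\<close> are
    1-Lipschitz.\<close>
  define \<kappa> where "\<kappa> = \<rho> / (N * (C0 + c0 + 1))"
  have pos: "0 < N * (C0 + c0 + 1)" using N C0 c0 by (intro mult_pos_pos) auto
  have \<kappa>: "0 < \<kappa>" "N * (C0 + c0 + 1) * \<kappa> = \<rho>"
  proof -
    show "0 < \<kappa>" unfolding \<kappa>_def using \<rho>(1) pos by (rule divide_pos_pos)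
    have "P * (\<rho> / P) = \<rho>" if "0 < P" for P using that by simp
    then show "N * (C0 + c0 + 1) * \<kappa> = \<rho>" unfolding \<kappa>_def using pos by blast
  qed
  have \<kappa>1: "N * (C0 * \<kappa>) \<le> \<rho>" "N * (c0 * \<kappa>) \<le> 1" "N * \<kappa> \<le> 1"
  proof -
    have "N * (C0 * \<kappa>) + N * (c0 * \<kappa>) + N * \<kappa> = \<rho>" using \<kappa>(2) by (simp add: algebra_simps)
    moreover have "0 \<le> N * (C0 * \<kappa>)" "0 \<le> N * (c0 * \<kappa>)" "0 \<le> N * \<kappa>" using N C0 c0 \<kappa> by auto
    ultimately show "N * (C0 * \<kappa>) \<le> \<rho>" "N * (c0 * \<kappa>) \<le> 1" "N * \<kappa> \<le> 1" using \<rho> by linarith+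
  qed
  show thesis
  proof (rule that[OF \<kappa>(1)])
    fix I :: "'i set" and Nm :: "'i \<Rightarrow> int ^ 'n ^ 'n" and M :: "'i \<Rightarrow> real ^ 'n ^ 'n" and k :: nat and \<mu> :: real
      and f :: "'i \<Rightarrow> int \<Rightarrow> real ^ 'n \<Rightarrow> real ^ 'n" and v :: "real ^ 'n \<Rightarrow> real ^ 'n"
    assume I: "finite I" and k: "0 < k" and N2: "\<And>i. i \<in> I \<Longrightarrow> Nm i ** Nm i = 0"
      and M: "(\<Sum>i\<in>I. M i ** rmat (Nm i)) = mat 1" and \<mu>: "0 \<le> \<mu>" "\<And>i z. i \<in> I \<Longrightarrow> norm (cmat (M i) *v z) \<le> \<mu> * norm z"
      and q9: "card I * \<mu> / real k * 9 * CARD('n) \<le> 1"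
      and f: "\<And>i s. i \<in> I \<Longrightarrow> s = 1 \<or> s = - 1 \<Longrightarrow> smooth_periodic (f i s) \<and> CB (2 * CARD('n) + 2) \<kappa> (f i s)" and v: "cont_periodic v"
      and eq: "\<And>i s x. i \<in> I \<Longrightarrow> s = 1 \<or> s = - 1 \<Longrightarrow> v (rmat (shear (s * int k) (Nm i)) *v x) = rmat (shear (s * int k) (Nm i)) *v v x + f i s (x + v x)"
    define q where "q = card I * \<mu> / k"
    note ctx = I k N2 M \<mu> q_def
    have q0: "0 \<le> q" using \<mu> by (simp add: q_def)
    \<comment> \<open>\<open>q\<close> at most 1/9 preserves the balls of the decay classes; the
      dimension enters the mean square contraction through \<open>vparseval\<close>, which is why
      \<open>N\<close> stands here as well.\<close>
    have qN: "q * 9 * N \<le> 1" using q9 by (simp add: q_def N_def)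
    have q1: "q \<le> 1 / 9"
    proof -
      have "q * 9 * 1 \<le> q * 9 * N" by (rule mult_left_mono[OF N]) (use q0 in simp)
      then show ?thesis using qN by linarith
    qed
    define stp where "stp = step I Nm M k"
    have fp: "cont_periodic (f i s)" "CB s0 \<kappa> (f i s)" "\<exists>K. CB n K (f i s)" if "i \<in> I" "s = 1 \<or> s = - 1" for i s n
      using f[OF that] by (auto simp: smooth_periodic_cont_periodic s0_def smooth_periodic_def)
    have lip: "norm (f i s x - f i s y) \<le> norm (x - y)" if "i \<in> I" "s = 1 \<or> s = - 1" for i s x y
    proof -
      have "CB (Suc 0) \<kappa> (f i s)" by (rule CB_le[OF fp(2)[OF that]]) (simp add: s0_def)
      then have "norm (f i s x - f i s y) \<le> N * \<kappa> * norm (x - y)" unfolding N_def by (rule CB_lipschitz)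
      also have "\<dots> \<le> 1 * norm (x - y)" using \<kappa>1 by (intro mult_right_mono) auto
      finally show ?thesis by simp
    qed
    define Fh where "Fh w i s = vfcoef (\<lambda>x. f i s (x + w x))" for w i s
    have cpf: "cont_periodic (\<lambda>x. f i s (x + w x))" if "i \<in> I" "s = 1 \<or> s = - 1" "cont_periodic w" for i s w
    proof -
      have "continuous_on UNIV (\<lambda>x. f i s (x + w x))"
        by (rule continuous_on_compose2[OF cperD(1)[OF fp(1)[OF that(1,2)], of UNIV]])
           (auto intro!: continuous_intros cperD(1)[OF that(3)])
      moreover have "f i s (x + lat m + w (x + lat m)) = f i s (x + w x)" for x m
        using cperD(2)[OF fp(1)[OF that(1,2)], of "x + w x" m] cperD(2)[OF that(3)] by (simp add: algebra_simps)
      ultimately show ?thesis by (simp add: cont_periodic_def)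
    qed
    have fix_v: "stp (vfcoef v) (Fh v) n = vfcoef v n" for n
      unfolding stp_def Fh_def
      using step_fixpoint[OF ctx v, of "\<lambda>i s x. f i s (x + v x)"] cpf[OF _ _ v] eq by blast
    define cc where "cc j = rec_nat (\<lambda>n. 0) (\<lambda>j c. stp c (Fh (vser c))) j" for j :: nat
    have cc_0: "cc 0 = (\<lambda>n. 0)" and cc_Suc: "cc (Suc j) = stp (cc j) (Fh (vser (cc j)))" for j
      by (simp_all add: cc_def)
    have dec0: "decay s K (cc 0)" if "0 \<le> K" for s K
      using that by (simp add: cc_0 decay_def csym_def)
    have dec_stp: "decay t (q * (2 * X + Y)) (stp c F)"
      if "decay t X c" "\<And>i s. i \<in> I \<Longrightarrow> s = 1 \<or> s = - 1 \<Longrightarrow> decay t Y (F i s)" for t X Y c F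
      unfolding stp_def by (rule decay_step[OF ctx that])
    have dec_mono: "decay s K' c" if "decay s K c" "K \<le> K'" for s K K' and c :: "int ^ 'n \<Rightarrow> complex ^ 'n"
      using that unfolding decay_def by (meson divide_right_mono order_trans wt_nonneg zero_le_power)
    have base: "decay s0 \<rho> (cc j)" for j
    proof (induction j)
      case 0
      show ?case using \<rho> by (intro dec0) simp
    next
      case (Suc j)
      have c1: "decay s0 1 (cc j)" by (rule dec_mono[OF Suc \<rho>(2)])
      have cv: "cont_periodic (vser (cc j))" by (rule cont_periodic_vser[OF S c1 s0])
      have "decay s0 \<rho> (Fh (vser (cc j)) i s)" if it: "i \<in> I" "s = 1 \<or> s = - 1" for i s
        unfolding Fh_def
      proof (rule csym_decayI[OF cpf[OF it cv]])
        fix n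
        have "norm (vfcoef (\<lambda>x. f i s (x + vser (cc j) x)) n) \<le> CARD('n) * (C0 * \<kappa> / wt n ^ s0)"
          by (intro norm_vfcoef_le C0(2)[OF c1 CB_component[OF fp(2)[OF it]]] cont_periodic_comp_nth[OF fp(1)[OF it]])
        also have "\<dots> = N * (C0 * \<kappa>) / wt n ^ s0" by (simp add: N_def)
        also have "\<dots> \<le> \<rho> / wt n ^ s0" using \<kappa>1 by (intro divide_right_mono) auto
        finally show "norm (vfcoef (\<lambda>x. f i s (x + vser (cc j) x)) n) \<le> \<rho> / wt n ^ s0" .
      qed
      then have "decay s0 (q * (2 * \<rho> + \<rho>)) (cc (Suc j))"
        unfolding cc_Suc by (intro dec_stp Suc)
      moreover have "q * (2 * \<rho> + \<rho>) \<le> \<rho>"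
        using mult_right_mono[OF q1, of "3 * \<rho>"] \<rho> by simp
      ultimately show ?case by (rule dec_mono)
    qed
    have base1: "decay s0 1 (cc j)" for j by (rule dec_mono[OF base \<rho>(2)])
    have cvj: "cont_periodic (vser (cc j))" for j by (rule cont_periodic_vser[OF S base1 s0])
    \<comment> \<open>Induction on the order: the bound \<open>K\<close> at order \<open>s\<close>
      holds along the whole iteration and determines the constant \<open>C\<close> of the tame
      estimate at the next order.\<close>
    have higher: "\<exists>K\<ge>0. \<forall>j. decay s K (cc j)" if "s0 \<le> s" for s
      using that
    proof (induction s rule: nat_induct_at_least)
      case base
      show ?case using base1 by (intro exI[of _ 1]) auto
    next
      case (Suc s)
      then obtain K where K: "0 \<le> K" "\<And>j. decay s K (cc j)" by blast
      define Kf where "Kf i t = (SOME K. CB (Suc s) K (f i t))" for i t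
      have Kf: "CB (Suc s) (Kf i t) (f i t)" if "i \<in> I" "t = 1 \<or> t = - 1" for i t
        unfolding Kf_def by (rule someI_ex[OF fp(3)[OF that]])
      define K' where "K' = (\<Sum>i\<in>I. \<bar>Kf i 1\<bar> + \<bar>Kf i (- 1)\<bar>)"
      have K'0: "0 \<le> K'" unfolding K'_def by (intro sum_nonneg) auto
      have K': "CB (Suc s) K' (f i t)" if it: "i \<in> I" "t = 1 \<or> t = - 1" for i t
      proof (rule CB_mono[OF Kf[OF it]])
        have "\<bar>Kf i 1\<bar> + \<bar>Kf i (- 1)\<bar> \<le> K'"
          unfolding K'_def by (rule member_le_sum[OF it(1) _ I]) auto
        then show "Kf i t \<le> K'" using it(2) by auto
      qed
      obtain C where C: "0 \<le> C" "\<And>(c :: int ^ 'n \<Rightarrow> complex ^ 'n) (u :: real ^ 'n \<Rightarrow> complex) \<kappa> X n.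
         decay s0 1 c \<Longrightarrow> decay s K c \<Longrightarrow> decay (Suc s) X c \<Longrightarrow> CB s0 \<kappa> u \<Longrightarrow> CB (Suc s) K' u \<Longrightarrow> cont_periodic u \<Longrightarrow>
         cmod (fcoef (\<lambda>x. u (x + vser c x)) n) \<le> (C + c0 * \<kappa> * X) / wt n ^ Suc s"
        using c0(2)[OF Suc.hyps K(1) K'0] by blast
      \<comment> \<open>The radius is reproduced: one step turns \<open>X\<close> into at most
        \<open>q * (3 * X + N * C)\<close>, which is \<open>7 * q * (N * C)\<close>, and
        \<open>q\<close> is at most 1/9.\<close>
      define X where "X = 2 * (N * C)"
      have X: "0 \<le> X" using N C by (simp add: X_def)
      have "decay (Suc s) X (cc j)" for j
      proof (induction j)
        case 0
        show ?case by (rule dec0[OF X])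
      next
        case (Suc j)
        have "decay (Suc s) (N * C + X) (Fh (vser (cc j)) i t)" if it: "i \<in> I" "t = 1 \<or> t = - 1" for i t
          unfolding Fh_def
        proof (rule csym_decayI[OF cpf[OF it cvj]])
          fix n
          have "norm (vfcoef (\<lambda>x. f i t (x + vser (cc j) x)) n) \<le> CARD('n) * ((C + c0 * \<kappa> * X) / wt n ^ Suc s)"
            by (intro norm_vfcoef_le C(2)[OF base1 K(2) Suc CB_component[OF fp(2)[OF it]] CB_component[OF K'[OF it]]] cont_periodic_comp_nth[OF fp(1)[OF it]])
          also have "\<dots> = (N * C + (N * (c0 * \<kappa>)) * X) / wt n ^ Suc s" by (simp add: N_def algebra_simps)
          also have "\<dots> \<le> (N * C + X) / wt n ^ Suc s"
            using mult_right_mono[OF \<kappa>1(2) X] by (intro divide_right_mono) auto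
          finally show "norm (vfcoef (\<lambda>x. f i t (x + vser (cc j) x)) n) \<le> (N * C + X) / wt n ^ Suc s" .
        qed
        then have "decay (Suc s) (q * (2 * X + (N * C + X))) (cc (Suc j))"
          unfolding cc_Suc by (intro dec_stp Suc)
        moreover have "q * (2 * X + (N * C + X)) \<le> X"
        proof -
          have "0 \<le> N * C" using N C by simp
          then have "q * (7 * (N * C)) \<le> 1 / 9 * (7 * (N * C))" using q1 by (intro mult_right_mono) auto
          moreover have e: "2 * X + (N * C + X) = 7 * (N * C)" by (simp add: X_def)
          ultimately show ?thesis unfolding e using \<open>0 \<le> N * C\<close> unfolding X_def by linarith
        qed
        ultimately show ?case by (rule dec_mono)
      qed
      then show ?case using X by blast
    qed
    define w where "w j x = vser (cc j) x - v x" for j x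
    have cw: "cont_periodic (w j)" for j unfolding w_def[abs_def] by (rule cont_periodic_diff[OF cvj v])
    have fw: "vfcoef (w j) n = cc j n - vfcoef v n" for j n
      unfolding w_def[abs_def] by (simp add: vfcoef_diff[OF cvj v] vfcoef_vser[OF S base1 s0])
    \<comment> \<open>\<open>v\<close> is itself fixed by the step, so the error evolves by a
      difference of two steps, and the nonlinear part is controlled by the Lipschitz bound. The
      factor is \<open>15 * N * q^2\<close>, at most 15/81.\<close>
    have contr: "vmean_sq (w (Suc j)) \<le> vmean_sq (w j) / 4" for j
    proof -
      define h where "h i s x = f i s (x + vser (cc j) x) - f i s (x + v x)" for i s x
      have ch: "cont_periodic (h i s)" if "i \<in> I" "s = 1 \<or> s = - 1" for i s
        unfolding h_def[abs_def] by (rule cont_periodic_diff[OF cpf[OF that cvj] cpf[OF that v]])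
      have hw: "norm (h i s x) \<le> norm (w j x)" if "i \<in> I" "s = 1 \<or> s = - 1" for i s x
        using lip[OF that, of "x + vser (cc j) x" "x + v x"] by (simp add: h_def w_def)
      have step_w: "vfcoef (w (Suc j)) n = step I Nm M k (vfcoef (w j)) (\<lambda>i s. vfcoef (h i s)) n" for n
      proof -
        have "vfcoef (w (Suc j)) n = stp (cc j) (Fh (vser (cc j))) n - stp (vfcoef v) (Fh v) n"
          by (simp add: fw cc_Suc fix_v)
        also have "\<dots> = stp (\<lambda>n. cc j n - vfcoef v n) (\<lambda>i s n. Fh (vser (cc j)) i s n - Fh v i s n) n"
          unfolding stp_def by (rule step_diff[OF ctx])
        also have "\<dots> = step I Nm M k (vfcoef (w j)) (\<lambda>i s. vfcoef (h i s)) n"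
        proof -
          show ?thesis unfolding stp_def
          proof (rule step_cong[OF ctx])
            show "cc j n - vfcoef v n = vfcoef (w j) n" for n by (simp add: fw)
            show "Fh (vser (cc j)) i s n - Fh v i s n = vfcoef (h i s) n" if "i \<in> I" "s = 1 \<or> s = - 1" for i s
              unfolding Fh_def h_def[abs_def] by (rule vfcoef_diff[OF cpf[OF that cvj] cpf[OF that v], symmetric])
          qed
        qed
        finally show ?thesis .
      qed
      have "vmean_sq (w (Suc j)) \<le> CARD('n) * (15 * q\<^sup>2 * vmean_sq (w j))"
      proof (rule vparseval[OF cw])
        fix E :: "(int ^ 'n) set" assume E: "finite E"
        show "(\<Sum>n\<in>E. (norm (vfcoef (w (Suc j)) n))\<^sup>2) \<le> 15 * q\<^sup>2 * vmean_sq (w j)"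
          unfolding step_w by (rule step_l2[OF I k N2 M \<mu> q_def cw ch hw E])
      qed
      also have "\<dots> = (15 * (N * q\<^sup>2)) * vmean_sq (w j)" by (simp add: N_def)
      also have "\<dots> \<le> 1 / 4 * vmean_sq (w j)"
      proof (rule mult_right_mono[OF _ vmean_sq_nonneg])
        have "N * q\<^sup>2 \<le> (q * 9 * N) * (q / 9)" by (simp add: power2_eq_square)
        also have "\<dots> \<le> 1 * (q / 9)" using qN q0 by (intro mult_right_mono) auto
        finally show "15 * (N * q\<^sup>2) \<le> 1 / 4" using q1 by simp
      qed
      finally show ?thesis by simp
    qed
    have small: "vmean_sq (w j) \<le> vmean_sq (w 0) / 4 ^ j" for j
    proof (induction j)
      case (Suc j)
      then show ?case using contr[of j] by simp
    qed simp
    \<comment> \<open>Decay bounds pass to coefficientwise limits, and Bessel's inequality at a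
      single frequency turns mean square convergence into convergence of the coefficient.\<close>
    have lim: "decay s K (vfcoef v)" if dK: "\<And>j. decay s K (cc j)" for s K
    proof (rule csym_decayI[OF v])
      fix n
      show "norm (vfcoef v n) \<le> K / wt n ^ s"
      proof (rule field_le_epsilon)
        fix e :: real assume e: "0 < e"
        have "\<forall>\<^sub>F j in sequentially. vmean_sq (w 0) / 4 ^ j < e\<^sup>2"
          using e by (intro order_tendstoD(2)[OF LIMSEQ_divide_realpow_zero]) auto
        then obtain j where j: "vmean_sq (w 0) / 4 ^ j < e\<^sup>2" by (auto simp: eventually_sequentially)
        have "(norm (vfcoef (w j) n))\<^sup>2 \<le> vmean_sq (w j)" using vbessel[OF cw, of "{n}" j] by simp
        then have "(norm (vfcoef (w j) n))\<^sup>2 \<le> e\<^sup>2" using small[of j] j by linarith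
        then have "norm (vfcoef (w j) n) \<le> e" using e power2_le_imp_le by (meson less_imp_le)
        moreover have "norm (cc j n) \<le> K / wt n ^ s" using dK[of j] by (simp add: decay_def)
        moreover have "vfcoef v n = cc j n - vfcoef (w j) n" by (simp add: fw)
        ultimately show "norm (vfcoef v n) \<le> K / wt n ^ s + e"
          using norm_triangle_ineq4[of "cc j n" "vfcoef (w j) n"] by simp
      qed
    qed
    show "decay (2 * CARD('n) + 2) \<rho> (vfcoef v) \<and> (\<forall>s. \<exists>K. decay s K (vfcoef v))"
    proof (intro conjI allI)
      show "decay (2 * CARD('n) + 2) \<rho> (vfcoef v)" using lim[OF base] by (simp add: s0_def)
      fix s
      obtain K where K: "0 \<le> K" "\<And>j. decay (max s0 s) K (cc j)" using higher[of "max s0 s"] by auto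
      have "decay (max s0 s) K (vfcoef v)" by (rule lim[OF K(2)])
      then have "norm (vfcoef v n) \<le> K / wt n ^ s" for n
      proof -
        have "norm (vfcoef v n) \<le> K * (1 / wt n ^ max s0 s)"
          using \<open>decay (max s0 s) K (vfcoef v)\<close> by (simp add: decay_def)
        also have "\<dots> \<le> K * (1 / wt n ^ s)"
          by (intro mult_left_mono wt_power_le K(1)) simp
        finally show ?thesis by simp
      qed
      then show "\<exists>K. decay s K (vfcoef v)" using csym_decayI[OF v] by blast
    qed
  qed
qed

section \<open>From decay of the coefficients back to smoothness\<close>

text \<open>Both functions have the same coefficients, so their difference has mean square 0, and a
  continuous function with this property vanishes.\<close>

lemma vser_vfcoef:
  fixes v :: "real ^ 'n \<Rightarrow> real ^ 'n"
  assumes S: "1 \<le> S" "\<And>E :: (int ^ 'n) set. finite E \<Longrightarrow> (\<Sum>n\<in>E. 1 / wt n ^ (2 * CARD('n))) \<le> S"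
    and c: "decay s K (vfcoef v)" and s: "2 * CARD('n) + 2 \<le> s" and v: "cont_periodic v"
  shows "vser (vfcoef v) = v"
proof
  fix x
  define w where "w x = v x - vser (vfcoef v) x" for x
  have cv: "cont_periodic (vser (vfcoef v))" by (rule cont_periodic_vser[OF S c s])
  have w: "cont_periodic w" unfolding w_def[abs_def] by (rule cont_periodic_diff[OF v cv])
  have "vfcoef w n = 0" for n
    unfolding w_def[abs_def] by (simp add: vfcoef_diff[OF v cv] vfcoef_vser[OF S c s])
  then have "vmean_sq w \<le> real CARD('n) * 0" using vparseval[OF w, of 0] by simp
  then have 0: "vmean_sq w \<le> 0" by simp
  have "w x $ a = 0" for a
  proof -
    have "mean_sq (\<lambda>x. complex_of_real (w x $ a)) \<le> vmean_sq w"
      unfolding vmean_sq_def by (rule member_le_sum) (auto simp: mean_sq_nonneg)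
    then have "complex_of_real (w x $ a) = 0"
      using 0 by (intro mean_sq_eq_0[OF cont_periodic_comp_nth[OF w]]) simp
    then show ?thesis by simp
  qed
  then show "vser (vfcoef v) x = v x" by (simp add: w_def vec_eq_iff)
qed

text \<open>Rapid decay is inherited by the coefficients of every partial derivative, so the
  induction applies to the differentiated series.\<close>

lemma CB_fser:
  fixes c :: "int ^ 'n \<Rightarrow> complex"
  shows "(\<And>s. \<exists>K. \<forall>n. cmod (c n) \<le> K / wt n ^ s) \<Longrightarrow> \<exists>K. CB m K (fser c)"
proof (induction m arbitrary: c)
  case (0 c)
  obtain S where S: "1 \<le> S" "\<And>E :: (int ^ 'n) set. finite E \<Longrightarrow> (\<Sum>n\<in>E. 1 / wt n ^ (2 * CARD('n))) \<le> S"
    by (rule wt_sum_bounded) blast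
  obtain K where K: "\<And>n. cmod (c n) \<le> K / wt n ^ (2 * CARD('n))" using 0 by blast
  note sm = abs_summable_wt[OF S(2) K]
  show ?case
    using continuous_fser[OF sm(1)] cmod_fser_le[OF sm(1) sm(2)] by auto
next
  case (Suc m c)
  obtain S where S: "1 \<le> S" "\<And>E :: (int ^ 'n) set. finite E \<Longrightarrow> (\<Sum>n\<in>E. 1 / wt n ^ (2 * CARD('n))) \<le> S"
    by (rule wt_sum_bounded) blast
  obtain K where K: "\<And>n. cmod (c n) \<le> K / wt n ^ (2 * CARD('n) + 2)" using Suc.prems by blast
  have K2: "cmod (complex_of_real ((wt n)\<^sup>2) * c n) \<le> K / wt n ^ (2 * CARD('n))" for n
  proof -
    have "cmod (complex_of_real ((wt n)\<^sup>2) * c n) = (wt n)\<^sup>2 * cmod (c n)" by (simp add: norm_mult norm_power)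
    also have "\<dots> \<le> (wt n)\<^sup>2 * (K / wt n ^ (2 * CARD('n) + 2))" by (intro mult_left_mono K) simp
    also have "\<dots> = K / wt n ^ (2 * CARD('n))" by (simp add: power_add power2_eq_square)
    finally show ?thesis .
  qed
  have sm: "(\<lambda>n. (wt n)\<^sup>2 * cmod (c n)) summable_on UNIV"
    using abs_summable_wt(1)[OF S(2) K2] by (simp add: norm_mult norm_power)
  define d where "d i n = 2 * pi * \<i> * of_int (n $ i) * c n" for i and n :: "int ^ 'n"
  have "\<exists>K. CB m K (fser (d i))" for i
  proof (rule Suc.IH)
    fix s
    obtain K where K: "\<And>n. cmod (c n) \<le> K / wt n ^ Suc s" using Suc.prems by blast
    have "cmod (d i n) \<le> (2 * pi * K) / wt n ^ s" for n
    proof -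
      have "cmod (d i n) = 2 * pi * \<bar>of_int (n $ i)\<bar> * cmod (c n)" by (simp add: d_def norm_mult)
      also have "\<dots> \<le> 2 * pi * wt n * (K / wt n ^ Suc s)"
        using abs_nth_le_wt[of n i] K by (intro mult_mono) auto
      also have "\<dots> = (2 * pi * K) / wt n ^ s" by simp
      finally show ?thesis .
    qed
    then show "\<exists>K. \<forall>n. cmod (d i n) \<le> K / wt n ^ s" by blast
  qed
  then obtain L where L: "\<And>i. CB m (L i) (fser (d i))" by metis
  obtain K0 where K0: "CB 0 K0 (fser c)"
  proof -
    obtain K where K: "\<And>n. cmod (c n) \<le> K / wt n ^ (2 * CARD('n))" using Suc.prems by blast
    note sm = abs_summable_wt[OF S(2) K]
    have "CB 0 (K * S) (fser c)" using continuous_fser[OF sm(1)] cmod_fser_le[OF sm(1) sm(2)] by simp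
    then show thesis by (rule that)
  qed
  define B where "B = \<bar>K0\<bar> + (\<Sum>i\<in>UNIV. \<bar>L i\<bar>)"
  have B: "K0 \<le> B" "L i \<le> B" for i
  proof -
    have "\<bar>L i\<bar> \<le> (\<Sum>i\<in>UNIV. \<bar>L i\<bar>)" by (rule member_le_sum) auto
    then show "K0 \<le> B" "L i \<le> B" by (auto simp: B_def)
  qed
  have "CB (Suc m) B (fser c)"
  proof (rule CB_I[OF has_derivative_fser[OF sm]])
    show "cmod (fser c x) \<le> B" for x using CB_bound[OF K0, of x] B(1) by linarith
    show "CB m B (\<lambda>x. fser (\<lambda>n. 2 * pi * \<i> * (lat n \<bullet> axis i 1) * c n) x)" for i
      using CB_mono[OF L B(2), of i] by (simp add: d_def[abs_def] inner_axis)
  qed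
  then show ?case by blast
qed

lemma smooth_periodic_of_decay:
  fixes v :: "real ^ 'n \<Rightarrow> real ^ 'n"
  assumes v: "cont_periodic v" and dec: "\<And>s. \<exists>K. decay s K (vfcoef v)"
  shows "smooth_periodic v"
proof -
  obtain S where S: "1 \<le> S" "\<And>E :: (int ^ 'n) set. finite E \<Longrightarrow> (\<Sum>n\<in>E. 1 / wt n ^ (2 * CARD('n))) \<le> S"
    by (rule wt_sum_bounded) blast
  obtain K where c: "decay (2 * CARD('n) + 2) K (vfcoef v)" using dec by blast
  have ve: "vser (vfcoef v) = v" by (rule vser_vfcoef[OF S c order_refl v])
  have "\<exists>K. CB m K v" for m
  proof -
    have "\<exists>K. CB m K (fser (\<lambda>n. vfcoef v n $ a))" for a
    proof (rule CB_fser)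
      fix s
      obtain K where "decay s K (vfcoef v)" using dec by blast
      then show "\<exists>K. \<forall>n. cmod (vfcoef v n $ a) \<le> K / wt n ^ s"
        using Finite_Cartesian_Product.norm_nth_le[of "vfcoef v _" a] unfolding decay_def by (meson order_trans)
    qed
    then obtain K where K: "\<And>a. CB m (K a) (fser (\<lambda>n. vfcoef v n $ a))" by metis
    have "CB m (\<Sum>a\<in>UNIV. 1 * K a) (\<lambda>x. \<Sum>a\<in>UNIV. Re (fser (\<lambda>n. vfcoef v n $ a) x) *\<^sub>R (axis a 1 :: real ^ 'n))"
    proof (intro CB_sum CB_linear[OF _ _ _ K])
      show "bounded_linear (\<lambda>z. Re z *\<^sub>R (axis a 1 :: real ^ 'n))" for a
        by (rule bounded_linear_compose[OF bounded_linear_scaleR_left bounded_linear_Re])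
      show "norm (Re z *\<^sub>R (axis a 1 :: real ^ 'n)) \<le> 1 * cmod z" for a z by (simp add: abs_Re_le_cmod)
    qed auto
    moreover have "(\<Sum>a\<in>UNIV. Re (fser (\<lambda>n. vfcoef v n $ a) x) *\<^sub>R (axis a 1 :: real ^ 'n)) = v x" for x
    proof -
      have "v x = (\<chi> a. Re (fser (\<lambda>n. vfcoef v n $ a) x))" using fun_cong[OF ve, of x] by (simp add: vser_def)
      then show ?thesis using basis_expansion[of "v x"] by (simp add: scalar_mult_eq_scaleR)
    qed
    ultimately show ?thesis by auto
  qed
  then show ?thesis using v by (simp add: smooth_periodic_def cont_periodic_def)
qed

text \<open>Decay at the base order makes the coefficients of the first partials absolutely summable
  with total at most \<open>2 * pi * \<rho> * S\<close>. The Lipschitz constant is thus proportional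
  to \<rho>.\<close>

lemma lipschitz_of_decay:
  fixes v :: "real ^ 'n \<Rightarrow> real ^ 'n"
  assumes S: "1 \<le> S" "\<And>E :: (int ^ 'n) set. finite E \<Longrightarrow> (\<Sum>n\<in>E. 1 / wt n ^ (2 * CARD('n))) \<le> S"
    and v: "cont_periodic v" and c: "decay (2 * CARD('n) + 2) \<rho> (vfcoef v)" and sv: "smooth_periodic v"
  shows "norm (v x - v y) \<le> CARD('n) * (CARD('n) * (2 * pi * \<rho> * S)) * norm (x - y)"
proof (rule differentiable_bound[of UNIV v "\<lambda>x. frechet_derivative v (at x)"])
  have ve: "vser (vfcoef v) = v" by (rule vser_vfcoef[OF S c order_refl v])
  obtain K where K: "CB (Suc 0) K v" using sv unfolding smooth_periodic_def by blast
  show "(v has_derivative frechet_derivative v (at x)) (at x within UNIV)" for x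
    using CB_has_derivative[OF K] by simp
  have pdle: "\<bar>pd i v x $ a\<bar> \<le> 2 * pi * \<rho> * S" for i x a
  proof -
    have "pd i (vser (vfcoef v)) x $ a = Re (fser (dcoef (vfcoef v) i a) x)" by (rule pd_vser[OF S c order_refl])
    then have "\<bar>pd i v x $ a\<bar> \<le> cmod (fser (dcoef (vfcoef v) i a) x)" by (simp add: ve abs_Re_le_cmod)
    also have "\<dots> \<le> 2 * pi * \<rho> * S"
    proof (rule cmod_fser_le)
      show "Infinite_Sum.abs_summable_on (dcoef (vfcoef v) i a) UNIV" by (rule dcoef_summable[OF S c order_refl])
      fix E :: "(int ^ 'n) set" assume E: "finite E"
      have d: "cmod (dcoef (vfcoef v) i a n) \<le> 2 * pi * \<rho> / wt n ^ (2 * CARD('n))" for n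
      proof -
        have "cmod (dcoef (vfcoef v) i a n) \<le> 2 * pi * \<rho> / wt n ^ (2 * CARD('n) + 2 - 1)" by (rule dcoef_le[OF S c order_refl])
        also have "\<dots> \<le> 2 * pi * \<rho> / wt n ^ (2 * CARD('n))"
          using mult_left_mono[OF wt_power_le[of "2 * CARD('n)" "2 * CARD('n) + 2 - 1" n], of "2 * pi * \<rho>"] decay_nonneg[OF c] by simp
        finally show ?thesis .
      qed
      show "(\<Sum>n\<in>E. cmod (dcoef (vfcoef v) i a n)) \<le> 2 * pi * \<rho> * S"
        by (rule abs_summable_wt(2)[OF S(2) d E])
    qed
    finally show ?thesis .
  qed
  have pdn: "norm (pd i v x) \<le> CARD('n) * (2 * pi * \<rho> * S)" for i x
  proof -
    have "norm (pd i v x) \<le> (\<Sum>a\<in>UNIV. \<bar>pd i v x $ a\<bar>)" by (rule norm_le_l1_cart)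
    also have "\<dots> \<le> (\<Sum>a\<in>(UNIV :: 'n set). 2 * pi * \<rho> * S)" by (intro sum_mono pdle)
    finally show ?thesis by simp
  qed
  have nn: "0 \<le> CARD('n) * (2 * pi * \<rho> * S)" using decay_nonneg[OF c] S by simp
  show "onorm (frechet_derivative v (at z)) \<le> CARD('n) * (CARD('n) * (2 * pi * \<rho> * S))" for z
  proof (rule onorm_le)
    fix y
    have "norm (frechet_derivative v (at z) y) \<le> (\<Sum>i\<in>UNIV. norm (y $ i *\<^sub>R pd i v z))"
      using K by (subst frechet_derivative_expansion, simp) (rule norm_sum)
    also have "\<dots> \<le> (\<Sum>i\<in>(UNIV :: 'n set). norm y * (CARD('n) * (2 * pi * \<rho> * S)))"
      using pdn nn by (intro sum_mono) (auto intro!: mult_mono component_le_norm_cart)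
    finally show "norm (frechet_derivative v (at z) y) \<le> CARD('n) * (CARD('n) * (2 * pi * \<rho> * S)) * norm y"
      by (simp add: mult_ac)
  qed
qed auto

subsection \<open>Inverting a perturbation of the identity\<close>

lemma CB_recip:
  fixes u :: "real ^ 'n \<Rightarrow> real"
  assumes nz: "\<And>x. u x \<noteq> 0" and B: "\<And>x. \<bar>1 / u x\<bar> \<le> B"
  shows "CB m K u \<Longrightarrow> \<exists>L. CB m L (\<lambda>x. 1 / u x)"
proof (induction m)
  case 0
  then have "continuous_on UNIV (\<lambda>x. 1 / u x)" using nz by (auto intro!: continuous_intros)
  then show ?case using B by (auto simp del: abs_divide)
next
  case (Suc m)
  obtain L where L: "CB m L (\<lambda>x. 1 / u x)" using Suc.IH[OF CB_Suc_D[OF Suc.prems]] by blast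
  define Z where "Z = 2 ^ m * K * (2 ^ m * L * L)"
  have Z: "CB m Z (\<lambda>x. - (pd i u x * (1 / u x * (1 / u x))))" for i
    using CB_uminus[OF CB_scaleR[OF CB_pd[OF Suc.prems, of i] CB_scaleR[OF L L]]] by (simp add: Z_def)
  have "CB (Suc m) (max Z B) (\<lambda>x. 1 / u x)"
  proof (rule CB_I[where D = "\<lambda>x y. - (frechet_derivative u (at x) y * (1 / u x * (1 / u x)))"])
    show "((\<lambda>x. 1 / u x) has_derivative (\<lambda>y. - (frechet_derivative u (at x) y * (1 / u x * (1 / u x))))) (at x)" for x
      using CB_has_derivative[OF Suc.prems, of x] nz[of x]
      by (auto intro!: derivative_eq_intros simp: field_simps)
    show "norm (1 / u x) \<le> max Z B" for x using B[of x] by (simp add: max.coboundedI2)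
    show "CB m (max Z B) (\<lambda>x. - (pd i u x * (1 / u x * (1 / u x))))" for i
      by (rule CB_mono[OF Z]) simp
  qed
  then show ?case by blast
qed

lemma CB_prod_ex:
  fixes u :: "'a \<Rightarrow> real ^ 'n \<Rightarrow> real"
  shows "finite J \<Longrightarrow> (\<And>j. j \<in> J \<Longrightarrow> \<exists>K. CB m K (u j)) \<Longrightarrow> \<exists>K. CB m K (\<lambda>x. \<Prod>j\<in>J. u j x)"
proof (induction J rule: finite_induct)
  case empty
  show ?case using CB_const[of "1 :: real" 1 m] by auto
next
  case (insert j J)
  then obtain K L where "CB m K (u j)" "CB m L (\<lambda>x. \<Prod>j\<in>J. u j x)" by blast
  from CB_scaleR[OF this] show ?case using insert by auto
qed

lemma CB_sum_ex:
  assumes "finite J" "\<And>j. j \<in> J \<Longrightarrow> \<exists>K. CB m K (u j)"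
  shows "\<exists>K. CB m K (\<lambda>x. \<Sum>j\<in>J. u j x)"
proof -
  obtain K where "\<And>j. j \<in> J \<Longrightarrow> CB m (K j) (u j)" using assms(2) by metis
  then show ?thesis using CB_sum[OF assms(1)] by blast
qed

lemma CB_det_ex:
  fixes J :: "real ^ 'n \<Rightarrow> real ^ 'm ^ 'm"
  assumes "\<And>a b. \<exists>K. CB m K (\<lambda>x. J x $ a $ b)"
  shows "\<exists>K. CB m K (\<lambda>x. det (J x))"
  unfolding det_def
proof (rule CB_sum_ex)
  show "finite {p. p permutes (UNIV :: 'm set)}" by simp
  fix p :: "'m \<Rightarrow> 'm"
  obtain K where "CB m K (\<lambda>x. \<Prod>i\<in>UNIV. J x $ i $ p i)" using CB_prod_ex[of UNIV m "\<lambda>i x. J x $ i $ p i"] assms by auto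
  from CB_scaleR[OF CB_const[OF order_refl] this]
  show "\<exists>K. CB m K (\<lambda>x. of_int (sign p) * (\<Prod>i\<in>UNIV. J x $ i $ p i))" by auto
qed

text \<open>Banach's theorem gives the inverse \<open>h\<close> and the expansion bound
  \<open>inj\<close> its continuity. Its derivative is the inverse Jacobian along \<open>h\<close>,
  which Cramer's rule expresses through determinants of entries of \<open>J\<close> and
  \<open>1 / det\<close>; these operations preserve the \<open>CB\<close> classes, so regularity can
  be bootstrapped.\<close>

lemma smooth_periodic_inverse:
  fixes v :: "real ^ 'n \<Rightarrow> real ^ 'n"
  assumes v: "smooth_periodic v" and lip: "\<And>x y. norm (v x - v y) \<le> 1 / 2 * norm (x - y)"
  obtains w where "smooth_periodic w" "\<And>y. (y + w y) + v (y + w y) = y" "\<And>x. (x + v x) + w (x + v x) = x"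
proof -
  define g where "g x = x + v x" for x
  have per: "v (x + lat m) = v x" for x m using v by (simp add: smooth_periodic_def)
  have inj: "norm (x - y) \<le> 2 * norm (g x - g y)" for x y
  proof -
    have "x - y = (g x - g y) - (v x - v y)" by (simp add: g_def)
    then have "norm (x - y) \<le> norm (g x - g y) + norm (v x - v y)" by (metis norm_triangle_ineq4)
    then show ?thesis using lip[of x y] by linarith
  qed
  have "\<exists>x. g x = y" for y
  proof -
    have "\<exists>!x. y - v x = x"
    proof (rule banach_fix_type[of "1 / 2"])
      show "\<forall>x z. dist (y - v x) (y - v z) \<le> 1 / 2 * dist x z"
        using lip by (auto simp: dist_norm norm_minus_commute)
    qed auto
    then obtain x where "y - v x = x" by blast
    then have "g x = y" by (simp add: g_def algebra_simps)
    then show ?thesis by blast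
  qed
  then obtain h where gh: "\<And>y. g (h y) = y" by metis
  have hg: "h (g x) = x" for x using inj[of "h (g x)" x] by (simp add: gh)
  have hlip: "norm (h x - h y) \<le> 2 * norm (x - y)" for x y using inj[of "h x" "h y"] by (simp add: gh)
  have hc: "isCont h y" for y
    unfolding continuous_at_eps_delta
  proof (intro allI impI)
    fix e :: real assume e: "0 < e"
    have "dist (h x) (h y) < e" if "dist x y < e / 2" for x
      using hlip[of x y] that by (simp add: dist_norm)
    then show "\<exists>d>0. \<forall>x. dist x y < d \<longrightarrow> dist (h x) (h y) < e"
      using e half_gt_zero by blast
  qed
  define w where "w y = h y - y" for y
  have wv: "w y = - v (h y)" for y using gh[of y] by (simp add: w_def g_def algebra_simps)
  have hw: "h y = mat 1 *v y + w y" for y by (simp add: w_def)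
  have hper: "h (y + lat m) = h y + lat m" for y m
  proof -
    have "g (h y + lat m) = y + lat m" using gh[of y] by (simp add: g_def per[of "h y"])
    then show ?thesis using hg by metis
  qed
  define J where "J x = (\<chi> a b. (if a = b then 1 else 0) + pd b v x $ a)" for x
  have dv: "(v has_derivative frechet_derivative v (at x)) (at x)" for x
    using v CB_has_derivative unfolding smooth_periodic_def by blast
  have vdiff: "v differentiable (at x)" for x using dv by (auto simp: differentiable_def)
  have Jv: "J x *v y = y + frechet_derivative v (at x) y" for x y
  proof -
    have "(J x *v y) $ a = (\<Sum>b\<in>UNIV. (if a = b then y $ b else 0) + y $ b * pd b v x $ a)" for a
      by (auto simp: J_def matrix_vector_mult_def ring_distribs intro!: sum.cong)
    then show ?thesis
      by (subst frechet_derivative_expansion[OF vdiff]) (simp add: vec_eq_iff sum.distrib)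
  qed
  have dg: "(g has_derivative (*v) (J x)) (at x)" for x
    unfolding g_def Jv by (intro has_derivative_add has_derivative_ident dv)
  \<comment> \<open>By \<open>inj\<close>, \<open>g\<close> moves points apart by at least half
    their distance, while along a null vector of \<open>J x\<close> it would move them by at most a
    quarter at small scale.\<close>
  have Jinj: "J x *v y = 0 \<Longrightarrow> y = 0" for x y
  proof (rule ccontr)
    assume Jy: "J x *v y = 0" and y: "y \<noteq> 0"
    define e where "e = norm y / 4"
    have lin: "linear ((*v) (J x))" by simp
    have "0 < 1 / (4 :: real)" by simp
    then obtain d where d: "0 < d" "\<And>z. norm (z - x) < d \<Longrightarrow> norm (g z - g x - J x *v (z - x)) \<le> 1 / 4 * norm (z - x)"
      using dg[of x] unfolding has_derivative_at_alt by blast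
    define t where "t = d / (2 * norm y)"
    have t: "0 < t" using d y by (simp add: t_def)
    define z where "z = x + t *\<^sub>R y"
    have nz: "norm (z - x) = d / 2" using y d t by (simp add: z_def t_def)
    have "norm (g z - g x - J x *v (z - x)) \<le> 1 / 4 * norm (z - x)" using nz d by (intro d(2)) simp
    moreover have "J x *v (z - x) = 0" by (simp add: z_def matrix_vector_mult_scaleR Jy)
    ultimately have "norm (g z - g x) \<le> 1 / 4 * norm (z - x)" by simp
    then show False using inj[of z x] nz d by linarith
  qed
  have Jdet: "det (J x) \<noteq> 0" for x
  proof -
    have "invertible (J x)" unfolding invertible_left_inverse matrix_left_invertible_ker using Jinj by blast
    then show ?thesis by (simp add: invertible_det_nz)
  qed
  have JK: "\<exists>K. CB m K (\<lambda>x. J x $ a $ b)" for m a b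
  proof -
    obtain K where K: "CB (Suc m) K v" using v unfolding smooth_periodic_def by blast
    have "CB m (1 * K) (\<lambda>x. pd b v x $ a)"
      by (intro CB_linear[OF bounded_linear_vec_nth] CB_pd[OF K]) (auto simp: component_le_norm_cart)
    moreover have "CB m 1 (\<lambda>x :: real ^ 'n. if a = b then 1 else 0 :: real)" by (rule CB_const) simp
    ultimately show ?thesis using CB_add by (fastforce simp: J_def)
  qed
  have Jper: "J (x + lat m) = J x" for x m
    using periodic_pd[of v, OF per] by (simp add: J_def)
  obtain B where B: "\<And>x. \<bar>1 / det (J x)\<bar> \<le> B"
  proof -
    have "continuous_on UNIV (\<lambda>x. det (J x))" using CB_det_ex[OF JK] CB_continuous by blast
    then have "cont_periodic (\<lambda>x. 1 / det (J x))"
      using Jdet by (auto simp: cont_periodic_def Jper intro!: continuous_intros)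
    then obtain B where "\<And>x. norm (1 / det (J x)) \<le> B" using cont_periodic_bounded by blast
    then show thesis by (intro that) (simp only: real_norm_def)
  qed
  \<comment> \<open>Column \<open>b\<close> of the inverse of \<open>J (h y)\<close>, by Cramer's
    rule.\<close>
  define R where "R b y = (\<chi> k. det (\<chi> i j. if j = k then (axis b 1 :: real ^ 'n) $ i else J (h y) $ i $ j) * (1 / det (J (h y))))" for b y
  have R: "J (h y) *v R b y = axis b 1" for b y
    using cramer[OF Jdet[of "h y"], of "R b y" "axis b 1"] by (simp add: R_def)
  have "\<exists>Q. Q ** J x = mat 1" for x
    using Jdet by (simp add: invertible_left_inverse[symmetric] invertible_det_nz)
  then obtain Ji where Ji: "\<And>x. Ji x ** J x = mat 1" by metis
  have dh: "(h has_derivative (*v) (Ji (h y))) (at y)" for y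
  proof (rule has_derivative_inverse_basic[OF dg _ _ _ open_UNIV UNIV_I])
    show "(*v) (Ji (h y)) \<circ> (*v) (J (h y)) = id"
      by (auto simp: fun_eq_iff matrix_vector_mul_assoc Ji)
  qed (use hc gh in auto)
  have dhb: "Ji (h y) *v axis b 1 = R b y" for b y
    by (metis Ji R matrix_vector_mul_assoc matrix_vector_mul_lid)
  have dw: "(w has_derivative (\<lambda>z. Ji (h y) *v z - z)) (at y)" for y
    unfolding w_def[abs_def] by (intro has_derivative_diff dh has_derivative_ident)
  have wper: "w (y + lat m) = w y" for y m by (simp add: w_def hper)
  have wc: "cont_periodic w"
    using hc wper by (auto simp: cont_periodic_def w_def[abs_def] intro!: continuous_at_imp_continuous_on continuous_intros)
  obtain W where W: "\<And>y. norm (w y) \<le> W" using cont_periodic_bounded[OF wc] by blast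
  have "\<exists>K. CB m K w" for m
  proof (induction m)
    case 0
    show ?case using W cperD(1)[OF wc] by auto
  next
    \<comment> \<open>As \<open>h = id + w\<close>, a bound of order \<open>m\<close> on
      \<open>w\<close> controls \<open>J\<close> along \<open>h\<close> to order \<open>m\<close>,
      hence the derivative of \<open>w\<close>: one order is gained.\<close>
    case (Suc m)
    then obtain K where K: "CB m K w" by blast
    obtain C where C: "\<And>(u :: real ^ 'n \<Rightarrow> real) L. CB m L u \<Longrightarrow> CB m (C * L) (\<lambda>y. u (mat 1 *v y + w y))"
      using CB_comp_affine[OF CB_nonneg[OF K], of m "mat 1"] K by metis
    have JhK: "\<exists>K. CB m K (\<lambda>y. J (h y) $ a $ b)" for a b
      using JK[of m a b] C unfolding hw by blast
    have "\<exists>K. CB m K (\<lambda>y. 1 / det (J (h y)))"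
      using CB_det_ex[OF JhK] CB_recip[of "\<lambda>y. det (J (h y))" B] Jdet B by blast
    then obtain L where L: "CB m L (\<lambda>y. 1 / det (J (h y)))" by blast
    have RK: "\<exists>K. CB m K (R b)" for b
    proof -
      have "\<exists>K. CB m K (\<lambda>y. R b y $ k)" for k
      proof -
        have "\<exists>K. CB m K (\<lambda>y. (\<chi> i j. if j = k then (axis b 1 :: real ^ 'n) $ i else J (h y) $ i $ j) $ i $ j)" for i j
          using JhK[of i j] CB_const[OF order_refl, of m "(axis b 1 :: real ^ 'n) $ i"] by (cases "j = k") auto
        then obtain K where "CB m K (\<lambda>y. det (\<chi> i j. if j = k then (axis b 1 :: real ^ 'n) $ i else J (h y) $ i $ j))"
          using CB_det_ex[where J = "\<lambda>y. \<chi> i j. if j = k then (axis b 1 :: real ^ 'n) $ i else J (h y) $ i $ j"] by blast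
        from CB_scaleR[OF this L] show ?thesis by (auto simp: R_def)
      qed
      then obtain K where K: "\<And>k. CB m (K k) (\<lambda>y. R b y $ k)" by metis
      have "CB m (\<Sum>k\<in>UNIV. 1 * K k) (\<lambda>y. \<Sum>k\<in>UNIV. R b y $ k *\<^sub>R (axis k 1 :: real ^ 'n))"
        by (intro CB_sum CB_linear[OF bounded_linear_scaleR_left _ _ K]) auto
      moreover have "(\<Sum>k\<in>UNIV. R b y $ k *\<^sub>R (axis k 1 :: real ^ 'n)) = R b y" for y
        using basis_expansion[of "R b y"] by (simp add: scalar_mult_eq_scaleR)
      ultimately show ?thesis by auto
    qed
    then obtain Q where Q: "\<And>b. CB m (Q b) (R b)" by metis
    define T where "T = W + (\<Sum>b\<in>UNIV. Q b + 1)"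
    have T: "W \<le> T" "Q b + 1 \<le> T" for b
    proof -
      have 0: "0 \<le> Q b + 1" for b using CB_nonneg[OF Q[of b]] by simp
      have "Q b + 1 \<le> (\<Sum>b\<in>UNIV. Q b + 1)" using 0 by (intro member_le_sum) auto
      moreover have "0 \<le> W" using W[of 0] norm_ge_zero order_trans by blast
      moreover have "0 \<le> (\<Sum>b\<in>UNIV. Q b + 1)" using 0 by (intro sum_nonneg) auto
      ultimately show "W \<le> T" "Q b + 1 \<le> T" by (auto simp: T_def)
    qed
    have "CB (Suc m) T w"
    proof (rule CB_I[OF dw])
      show "norm (w x) \<le> T" for x using W[of x] T(1) by linarith
      fix b
      have "CB m (Q b + 1) (\<lambda>y. R b y + (- axis b 1))" by (intro CB_add Q CB_const) simp
      then have "CB m T (\<lambda>y. R b y + (- axis b 1))" by (rule CB_mono) (rule T)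
      then show "CB m T (\<lambda>y. Ji (h y) *v axis b 1 - axis b 1)" by (simp add: dhb)
    qed
    then show ?case by blast
  qed
  then have sw: "smooth_periodic w" using wper by (simp add: smooth_periodic_def)
  show thesis
  proof (rule that[OF sw])
    show "(y + w y) + v (y + w y) = y" for y using gh[of y] by (simp add: w_def g_def)
    show "(x + v x) + w (x + v x) = x" for x using hg[of x] by (simp add: w_def g_def)
  qed
qed

subsection \<open>Conjugating the perturbed action\<close>

lemma torus_eqI:
  assumes "\<And>x. \<phi> (torus_proj x) = \<psi> (torus_proj x)" shows "\<phi> = \<psi>"
  using assms by (metis ext torus_proj_rep)

lemma torus_aut_mult: "torus_aut (B ** C) = torus_aut B \<circ> torus_aut C"
  by (rule torus_eqI) (simp add: torus_aut_proj rmat_mult matrix_vector_mul_assoc)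

lemma torus_aut_one: "torus_aut (mat 1) = id"
  by (rule torus_eqI) (simp add: torus_aut_proj)

lemma smooth_periodic_descends:
  fixes v :: "real ^ 'n \<Rightarrow> real ^ 'n"
  assumes v: "smooth_periodic v"
  obtains h where "torus_Ck \<infinity> h" "\<And>x. h (torus_proj x) = torus_proj (x + v x)"
proof -
  define h where "h p = torus_proj (torus_rep p + v (torus_rep p))" for p
  have h: "h (torus_proj x) = torus_proj (x + v x)" for x
  proof -
    have "torus_proj (torus_rep (torus_proj x)) = torus_proj x" by simp
    then obtain m where m: "torus_rep (torus_proj x) = x + lat m" unfolding torus_proj_eq_iff by blast
    have "v (x + lat m) = v x" using v unfolding smooth_periodic_def by blast
    then have "h (torus_proj x) = torus_proj ((x + v x) + lat m)" by (simp add: h_def m add_ac)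
    then show ?thesis by simp
  qed
  have "torus_Ck \<infinity> h"
    unfolding torus_Ck_def
  proof
    fix p
    have "local_lift h UNIV (\<lambda>x. mat 1 *v x + v x)" by (simp add: local_lift_def h)
    then show "\<exists>U F. open U \<and> p \<in> U \<and> local_lift h U F \<and> Ck_on \<infinity> F U"
      using smooth_periodic_Ck_affine[OF v] open_UNIV UNIV_I by blast
  qed
  then show thesis using h by (rule that)
qed

lemma smooth_periodic_diffeo:
  fixes v w :: "real ^ 'n \<Rightarrow> real ^ 'n"
  assumes v: "smooth_periodic v" and w: "smooth_periodic w"
    and vw: "\<And>y. (y + w y) + v (y + w y) = y" and wv: "\<And>x. (x + v x) + w (x + v x) = x"
  obtains h where "torus_diffeo \<infinity> h" "\<And>x. h (torus_proj x) = torus_proj (x + v x)"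
proof -
  obtain h where h: "torus_Ck \<infinity> h" "\<And>x. h (torus_proj x) = torus_proj (x + v x)"
    by (rule smooth_periodic_descends[OF v]) blast
  obtain h' where h': "torus_Ck \<infinity> h'" "\<And>x. h' (torus_proj x) = torus_proj (x + w x)"
    by (rule smooth_periodic_descends[OF w]) blast
  have 1: "h' \<circ> h = id" by (rule torus_eqI) (simp add: h h' wv)
  have 2: "h \<circ> h' = id" by (rule torus_eqI) (simp add: h h' vw)
  have "bij h" by (rule o_bij[OF 1 2])
  moreover have "inv_into UNIV h = h'" by (rule inv_unique_comp[OF 2 1])
  ultimately have "torus_diffeo \<infinity> h" using h(1) h'(1) by (simp add: torus_diffeo_def)
  then show thesis using h(2) by (rule that)
qed

text \<open>The two sides differ by a lattice vector, which is small, hence zero.\<close>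

lemma lifts_commute:
  fixes A C :: "int ^ 'n ^ 'n" and b \<delta> :: real
  assumes \<phi>: "lifts \<phi> A fA" and \<psi>: "lifts \<psi> C fC" and com: "\<phi> \<circ> \<psi> = \<psi> \<circ> \<phi>" and AC: "A ** C = C ** A"
    and fA: "\<And>x. norm (fA x) \<le> \<delta>" and fC: "\<And>x. norm (fC x) \<le> \<delta>"
    and b: "0 \<le> b" "\<And>y. norm (rmat A *v y) \<le> b * norm y" "\<And>y. norm (rmat C *v y) \<le> b * norm y"
    and small: "(2 * b + 2) * \<delta> < 1"
  shows "rmat A *v (rmat C *v x + fC x) + fA (rmat C *v x + fC x) = rmat C *v (rmat A *v x + fA x) + fC (rmat A *v x + fA x)"
    (is "?L = ?R")
proof -
  have "torus_proj ?L = \<phi> (\<psi> (torus_proj x))" using \<phi> \<psi> by (simp add: lifts_def)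
  also have "\<dots> = \<psi> (\<phi> (torus_proj x))" using fun_cong[OF com] by simp
  also have "\<dots> = torus_proj ?R" using \<phi> \<psi> by (simp add: lifts_def)
  finally obtain m where m: "?L = ?R + lat m" unfolding torus_proj_eq_iff by blast
  have "rmat A *v (rmat C *v x) = rmat C *v (rmat A *v x)"
    by (simp add: matrix_vector_mul_assoc rmat_mult[symmetric] AC)
  then have "lat m = (rmat A *v fC x + fA (rmat C *v x + fC x)) - (rmat C *v fA x + fC (rmat A *v x + fA x))"
    using m by (simp add: matrix_vector_right_distrib algebra_simps)
  then have "norm (lat m) \<le> (norm (rmat A *v fC x) + norm (fA (rmat C *v x + fC x))) + (norm (rmat C *v fA x) + norm (fC (rmat A *v x + fA x)))"
    by (simp only:) (intro order_trans[OF norm_triangle_ineq4] add_mono norm_triangle_ineq)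
  also have "\<dots> \<le> (b * \<delta> + \<delta>) + (b * \<delta> + \<delta>)"
    using fA fC b(1) by (intro add_mono order_trans[OF b(2)] order_trans[OF b(3)] mult_left_mono) auto
  also have "\<dots> = (2 * b + 2) * \<delta>" by (simp add: algebra_simps)
  finally have "norm (lat m) < 1" using small by linarith
  then have "m = 0" by (rule lat_small)
  then show ?thesis using m by (simp add: lat_simps)
qed

lemma int_matrix_scale:
  fixes B :: "int ^ 'n ^ 'm"
  shows "B *v (t *s m) = t *s (B *v m)"
  by (simp add: vec_eq_iff matrix_vector_mult_def sum_distrib_left mult_ac)

lemma shear_add:
  assumes "N ** N = 0" shows "shear s N ** shear t N = shear (s + t) N"
proof -
  have "N *v (N *v m) = 0" for m using assms by (simp add: matrix_vector_mul_assoc)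
  then show ?thesis
    unfolding matrix_eq
    by (simp add: matrix_vector_mul_assoc[symmetric] shear_mult matrix_vector_right_distrib int_matrix_scale
        vector_sadd_rdistrib add_ac)
qed

lemma shear_0 [simp]: "shear 0 N = mat 1"
  unfolding matrix_eq by (simp add: shear_mult vec_eq_iff)

lemma shear_1: "shear 1 (B - mat 1) = B"
  unfolding matrix_eq by (simp add: shear_mult matrix_vector_mult_diff_rdistrib vec_eq_iff)

lemma shear_commute:
  assumes "A ** N = N ** A" shows "A ** shear t N = shear t N ** A"
proof -
  have "A *v (N *v m) = N *v (A *v m)" for m using assms by (simp add: matrix_vector_mul_assoc)
  then show ?thesis
    unfolding matrix_eq
    by (simp add: matrix_vector_mul_assoc[symmetric] shear_mult matrix_vector_right_distrib int_matrix_scale)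
qed

lemma sum_matrix_vector: "(\<Sum>i\<in>I. Q i) *v d = (\<Sum>i\<in>I. Q i *v d)"
  by (induction I rule: infinite_finite_induct) (simp_all add: matrix_vector_mult_add_rdistrib)

text \<open>The order of the quantifiers matters: \<open>k\<close> and \<delta> depend on the
  matrices only, so the group elements whose lifts must be small are known before the perturbation.
  Equivariance is stated for every commuting \<open>C\<close> with a commuting lift, which later
  covers all generators at once.\<close>

theorem smooth_conjugacy:
  fixes A A' :: "int ^ 'n ^ 'n" and I :: "nat set"
  assumes A': "A' ** A = mat 1" and nondeg: "\<And>m. 0 < m \<Longrightarrow> det (mpow A m - mat 1) \<noteq> 0"
    and I: "finite I" and NN: "\<And>i. i \<in> I \<Longrightarrow> Nm i ** Nm i = 0"
    and AN: "\<And>i. i \<in> I \<Longrightarrow> A ** Nm i = Nm i ** A"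
    and ker: "\<And>d. (\<And>i. i \<in> I \<Longrightarrow> rmat (Nm i) *v d = 0) \<Longrightarrow> d = 0"
  obtains k :: nat and \<delta> :: real where "0 < k" "0 < \<delta>"
    "\<And>fA f. smooth_periodic fA \<Longrightarrow>
      (\<And>i s. i \<in> I \<Longrightarrow> s = 1 \<or> s = - 1 \<Longrightarrow> smooth_periodic (f i s) \<and> CB (2 * CARD('n) + 2) \<delta> (f i s)) \<Longrightarrow>
      (\<And>i s x. i \<in> I \<Longrightarrow> s = 1 \<or> s = - 1 \<Longrightarrow>
         rmat A *v (rmat (shear (s * int k) (Nm i)) *v x + f i s x) + fA (rmat (shear (s * int k) (Nm i)) *v x + f i s x)
         = rmat (shear (s * int k) (Nm i)) *v (rmat A *v x + fA x) + f i s (rmat A *v x + fA x)) \<Longrightarrow>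
      \<exists>v w. smooth_periodic v \<and> smooth_periodic w \<and> (\<forall>y. (y + w y) + v (y + w y) = y) \<and> (\<forall>x. (x + v x) + w (x + v x) = x) \<and>
        (\<forall>C fC x. cont_periodic fC \<longrightarrow> A ** C = C ** A \<longrightarrow>
           (\<forall>x. rmat A *v (rmat C *v x + fC x) + fA (rmat C *v x + fC x) = rmat C *v (rmat A *v x + fA x) + fC (rmat A *v x + fA x)) \<longrightarrow>
           rmat C *v (x + v x) + fC (x + v x) = rmat C *v x + v (rmat C *v x))"
proof -
  obtain S where S: "1 \<le> S" "\<And>E :: (int ^ 'n) set. finite E \<Longrightarrow> (\<Sum>n\<in>E. 1 / wt n ^ (2 * CARD('n))) \<le> S"
    by (rule wt_sum_bounded) blast
  define L where "L = CARD('n) * (CARD('n) * (2 * pi * S))"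
  have L: "0 < L" using S(1) by (simp add: L_def)
  \<comment> \<open>\<open>L * \<rho>\<close> is the Lipschitz constant of \<open>v\<close>; a value
    of at most 1/2 makes \<open>id + v\<close> invertible.\<close>
  define \<rho> where "\<rho> = min 1 (1 / (2 * L))"
  have \<rho>: "0 < \<rho>" "\<rho> \<le> 1" "L * \<rho> \<le> 1 / 2"
  proof -
    show "0 < \<rho>" "\<rho> \<le> 1" using L by (auto simp: \<rho>_def)
    have "L * \<rho> \<le> L * (1 / (2 * L))" using L by (intro mult_left_mono) (auto simp: \<rho>_def)
    then show "L * \<rho> \<le> 1 / 2" using L by simp
  qed
  obtain \<kappa> where \<kappa>: "0 < \<kappa>"
    "\<And>(I :: nat set) (Nm :: nat \<Rightarrow> int ^ 'n ^ 'n) (M :: nat \<Rightarrow> real ^ 'n ^ 'n) (k :: nat) (\<mu> :: real) (f :: nat \<Rightarrow> int \<Rightarrow> real ^ 'n \<Rightarrow> real ^ 'n) v.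
      finite I \<Longrightarrow> 0 < k \<Longrightarrow> (\<And>i. i \<in> I \<Longrightarrow> Nm i ** Nm i = 0) \<Longrightarrow> (\<Sum>i\<in>I. M i ** rmat (Nm i)) = mat 1 \<Longrightarrow>
      0 \<le> \<mu> \<Longrightarrow> (\<And>i z. i \<in> I \<Longrightarrow> norm (cmat (M i) *v z) \<le> \<mu> * norm z) \<Longrightarrow> card I * \<mu> / real k * 9 * CARD('n) \<le> 1 \<Longrightarrow>
      (\<And>i s. i \<in> I \<Longrightarrow> s = 1 \<or> s = - 1 \<Longrightarrow> smooth_periodic (f i s) \<and> CB (2 * CARD('n) + 2) \<kappa> (f i s)) \<Longrightarrow> cont_periodic v \<Longrightarrow>
      (\<And>i s x. i \<in> I \<Longrightarrow> s = 1 \<or> s = - 1 \<Longrightarrow> v (rmat (shear (s * int k) (Nm i)) *v x) = rmat (shear (s * int k) (Nm i)) *v v x + f i s (x + v x)) \<Longrightarrow>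
      decay (2 * CARD('n) + 2) \<rho> (vfcoef v) \<and> (\<forall>s. \<exists>K. decay s K (vfcoef v))"
    by (rule conjugacy_decay[OF \<rho>(1,2), where 'i = nat]) blast
  obtain M where M: "\<And>d. (\<Sum>i\<in>I. M i *v (rmat (Nm i) *v d)) = d"
  proof (rule gram_left_inverse[where N = "\<lambda>i. rmat (Nm i)", OF I ker])
    fix M assume "\<And>d. (\<Sum>i\<in>I. M i *v (rmat (Nm i) *v d)) = d"
    then show thesis by (rule that)
  qed
  have M1: "(\<Sum>i\<in>I. M i ** rmat (Nm i)) = mat 1"
    unfolding matrix_eq using M by (simp add: sum_matrix_vector matrix_vector_mul_assoc[symmetric])
  \<comment> \<open>The real bound is used for the periodic points, the complexified one for the
    Fourier coefficients.\<close>
  have "\<exists>b\<ge>0. (\<forall>y. norm (M i *v y) \<le> b * norm y) \<and> (\<forall>z. norm (cmat (M i) *v z) \<le> b * norm z)" for i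
  proof -
    obtain b where b: "0 \<le> b" "\<And>y. norm (M i *v y) \<le> b * norm y" by (rule matrix_vector_bound) blast
    obtain b' where b': "0 \<le> b'" "\<And>z. norm (cmat (M i) *v z) \<le> b' * norm z" by (rule cmat_bound) blast
    have "norm (M i *v y) \<le> (b + b') * norm y" for y
      using b(2)[of y] b'(1) by (simp add: distrib_right add_increasing2)
    moreover have "norm (cmat (M i) *v z) \<le> (b + b') * norm z" for z
      using b'(2)[of z] b(1) by (simp add: distrib_right add_increasing)
    ultimately show ?thesis using b(1) b'(1) by (intro exI[of _ "b + b'"]) auto
  qed
  then obtain \<mu>' where \<mu>': "\<And>i. 0 \<le> \<mu>' i" "\<And>i y. norm (M i *v y) \<le> \<mu>' i * norm y" "\<And>i z. norm (cmat (M i) *v z) \<le> \<mu>' i * norm z"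
    by metis
  define \<mu> where "\<mu> = sum \<mu>' I"
  have \<mu>0: "0 \<le> \<mu>" using \<mu>'(1) by (simp add: \<mu>_def sum_nonneg)
  have \<mu>: "norm (M i *v y) \<le> \<mu> * norm y" "norm (cmat (M i) *v z) \<le> \<mu> * norm z" if "i \<in> I" for i y z
  proof -
    have "\<mu>' i \<le> \<mu>" unfolding \<mu>_def using I that \<mu>'(1) by (intro member_le_sum) auto
    then show "norm (M i *v y) \<le> \<mu> * norm y" "norm (cmat (M i) *v z) \<le> \<mu> * norm z"
      using \<mu>'(2)[of i y] \<mu>'(3)[of i z] by (meson mult_right_mono norm_ge_zero order_trans)+
  qed
  define Z where "Z = card I * \<mu>"
  have Z: "0 \<le> Z" using \<mu>0 by (simp add: Z_def)
  \<comment> \<open>The summand with 9 is the contraction condition on Fourier coefficients, the one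
    with 4 the condition \<open>card I * c \<le> 1 / 4\<close> for periodic points.\<close>
  obtain k :: nat where k: "Z * 9 * CARD('n) + Z * 4 + 1 < real k" using reals_Archimedean2 by blast
  have Zn: "0 \<le> Z * 9 * CARD('n)" using Z by simp
  have rk: "0 < real k" using k Z Zn by linarith
  then have k0: "0 < k" by simp
  have k9: "card I * \<mu> / real k * 9 * CARD('n) \<le> 1"
  proof -
    have "Z * 9 * CARD('n) / real k \<le> 1" using k Z rk by simp
    then show ?thesis by (simp add: Z_def)
  qed
  have k4: "card I * (\<mu> / real k) \<le> 1 / 4"
  proof -
    have "Z * 4 \<le> real k" using k Zn by linarith
    then have "Z / real k \<le> 1 / 4" using rk by (simp add: field_simps)
    then show ?thesis by (simp add: Z_def)
  qed
  \<comment> \<open>\<kappa> serves the regularity theorem; \<open>1 / CARD('n)\<close> makes the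
    \<open>f i 1\<close> 1-Lipschitz.\<close>
  define \<delta> where "\<delta> = min \<kappa> (1 / CARD('n))"
  have \<delta>: "0 < \<delta>" "\<delta> \<le> \<kappa>" "CARD('n) * \<delta> \<le> 1"
    using \<kappa>(1) by (auto simp: \<delta>_def min_def field_simps)
  define P where "P i = (1 / real k) *\<^sub>R M i" for i
  have P1: "(\<Sum>i\<in>I. P i *v (rmat (shear (int k) (Nm i)) *v d - d)) = d" for d
  proof -
    have "P i *v (rmat (shear (int k) (Nm i)) *v d - d) = M i *v (rmat (Nm i) *v d)" for i
      using rk by (simp add: P_def rmat_shear scaleR_matrix_vector_assoc[symmetric] matrix_vector_mult_scaleR)
    then show ?thesis using M by simp
  qed
  have P2: "norm (P i *v y) \<le> \<mu> / real k * norm y" if "i \<in> I" for i y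
    using \<mu>(1)[OF that, of y] rk by (simp add: P_def scaleR_matrix_vector_assoc[symmetric] divide_right_mono)
  show thesis
  proof (rule that[OF k0 \<delta>(1)])
    fix fA :: "real ^ 'n \<Rightarrow> real ^ 'n" and f :: "nat \<Rightarrow> int \<Rightarrow> real ^ 'n \<Rightarrow> real ^ 'n"
    assume fA: "smooth_periodic fA"
      and f: "\<And>i s. i \<in> I \<Longrightarrow> s = 1 \<or> s = - 1 \<Longrightarrow> smooth_periodic (f i s) \<and> CB (2 * CARD('n) + 2) \<delta> (f i s)"
      and comm: "\<And>i s x. i \<in> I \<Longrightarrow> s = 1 \<or> s = - 1 \<Longrightarrow>
         rmat A *v (rmat (shear (s * int k) (Nm i)) *v x + f i s x) + fA (rmat (shear (s * int k) (Nm i)) *v x + f i s x)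
         = rmat (shear (s * int k) (Nm i)) *v (rmat A *v x + fA x) + f i s (rmat A *v x + fA x)"
    have f1: "smooth_periodic (f i 1)" "CB (Suc (2 * CARD('n) + 1)) \<delta> (f i 1)" if "i \<in> I" for i
      using f[OF that, of 1] by auto
    have AB: "A ** shear t (Nm i) = shear t (Nm i) ** A" if "i \<in> I" for t i
      by (rule shear_commute[OF AN[OF that]])
    have lip1: "norm (f i 1 x - f i 1 y) \<le> norm (x - y)" if "i \<in> I" for i x y
    proof -
      have "norm (f i 1 x - f i 1 y) \<le> CARD('n) * \<delta> * norm (x - y)" by (rule CB_lipschitz[OF f1(2)[OF that]])
      also have "\<dots> \<le> 1 * norm (x - y)" by (intro mult_right_mono \<delta>(3)) simp
      finally show ?thesis by simp
    qed
    have comm1: "rmat A *v (rmat (shear (int k) (Nm i)) *v x + f i 1 x) + fA (rmat (shear (int k) (Nm i)) *v x + f i 1 x)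
         = rmat (shear (int k) (Nm i)) *v (rmat A *v x + fA x) + f i 1 (rmat A *v x + fA x)" if "i \<in> I" for i x
      using comm[OF that, of 1 x] by simp
    obtain g where g: "continuous_on UNIV g" "\<And>x m. g (x + lat m) = g x + lat m"
      "\<And>C fC x. cont_periodic fC \<Longrightarrow> A ** C = C ** A \<Longrightarrow>
       (\<And>x. rmat A *v (rmat C *v x + fC x) + fA (rmat C *v x + fC x) = rmat C *v (rmat A *v x + fA x) + fC (rmat A *v x + fA x)) \<Longrightarrow>
       rmat C *v g x + fC (g x) = g (rmat C *v x)"
    proof (rule topological_conjugacy[where A = A and fA = fA and I = I and B = "\<lambda>i. shear (int k) (Nm i)" and f = "\<lambda>i. f i 1"
          and P = P and c = "\<mu> / real k" and \<eta> = \<delta>, OF A' nondeg smooth_periodic_cont_periodic[OF fA] I])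
      show "norm (f i 1 x) \<le> \<delta>" if "i \<in> I" for i x by (rule CB_bound[OF f1(2)[OF that]])
      show "0 \<le> \<mu> / real k" using \<mu>0 by simp
      show "0 \<le> \<delta>" using \<delta>(1) by simp
      show "A ** shear (int k) (Nm i) = shear (int k) (Nm i) ** A" if "i \<in> I" for i by (rule AB[OF that])
      show "cont_periodic (f i 1)" if "i \<in> I" for i by (rule smooth_periodic_cont_periodic[OF f1(1)[OF that]])
      show "norm (f i 1 x - f i 1 y) \<le> norm (x - y)" if "i \<in> I" for i x y by (rule lip1[OF that])
      show "norm (P i *v y) \<le> \<mu> / real k * norm y" if "i \<in> I" for i y by (rule P2[OF that])
      show "rmat A *v (rmat (shear (int k) (Nm i)) *v x + f i 1 x) + fA (rmat (shear (int k) (Nm i)) *v x + f i 1 x)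
         = rmat (shear (int k) (Nm i)) *v (rmat A *v x + fA x) + f i 1 (rmat A *v x + fA x)" if "i \<in> I" for i x
        by (rule comm1[OF that])
    qed (use P1 k4 that in blast)+
    define v where "v x = g x - x" for x
    have gv: "g x = x + v x" for x by (simp add: v_def)
    have v: "cont_periodic v"
      using g(1,2) by (auto simp: cont_periodic_def v_def[abs_def] intro!: continuous_intros)
    have veq: "rmat C *v (x + v x) + fC (x + v x) = rmat C *v x + v (rmat C *v x)"
      if "cont_periodic fC" "A ** C = C ** A"
        "\<And>x. rmat A *v (rmat C *v x + fC x) + fA (rmat C *v x + fC x) = rmat C *v (rmat A *v x + fA x) + fC (rmat A *v x + fA x)"
      for C fC x
      using g(3)[OF that] by (simp add: gv)
    have "decay (2 * CARD('n) + 2) \<rho> (vfcoef v) \<and> (\<forall>s. \<exists>K. decay s K (vfcoef v))"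
    proof (rule \<kappa>(2)[OF I k0 NN M1 \<mu>0 \<mu>(2) k9 _ v, where f = f])
      fix i s assume i: "i \<in> I" and s: "s = 1 \<or> s = (- 1 :: int)"
      note fi = f[OF i s]
      show "smooth_periodic (f i s) \<and> CB (2 * CARD('n) + 2) \<kappa> (f i s)" using fi CB_mono \<delta>(2) by blast
      show "v (rmat (shear (s * int k) (Nm i)) *v x) = rmat (shear (s * int k) (Nm i)) *v v x + f i s (x + v x)" for x
        using veq[OF smooth_periodic_cont_periodic[OF conjunct1[OF fi]] AB[OF i] comm[OF i s], of x]
        by (simp add: matrix_vector_right_distrib add.assoc)
    qed
    then have d: "decay (2 * CARD('n) + 2) \<rho> (vfcoef v)" "\<And>s. \<exists>K. decay s K (vfcoef v)" by auto
    have sv: "smooth_periodic v" by (rule smooth_periodic_of_decay[OF v d(2)])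
    have lip: "norm (v x - v y) \<le> 1 / 2 * norm (x - y)" for x y
    proof -
      have "norm (v x - v y) \<le> CARD('n) * (CARD('n) * (2 * pi * \<rho> * S)) * norm (x - y)"
        by (rule lipschitz_of_decay[OF S v d(1) sv])
      also have "\<dots> = L * \<rho> * norm (x - y)" by (simp add: L_def)
      also have "\<dots> \<le> 1 / 2 * norm (x - y)" by (intro mult_right_mono \<rho>(3)) simp
      finally show ?thesis .
    qed
    obtain w where "smooth_periodic w" "\<And>y. (y + w y) + v (y + w y) = y" "\<And>x. (x + v x) + w (x + v x) = x"
      by (rule smooth_periodic_inverse[OF sv lip]) blast
    then show "\<exists>v w. smooth_periodic v \<and> smooth_periodic w \<and> (\<forall>y. (y + w y) + v (y + w y) = y) \<and> (\<forall>x. (x + v x) + w (x + v x) = x) \<and>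
        (\<forall>C fC x. cont_periodic fC \<longrightarrow> A ** C = C ** A \<longrightarrow>
           (\<forall>x. rmat A *v (rmat C *v x + fC x) + fA (rmat C *v x + fC x) = rmat C *v (rmat A *v x + fA x) + fC (rmat A *v x + fA x)) \<longrightarrow>
           rmat C *v (x + v x) + fC (x + v x) = rmat C *v x + v (rmat C *v x))"
      using sv veq by (intro exI[of _ v] exI[of _ w]) blast
  qed
qed

section \<open>The generated group and the final assembly\<close>

lemma GLZ_simps [simp]: "mult GLZ = (**)" "one GLZ = mat 1" "carrier GLZ = {A. det A = 1 \<or> det A = - 1}"
  by (simp_all add: GLZ_def)

text \<open>\<open>generate GLZ\<close> adjoins inverses formed in \<open>GLZ\<close>; this
  identifies them with inverses found in the generated group.\<close>

lemma GLZ_inverse: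
  fixes B C :: "int ^ 'n ^ 'n"
  assumes "C ** B = mat 1" "B ** C = mat 1"
  shows "inv\<^bsub>GLZ\<^esub> B = C"
  unfolding m_inv_def
proof (rule the_equality)
  have "det C * det B = 1" using assms(1) by (metis det_I det_mul)
  then have "det C = 1 \<or> det C = - 1" by (auto simp: zmult_eq_1_iff)
  then show "C \<in> carrier GLZ \<and> B \<otimes>\<^bsub>GLZ\<^esub> C = \<one>\<^bsub>GLZ\<^esub> \<and> C \<otimes>\<^bsub>GLZ\<^esub> B = \<one>\<^bsub>GLZ\<^esub>" using assms by simp
  fix D assume "D \<in> carrier GLZ \<and> B \<otimes>\<^bsub>GLZ\<^esub> D = \<one>\<^bsub>GLZ\<^esub> \<and> D \<otimes>\<^bsub>GLZ\<^esub> B = \<one>\<^bsub>GLZ\<^esub>"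
  then have "B ** D = mat 1" by simp
  then show "D = C" using assms(1) by (metis matrix_mul_assoc matrix_mul_lid matrix_mul_rid)
qed

text \<open>The elements intertwined by \<open>h\<close> are closed under products and inverses, so
  it is enough to treat the generators.\<close>

lemma conjugacy_generate:
  fixes T :: "(int ^ 'n ^ 'n) set"
  defines "X \<equiv> generate GLZ T"
  assumes H: "group (GLZ\<lparr>carrier := X\<rparr>)" and \<beta>: "Ck_action k (GLZ\<lparr>carrier := X\<rparr>) \<beta>"
    and T: "\<And>g. g \<in> T \<Longrightarrow> \<beta> g \<circ> h = h \<circ> torus_aut g" and g: "g \<in> X"
  shows "\<beta> g \<circ> h = h \<circ> torus_aut g"
proof -
  interpret H: group "GLZ\<lparr>carrier := X\<rparr>" by fact
  have "g \<in> generate GLZ T" using g by (simp add: X_def)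
  then show ?thesis
  proof (induction rule: generate.induct)
    case one
    show ?case using Ck_action_one[OF \<beta>] by (simp add: torus_aut_one)
  next
    case (incl g)
    then show ?case by (rule T)
  next
    case (inv g)
    define y where "y = inv\<^bsub>GLZ\<lparr>carrier := X\<rparr>\<^esub> g"
    have gX: "g \<in> X" using inv by (auto simp: X_def intro: generate.incl)
    have yX: "y \<in> X" using H.inv_closed[of g] gX by (simp add: y_def)
    have y: "y ** g = mat 1" "g ** y = mat 1" using H.l_inv[of g] H.r_inv[of g] gX by (auto simp: y_def)
    have "torus_aut g \<circ> torus_aut y = id" using y by (simp add: torus_aut_mult[symmetric] torus_aut_one)
    then have "\<beta> y \<circ> h = \<beta> y \<circ> (h \<circ> torus_aut g) \<circ> torus_aut y" by (simp add: comp_assoc)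
    also have "\<dots> = (\<beta> y \<circ> \<beta> g) \<circ> h \<circ> torus_aut y" by (simp add: T[OF inv, symmetric] comp_assoc)
    also have "\<beta> y \<circ> \<beta> g = id" using Ck_action_mult[OF \<beta> yX gX] Ck_action_one[OF \<beta>] y by simp
    finally show ?case by (simp add: GLZ_inverse[OF y])
  next
    case (eng g1 g2)
    have "\<beta> (g1 ** g2) = \<beta> g1 \<circ> \<beta> g2" using eng by (intro Ck_action_mult[OF \<beta>]) (auto simp: X_def)
    then have "\<beta> (g1 ** g2) \<circ> h = \<beta> g1 \<circ> (\<beta> g2 \<circ> h)" by (simp add: comp_assoc)
    also have "\<dots> = (\<beta> g1 \<circ> h) \<circ> torus_aut g2" by (metis eng.IH(2) comp_assoc)
    also have "\<dots> = h \<circ> torus_aut (g1 ** g2)" by (metis eng.IH(1) torus_aut_mult comp_assoc)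
    finally show ?case by simp
  qed
qed

text \<open>These are the powers of \<open>1 + N\<close> with exponents \<open>k\<close> and
  \<open>- k\<close>.\<close>

lemma shear_in_generate:
  fixes T :: "(int ^ 'n ^ 'n) set"
  defines "X \<equiv> generate GLZ T"
  assumes H: "group (GLZ\<lparr>carrier := X\<rparr>)" and B: "shear 1 N \<in> T" and N: "N ** N = 0"
  shows "shear (int k) N \<in> X" "shear (- int k) N \<in> X"
proof -
  interpret H: group "GLZ\<lparr>carrier := X\<rparr>" by fact
  have 1: "shear (int k) N \<in> X" for k
  proof (induction k)
    case 0
    show ?case using H.one_closed by simp
  next
    case (Suc k)
    have "shear 1 N \<in> X" using B by (auto simp: X_def intro: generate.incl)
    then have "shear 1 N ** shear (int k) N \<in> X" using H.m_closed[of "shear 1 N" "shear (int k) N"] Suc by simp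
    then show ?case by (simp add: shear_add[OF N])
  qed
  show "shear (int k) N \<in> X" by (rule 1)
  define y where "y = inv\<^bsub>GLZ\<lparr>carrier := X\<rparr>\<^esub> shear (int k) N"
  have yX: "y \<in> X" using H.inv_closed[of "shear (int k) N"] 1 by (simp add: y_def)
  have "y ** shear (int k) N = mat 1" using H.l_inv[of "shear (int k) N"] 1 by (simp add: y_def)
  moreover have "shear (int k) N ** shear (- int k) N = mat 1" by (simp add: shear_add[OF N])
  ultimately have "y = shear (- int k) N" by (metis matrix_mul_assoc matrix_mul_lid matrix_mul_rid)
  then show "shear (- int k) N \<in> X" using yX by simp
qed

theorem theorem1p4:
  fixes A :: "nat \<Rightarrow> int ^ 'n ^ 'n" and n :: nat
  assumes "ergodic_matrix (A 1)"
    and "\<And>i. i \<in> {2..n} \<Longrightarrow> A i \<in> carrier GLZ"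
    and "\<And>i. i \<in> {2..n} \<Longrightarrow> unipotent (A i)"
    and "\<And>i. i \<in> {2..n} \<Longrightarrow> A 1 ** A i = A i ** A 1"
    and "\<And>i. i \<in> {2..n} \<Longrightarrow> (A i - mat 1) ** (A i - mat 1) = 0"
    and "(\<Inter>i\<in>{2..n}. p1 (A i)) = {0}"
  shows "\<exists>l::nat. locally_rigid \<infinity> l \<infinity>
           (GLZ\<lparr>carrier := generate GLZ (A ` {1..n})\<rparr>) torus_aut"
proof -
  define X where "X = generate GLZ (A ` {1..n})"
  define H where "H = GLZ\<lparr>carrier := X\<rparr>"
  define Nm where "Nm i = A i - mat 1" for i
  define I where "I = {2..n}"
  have I: "finite I" "I \<subseteq> {1..n}" by (auto simp: I_def)
  \<comment> \<open>For \<open>n < 2\<close> the intersection would be empty-indexed, hence the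
    whole space and not \<open>{0}\<close>. In particular \<open>A 1\<close> really is among the
    generators.\<close>
  have "2 \<le> n"
  proof (rule ccontr)
    assume "\<not> 2 \<le> n"
    then have "(1 :: real ^ 'n) \<in> (\<Inter>i\<in>{2..n}. p1 (A i))" by simp
    then show False using assms(6) by (simp add: vec_eq_iff)
  qed
  then have A_gen: "A i \<in> A ` {1..n}" if "i \<in> insert 1 I" for i using that I by auto
  have NN: "Nm i ** Nm i = 0" if "i \<in> I" for i using assms(5) that by (simp add: Nm_def I_def)
  have AA: "A 1 ** A i = A i ** A 1" if "i \<in> I" for i using assms(4) that by (simp add: I_def)
  have AN: "A 1 ** Nm i = Nm i ** A 1" if "i \<in> I" for i
  proof -
    have "A 1 *v (A i *v m) = A i *v (A 1 *v m)" for m using AA[OF that] by (simp add: matrix_vector_mul_assoc)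
    then show ?thesis
      unfolding matrix_eq
      by (simp add: Nm_def matrix_vector_mul_assoc[symmetric] matrix_vector_mult_diff_rdistrib matrix_vector_mult_diff_distrib)
  qed
  have ker: "d = 0" if d: "\<And>i. i \<in> I \<Longrightarrow> rmat (Nm i) *v d = 0" for d
  proof -
    have "rmat (Nm i) = rmat (A i) - mat 1" for i by (simp add: Nm_def vec_eq_iff map_matrix_def mat_def)
    then have "d \<in> p1 (A i)" if "i \<in> I" for i
      using d[OF that] by (simp add: p1_def matrix_vector_mult_diff_rdistrib)
    then show ?thesis using assms(6) by (auto simp: I_def)
  qed
  \<comment> \<open>The order \<open>2 * CARD('n) + 2\<close> is the one at which the conjugacy
    theorem asks for smallness.\<close>
  have "locally_rigid \<infinity> (2 * CARD('n) + 2) \<infinity> H torus_aut"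
    unfolding locally_rigid_def
  proof (intro allI impI)
    fix S assume S: "finite S \<and> S \<subseteq> carrier H \<and> generate H S = carrier H"
    have XH: "carrier H = X" by (simp add: H_def)
    show "\<exists>\<epsilon>>0. \<forall>\<beta>. Ck_action \<infinity> H \<beta> \<and> (\<forall>g\<in>S. Cr_close (2 * CARD('n) + 2) \<epsilon> (\<beta> g) (torus_aut g)) \<longrightarrow>
      (\<exists>h. torus_diffeo \<infinity> h \<and> (\<forall>g\<in>carrier H. \<beta> g \<circ> h = h \<circ> torus_aut g))"
    proof (cases "group H")
      \<comment> \<open>An action presupposes a group, so there is nothing to conjugate in this
        case.\<close>
      case False
      then have "\<not> Ck_action \<infinity> H \<beta>" for \<beta> :: "int ^ 'n ^ 'n \<Rightarrow> 'n torus \<Rightarrow> 'n torus"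
        by (auto simp: Ck_action_def group_action_def group_hom_def)
      then show ?thesis by (intro exI[of _ 1]) auto
    next
      case True
      then interpret H: group H .
      have H': "group (GLZ\<lparr>carrier := generate GLZ (A ` {1..n})\<rparr>)" using True by (simp add: H_def X_def)
      have AX: "A i \<in> X" if "i \<in> insert 1 I" for i
        unfolding X_def using A_gen[OF that] by (rule generate.incl)
      have inv: "inv\<^bsub>H\<^esub> A 1 ** A 1 = mat 1" using H.l_inv[of "A 1"] AX by (simp add: H_def)
      obtain k :: nat and \<delta>0 :: real where k: "0 < k" "0 < \<delta>0"
        "\<And>fA f. smooth_periodic fA \<Longrightarrow>
          (\<And>i s. i \<in> I \<Longrightarrow> s = 1 \<or> s = - 1 \<Longrightarrow> smooth_periodic (f i s) \<and> CB (2 * CARD('n) + 2) \<delta>0 (f i s)) \<Longrightarrow>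
          (\<And>i s x. i \<in> I \<Longrightarrow> s = 1 \<or> s = - 1 \<Longrightarrow>
             rmat (A 1) *v (rmat (shear (s * int k) (Nm i)) *v x + f i s x) + fA (rmat (shear (s * int k) (Nm i)) *v x + f i s x)
             = rmat (shear (s * int k) (Nm i)) *v (rmat (A 1) *v x + fA x) + f i s (rmat (A 1) *v x + fA x)) \<Longrightarrow>
          \<exists>v w. smooth_periodic v \<and> smooth_periodic w \<and> (\<forall>y. (y + w y) + v (y + w y) = y) \<and> (\<forall>x. (x + v x) + w (x + v x) = x) \<and>
            (\<forall>C fC x. cont_periodic fC \<longrightarrow> A 1 ** C = C ** A 1 \<longrightarrow>
               (\<forall>x. rmat (A 1) *v (rmat C *v x + fC x) + fA (rmat C *v x + fC x) = rmat C *v (rmat (A 1) *v x + fA x) + fC (rmat (A 1) *v x + fA x)) \<longrightarrow>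
               rmat C *v (x + v x) + fC (x + v x) = rmat C *v x + v (rmat C *v x))"
      proof (rule smooth_conjugacy[where A = "A 1" and I = I and Nm = Nm, OF inv _ I(1)], goal_cases)
        case (1 m)
        show ?case by (rule ergodic_det_nonzero[OF assms(1) 1(2)])
      next
        case (2 i)
        show ?case by (rule NN[OF 2(2)])
      next
        case (3 i)
        show ?case by (rule AN[OF 3(2)])
      next
        case (4 d)
        show ?case by (rule ker) (rule 4(2))
      next
        case (5 k \<delta>0)
        show ?case using 5(2-) by (rule that)
      qed
      \<comment> \<open>The finitely many elements whose lifts must be small: the generators and the
        shears of both signs. \<epsilon> will be the minimum of the bounds found for each of
        them.\<close>
      define G where "G = A ` insert 1 I \<union> (\<lambda>(s, i). shear (s * int k) (Nm i)) ` ({1, - 1} \<times> I)"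
      have G: "finite G" using I(1) by (simp add: G_def)
      have Gsh: "shear (s * int k) (Nm i) \<in> G" if "i \<in> I" "s = 1 \<or> s = - 1" for i s
        unfolding G_def using that by (intro UnI2 image_eqI[of _ _ "(s, i)"]) auto
      have GA: "A i \<in> G" if "i \<in> insert 1 I" for i using that by (auto simp: G_def)
      have sh: "shear (s * int k) (Nm i) \<in> X" if "i \<in> I" "s = 1 \<or> s = - 1" for i s
        using shear_in_generate[OF H' _ NN[OF that(1)], of k] A_gen[of i] that
        by (auto simp: X_def Nm_def shear_1)
      have GX: "\<gamma> \<in> X" if "\<gamma> \<in> G" for \<gamma>
        using that AX sh unfolding G_def by fastforce
      have Gcomm: "A 1 ** \<gamma> = \<gamma> ** A 1" if "\<gamma> \<in> G" for \<gamma>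
        using that AA shear_commute[OF AN] unfolding G_def by auto
      have "\<exists>b\<ge>0. \<forall>y. norm (rmat \<gamma> *v y) \<le> b * norm y" for \<gamma> :: "int ^ 'n ^ 'n"
        by (metis matrix_vector_bound)
      then obtain bb where bb: "\<And>\<gamma> :: int ^ 'n ^ 'n. 0 \<le> bb \<gamma>" "\<And>(\<gamma> :: int ^ 'n ^ 'n) y. norm (rmat \<gamma> *v y) \<le> bb \<gamma> * norm y" by metis
      define b where "b = sum bb G"
      have b0: "0 \<le> b" using bb(1) by (simp add: b_def sum_nonneg)
      have b: "norm (rmat \<gamma> *v y) \<le> b * norm y" if "\<gamma> \<in> G" for \<gamma> y
      proof -
        have "bb \<gamma> \<le> b" unfolding b_def using G that bb(1) by (intro member_le_sum) auto
        then show ?thesis using bb(2)[of \<gamma> y] by (meson mult_right_mono norm_ge_zero order_trans)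
      qed
      \<comment> \<open>The second entry makes lifts of commuting elements commute exactly, through
        \<open>(2 * b + 2) * \<delta> < 1\<close>.\<close>
      define \<delta> where "\<delta> = min \<delta>0 (1 / (4 * b + 4))"
      have \<delta>: "0 < \<delta>" "\<delta> \<le> \<delta>0" using k(2) b0 by (auto simp: \<delta>_def)
      have \<delta>b: "(2 * b + 2) * \<delta> < 1"
      proof -
        have "(2 * b + 2) * \<delta> \<le> (2 * b + 2) * (1 / (4 * b + 4))" using b0 by (intro mult_left_mono) (auto simp: \<delta>_def)
        also have "\<dots> < 1" using b0 by (simp add: field_simps)
        finally show ?thesis .
      qed
      have "\<exists>\<epsilon>>0. \<forall>\<beta> :: int ^ 'n ^ 'n \<Rightarrow> 'n torus \<Rightarrow> 'n torus. Ck_action \<infinity> H \<beta> \<longrightarrow>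
          (\<forall>g\<in>S. Cr_close (2 * CARD('n) + 2) \<epsilon> (\<beta> g) (torus_aut g)) \<longrightarrow>
          (\<exists>f. lifts (\<beta> \<gamma>) \<gamma> f \<and> CB (2 * CARD('n) + 2) \<delta> f)" if "\<gamma> \<in> G" for \<gamma>
        unfolding H_def
      proof (rule generate_small_lifts)
        show "group (GLZ\<lparr>carrier := X\<rparr>)" "S \<subseteq> X" "\<gamma> \<in> generate (GLZ\<lparr>carrier := X\<rparr>) S"
          using True S GX[OF that] by (simp_all add: H_def)
      qed fact
      then obtain e where e: "\<And>\<gamma>. \<gamma> \<in> G \<Longrightarrow> 0 < e \<gamma>"
        "\<And>\<gamma> (\<beta> :: int ^ 'n ^ 'n \<Rightarrow> 'n torus \<Rightarrow> 'n torus). \<gamma> \<in> G \<Longrightarrow> Ck_action \<infinity> H \<beta> \<Longrightarrow>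
          (\<forall>g\<in>S. Cr_close (2 * CARD('n) + 2) (e \<gamma>) (\<beta> g) (torus_aut g)) \<Longrightarrow>
          (\<exists>f. lifts (\<beta> \<gamma>) \<gamma> f \<and> CB (2 * CARD('n) + 2) \<delta> f)"
        by metis
      define \<epsilon> where "\<epsilon> = Min (e ` G)"
      have Gne: "G \<noteq> {}" using GA by blast
      have \<epsilon>: "0 < \<epsilon>" using G Gne e(1) by (simp add: \<epsilon>_def)
      have \<epsilon>e: "\<epsilon> \<le> e \<gamma>" if "\<gamma> \<in> G" for \<gamma> using G that by (simp add: \<epsilon>_def)
      show ?thesis
      proof (intro exI[of _ \<epsilon>] conjI allI impI)
        fix \<beta> :: "int ^ 'n ^ 'n \<Rightarrow> 'n torus \<Rightarrow> 'n torus"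
        assume \<beta>: "Ck_action \<infinity> H \<beta> \<and> (\<forall>g\<in>S. Cr_close (2 * CARD('n) + 2) \<epsilon> (\<beta> g) (torus_aut g))"
        have \<beta>1: "Ck_action \<infinity> (GLZ\<lparr>carrier := X\<rparr>) \<beta>" using \<beta> by (simp add: H_def)
        have "\<exists>f. lifts (\<beta> \<gamma>) \<gamma> f \<and> CB (2 * CARD('n) + 2) \<delta> f" if "\<gamma> \<in> G" for \<gamma>
          using e(2)[OF that] \<beta> Cr_close_mono[OF _ \<epsilon>e[OF that]] by blast
        then obtain F where F: "\<And>\<gamma>. \<gamma> \<in> G \<Longrightarrow> lifts (\<beta> \<gamma>) \<gamma> (F \<gamma>)" "\<And>\<gamma>. \<gamma> \<in> G \<Longrightarrow> CB (2 * CARD('n) + 2) \<delta> (F \<gamma>)"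
          by metis
        have Fs: "smooth_periodic (F \<gamma>)" if "\<gamma> \<in> G" for \<gamma> using F(1)[OF that] by (simp add: lifts_def)
        have A1: "A 1 \<in> G" by (rule GA) simp
        have comm: "rmat (A 1) *v (rmat \<gamma> *v x + F \<gamma> x) + F (A 1) (rmat \<gamma> *v x + F \<gamma> x)
            = rmat \<gamma> *v (rmat (A 1) *v x + F (A 1) x) + F \<gamma> (rmat (A 1) *v x + F (A 1) x)" if \<gamma>: "\<gamma> \<in> G" for \<gamma> x
        proof (rule lifts_commute[OF F(1)[OF A1] F(1)[OF \<gamma>] _ Gcomm[OF \<gamma>] CB_bound[OF F(2)[OF A1]] CB_bound[OF F(2)[OF \<gamma>]] b0 b[OF A1] b[OF \<gamma>] \<delta>b])
          show "\<beta> (A 1) \<circ> \<beta> \<gamma> = \<beta> \<gamma> \<circ> \<beta> (A 1)"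
            using Ck_action_mult[OF \<beta>1 GX[OF A1] GX[OF \<gamma>]] Ck_action_mult[OF \<beta>1 GX[OF \<gamma>] GX[OF A1]] Gcomm[OF \<gamma>] by simp
        qed
        have "\<exists>v w. smooth_periodic v \<and> smooth_periodic w \<and> (\<forall>y. (y + w y) + v (y + w y) = y) \<and> (\<forall>x. (x + v x) + w (x + v x) = x) \<and>
            (\<forall>C fC x. cont_periodic fC \<longrightarrow> A 1 ** C = C ** A 1 \<longrightarrow>
               (\<forall>x. rmat (A 1) *v (rmat C *v x + fC x) + F (A 1) (rmat C *v x + fC x) = rmat C *v (rmat (A 1) *v x + F (A 1) x) + fC (rmat (A 1) *v x + F (A 1) x)) \<longrightarrow>
               rmat C *v (x + v x) + fC (x + v x) = rmat C *v x + v (rmat C *v x))"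
        proof (rule k(3)[where f = "\<lambda>i s. F (shear (s * int k) (Nm i))", OF Fs[OF A1]])
          fix i s assume ii: "i \<in> I" "s = 1 \<or> s = (- 1 :: int)"
          show "smooth_periodic (F (shear (s * int k) (Nm i))) \<and> CB (2 * CARD('n) + 2) \<delta>0 (F (shear (s * int k) (Nm i)))"
            using Fs[OF Gsh[OF ii]] CB_mono[OF F(2)[OF Gsh[OF ii]] \<delta>(2)] by blast
        qed (rule comm[OF Gsh])
        then obtain v w where v: "smooth_periodic v" and w: "smooth_periodic w" and vw: "\<And>y. (y + w y) + v (y + w y) = y"
          and wv: "\<And>x. (x + v x) + w (x + v x) = x"
          and eqv: "\<And>C fC x. cont_periodic fC \<Longrightarrow> A 1 ** C = C ** A 1 \<Longrightarrow>
               (\<And>x. rmat (A 1) *v (rmat C *v x + fC x) + F (A 1) (rmat C *v x + fC x) = rmat C *v (rmat (A 1) *v x + F (A 1) x) + fC (rmat (A 1) *v x + F (A 1) x)) \<Longrightarrow>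
               rmat C *v (x + v x) + fC (x + v x) = rmat C *v x + v (rmat C *v x)"
          by blast
        obtain h where h: "torus_diffeo \<infinity> h" "\<And>x. h (torus_proj x) = torus_proj (x + v x)"
          by (rule smooth_periodic_diffeo[OF v w vw wv]) blast
        \<comment> \<open>Every element of \<open>G\<close>, among them \<open>A 1\<close> itself,
          commutes with \<open>A 1\<close>, and so do the lifts; hence the equivariance of
          \<open>id + v\<close> applies to all of them alike.\<close>
        have hA: "\<beta> \<gamma> \<circ> h = h \<circ> torus_aut \<gamma>" if "\<gamma> \<in> G" for \<gamma>
        proof (rule torus_eqI)
          fix x
          have "(\<beta> \<gamma> \<circ> h) (torus_proj x) = torus_proj (rmat \<gamma> *v (x + v x) + F \<gamma> (x + v x))"
            using F(1)[OF that] by (simp add: h lifts_def)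
          also have "\<dots> = torus_proj (rmat \<gamma> *v x + v (rmat \<gamma> *v x))"
            by (simp only: eqv[OF smooth_periodic_cont_periodic[OF Fs[OF that]] Gcomm[OF that] comm[OF that]])
          also have "\<dots> = (h \<circ> torus_aut \<gamma>) (torus_proj x)" by (simp add: h torus_aut_proj)
          finally show "(\<beta> \<gamma> \<circ> h) (torus_proj x) = (h \<circ> torus_aut \<gamma>) (torus_proj x)" .
        qed
        have hT: "\<beta> \<gamma> \<circ> h = h \<circ> torus_aut \<gamma>" if "\<gamma> \<in> A ` {1..n}" for \<gamma>
        proof -
          have "{1..n} \<subseteq> insert 1 I" by (auto simp: I_def)
          then show ?thesis using that GA by (intro hA) auto
        qed
        have "\<beta> g \<circ> h = h \<circ> torus_aut g" if "g \<in> carrier H" for g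
          using conjugacy_generate[OF H' _ hT] \<beta>1 that XH unfolding X_def by blast
        then show "\<exists>h. torus_diffeo \<infinity> h \<and> (\<forall>g\<in>carrier H. \<beta> g \<circ> h = h \<circ> torus_aut g)"
          using h(1) by blast
      qed (rule \<epsilon>)
    qed
  qed
  then show ?thesis unfolding H_def X_def by blast
qed

end
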